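(* Let the parameters $(\mathsf R,\mathsf S,\mathsf P,\mathsf k_1)$ be admissible, let $\mathbf X_0=(\mathbf u_0,\theta_0)\in\mathbf H^0$ be phase-locked, let $\mathbf X(t)$ be the solution of the Boussinesq–Coriolis system with $\mathbf X(0)=\mathbf X_0$, and for each $M\ge1$ let $\mathbf X^M(t)$ be the solution of the HKC-$M$ model whose initial condition $\mathbf X_0^M$ is the projection of $\mathbf X_0$ onto the modes of the HKC-$M$ model. Then for any $\tau>0$ and any $\varepsilon>0$ there exists $M^*(\tau,\varepsilon)>0$ such that for all $M>M^*(\tau,\varepsilon)$ $$\|\mathbf X-\mathbf X^M\|_{L^2([0,\tau];\mathbf H^0)}<\varepsilon.$$
   Context: Parameters $(\mathsf R,\mathsf S,\mathsf P,\mathsf k_1)$ are admissible if $\mathsf R,\mathsf S\ge0$ and $\mathsf P,\mathsf k_1>0$. $\Omega=[0,2\pi/\mathsf k_1]\times[0,\pi]$ with coordinates $\mathbf x=(x_1,x_3)$; all functions are periodic in $x_1$ and independent of $x_2$ (so $\partial_{x_2}=0$); velocity fields have three components. $\langle f\rangle:=\int_\Omega f\,d\mathbf x$; $\hat{\mathbf e}^j$ are the unit vectors; $\mathcal P$ is the Leray projector onto divergence-free fields. Boussinesq–Coriolis system: $\partial_t\mathbf u=\mathsf P\Delta\mathbf u+\mathcal P[\mathsf P\mathsf R\,\theta\hat{\mathbf e}^3-\mathsf P\mathsf S\,\hat{\mathbf e}^3\times\mathbf u-\mathbf u\cdot\nabla\mathbf u]$, $\partial_t\theta=\Delta\theta+u_3-\mathbf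 u\cdot\nabla\theta$, $\nabla\cdot\mathbf u=0$, with $u_3=\partial_{x_3}u_1=\partial_{x_3}u_2=\theta=0$ at $x_3=0,\pi$. $\mathbf H^0=\mathbf L^2_\sigma\times L^2$ and $\mathbf H^1=\mathbf H^1_\sigma\times H^1_0$, where $\mathbf L^2_\sigma,\mathbf H^1_\sigma$ are the closures in $L^2,H^1$ of the smooth divergence-free fields satisfying the velocity boundary conditions with $u_1,u_2$ of zero mean, and $H_0^1$ is the space of $H^1$ functions with zero trace at $x_3=0,\pi$. For each $\mathbf X_0\in\mathbf H^0$ "the solution" is the unique one in $C([0,\tau];\mathbf H^0)\cap L^2((0,\tau);\mathbf H^1)$ that is smooth for $t>0$. Basis. Let $|\mathcal K\mathbf m|=(\mathsf k_1^2m_1^2+m_3^2)^{1/2}$, $V=(\pi^2/(2\mathsf k_1))^{1/2}$, $\eta^{\mathbf m}=\eta^{m_1}\eta^{m_3}$ with $\eta^m=1$ if $m>0$, $\eta^0=1/\sqrt2$. An index is $\mathbf n=(m_1,m_3,p_1,c)$, with wave vector $\mathbf m=(m_1,m_3)$, phase $p_1\in\{1,2\}$, component $c\in\{1,2\}$. Set $f^{(\mathbf m,1,1)}=\frac{\eta^{\mathbf m}}V\cos(\mathsf k_1m_1x_1)\sin(m_3x_3)$, $f^{(\mathbf m,2,1)}=\frac{\eta^{\mathbf m}}V\sin(\mathsf k_1m_1x_1)\sin(m_3x_3)$, $\mathbf v^{(\mathbf m,1,1)}=\frac{\eta^{\mathbf m}}{|\mathcal K\mathbf m|V}\big(m_3\sin(\mathsf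 k_1m_1x_1)\cos(m_3x_3),\,0,\,-\mathsf k_1m_1\cos(\mathsf k_1m_1x_1)\sin(m_3x_3)\big)$, $\mathbf v^{(\mathbf m,2,1)}=\frac{\eta^{\mathbf m}}{|\mathcal K\mathbf m|V}\big(m_3\cos(\mathsf k_1m_1x_1)\cos(m_3x_3),\,0,\,\mathsf k_1m_1\sin(\mathsf k_1m_1x_1)\sin(m_3x_3)\big)$, $\mathbf v^{(\mathbf m,1,2)}=\frac{\eta^{\mathbf m}}V\hat{\mathbf e}^2\sin(\mathsf k_1m_1x_1)\cos(m_3x_3)$, $\mathbf v^{(\mathbf m,2,2)}=\frac{\eta^{\mathbf m}}V\hat{\mathbf e}^2\cos(\mathsf k_1m_1x_1)\cos(m_3x_3)$. $\mathscr N_\theta$ is the set of $(m_1,m_3,p_1,1)$ with $m_1\ge0$, $m_3\ge1$, $p_1\in\{1,2\}$ if $m_1>0$ and $p_1=1$ if $m_1=0$. $\mathscr N_{\mathbf u}$ is the set of $(m_1,m_3,p_1,c)$ with $(m_1,m_3)\in\mathbb Z_{\ge0}^2\setminus\{\mathbf 0\}$, $p_1\in\{1,2\}$ if $m_1>0$ and $p_1=2$ if $m_1=0$, $c\in\{1,2\}$ if $m_3>0$ and $c=2$ if $m_3=0$. These functions form an orthonormal basis: $\{\mathbf v^{\mathbf n}\}_{\mathscr N_{\mathbf u}}$ of $\mathbf L^2_\sigma$, $\{f^{\mathbf n}\}_{\mathscr N_\theta}$ of $L^2$. $(\mathbf u,\theta)\in\mathbf H^0$ is called phase-locked if only basis functions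 with $p_1\equiv m_1+m_3+1\pmod 2$ occur in its expansion. HKC hierarchy. All phases are $p_1\equiv m_1+m_3+1\pmod2$, so modes are specified by wave vector sets $\mathscr M_u^M$ (velocity, $c=1$), $\mathscr M_w^M$ (velocity, $c=2$), $\mathscr M_\theta^M$. Enumerate $\mathbb Z_{>0}^2$ as $\mathbf m^1,\mathbf m^2,\dots$ by increasing $m_1+m_3$ and, for equal $m_1+m_3$, by decreasing $m_1$ ($\mathbf m^1=(1,1)$, $\mathbf m^2=(2,1)$, $\mathbf m^3=(1,2)$, …). Set $\mathscr M_u^1=\mathscr M_w^1=\{(0,1),(1,1)\}$, $\mathscr M_\theta^1=\{(1,1),(0,2)\}$. For $M>1$: if $m_1^M>1$, adjoin $\mathbf m^M$ to each of the three sets of step $M-1$; if $m_1^M=1$, set $\mathscr M_u^M=\mathscr M_u^{M-1}\cup\{\mathbf m^M,(0,2m_3^M-1)\}$, $\mathscr M_w^M=\mathscr M_w^{M-1}\cup\{\mathbf m^M,(0,2m_3^M-1),(m_3^M-1,0)\}$, $\mathscr M_\theta^M=\mathscr M_\theta^{M-1}\cup\{\mathbf m^M,(0,2m_3^M)\}$. Let $\mathscr N_{\mathbf u}^M,\mathscr N_\theta^M$ be the resulting index sets and $\mathcal P_{\mathbf u}^M,\mathcal P_\theta^M$ the $L^2$-orthogonal projections onto the spans of the corresponding basis functions. The HKC-$M$ model is the ODE, on these spans, $$\partial_t\mathbf u^M=\mathsf P\Delta\mathbf u^M+\mathsf P\mathsf R\,\mathcal P^M_{\mathbf u}[\theta^M\hat{\mathbf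 e}^3]-\mathsf P\mathsf S\,\mathcal P^M_{\mathbf u}[\hat{\mathbf e}^3\times\mathbf u^M]-\mathcal P^M_{\mathbf u}[\mathbf u^M\cdot\nabla\mathbf u^M],\quad \partial_t\theta^M=\Delta\theta^M+\mathcal P^M_\theta[u_3^M]-\mathcal P^M_\theta[\mathbf u^M\cdot\nabla\theta^M].$$ *)

theory Defs
  imports "HOL-Analysis.Analysis"
begin

text \<open>
  Points are pairs (x1, x3).  A function on the periodic cell is represented by a total function on
  the plane: elements of the Lebesgue and Sobolev spaces are only looked at (almost everywhere) on
  the cell, smooth functions on the closed strip, where they are required to be periodic in x1.
\<close>

type_synonym point = "real \<times> real"
type_synonym velocity = "point \<Rightarrow> real^3"
type_synonym temperature = "point \<Rightarrow> real"
type_synonym state = "velocity \<times> temperature"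

definition admissible :: "real \<Rightarrow> real \<Rightarrow> real \<Rightarrow> real \<Rightarrow> bool" where
  "admissible R S P k1 \<longleftrightarrow> R \<ge> 0 \<and> S \<ge> 0 \<and> P > 0 \<and> k1 > 0"

definition cell :: "real \<Rightarrow> point set" where
  "cell k1 = {0..2 * pi / k1} \<times> {0..pi}"

definition strip :: "point set" where
  "strip = UNIV \<times> {0..pi}"

definition periodic_x1 :: "real \<Rightarrow> (point \<Rightarrow> 'b) \<Rightarrow> bool" where
  "periodic_x1 k1 f \<longleftrightarrow> (\<forall>x1. \<forall>x3\<in>{0..pi}. f (x1 + 2 * pi / k1, x3) = f (x1, x3))"


section \<open>Differential operators and smoothness\<close>

text \<open>On the boundary of the strip the derivative in x3 is one-sided.\<close>

definition d1 :: "(point \<Rightarrow> 'b::real_normed_vector) \<Rightarrow> point \<Rightarrow> 'b" where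
  "d1 f x = vector_derivative (\<lambda>s. f (s, snd x)) (at (fst x))"

definition d3 :: "(point \<Rightarrow> 'b::real_normed_vector) \<Rightarrow> point \<Rightarrow> 'b" where
  "d3 f x = vector_derivative (\<lambda>s. f (fst x, s)) (at (snd x) within {0..pi})"

definition laplacian :: "(point \<Rightarrow> 'b::real_normed_vector) \<Rightarrow> point \<Rightarrow> 'b" where
  "laplacian f x = d1 (d1 f) x + d3 (d3 f) x"

definition divergence :: "velocity \<Rightarrow> point \<Rightarrow> real" where
  "divergence u x = d1 (\<lambda>y. u y $ 1) x + d3 (\<lambda>y. u y $ 3) x"

definition advect :: "velocity \<Rightarrow> (point \<Rightarrow> 'b::real_normed_vector) \<Rightarrow> point \<Rightarrow> 'b" where
  "advect u f x = (u x $ 1) *\<^sub>R d1 f x + (u x $ 3) *\<^sub>R d3 f x"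

text \<open>
  Smoothness up to the boundary.  The sets used below are convex with nonempty interior, so that
  the derivative relative to the set is unique.
\<close>

primrec Ck_on :: "nat \<Rightarrow> 'a::euclidean_space set \<Rightarrow> ('a \<Rightarrow> 'b::real_normed_vector) \<Rightarrow> bool" where
  "Ck_on 0 D f \<longleftrightarrow> continuous_on D f"
| "Ck_on (Suc n) D f \<longleftrightarrow>
     (\<exists>f'. (\<forall>x\<in>D. (f has_derivative f' x) (at x within D)) \<and> (\<forall>h. Ck_on n D (\<lambda>x. f' x h)))"

definition smooth_on :: "'a::euclidean_space set \<Rightarrow> ('a \<Rightarrow> 'b::real_normed_vector) \<Rightarrow> bool" where
  "smooth_on D f \<longleftrightarrow> (\<forall>n. Ck_on n D f)"

definition smooth_periodic :: "real \<Rightarrow> (point \<Rightarrow> 'b::real_normed_vector) set" where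
  "smooth_periodic k1 = {f. smooth_on strip f \<and> periodic_x1 k1 f}"


section \<open>Function spaces\<close>

definition L2_space :: "real \<Rightarrow> (point \<Rightarrow> 'b::euclidean_space) set" where
  "L2_space k1 = {f. f \<in> borel_measurable (lebesgue_on (cell k1)) \<and>
     integrable (lebesgue_on (cell k1)) (\<lambda>x. (norm (f x))\<^sup>2)}"

definition L2_inner :: "real \<Rightarrow> (point \<Rightarrow> 'b::euclidean_space) \<Rightarrow> (point \<Rightarrow> 'b) \<Rightarrow> real" where
  "L2_inner k1 f g = (LINT x|lebesgue_on (cell k1). f x \<bullet> g x)"

definition L2_norm :: "real \<Rightarrow> (point \<Rightarrow> 'b::euclidean_space) \<Rightarrow> real" where
  "L2_norm k1 f = sqrt (LINT x|lebesgue_on (cell k1). (norm (f x))\<^sup>2)"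

text \<open>
  The test functions for weak derivatives vanish near x3 = 0 and x3 = pi but are only periodic
  in x1, so that the functions of class H1 below have matching traces at the ends of the period.
\<close>

definition test_functions :: "real \<Rightarrow> (point \<Rightarrow> real) set" where
  "test_functions k1 = {\<phi> \<in> smooth_periodic k1.
     \<exists>\<delta>>0. \<forall>x\<in>strip. snd x < \<delta> \<or> snd x > pi - \<delta> \<longrightarrow> \<phi> x = 0}"

definition weak_gradient ::
    "real \<Rightarrow> (point \<Rightarrow> 'b::euclidean_space) \<Rightarrow> (point \<Rightarrow> 'b \<times> 'b) \<Rightarrow> bool" where
  "weak_gradient k1 f g \<longleftrightarrow> g \<in> L2_space k1 \<and> (\<forall>\<phi>\<in>test_functions k1.
     (LINT x|lebesgue_on (cell k1). \<phi> x *\<^sub>R g x) =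
     - (LINT x|lebesgue_on (cell k1). (d1 \<phi> x *\<^sub>R f x, d3 \<phi> x *\<^sub>R f x)))"

definition H1_space :: "real \<Rightarrow> (point \<Rightarrow> 'b::euclidean_space) set" where
  "H1_space k1 = {f \<in> L2_space k1. \<exists>g. weak_gradient k1 f g}"

definition H1_norm :: "real \<Rightarrow> (point \<Rightarrow> 'b::euclidean_space) \<Rightarrow> real" where
  "H1_norm k1 f = sqrt ((L2_norm k1 f)\<^sup>2 + (L2_norm k1 (SOME g. weak_gradient k1 f g))\<^sup>2)"

text \<open>
  The function g is the trace of f on the line x3 = b, where the trace operator is the continuous
  extension of the restriction of smooth functions to that line.
\<close>

definition has_trace :: "real \<Rightarrow> real \<Rightarrow> (point \<Rightarrow> real) \<Rightarrow> (real \<Rightarrow> real) \<Rightarrow> bool" where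
  "has_trace k1 b f g \<longleftrightarrow>
     g \<in> borel_measurable (lebesgue_on {0..2 * pi / k1}) \<and>
     integrable (lebesgue_on {0..2 * pi / k1}) (\<lambda>s. (g s)\<^sup>2) \<and> (\<exists>\<phi>. (\<forall>n. \<phi> n \<in> smooth_periodic k1) \<and>
     (\<lambda>n. H1_norm k1 (\<phi> n - f)) \<longlonglongrightarrow> 0 \<and>
     (\<lambda>n::nat. LINT s|lebesgue_on {0..2 * pi / k1}. (\<phi> n (s, b) - g s)\<^sup>2) \<longlonglongrightarrow> 0)"

definition H10 :: "real \<Rightarrow> temperature set" where
  "H10 k1 = {f \<in> H1_space k1. \<forall>b\<in>{0, pi}. has_trace k1 b f (\<lambda>_. 0)}"

definition velocity_bc :: "velocity \<Rightarrow> bool" where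
  "velocity_bc u \<longleftrightarrow> (\<forall>x1. \<forall>b\<in>{0, pi}. u (x1, b) $ 3 = 0 \<and>
     d3 (\<lambda>x. u x $ 1) (x1, b) = 0 \<and> d3 (\<lambda>x. u x $ 2) (x1, b) = 0)"

definition temperature_bc :: "temperature \<Rightarrow> bool" where
  "temperature_bc \<theta> \<longleftrightarrow> (\<forall>x1. \<forall>b\<in>{0, pi}. \<theta> (x1, b) = 0)"

definition smooth_solenoidal :: "real \<Rightarrow> velocity set" where
  "smooth_solenoidal k1 = {u \<in> smooth_periodic k1.
     (\<forall>x\<in>strip. divergence u x = 0) \<and> velocity_bc u \<and>
     (\<forall>j\<in>{1, 2}. (LINT x|lebesgue_on (cell k1). u x $ j) = 0)}"

definition L2_sigma :: "real \<Rightarrow> velocity set" where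
  "L2_sigma k1 = {u \<in> L2_space k1. \<forall>e>0. \<exists>v\<in>smooth_solenoidal k1. L2_norm k1 (v - u) < e}"

definition H1_sigma :: "real \<Rightarrow> velocity set" where
  "H1_sigma k1 = {u \<in> H1_space k1. \<forall>e>0. \<exists>v\<in>smooth_solenoidal k1. H1_norm k1 (v - u) < e}"

definition HH0 :: "real \<Rightarrow> state set" where
  "HH0 k1 = L2_sigma k1 \<times> L2_space k1"

definition HH0_norm :: "real \<Rightarrow> state \<Rightarrow> real" where
  "HH0_norm k1 X = sqrt ((L2_norm k1 (fst X))\<^sup>2 + (L2_norm k1 (snd X))\<^sup>2)"

definition HH1 :: "real \<Rightarrow> state set" where
  "HH1 k1 = H1_sigma k1 \<times> H10 k1"

definition HH1_norm :: "real \<Rightarrow> state \<Rightarrow> real" where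
  "HH1_norm k1 X = sqrt ((H1_norm k1 (fst X))\<^sup>2 + (H1_norm k1 (snd X))\<^sup>2)"

definition L2_time_norm :: "real \<Rightarrow> real \<Rightarrow> (real \<Rightarrow> state) \<Rightarrow> real" where
  "L2_time_norm k1 \<tau> Y = sqrt (LINT t|lebesgue_on {0..\<tau>}. (HH0_norm k1 (Y t))\<^sup>2)"

definition in_C_HH0 :: "real \<Rightarrow> real \<Rightarrow> (real \<Rightarrow> state) \<Rightarrow> bool" where
  "in_C_HH0 k1 \<tau> X \<longleftrightarrow> (\<forall>t\<in>{0..\<tau>}. X t \<in> HH0 k1 \<and>
     ((\<lambda>s. HH0_norm k1 (X s - X t)) \<longlongrightarrow> 0) (at t within {0..\<tau>}))"

text \<open>
  Strong measurability into the Hilbert space HH1 is not listed separately: for the functions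
  considered here it follows from continuity into HH0.
\<close>

definition in_L2_HH1 :: "real \<Rightarrow> real \<Rightarrow> (real \<Rightarrow> state) \<Rightarrow> bool" where
  "in_L2_HH1 k1 \<tau> X \<longleftrightarrow> (AE t in lebesgue_on {0<..<\<tau>}. X t \<in> HH1 k1) \<and>
     integrable (lebesgue_on {0<..<\<tau>}) (\<lambda>t. (HH1_norm k1 (X t))\<^sup>2)"


section \<open>Orthogonal projections\<close>

text \<open>
  For closed subspaces of the space of square-integrable functions, a representative (modulo null
  sets) of the orthogonal projection.  On the finite-dimensional spans of trigonometric functions
  used below the representative is unique.
\<close>

definition orth_proj ::
    "real \<Rightarrow> (point \<Rightarrow> 'b::euclidean_space) set \<Rightarrow> (point \<Rightarrow> 'b) \<Rightarrow> point \<Rightarrow> 'b" where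
  "orth_proj k1 V F = (SOME G. G \<in> V \<and> (\<forall>v\<in>V. L2_inner k1 (F - G) v = 0))"

definition leray :: "real \<Rightarrow> velocity \<Rightarrow> velocity" where
  "leray k1 = orth_proj k1 (L2_sigma k1)"


section \<open>The Boussinesq-Coriolis system\<close>

abbreviation e2 :: "real^3" where "e2 \<equiv> axis 2 1"
abbreviation e3 :: "real^3" where "e3 \<equiv> axis 3 1"

definition bc_solution ::
    "real \<Rightarrow> real \<Rightarrow> real \<Rightarrow> real \<Rightarrow> state \<Rightarrow> (real \<Rightarrow> state) \<Rightarrow> bool" where
  "bc_solution R S P k1 X0 X \<longleftrightarrow>
    (let u = (\<lambda>t. fst (X t)); \<theta> = (\<lambda>t. snd (X t)) in
     (\<forall>\<tau>>0. in_C_HH0 k1 \<tau> X \<and> in_L2_HH1 k1 \<tau> X) \<and>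
     (AE x in lebesgue_on (cell k1). u 0 x = fst X0 x \<and> \<theta> 0 x = snd X0 x) \<and>
     smooth_on ({0<..} \<times> strip) (\<lambda>(t, x). u t x) \<and>
     smooth_on ({0<..} \<times> strip) (\<lambda>(t, x). \<theta> t x) \<and>
     (\<forall>t>0.
       periodic_x1 k1 (u t) \<and> periodic_x1 k1 (\<theta> t) \<and>
       (\<forall>x\<in>strip. divergence (u t) x = 0) \<and>
       velocity_bc (u t) \<and> temperature_bc (\<theta> t) \<and>
       (AE x in lebesgue_on (cell k1).
          vector_derivative (\<lambda>s. u s x) (at t) =
            P *\<^sub>R laplacian (u t) x +
            leray k1 (\<lambda>y. (P * R * \<theta> t y) *\<^sub>R e3 - (P * S) *\<^sub>R cross3 e3 (u t y)
                          - advect (u t) (u t) y) x) \<and>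
       (AE x in lebesgue_on (cell k1).
          vector_derivative (\<lambda>s. \<theta> s x) (at t) =
            laplacian (\<theta> t) x + u t x $ 3 - advect (u t) (\<theta> t) x)))"


section \<open>The orthonormal basis\<close>

text \<open>An index (m1, m3, p, c) consists of a wave vector, a phase and a component.\<close>

type_synonym mode = "nat \<times> nat \<times> nat \<times> nat"

definition wave_norm :: "real \<Rightarrow> nat \<Rightarrow> nat \<Rightarrow> real" where
  "wave_norm k1 m1 m3 = sqrt (k1\<^sup>2 * (real m1)\<^sup>2 + (real m3)\<^sup>2)"

definition eta :: "nat \<Rightarrow> real" where
  "eta m = (if m > 0 then 1 else 1 / sqrt 2)"

definition basis_scale :: "real \<Rightarrow> nat \<Rightarrow> nat \<Rightarrow> real" where
  "basis_scale k1 m1 m3 = eta m1 * eta m3 / sqrt (pi\<^sup>2 / (2 * k1))"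

fun theta_basis :: "real \<Rightarrow> mode \<Rightarrow> temperature" where
  "theta_basis k1 (m1, m3, p, c) (x1, x3) = basis_scale k1 m1 m3 *
     (if p = 1 then cos (k1 * m1 * x1) else sin (k1 * m1 * x1)) * sin (m3 * x3)"

fun u_basis :: "real \<Rightarrow> mode \<Rightarrow> velocity" where
  "u_basis k1 (m1, m3, p, c) (x1, x3) =
    (if c = 1 then
       (basis_scale k1 m1 m3 / wave_norm k1 m1 m3) *\<^sub>R
         (if p = 1
          then vector [m3 * sin (k1 * m1 * x1) * cos (m3 * x3), 0,
                       - (k1 * m1 * cos (k1 * m1 * x1) * sin (m3 * x3))]
          else vector [m3 * cos (k1 * m1 * x1) * cos (m3 * x3), 0,
                       k1 * m1 * sin (k1 * m1 * x1) * sin (m3 * x3)])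
     else
       (basis_scale k1 m1 m3 *
         (if p = 1 then sin (k1 * m1 * x1) else cos (k1 * m1 * x1)) * cos (m3 * x3)) *\<^sub>R e2)"

definition N_theta :: "mode set" where
  "N_theta = {(m1, m3, p, c). m3 \<ge> 1 \<and> c = 1 \<and> (if m1 > 0 then p \<in> {1, 2} else p = 1)}"

definition N_u :: "mode set" where
  "N_u = {(m1, m3, p, c). (m1, m3) \<noteq> (0, 0) \<and>
     (if m1 > 0 then p \<in> {1, 2} else p = 2) \<and> (if m3 > 0 then c \<in> {1, 2} else c = 2)}"

fun locked_phase :: "mode \<Rightarrow> bool" where
  "locked_phase (m1, m3, p, c) \<longleftrightarrow> p mod 2 = (m1 + m3 + 1) mod 2"

definition phase_locked :: "real \<Rightarrow> state \<Rightarrow> bool" where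
  "phase_locked k1 X \<longleftrightarrow>
     (\<forall>n\<in>N_u. L2_inner k1 (fst X) (u_basis k1 n) \<noteq> 0 \<longrightarrow> locked_phase n) \<and>
     (\<forall>n\<in>N_theta. L2_inner k1 (snd X) (theta_basis k1 n) \<noteq> 0 \<longrightarrow> locked_phase n)"


section \<open>The HKC hierarchy\<close>

text \<open>
  The enumeration of the pairs of positive integers by increasing m1 + m3 and, within a diagonal,
  decreasing m1.  It starts with index 1; the values at index 0 here and below are irrelevant.
\<close>

fun next_wave :: "nat \<times> nat \<Rightarrow> nat \<times> nat" where
  "next_wave (m1, m3) = (if m1 > 1 then (m1 - 1, m3 + 1) else (m3 + 1, 1))"

definition wave :: "nat \<Rightarrow> nat \<times> nat" where
  "wave i = (next_wave ^^ (i - 1)) (1, 1)"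

fun M_u :: "nat \<Rightarrow> (nat \<times> nat) set" where
  "M_u 0 = {}"
| "M_u (Suc 0) = {(0, 1), (1, 1)}"
| "M_u (Suc (Suc n)) = (let (m1, m3) = wave (Suc (Suc n)) in
     M_u (Suc n) \<union> (if m1 > 1 then {(m1, m3)} else {(m1, m3), (0, 2 * m3 - 1)}))"

fun M_w :: "nat \<Rightarrow> (nat \<times> nat) set" where
  "M_w 0 = {}"
| "M_w (Suc 0) = {(0, 1), (1, 1)}"
| "M_w (Suc (Suc n)) = (let (m1, m3) = wave (Suc (Suc n)) in
     M_w (Suc n) \<union>
       (if m1 > 1 then {(m1, m3)} else {(m1, m3), (0, 2 * m3 - 1), (m3 - 1, 0)}))"

fun M_theta :: "nat \<Rightarrow> (nat \<times> nat) set" where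
  "M_theta 0 = {}"
| "M_theta (Suc 0) = {(1, 1), (0, 2)}"
| "M_theta (Suc (Suc n)) = (let (m1, m3) = wave (Suc (Suc n)) in
     M_theta (Suc n) \<union> (if m1 > 1 then {(m1, m3)} else {(m1, m3), (0, 2 * m3)}))"

definition N_u_HKC :: "nat \<Rightarrow> mode set" where
  "N_u_HKC M = {(m1, m3, p, c). p \<in> {1, 2} \<and> locked_phase (m1, m3, p, c) \<and>
     (c = 1 \<and> (m1, m3) \<in> M_u M \<or> c = 2 \<and> (m1, m3) \<in> M_w M)}"

definition N_theta_HKC :: "nat \<Rightarrow> mode set" where
  "N_theta_HKC M = {(m1, m3, p, c). p \<in> {1, 2} \<and> locked_phase (m1, m3, p, c) \<and>
     c = 1 \<and> (m1, m3) \<in> M_theta M}"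

definition span_u :: "real \<Rightarrow> nat \<Rightarrow> velocity set" where
  "span_u k1 M = {\<lambda>x. \<Sum>n\<in>N_u_HKC M. a n *\<^sub>R u_basis k1 n x | a. True}"

definition span_theta :: "real \<Rightarrow> nat \<Rightarrow> temperature set" where
  "span_theta k1 M = {\<lambda>x. \<Sum>n\<in>N_theta_HKC M. a n *\<^sub>R theta_basis k1 n x | a. True}"

definition proj_u :: "real \<Rightarrow> nat \<Rightarrow> velocity \<Rightarrow> velocity" where
  "proj_u k1 M = orth_proj k1 (span_u k1 M)"

definition proj_theta :: "real \<Rightarrow> nat \<Rightarrow> temperature \<Rightarrow> temperature" where
  "proj_theta k1 M = orth_proj k1 (span_theta k1 M)"

definition proj_HKC :: "real \<Rightarrow> nat \<Rightarrow> state \<Rightarrow> state" where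
  "proj_HKC k1 M X = (proj_u k1 M (fst X), proj_theta k1 M (snd X))"

text \<open>
  On the finite-dimensional spans, the pointwise time derivative is the derivative of the curve
  with respect to any norm.
\<close>

definition hkc_solution ::
    "real \<Rightarrow> real \<Rightarrow> real \<Rightarrow> real \<Rightarrow> nat \<Rightarrow> state \<Rightarrow> (real \<Rightarrow> state) \<Rightarrow> bool" where
  "hkc_solution R S P k1 M X0 X \<longleftrightarrow>
    (let u = (\<lambda>t. fst (X t)); \<theta> = (\<lambda>t. snd (X t)) in
     X 0 = X0 \<and>
     (\<forall>t\<ge>0. u t \<in> span_u k1 M \<and> \<theta> t \<in> span_theta k1 M \<and>
       (\<forall>x\<in>cell k1.
         ((\<lambda>s. u s x) has_vector_derivative
            (P *\<^sub>R laplacian (u t) x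
             + (P * R) *\<^sub>R proj_u k1 M (\<lambda>y. \<theta> t y *\<^sub>R e3) x
             - (P * S) *\<^sub>R proj_u k1 M (\<lambda>y. cross3 e3 (u t y)) x
             - proj_u k1 M (advect (u t) (u t)) x)) (at t within {0..}) \<and>
         ((\<lambda>s. \<theta> s x) has_vector_derivative
            (laplacian (\<theta> t) x
             + proj_theta k1 M (\<lambda>y. u t y $ 3) x
             - proj_theta k1 M (advect (u t) (\<theta> t)) x)) (at t within {0..}))))"

end

theory Submission
  imports Defs
begin

text \<open>Velocity and temperature form one field \<open>w\<close> with values in \<open>\<real>\<^sup>3 \<times> \<real>\<close>. The model \<open>X\<^sup>M\<close> is compared with
the projection of \<open>X\<close> onto the modes of the hierarchy together with finitely many of the modes of the wrong
phase, exhausting all modes as \<open>M\<close> grows. Phase-locked fields are odd and the remaining basis fields even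
under the rotation by \<open>\<pi>\<close> about the centre of the cell, so \<open>X\<^sup>M\<close> also solves the Galerkin system on this
larger span, and it is unnecessary to know that \<open>X\<close> stays phase-locked. Ladyzhenskaya's inequality yields
\<open>z' \<le> C (1 + g) (z + r)\<close> for the squared distance \<open>z\<close>, where \<open>g = \<parallel>\<nabla>w\<parallel>\<^sup>2\<close> and \<open>r\<close> bounds the projection
error, which tends to zero uniformly on \<open>[0,\<tau>]\<close> by compactness of the trajectory in \<open>L\<^sup>2\<close>. Up to a bounded
term the energy identity bounds \<open>g\<close> by a multiple of \<open>-y'\<close>, where \<open>y = \<parallel>w\<parallel>\<^sup>2\<close>, so Gronwall's inequality
applies.\<close>

text \<open>The projection error is small in L2, but its gradient is merely bounded by
  \<open>g\<close>, so no smallness may be drawn from its derivatives. Two facts allow for this. The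
  basis fields are eigenfunctions of the Laplacian, so the L2 projection is orthogonal for gradients
  as well and its error drops out of the diffusion term. The transport term is antisymmetric, so the
  derivative can be moved onto the difference inside the span, whose gradient the diffusion absorbs;
  the L4 norms that remain cost half a power of a gradient each, which the dimension two affords.
  Nothing is known about gradients at t = 0: the differential inequality lives on the open interval,
  and only L2 norms are followed down to t = 0. The Leray projection is given by choice. It acquires
  meaning only once the orthogonal projection is known to exist, and then it disappears from every
  pairing with a solenoidal field. Both this and the comparison need the basis to be complete. For
  the planar velocities this is a statement about gradients of sine series, reached through a stream
  function.\<close>

locale channel =
  fixes k1 :: real
  assumes k1_pos: "0 < k1"
begin

abbreviation mC :: "point measure" where "mC \<equiv> lebesgue_on (cell k1)"

section \<open>The cell as a compact box of finite measure\<close>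

lemma cell_cbox: "cell k1 = cbox (0, 0) (2 * pi / k1, pi)"
  by (simp only: cell_def cbox_Pair_eq box_real)

lemma cell_sets [measurable, simp]: "cell k1 \<in> sets lebesgue"
  by (simp add: cell_cbox)

lemma finite_measure_mC: "finite_measure mC"
  by (rule finite_measure_lebesgue_on) (simp add: cell_cbox)

lemma cell_subset_strip: "cell k1 \<subseteq> strip"
  by (auto simp: cell_def strip_def)

lemma compact_cell: "compact (cell k1)"
  by (simp add: cell_cbox compact_cbox)

lemma period_pos: "0 < 2 * pi / k1"
  using k1_pos by simp

subsection \<open>Square-integrable functions\<close>

lemma L2_spaceI:
  fixes f :: "point \<Rightarrow> 'b::euclidean_space"
  assumes "f \<in> borel_measurable mC" "integrable mC (\<lambda>x. (norm (f x))\<^sup>2)"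
  shows "f \<in> L2_space k1"
  using assms by (simp add: L2_space_def)

lemma L2_measurable:
  fixes f :: "point \<Rightarrow> 'b::euclidean_space"
  shows "f \<in> L2_space k1 \<Longrightarrow> f \<in> borel_measurable mC"
  by (simp add: L2_space_def)

lemma L2_integrable_sq:
  fixes f :: "point \<Rightarrow> 'b::euclidean_space"
  shows "f \<in> L2_space k1 \<Longrightarrow> integrable mC (\<lambda>x. (norm (f x))\<^sup>2)"
  by (simp add: L2_space_def)

lemma continuous_integrable_cell:
  fixes f :: "point \<Rightarrow> 'b::euclidean_space"
  assumes "continuous_on strip f"
  shows "integrable mC f"
  unfolding cell_cbox
  using continuous_on_subset[OF assms cell_subset_strip]
  by (intro continuous_imp_integrable) (simp add: cell_cbox)

lemma continuous_L2:
  fixes f :: "point \<Rightarrow> 'b::euclidean_space"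
  assumes "continuous_on strip f"
  shows "f \<in> L2_space k1"
proof (rule L2_spaceI)
  show "f \<in> borel_measurable mC"
    using continuous_integrable_cell[OF assms] by auto
  show "integrable mC (\<lambda>x. (norm (f x))\<^sup>2)"
    by (intro continuous_integrable_cell continuous_intros assms)
qed

lemma L2_inner_integrable:
  fixes f g :: "point \<Rightarrow> 'b::euclidean_space"
  assumes "f \<in> L2_space k1" "g \<in> L2_space k1"
  shows "integrable mC (\<lambda>x. f x \<bullet> g x)"
proof (rule Bochner_Integration.integrable_bound)
  show "integrable mC (\<lambda>x. (norm (f x))\<^sup>2 + (norm (g x))\<^sup>2)"
    using assms by (intro Bochner_Integration.integrable_add L2_integrable_sq)
  show "(\<lambda>x. f x \<bullet> g x) \<in> borel_measurable mC"
    using assms by (intro borel_measurable_inner L2_measurable)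
  show "AE x in mC. norm (f x \<bullet> g x) \<le> norm ((norm (f x))\<^sup>2 + (norm (g x))\<^sup>2)"
  proof (rule AE_I2)
    fix x
    have "norm (f x \<bullet> g x) \<le> norm (f x) * norm (g x)"
      by (simp add: Cauchy_Schwarz_ineq2)
    also have "\<dots> \<le> (norm (f x))\<^sup>2 + (norm (g x))\<^sup>2"
      using sum_squares_bound[of "norm (f x)" "norm (g x)"] mult_nonneg_nonneg[OF norm_ge_zero norm_ge_zero, of "f x" "g x"]
      by linarith
    finally show "norm (f x \<bullet> g x) \<le> norm ((norm (f x))\<^sup>2 + (norm (g x))\<^sup>2)" by simp
  qed
qed

lemma L2_zero: "(\<lambda>x. 0::'b::euclidean_space) \<in> L2_space k1"
  by (intro continuous_L2 continuous_intros)

lemma L2_add: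
  fixes f g :: "point \<Rightarrow> 'b::euclidean_space"
  assumes "f \<in> L2_space k1" "g \<in> L2_space k1"
  shows "(\<lambda>x. f x + g x) \<in> L2_space k1"
proof (rule L2_spaceI)
  show "(\<lambda>x. f x + g x) \<in> borel_measurable mC"
    using assms by (intro borel_measurable_add L2_measurable)
  have "integrable mC (\<lambda>x. (norm (f x))\<^sup>2 + (norm (g x))\<^sup>2 + 2 * (f x \<bullet> g x))"
    using assms by (intro Bochner_Integration.integrable_add integrable_mult_right L2_integrable_sq L2_inner_integrable)
  moreover have "(norm (f x))\<^sup>2 + (norm (g x))\<^sup>2 + 2 * (f x \<bullet> g x) = (norm (f x + g x))\<^sup>2" for x
    by (simp add: power2_norm_eq_inner algebra_simps inner_commute)
  ultimately show "integrable mC (\<lambda>x. (norm (f x + g x))\<^sup>2)"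
    by simp
qed

lemma L2_scaleR:
  fixes f :: "point \<Rightarrow> 'b::euclidean_space"
  assumes "f \<in> L2_space k1"
  shows "(\<lambda>x. c *\<^sub>R f x) \<in> L2_space k1"
proof (rule L2_spaceI)
  show "(\<lambda>x. c *\<^sub>R f x) \<in> borel_measurable mC"
    using L2_measurable[OF assms] by simp
  show "integrable mC (\<lambda>x. (norm (c *\<^sub>R f x))\<^sup>2)"
    using L2_integrable_sq[OF assms] by (simp add: power_mult_distrib)
qed

lemma L2_diff:
  fixes f g :: "point \<Rightarrow> 'b::euclidean_space"
  assumes "f \<in> L2_space k1" "g \<in> L2_space k1"
  shows "(\<lambda>x. f x - g x) \<in> L2_space k1"
  using L2_add[OF assms(1) L2_scaleR[OF assms(2), of "-1"]] by simp

lemma L2_sum: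
  fixes f :: "'n \<Rightarrow> point \<Rightarrow> 'b::euclidean_space"
  assumes "\<And>n. n \<in> A \<Longrightarrow> f n \<in> L2_space k1"
  shows "(\<lambda>x. \<Sum>n\<in>A. f n x) \<in> L2_space k1"
  using assms by (induction A rule: infinite_finite_induct) (auto intro: L2_zero L2_add)

lemma L2_bounded_linear:
  fixes f :: "point \<Rightarrow> 'b::euclidean_space" and h :: "'b \<Rightarrow> 'c::euclidean_space"
  assumes h: "bounded_linear h" and f: "f \<in> L2_space k1"
  shows "(\<lambda>x. h (f x)) \<in> L2_space k1"
proof (rule L2_spaceI)
  have ch: "continuous_on UNIV h"
    using h by (simp add: linear_continuous_on)
  show m: "(\<lambda>x. h (f x)) \<in> borel_measurable mC"
    using borel_measurable_continuous_on[OF ch L2_measurable[OF f]] .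
  obtain K where K: "\<And>x. norm (h x) \<le> norm x * K" "K > 0"
    using bounded_linear.pos_bounded[OF h] by blast
  show "integrable mC (\<lambda>x. (norm (h (f x)))\<^sup>2)"
  proof (rule Bochner_Integration.integrable_bound)
    show "integrable mC (\<lambda>x. K\<^sup>2 * (norm (f x))\<^sup>2)"
      using L2_integrable_sq[OF f] by simp
    show "(\<lambda>x. (norm (h (f x)))\<^sup>2) \<in> borel_measurable mC"
      using m by simp
    show "AE x in mC. norm ((norm (h (f x)))\<^sup>2) \<le> norm (K\<^sup>2 * (norm (f x))\<^sup>2)"
    proof (rule AE_I2)
      fix x
      have "(norm (h (f x)))\<^sup>2 \<le> (norm (f x) * K)\<^sup>2"
        by (intro power_mono K) simp
      then show "norm ((norm (h (f x)))\<^sup>2) \<le> norm (K\<^sup>2 * (norm (f x))\<^sup>2)"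
        by (simp add: power_mult_distrib mult.commute)
    qed
  qed
qed

lemma L2_inner_commute:
  fixes f g :: "point \<Rightarrow> 'b::euclidean_space"
  shows "L2_inner k1 f g = L2_inner k1 g f"
  by (simp add: L2_inner_def inner_commute)

lemma L2_inner_add_left:
  fixes f g h :: "point \<Rightarrow> 'b::euclidean_space"
  assumes "f \<in> L2_space k1" "g \<in> L2_space k1" "h \<in> L2_space k1"
  shows "L2_inner k1 (\<lambda>x. f x + g x) h = L2_inner k1 f h + L2_inner k1 g h"
  using assms by (simp add: L2_inner_def inner_add_left L2_inner_integrable)

lemma L2_inner_diff_left:
  fixes f g h :: "point \<Rightarrow> 'b::euclidean_space"
  assumes "f \<in> L2_space k1" "g \<in> L2_space k1" "h \<in> L2_space k1"
  shows "L2_inner k1 (\<lambda>x. f x - g x) h = L2_inner k1 f h - L2_inner k1 g h"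
  using assms by (simp add: L2_inner_def inner_diff_left L2_inner_integrable)

lemma L2_inner_scaleR_left:
  fixes f h :: "point \<Rightarrow> 'b::euclidean_space"
  shows "L2_inner k1 (\<lambda>x. c *\<^sub>R f x) h = c * L2_inner k1 f h"
  by (simp add: L2_inner_def)

lemma L2_inner_add_right:
  fixes f g h :: "point \<Rightarrow> 'b::euclidean_space"
  assumes "f \<in> L2_space k1" "g \<in> L2_space k1" "h \<in> L2_space k1"
  shows "L2_inner k1 h (\<lambda>x. f x + g x) = L2_inner k1 h f + L2_inner k1 h g"
  using assms by (simp add: L2_inner_def inner_add_right L2_inner_integrable)

lemma L2_inner_diff_right:
  fixes f g h :: "point \<Rightarrow> 'b::euclidean_space"
  assumes "f \<in> L2_space k1" "g \<in> L2_space k1" "h \<in> L2_space k1"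
  shows "L2_inner k1 h (\<lambda>x. f x - g x) = L2_inner k1 h f - L2_inner k1 h g"
  using assms by (simp add: L2_inner_def inner_diff_right L2_inner_integrable)

lemma L2_inner_scaleR_right:
  fixes f h :: "point \<Rightarrow> 'b::euclidean_space"
  shows "L2_inner k1 h (\<lambda>x. c *\<^sub>R f x) = c * L2_inner k1 h f"
  by (simp add: L2_inner_def)

lemma L2_inner_sum_left:
  fixes f :: "'n \<Rightarrow> point \<Rightarrow> 'b::euclidean_space"
  assumes "\<And>n. n \<in> A \<Longrightarrow> f n \<in> L2_space k1" "h \<in> L2_space k1"
  shows "L2_inner k1 (\<lambda>x. \<Sum>n\<in>A. f n x) h = (\<Sum>n\<in>A. L2_inner k1 (f n) h)"
  using assms by (simp add: L2_inner_def inner_sum_left L2_inner_integrable)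

lemma L2_inner_sum_right:
  fixes f :: "'n \<Rightarrow> point \<Rightarrow> 'b::euclidean_space"
  assumes "\<And>n. n \<in> A \<Longrightarrow> f n \<in> L2_space k1" "h \<in> L2_space k1"
  shows "L2_inner k1 h (\<lambda>x. \<Sum>n\<in>A. f n x) = (\<Sum>n\<in>A. L2_inner k1 h (f n))"
  using L2_inner_sum_left[OF assms] by (simp add: L2_inner_commute)

lemma L2_inner_cong_AE:
  fixes f g h :: "point \<Rightarrow> 'b::euclidean_space"
  assumes "f \<in> borel_measurable mC" "f' \<in> borel_measurable mC" "g \<in> borel_measurable mC"
    and "AE x in mC. f x = f' x"
  shows "L2_inner k1 f g = L2_inner k1 f' g"
  unfolding L2_inner_def using assms
  by (intro integral_cong_AE) (auto intro: borel_measurable_inner)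

lemma L2_inner_cong:
  fixes f g :: "point \<Rightarrow> 'b::euclidean_space"
  assumes "\<And>x. x \<in> strip \<Longrightarrow> f x \<bullet> g x = f' x \<bullet> g' x"
  shows "L2_inner k1 f g = L2_inner k1 f' g'"
  unfolding L2_inner_def using assms cell_subset_strip
  by (intro Bochner_Integration.integral_cong) auto

lemma L2_norm_sq:
  fixes f :: "point \<Rightarrow> 'b::euclidean_space"
  shows "(L2_norm k1 f)\<^sup>2 = L2_inner k1 f f"
  by (simp add: L2_norm_def L2_inner_def power2_norm_eq_inner)

lemma L2_norm_nonneg: "0 \<le> L2_norm k1 (f :: point \<Rightarrow> 'b::euclidean_space)"
  by (simp add: L2_norm_def)

lemma L2_inner_self_nonneg: "0 \<le> L2_inner k1 f (f :: point \<Rightarrow> 'b::euclidean_space)"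
  by (metis L2_norm_sq zero_le_power2)

lemma L2_norm_eq_sqrt: "L2_norm k1 (f :: point \<Rightarrow> 'b::euclidean_space) = sqrt (L2_inner k1 f f)"
  by (simp add: L2_norm_def L2_inner_def power2_norm_eq_inner)

lemma L2_norm_sq_add:
  fixes f g :: "point \<Rightarrow> 'b::euclidean_space"
  assumes "f \<in> L2_space k1" "g \<in> L2_space k1"
  shows "L2_inner k1 (\<lambda>x. f x + g x) (\<lambda>x. f x + g x)
    = L2_inner k1 f f + 2 * L2_inner k1 f g + L2_inner k1 g g"
  using assms by (simp add: L2_inner_add_left L2_inner_add_right L2_add L2_inner_commute[of g f])

lemma L2_norm_sq_diff:
  fixes f g :: "point \<Rightarrow> 'b::euclidean_space"
  assumes "f \<in> L2_space k1" "g \<in> L2_space k1"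
  shows "L2_inner k1 (\<lambda>x. f x - g x) (\<lambda>x. f x - g x)
    = L2_inner k1 f f - 2 * L2_inner k1 f g + L2_inner k1 g g"
  using assms by (simp add: L2_inner_diff_left L2_inner_diff_right L2_diff L2_inner_commute[of g f])

text \<open>The quadratic s \<mapsto> ||f + s g||^2 is nonnegative. The case c = 0 is separate
  because functions are not identified modulo null sets: g need not be the zero function then, but
  the quadratic becomes affine in s, which forces b = 0.\<close>

lemma L2_Cauchy_Schwarz_sq:
  fixes f g :: "point \<Rightarrow> 'b::euclidean_space"
  assumes "f \<in> L2_space k1" "g \<in> L2_space k1"
  shows "(L2_inner k1 f g)\<^sup>2 \<le> L2_inner k1 f f * L2_inner k1 g g"
proof -
  define a b c where "a = L2_inner k1 f f" and "b = L2_inner k1 f g" and "c = L2_inner k1 g g"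
  have q: "0 \<le> a + 2 * (s * b) + s * (s * c)" for s
    using L2_inner_self_nonneg[of "\<lambda>x. f x + s *\<^sub>R g x"]
    by (simp add: L2_norm_sq_add assms L2_scaleR L2_inner_scaleR_left L2_inner_scaleR_right a_def b_def c_def)
  have c0: "0 \<le> c" by (simp add: c_def L2_inner_self_nonneg)
  have "b\<^sup>2 \<le> a * c"
  proof (cases "c = 0")
    case True
    have "b = 0"
    proof (rule ccontr)
      assume "b \<noteq> 0"
      \<comment> \<open>This s turns the affine function a + 2 s b into -1.\<close>
      then show False using q[of "- (a + 1) / (2 * b)"] True by (simp add: field_simps)
    qed
    then show ?thesis using True by simp
  next
    case False
    then have "0 < c" using c0 by simp
    then show ?thesis using q[of "- b / c"] by (simp add: field_simps power2_eq_square)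
  qed
  then show ?thesis by (simp add: a_def b_def c_def)
qed

lemma L2_Cauchy_Schwarz:
  fixes f g :: "point \<Rightarrow> 'b::euclidean_space"
  assumes "f \<in> L2_space k1" "g \<in> L2_space k1"
  shows "\<bar>L2_inner k1 f g\<bar> \<le> L2_norm k1 f * L2_norm k1 g"
proof (rule power2_le_imp_le)
  show "\<bar>L2_inner k1 f g\<bar>\<^sup>2 \<le> (L2_norm k1 f * L2_norm k1 g)\<^sup>2"
    unfolding power_mult_distrib L2_norm_sq power2_abs by (rule L2_Cauchy_Schwarz_sq[OF assms])
  show "0 \<le> L2_norm k1 f * L2_norm k1 g"
    by (intro mult_nonneg_nonneg L2_norm_nonneg)
qed

lemma L2_triangle:
  fixes f g :: "point \<Rightarrow> 'b::euclidean_space"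
  assumes "f \<in> L2_space k1" "g \<in> L2_space k1"
  shows "L2_norm k1 (\<lambda>x. f x + g x) \<le> L2_norm k1 f + L2_norm k1 g"
proof (rule power2_le_imp_le)
  have "(L2_norm k1 (\<lambda>x. f x + g x))\<^sup>2 = L2_inner k1 f f + 2 * L2_inner k1 f g + L2_inner k1 g g"
    by (simp add: L2_norm_sq L2_norm_sq_add assms)
  also have "\<dots> \<le> (L2_norm k1 f + L2_norm k1 g)\<^sup>2"
    using L2_Cauchy_Schwarz[OF assms] by (simp add: power2_sum L2_norm_sq)
  finally show "(L2_norm k1 (\<lambda>x. f x + g x))\<^sup>2 \<le> (L2_norm k1 f + L2_norm k1 g)\<^sup>2" .
qed (simp add: L2_norm_nonneg)

lemma L2_norm_minus_commute:
  fixes f g :: "point \<Rightarrow> 'b::euclidean_space"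
  shows "L2_norm k1 (\<lambda>x. f x - g x) = L2_norm k1 (\<lambda>x. g x - f x)"
  by (simp add: L2_norm_def norm_minus_commute)

lemma L2_triangle_diff:
  fixes f g h :: "point \<Rightarrow> 'b::euclidean_space"
  assumes "f \<in> L2_space k1" "g \<in> L2_space k1" "h \<in> L2_space k1"
  shows "L2_norm k1 (\<lambda>x. f x - h x) \<le> L2_norm k1 (\<lambda>x. f x - g x) + L2_norm k1 (\<lambda>x. g x - h x)"
  using L2_triangle[of "\<lambda>x. f x - g x" "\<lambda>x. g x - h x"] assms by (simp add: L2_diff)

lemma L2_norm_le_of_sq:
  fixes f :: "point \<Rightarrow> 'b::euclidean_space"
  assumes "L2_inner k1 f f \<le> c\<^sup>2" "0 \<le> c"
  shows "L2_norm k1 f \<le> c"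
  by (rule power2_le_imp_le) (use assms in \<open>simp_all add: L2_norm_sq\<close>)

lemma L2_norm_abs_diff:
  fixes f g :: "point \<Rightarrow> 'b::euclidean_space"
  assumes "f \<in> L2_space k1" "g \<in> L2_space k1"
  shows "\<bar>L2_norm k1 f - L2_norm k1 g\<bar> \<le> L2_norm k1 (\<lambda>x. f x - g x)"
proof -
  have "L2_norm k1 f \<le> L2_norm k1 (\<lambda>x. f x - g x) + L2_norm k1 g"
    using L2_triangle_diff[OF assms L2_zero] by simp
  moreover have "L2_norm k1 g \<le> L2_norm k1 (\<lambda>x. f x - g x) + L2_norm k1 f"
    using L2_triangle_diff[OF assms(2,1) L2_zero] L2_norm_minus_commute[of f g] by simp
  ultimately show ?thesis by linarith
qed

text \<open>Riesz--Fischer: an $L^2$-Cauchy sequence is $L^1$-Cauchy on the cell, hence converges almost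
  everywhere along a subsequence, and Fatou's lemma identifies the limit.\<close>

lemma L2_complete:
  fixes s :: "nat \<Rightarrow> point \<Rightarrow> 'b::euclidean_space"
  assumes s: "\<And>n. s n \<in> L2_space k1"
    and cauchy: "\<And>e. e > 0 \<Longrightarrow> \<exists>N. \<forall>i\<ge>N. \<forall>j\<ge>N. L2_norm k1 (\<lambda>x. s i x - s j x) < e"
  shows "\<exists>g\<in>L2_space k1. \<forall>e>0. \<exists>N. \<forall>n\<ge>N. L2_norm k1 (\<lambda>x. s n x - g x) \<le> e"
proof -
  interpret finite_measure mC by (rule finite_measure_mC)
  \<comment> \<open>The square root of the area of the cell, which Cauchy-Schwarz against the
    constant 1 produces when L1 is bounded by L2.\<close>
  define m1 where "m1 = L2_norm k1 (\<lambda>x. 1::real)"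
  have m1: "0 \<le> m1" by (simp add: m1_def L2_norm_nonneg)
  have sm [measurable]: "s n \<in> borel_measurable mC" for n
    by (rule L2_measurable[OF s])
  have l1: "(LINT x|mC. norm (f x)) \<le> L2_norm k1 f * m1" and l1i: "integrable mC f"
    if "f \<in> L2_space k1" for f :: "point \<Rightarrow> 'b"
  proof -
    have n: "(\<lambda>x. norm (f x)) \<in> L2_space k1"
      using that by (intro L2_spaceI) (auto simp: L2_space_def)
    have o: "(\<lambda>x. 1::real) \<in> L2_space k1"
      by (intro continuous_L2 continuous_intros)
    have "(LINT x|mC. norm (f x)) = L2_inner k1 (\<lambda>x. norm (f x)) (\<lambda>x. 1)"
      by (simp add: L2_inner_def)
    also have "\<dots> \<le> L2_norm k1 (\<lambda>x. norm (f x)) * m1"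
      using L2_Cauchy_Schwarz[OF n o] by (simp add: m1_def)
    also have "L2_norm k1 (\<lambda>x. norm (f x)) = L2_norm k1 f"
      by (simp add: L2_norm_def)
    finally show "(LINT x|mC. norm (f x)) \<le> L2_norm k1 f * m1" .
    have "integrable mC (\<lambda>x. norm (f x))"
      using L2_inner_integrable[OF n o] by simp
    then show "integrable mC f"
      using L2_measurable[OF that] integrable_norm_cancel by blast
  qed
  have "\<exists>N. \<forall>i\<ge>N. \<forall>j\<ge>N. (LINT x|mC. norm (s i x - s j x)) < e" if "e > 0" for e
  proof -
    have "e / (m1 + 1) > 0" using that m1 by simp
    from cauchy[OF this] obtain N where N: "\<And>i j. i \<ge> N \<Longrightarrow> j \<ge> N \<Longrightarrow> L2_norm k1 (\<lambda>x. s i x - s j x) < e / (m1 + 1)"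
      by blast
    have "(LINT x|mC. norm (s i x - s j x)) < e" if "i \<ge> N" "j \<ge> N" for i j
    proof -
      have "(LINT x|mC. norm (s i x - s j x)) \<le> L2_norm k1 (\<lambda>x. s i x - s j x) * m1"
        using l1[OF L2_diff[OF s s]] .
      also have "\<dots> \<le> (e / (m1 + 1)) * m1"
        using N[OF that] m1 by (intro mult_right_mono) auto
      also have "\<dots> < e" using m1 \<open>e > 0\<close> by (simp add: field_simps)
      finally show ?thesis .
    qed
    then show ?thesis by blast
  qed
  from cauchy_L1_AE_cauchy_subseq[OF l1i[OF s] this]
  obtain r where r: "strict_mono r" and ae: "AE x in mC. Cauchy (\<lambda>i. s (r i) x)"
    by blast
  define g where "g x = lim (\<lambda>i. s (r i) x)" for x
  have gm [measurable]: "g \<in> borel_measurable mC"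
    unfolding g_def by (intro borel_measurable_lim_metric) simp
  have conv: "AE x in mC. (\<lambda>i. s (r i) x) \<longlonglongrightarrow> g x"
    using ae by eventually_elim (simp add: g_def Cauchy_convergent_iff convergent_LIMSEQ_iff)
  have est: "(\<integral>\<^sup>+x. ennreal ((norm (s j x - g x))\<^sup>2) \<partial>mC) \<le> ennreal (e\<^sup>2)"
    if e: "e > 0" and N: "\<forall>i\<ge>N. \<forall>j\<ge>N. L2_norm k1 (\<lambda>x. s i x - s j x) < e" and j: "j \<ge> N" for e N j
  proof -
    have "(\<integral>\<^sup>+x. ennreal ((norm (s j x - g x))\<^sup>2) \<partial>mC)
      = (\<integral>\<^sup>+x. liminf (\<lambda>i. ennreal ((norm (s j x - s (r i) x))\<^sup>2)) \<partial>mC)"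
    proof (rule nn_integral_cong_AE)
      show "AE x in mC. ennreal ((norm (s j x - g x))\<^sup>2) = liminf (\<lambda>i. ennreal ((norm (s j x - s (r i) x))\<^sup>2))"
        using conv
      proof eventually_elim
        case (elim x)
        have "(\<lambda>i. ennreal ((norm (s j x - s (r i) x))\<^sup>2)) \<longlonglongrightarrow> ennreal ((norm (s j x - g x))\<^sup>2)"
          by (intro tendsto_ennrealI tendsto_intros elim)
        then show ?case
          by (intro lim_imp_Liminf[symmetric]) auto
      qed
    qed
    also have "\<dots> \<le> liminf (\<lambda>i. \<integral>\<^sup>+x. ennreal ((norm (s j x - s (r i) x))\<^sup>2) \<partial>mC)"
      by (rule nn_integral_liminf) simp
    also have "\<dots> \<le> ennreal (e\<^sup>2)"
    proof (rule Liminf_le, simp)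
      have ev: "\<forall>\<^sub>F i in sequentially. r i \<ge> N"
        using r by (meson eventually_sequentiallyI le_trans seq_suble)
      show "\<forall>\<^sub>F i in sequentially. (\<integral>\<^sup>+x. ennreal ((norm (s j x - s (r i) x))\<^sup>2) \<partial>mC) \<le> ennreal (e\<^sup>2)"
        using ev
      proof eventually_elim
        case (elim i)
        have d: "(\<lambda>x. s j x - s (r i) x) \<in> L2_space k1" by (rule L2_diff[OF s s])
        have "(\<integral>\<^sup>+x. ennreal ((norm (s j x - s (r i) x))\<^sup>2) \<partial>mC) = ennreal (LINT x|mC. (norm (s j x - s (r i) x))\<^sup>2)"
          by (rule nn_integral_eq_integral) (use L2_integrable_sq[OF d] in auto)
        also have "(LINT x|mC. (norm (s j x - s (r i) x))\<^sup>2) = (L2_norm k1 (\<lambda>x. s j x - s (r i) x))\<^sup>2"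
          by (simp add: L2_norm_sq L2_inner_def power2_norm_eq_inner)
        also have "\<dots> \<le> e\<^sup>2"
          using N j elim by (intro power_mono) (auto intro: less_imp_le simp: L2_norm_nonneg)
        finally show ?case by (simp add: ennreal_leI)
      qed
    qed
    finally show ?thesis .
  qed
  have dl2: "(\<lambda>x. s j x - g x) \<in> L2_space k1 \<and> L2_norm k1 (\<lambda>x. s j x - g x) \<le> e"
    if e: "e > 0" and N: "\<forall>i\<ge>N. \<forall>j\<ge>N. L2_norm k1 (\<lambda>x. s i x - s j x) < e" and j: "j \<ge> N" for e N j
  proof -
    have i: "integrable mC (\<lambda>x. (norm (s j x - g x))\<^sup>2)"
    proof (rule integrableI_bounded)
      show "(\<integral>\<^sup>+x. ennreal (norm ((norm (s j x - g x))\<^sup>2)) \<partial>mC) < \<infinity>"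
        using est[OF that] by (simp add: order_le_less_trans[OF _ ennreal_less_top])
    qed simp
    have l: "(\<lambda>x. s j x - g x) \<in> L2_space k1"
      using i by (intro L2_spaceI) auto
    have "ennreal (LINT x|mC. (norm (s j x - g x))\<^sup>2) \<le> ennreal (e\<^sup>2)"
      using est[OF that] nn_integral_eq_integral[OF i] by simp
    then have "(LINT x|mC. (norm (s j x - g x))\<^sup>2) \<le> e\<^sup>2"
      by (simp add: ennreal_le_iff)
    then have "L2_norm k1 (\<lambda>x. s j x - g x) \<le> e"
      using e by (intro L2_norm_le_of_sq) (auto simp: L2_inner_def power2_norm_eq_inner)
    with l show ?thesis by blast
  qed
  obtain N1 where N1: "\<forall>i\<ge>N1. \<forall>j\<ge>N1. L2_norm k1 (\<lambda>x. s i x - s j x) < 1"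
    using cauchy[of 1] by auto
  have "(\<lambda>x. s N1 x - g x) \<in> L2_space k1"
    using dl2[OF _ N1] by auto
  from L2_diff[OF s this, of N1] have "g \<in> L2_space k1" by simp
  moreover have "\<exists>N. \<forall>n\<ge>N. L2_norm k1 (\<lambda>x. s n x - g x) \<le> e" if "e > 0" for e
    using cauchy[OF that] dl2[OF that] by blast
  ultimately show ?thesis by blast
qed

subsection \<open>Orthonormal families\<close>

definition orthonormal :: "('n \<Rightarrow> point \<Rightarrow> 'b::euclidean_space) \<Rightarrow> 'n set \<Rightarrow> bool" where
  "orthonormal e A \<longleftrightarrow> (\<forall>n\<in>A. e n \<in> L2_space k1) \<and>
     (\<forall>n\<in>A. \<forall>m\<in>A. L2_inner k1 (e n) (e m) = (if n = m then 1 else 0))"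

definition partial_sum :: "('n \<Rightarrow> point \<Rightarrow> 'b::euclidean_space) \<Rightarrow> 'n set \<Rightarrow> (point \<Rightarrow> 'b) \<Rightarrow> point \<Rightarrow> 'b" where
  "partial_sum e A F = (\<lambda>x. \<Sum>n\<in>A. L2_inner k1 F (e n) *\<^sub>R e n x)"

lemma orthonormal_subset: "orthonormal e A \<Longrightarrow> B \<subseteq> A \<Longrightarrow> orthonormal e B"
  unfolding orthonormal_def by (meson subsetD)

lemma orthonormal_L2: "orthonormal e A \<Longrightarrow> n \<in> A \<Longrightarrow> e n \<in> L2_space k1"
  by (simp add: orthonormal_def)

context
  fixes e :: "'n \<Rightarrow> point \<Rightarrow> 'b::euclidean_space" and A :: "'n set"
  assumes o: "orthonormal e A" and fin: "finite A"
begin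

lemma L2_combination: "(\<lambda>x. \<Sum>n\<in>A. c n *\<^sub>R e n x) \<in> L2_space k1"
  using o by (intro L2_sum L2_scaleR orthonormal_L2)

lemma L2_inner_combination_right:
  assumes "F \<in> L2_space k1"
  shows "L2_inner k1 F (\<lambda>x. \<Sum>n\<in>A. c n *\<^sub>R e n x) = (\<Sum>n\<in>A. c n * L2_inner k1 F (e n))"
  using o assms by (subst L2_inner_sum_right) (auto simp: L2_inner_scaleR_right intro: L2_scaleR orthonormal_L2)

lemma combination_coeff:
  assumes "m \<in> A"
  shows "L2_inner k1 (\<lambda>x. \<Sum>n\<in>A. c n *\<^sub>R e n x) (e m) = c m"
proof -
  have "L2_inner k1 (\<lambda>x. \<Sum>n\<in>A. c n *\<^sub>R e n x) (e m) = (\<Sum>n\<in>A. c n * L2_inner k1 (e m) (e n))"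
    using L2_inner_combination_right[OF orthonormal_L2[OF o assms]] by (simp add: L2_inner_commute)
  also have "\<dots> = (\<Sum>n\<in>A. if n = m then c n else 0)"
    using o assms by (intro sum.cong) (auto simp: orthonormal_def)
  finally show ?thesis using assms fin by simp
qed

lemma L2_inner_combinations:
  "L2_inner k1 (\<lambda>x. \<Sum>n\<in>A. c n *\<^sub>R e n x) (\<lambda>x. \<Sum>n\<in>A. d n *\<^sub>R e n x) = (\<Sum>n\<in>A. c n * d n)"
  by (subst L2_inner_combination_right[OF L2_combination])
    (simp add: combination_coeff mult.commute)

lemma partial_sum_L2: "partial_sum e A F \<in> L2_space k1"
  unfolding partial_sum_def by (rule L2_combination)

lemma partial_sum_orth:
  assumes "F \<in> L2_space k1"
  shows "L2_inner k1 (\<lambda>x. F x - partial_sum e A F x) (\<lambda>x. \<Sum>n\<in>A. c n *\<^sub>R e n x) = 0"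
  using assms partial_sum_L2[of F] L2_combination[of c]
  by (simp add: L2_inner_diff_left L2_inner_combination_right partial_sum_def combination_coeff)

lemma partial_sum_inner:
  assumes "F \<in> L2_space k1"
  shows "L2_inner k1 F (partial_sum e A F) = (\<Sum>n\<in>A. (L2_inner k1 F (e n))\<^sup>2)"
    and "L2_inner k1 (partial_sum e A F) (partial_sum e A F) = (\<Sum>n\<in>A. (L2_inner k1 F (e n))\<^sup>2)"
  using assms by (simp_all add: partial_sum_def L2_inner_combination_right L2_inner_combinations power2_eq_square)

lemma partial_sum_residual:
  assumes "F \<in> L2_space k1"
  shows "L2_inner k1 (\<lambda>x. F x - partial_sum e A F x) (\<lambda>x. F x - partial_sum e A F x)
    = L2_inner k1 F F - (\<Sum>n\<in>A. (L2_inner k1 F (e n))\<^sup>2)"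
  using assms partial_sum_L2[of F] by (simp add: L2_norm_sq_diff partial_sum_inner)

lemma Bessel:
  assumes "F \<in> L2_space k1"
  shows "(\<Sum>n\<in>A. (L2_inner k1 F (e n))\<^sup>2) \<le> L2_inner k1 F F"
  using partial_sum_residual[OF assms] L2_inner_self_nonneg[of "\<lambda>x. F x - partial_sum e A F x"] by simp

text \<open>Completing the square: the squared distance exceeds the residual by the sum of the
  squared coefficient errors.\<close>

lemma partial_sum_best:
  assumes "F \<in> L2_space k1"
  shows "L2_norm k1 (\<lambda>x. F x - partial_sum e A F x) \<le> L2_norm k1 (\<lambda>x. F x - (\<Sum>n\<in>A. c n *\<^sub>R e n x))"
proof -
  have "L2_inner k1 (\<lambda>x. F x - (\<Sum>n\<in>A. c n *\<^sub>R e n x)) (\<lambda>x. F x - (\<Sum>n\<in>A. c n *\<^sub>R e n x))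
    = L2_inner k1 F F - 2 * (\<Sum>n\<in>A. c n * L2_inner k1 F (e n)) + (\<Sum>n\<in>A. c n * c n)"
    using assms L2_combination[of c]
    by (simp add: L2_norm_sq_diff L2_inner_combination_right L2_inner_combinations)
  also have "\<dots> = L2_inner k1 F F - (\<Sum>n\<in>A. (L2_inner k1 F (e n))\<^sup>2) + (\<Sum>n\<in>A. (c n - L2_inner k1 F (e n))\<^sup>2)"
    by (simp add: power2_diff sum.distrib sum_subtractf sum_distrib_left power2_eq_square algebra_simps)
  finally have "L2_inner k1 (\<lambda>x. F x - partial_sum e A F x) (\<lambda>x. F x - partial_sum e A F x)
    \<le> L2_inner k1 (\<lambda>x. F x - (\<Sum>n\<in>A. c n *\<^sub>R e n x)) (\<lambda>x. F x - (\<Sum>n\<in>A. c n *\<^sub>R e n x))"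
    by (simp add: partial_sum_residual[OF assms] sum_nonneg)
  then show ?thesis by (simp add: L2_norm_eq_sqrt)
qed

text \<open>The Fourier partial sum is a witness for the choice in \<open>orth_proj\<close>, so
  whatever function is chosen has both characterising properties.\<close>

lemma orth_proj_span:
  assumes "F \<in> L2_space k1"
  defines "V \<equiv> {\<lambda>x. \<Sum>n\<in>A. a n *\<^sub>R e n x | a. True}"
  shows "orth_proj k1 V F \<in> V \<and> (\<forall>v\<in>V. L2_inner k1 (\<lambda>x. F x - orth_proj k1 V F x) v = 0)"
proof -
  have "\<exists>G. G \<in> V \<and> (\<forall>v\<in>V. L2_inner k1 (F - G) v = 0)"
  proof (intro exI[of _ "partial_sum e A F"] conjI ballI)
    show "partial_sum e A F \<in> V" by (auto simp: V_def partial_sum_def)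
    show "L2_inner k1 (F - partial_sum e A F) v = 0" if "v \<in> V" for v
      using that partial_sum_orth[OF assms(1)] by (auto simp: V_def fun_diff_def)
  qed
  from someI_ex[OF this] show ?thesis
    by (simp add: orth_proj_def fun_diff_def)
qed

end

text \<open>A combination over B is one over A with zero coefficients added, and the partial sum
  over A is the best of those. This carries one fixed approximation over to all later spans.\<close>

lemma partial_sum_mono:
  fixes e :: "'n \<Rightarrow> point \<Rightarrow> 'b::euclidean_space"
  assumes "orthonormal e A" "finite A" "B \<subseteq> A" "F \<in> L2_space k1"
  shows "L2_norm k1 (\<lambda>x. F x - partial_sum e A F x) \<le> L2_norm k1 (\<lambda>x. F x - (\<Sum>n\<in>B. c n *\<^sub>R e n x))"
proof -
  have "(\<Sum>n\<in>B. c n *\<^sub>R e n x) = (\<Sum>n\<in>A. (if n \<in> B then c n else 0) *\<^sub>R e n x)" for x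
    using assms(2,3) by (intro sum.mono_neutral_cong_left) auto
  then show ?thesis
    using partial_sum_best[OF assms(1,2,4), of "\<lambda>n. if n \<in> B then c n else 0"] by simp
qed


subsection \<open>Continuously differentiable functions on the strip\<close>

text \<open>A relation instead of the operators \<open>d1\<close> and \<open>d3\<close>: it records
  at once that both partial derivatives exist on the whole strip and are continuous, and names them.
  The x3-derivative is one-sided on the walls, as in \<open>d3\<close>.\<close>

definition hasd :: "(point \<Rightarrow> 'b::euclidean_space) \<Rightarrow> (point \<Rightarrow> 'b) \<Rightarrow> (point \<Rightarrow> 'b) \<Rightarrow> bool" where
  "hasd f f1 f3 \<longleftrightarrow> periodic_x1 k1 f \<and> continuous_on strip f \<and> continuous_on strip f1 \<and> continuous_on strip f3 \<and>
    (\<forall>x1. \<forall>x3\<in>{0..pi}. ((\<lambda>s. f (s, x3)) has_vector_derivative f1 (x1, x3)) (at x1) \<and>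
      ((\<lambda>s. f (x1, s)) has_vector_derivative f3 (x1, x3)) (at x3 within {0..pi}))"

lemma hasd_continuous:
  assumes "hasd f f1 f3"
  shows "continuous_on strip f" "continuous_on strip f1" "continuous_on strip f3"
  using assms by (auto simp: hasd_def)

lemma hasd_L2:
  assumes "hasd f f1 f3"
  shows "f \<in> L2_space k1" "f1 \<in> L2_space k1" "f3 \<in> L2_space k1"
  using hasd_continuous[OF assms] by (auto intro: continuous_L2)

lemma hasd_derivs:
  assumes "hasd f f1 f3" "x3 \<in> {0..pi}"
  shows "((\<lambda>s. f (s, x3)) has_vector_derivative f1 (x1, x3)) (at x1)"
    "((\<lambda>s. f (x1, s)) has_vector_derivative f3 (x1, x3)) (at x3 within {0..pi})"
  using assms by (auto simp: hasd_def)

lemma hasd_d1: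
  assumes "hasd f f1 f3" "x \<in> strip"
  shows "d1 f x = f1 x"
  using assms unfolding d1_def strip_def
  by (intro vector_derivative_at) (cases x, auto simp: hasd_def)

lemma hasd_d3:
  assumes "hasd f f1 f3" "x \<in> strip"
  shows "d3 f x = f3 x"
  using assms unfolding d3_def strip_def
  by (intro vector_derivative_within_closed_interval) (cases x, auto simp: hasd_def)+

text \<open>Values off the strip do not matter: the x1-derivative moves along a line inside the
  strip, the x3-derivative is taken within {0..pi}. This allows \<open>d1 f\<close> and
  \<open>d3 f\<close>, which are controlled on the strip only, to be replaced by given
  derivatives.\<close>

lemma hasd_cong:
  assumes f: "hasd f f1 f3" and "\<And>x. x \<in> strip \<Longrightarrow> g x = f x" "\<And>x. x \<in> strip \<Longrightarrow> g1 x = f1 x"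
    "\<And>x. x \<in> strip \<Longrightarrow> g3 x = f3 x"
  shows "hasd g g1 g3"
proof -
  have s: "(x1, x3) \<in> strip" if "x3 \<in> {0..pi}" for x1 x3
    using that by (simp add: strip_def)
  have "continuous_on strip g = continuous_on strip f" "continuous_on strip g1 = continuous_on strip f1"
    "continuous_on strip g3 = continuous_on strip f3"
    using assms by (auto intro: continuous_on_cong)
  moreover have "periodic_x1 k1 g"
    using f s by (auto simp: hasd_def periodic_x1_def assms(2))
  moreover have "((\<lambda>s. g (s, x3)) has_vector_derivative g1 (x1, x3)) (at x1)" if "x3 \<in> {0..pi}" for x1 x3
    using hasd_derivs(1)[OF f that, of x1] by (simp add: assms(2,3) s[OF that])
  moreover have "((\<lambda>s. g (x1, s)) has_vector_derivative g3 (x1, x3)) (at x3 within {0..pi})"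
    if "x3 \<in> {0..pi}" for x1 x3
    using hasd_derivs(2)[OF f that, of x1] unfolding assms(4)[OF s[OF that]]
    by (rule has_vector_derivative_transform[OF that, rotated]) (simp add: assms(2) s)
  ultimately show ?thesis using f unfolding hasd_def by blast
qed

lemma hasd_bilinear:
  fixes pr :: "'a::euclidean_space \<Rightarrow> 'b::euclidean_space \<Rightarrow> 'c::euclidean_space"
  assumes pr: "bounded_bilinear pr" and f: "hasd f f1 f3" and g: "hasd g g1 g3"
  shows "hasd (\<lambda>x. pr (f x) (g x)) (\<lambda>x. pr (f x) (g1 x) + pr (f1 x) (g x)) (\<lambda>x. pr (f x) (g3 x) + pr (f3 x) (g x))"
  using f g unfolding hasd_def periodic_x1_def
  by (auto intro!: bounded_bilinear.continuous_on[OF pr] continuous_on_add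
      bounded_bilinear.has_vector_derivative[OF pr])

lemma hasd_linear:
  fixes h :: "'a::euclidean_space \<Rightarrow> 'b::euclidean_space"
  assumes h: "bounded_linear h" and f: "hasd f f1 f3"
  shows "hasd (\<lambda>x. h (f x)) (\<lambda>x. h (f1 x)) (\<lambda>x. h (f3 x))"
  using f unfolding hasd_def periodic_x1_def
  by (auto intro!: bounded_linear.continuous_on[OF h] bounded_linear.has_vector_derivative[OF h])

lemmas hasd_inner = hasd_bilinear[OF bounded_bilinear_inner]
lemmas hasd_mult = hasd_bilinear[OF bounded_bilinear_mult]
lemmas hasd_scaleR = hasd_linear[OF bounded_linear_scaleR_right]

lemma hasd_add:
  assumes "hasd f f1 f3" "hasd g g1 g3"
  shows "hasd (\<lambda>x. f x + g x) (\<lambda>x. f1 x + g1 x) (\<lambda>x. f3 x + g3 x)"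
  using assms unfolding hasd_def periodic_x1_def
  by (auto intro!: continuous_on_add has_vector_derivative_add)

lemma hasd_diff:
  assumes "hasd f f1 f3" "hasd g g1 g3"
  shows "hasd (\<lambda>x. f x - g x) (\<lambda>x. f1 x - g1 x) (\<lambda>x. f3 x - g3 x)"
  using assms unfolding hasd_def periodic_x1_def
  by (auto intro!: continuous_on_diff has_vector_derivative_diff)

lemma hasd_const: "hasd (\<lambda>x. c) (\<lambda>x. 0) (\<lambda>x. 0)"
  unfolding hasd_def periodic_x1_def by auto

lemma hasd_sum:
  assumes "\<And>n. n \<in> A \<Longrightarrow> hasd (f n) (f1 n) (f3 n)"
  shows "hasd (\<lambda>x. \<Sum>n\<in>A. f n x) (\<lambda>x. \<Sum>n\<in>A. f1 n x) (\<lambda>x. \<Sum>n\<in>A. f3 n x)"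
  using assms by (induction A rule: infinite_finite_induct) (auto intro: hasd_const hasd_add)

lemma hasd_Pair:
  fixes f :: "point \<Rightarrow> 'a::euclidean_space" and g :: "point \<Rightarrow> 'b::euclidean_space"
  assumes "hasd f f1 f3" "hasd g g1 g3"
  shows "hasd (\<lambda>x. (f x, g x)) (\<lambda>x. (f1 x, g1 x)) (\<lambda>x. (f3 x, g3 x))"
  using assms unfolding hasd_def periodic_x1_def
  by (auto intro!: continuous_on_Pair has_vector_derivative_Pair)

lemma hasd_nth:
  fixes f :: "point \<Rightarrow> real^3"
  shows "hasd f f1 f3 \<Longrightarrow> hasd (\<lambda>x. f x $ j) (\<lambda>x. f1 x $ j) (\<lambda>x. f3 x $ j)"
  by (rule hasd_linear[OF bounded_linear_vec_nth])

lemma hasd_fst: "hasd f f1 f3 \<Longrightarrow> hasd (\<lambda>x. fst (f x)) (\<lambda>x. fst (f1 x)) (\<lambda>x. fst (f3 x))"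
  for f :: "point \<Rightarrow> 'a::euclidean_space \<times> 'b::euclidean_space"
  by (rule hasd_linear[OF bounded_linear_fst])

lemma hasd_snd: "hasd f f1 f3 \<Longrightarrow> hasd (\<lambda>x. snd (f x)) (\<lambda>x. snd (f1 x)) (\<lambda>x. snd (f3 x))"
  for f :: "point \<Rightarrow> 'a::euclidean_space \<times> 'b::euclidean_space"
  by (rule hasd_linear[OF bounded_linear_snd])

subsection \<open>Iterated integrals and integration by parts\<close>

lemma LINT_eq_integral:
  fixes f :: "point \<Rightarrow> 'b::euclidean_space"
  assumes "continuous_on strip f"
  shows "(LINT x|mC. f x) = integral (cbox (0, 0) (2 * pi / k1, pi)) f"
  using lebesgue_integral_eq_integral[OF continuous_integrable_cell[OF assms]] cell_sets
  by (simp add: cell_cbox)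

lemma LINT_iterated:
  fixes f :: "point \<Rightarrow> 'b::euclidean_space"
  assumes "continuous_on strip f"
  shows "(LINT x|mC. f x) = integral {0..2 * pi / k1} (\<lambda>x1. integral {0..pi} (\<lambda>x3. f (x1, x3)))"
    and "(LINT x|mC. f x) = integral {0..pi} (\<lambda>x3. integral {0..2 * pi / k1} (\<lambda>x1. f (x1, x3)))"
proof -
  have c: "continuous_on (cbox (0, 0) (2 * pi / k1, pi)) f"
    using continuous_on_subset[OF assms cell_subset_strip] by (simp add: cell_cbox)
  show 1: "(LINT x|mC. f x) = integral {0..2 * pi / k1} (\<lambda>x1. integral {0..pi} (\<lambda>x3. f (x1, x3)))"
    using integral_prod_continuous[OF c] by (simp add: LINT_eq_integral[OF assms])
  show "(LINT x|mC. f x) = integral {0..pi} (\<lambda>x3. integral {0..2 * pi / k1} (\<lambda>x1. f (x1, x3)))"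
    unfolding 1 using integral_swap_continuous[of 0 0 "2 * pi / k1" pi "\<lambda>x y. f (x, y)"] c by simp
qed

text \<open>The fundamental theorem on each horizontal line; the end values cancel by
  periodicity.\<close>

lemma LINT_d1:
  fixes f :: "point \<Rightarrow> 'b::euclidean_space"
  assumes f: "hasd f f1 f3"
  shows "(LINT x|mC. f1 x) = 0"
proof -
  have "integral {0..2 * pi / k1} (\<lambda>x1. f1 (x1, x3)) = 0" if "x3 \<in> {0..pi}" for x3
  proof -
    have "((\<lambda>x1. f1 (x1, x3)) has_integral (f (2 * pi / k1, x3) - f (0, x3))) {0..2 * pi / k1}"
      using period_pos hasd_derivs(1)[OF f that]
      by (intro fundamental_theorem_of_calculus) (auto intro: has_vector_derivative_at_within)
    moreover have "f (2 * pi / k1, x3) = f (0, x3)"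
      using f that by (auto simp: hasd_def periodic_x1_def dest: spec[of _ 0])
    ultimately show ?thesis by (simp add: integral_unique)
  qed
  then have "integral {0..pi} (\<lambda>x3. integral {0..2 * pi / k1} (\<lambda>x1. f1 (x1, x3))) = integral {0..pi} (\<lambda>x3. 0 :: 'b)"
    by (intro Henstock_Kurzweil_Integration.integral_cong) auto
  then show ?thesis
    by (simp add: LINT_iterated(2)[OF hasd_continuous(2)[OF f]])
qed

lemma LINT_d3:
  fixes f :: "point \<Rightarrow> 'b::euclidean_space"
  assumes f: "hasd f f1 f3" and bd: "\<And>x1. f (x1, 0) = 0" "\<And>x1. f (x1, pi) = 0"
  shows "(LINT x|mC. f3 x) = 0"
proof -
  have "integral {0..pi} (\<lambda>x3. f3 (x1, x3)) = 0" for x1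
  proof -
    have "((\<lambda>x3. f3 (x1, x3)) has_integral (f (x1, pi) - f (x1, 0))) {0..pi}"
      using hasd_derivs(2)[OF f] by (intro fundamental_theorem_of_calculus) auto
    then show ?thesis by (simp add: integral_unique bd)
  qed
  then show ?thesis
    by (simp add: LINT_iterated(1)[OF hasd_continuous(3)[OF f]])
qed

text \<open>The divergence of the planar field with components w1 \<bullet> v and w3 \<bullet> v
  integrates to zero. The wall condition is put on the product, so that components with a Neumann
  condition (horizontal velocity) and with a Dirichlet condition (vertical velocity, temperature)
  can be treated in one field.\<close>

lemma green:
  fixes w1 w3 v :: "point \<Rightarrow> 'b::euclidean_space"
  assumes w1: "hasd w1 w11 w13" and w3: "hasd w3 w31 w33" and v: "hasd v v1 v3"
    and bd: "\<And>x1 b. b \<in> {0, pi} \<Longrightarrow> w3 (x1, b) \<bullet> v (x1, b) = 0"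
  shows "L2_inner k1 (\<lambda>x. w11 x + w33 x) v = - (L2_inner k1 w1 v1 + L2_inner k1 w3 v3)"
proof -
  note L = hasd_L2[OF w1] hasd_L2[OF w3] hasd_L2[OF v]
  have 1: "(LINT x|mC. w1 x \<bullet> v1 x + w11 x \<bullet> v x) = 0"
    by (rule LINT_d1[OF hasd_inner[OF w1 v]])
  have 3: "(LINT x|mC. w3 x \<bullet> v3 x + w33 x \<bullet> v x) = 0"
    using bd by (intro LINT_d3[OF hasd_inner[OF w3 v]]) auto
  have "L2_inner k1 w1 v1 + L2_inner k1 w11 v = 0" "L2_inner k1 w3 v3 + L2_inner k1 w33 v = 0"
    using 1 3 L by (simp_all add: L2_inner_def L2_inner_integrable)
  moreover have "L2_inner k1 (\<lambda>x. w11 x + w33 x) v = L2_inner k1 w11 v + L2_inner k1 w33 v"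
    using L by (intro L2_inner_add_left)
  ultimately show ?thesis by simp
qed

subsection \<open>Ladyzhenskaya's inequality\<close>

text \<open>g x exceeds g y by at most the total variation, for every y; averaging over y gives the
  bound.\<close>

lemma sup_le_average_plus_variation:
  fixes g :: "real \<Rightarrow> real"
  assumes ab: "a < b" and g: "\<And>x. x \<in> {a..b} \<Longrightarrow> (g has_vector_derivative g' x) (at x within {a..b})"
    and c: "continuous_on {a..b} g'" and x: "x \<in> {a..b}"
  shows "g x \<le> integral {a..b} g / (b - a) + integral {a..b} (\<lambda>s. \<bar>g' s\<bar>)"
proof -
  define N where "N = integral {a..b} (\<lambda>s. \<bar>g' s\<bar>)"
  have ci: "(\<lambda>s. \<bar>g' s\<bar>) integrable_on {a..b}"
    by (intro integrable_continuous_real continuous_intros c)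
  have le: "\<bar>g q - g p\<bar> \<le> N" if "a \<le> p" "p \<le> q" "q \<le> b" for p q
  proof -
    have sub: "{p..q} \<subseteq> {a..b}" using that by auto
    have i: "(g' has_integral (g q - g p)) {p..q}"
      using that sub by (intro fundamental_theorem_of_calculus)
        (auto intro: has_vector_derivative_within_subset[OF g])
    have ci': "(\<lambda>s. \<bar>g' s\<bar>) integrable_on {p..q}"
      by (rule integrable_subinterval_real[OF ci sub])
    have "\<bar>integral {p..q} g'\<bar> \<le> integral {p..q} (\<lambda>s. \<bar>g' s\<bar>)"
      using integral_norm_bound_integral[of g' "{p..q}" "\<lambda>s. \<bar>g' s\<bar>"] i ci' by auto
    also have "\<dots> \<le> N"
      unfolding N_def by (intro integral_subset_le sub ci ci') auto
    finally show ?thesis using i by (simp add: integral_unique)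
  qed
  have gc: "continuous_on {a..b} g"
    using g by (meson has_vector_derivative_continuous continuous_on_eq_continuous_within)
  have gi: "g integrable_on {a..b}"
    by (intro integrable_continuous_real gc)
  have pt: "g x \<le> g y + N" if "y \<in> {a..b}" for y
    using le[of x y] le[of y x] x that by (cases "x \<le> y") auto
  have "integral {a..b} (\<lambda>y. g x) \<le> integral {a..b} (\<lambda>y. g y + N)"
    using pt gi by (intro integral_le) (auto intro!: Henstock_Kurzweil_Integration.integrable_add)
  also have "\<dots> = integral {a..b} g + (b - a) * N"
    using gi ab by (subst Henstock_Kurzweil_Integration.integral_add) auto
  finally have "(b - a) * g x \<le> integral {a..b} g + (b - a) * N" using ab by simp
  then show ?thesis using ab by (simp add: field_simps N_def)
qed

lemma continuous_on_integral_x1: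
  fixes f :: "point \<Rightarrow> real"
  assumes "continuous_on strip f"
  shows "continuous_on {0..pi} (\<lambda>x3. integral {0..2 * pi / k1} (\<lambda>x1. f (x1, x3)))"
proof -
  have "continuous_on ({0..pi} \<times> cbox 0 (2 * pi / k1)) (\<lambda>(x3, x1). f (x1, x3))"
    unfolding split_beta
    by (rule continuous_on_compose2[OF assms, where f = "\<lambda>p. (snd p, fst p)"])
      (auto intro!: continuous_intros simp: strip_def)
  from integral_continuous_on_param[OF this] show ?thesis by simp
qed

lemma continuous_on_integral_x3:
  fixes f :: "point \<Rightarrow> real"
  assumes "continuous_on strip f"
  shows "continuous_on {0..2 * pi / k1} (\<lambda>x1. integral {0..pi} (\<lambda>x3. f (x1, x3)))"
proof -
  have "continuous_on ({0..2 * pi / k1} \<times> cbox 0 pi) (\<lambda>(x1, x3). f (x1, x3))"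
    unfolding split_beta
    by (rule continuous_on_compose2[OF assms, where f = "\<lambda>p. (fst p, snd p)"])
      (auto intro!: continuous_intros simp: strip_def)
  from integral_continuous_on_param[OF this] show ?thesis by simp
qed

lemma LINT_abs_inner_le:
  fixes f g :: "point \<Rightarrow> 'b::euclidean_space"
  assumes f: "continuous_on strip f" and g: "continuous_on strip g"
  shows "(LINT x|mC. \<bar>f x \<bullet> g x\<bar>) \<le> L2_norm k1 f * L2_norm k1 g"
proof -
  have fn: "(\<lambda>x. norm (f x)) \<in> L2_space k1" and gn: "(\<lambda>x. norm (g x)) \<in> L2_space k1"
    by (intro continuous_L2 continuous_intros f g)+
  have "(LINT x|mC. \<bar>f x \<bullet> g x\<bar>) \<le> (LINT x|mC. norm (f x) \<bullet> norm (g x))"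
    by (intro integral_mono continuous_integrable_cell continuous_intros f g)
      (simp add: Cauchy_Schwarz_ineq2)
  also have "\<dots> \<le> L2_norm k1 (\<lambda>x. norm (f x)) * L2_norm k1 (\<lambda>x. norm (g x))"
    using L2_Cauchy_Schwarz[OF fn gn] by (simp add: L2_inner_def)
  finally show ?thesis by (simp add: L2_norm_def)
qed

text \<open>One factor for each direction: the reciprocal length comes from the average, the 2 from
  differentiating |f|^2.\<close>

definition lady_const :: real where
  "lady_const = (1 / (2 * pi / k1) + 2) * (1 / pi + 2)"

lemma lady_const_pos: "0 < lady_const"
  using k1_pos by (simp add: lady_const_def add_pos_pos)

text \<open>Along a horizontal line |f|^2 is at most \<open>A\<close>, which depends on x3 alone,
  and along a vertical line at most \<open>B\<close>, which depends on x1 alone. So |f|^4 is at most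
  \<open>A x3 * B x1\<close>, and the double integral factorises. The zero-order term in the bracket
  stems from the averages: f need not vanish anywhere.\<close>

lemma Ladyzhenskaya:
  fixes f :: "point \<Rightarrow> 'b::euclidean_space"
  assumes f: "hasd f f1 f3"
  shows "(LINT x|mC. (f x \<bullet> f x)\<^sup>2) \<le>
    lady_const * L2_inner k1 f f * (L2_inner k1 f f + (L2_inner k1 f1 f1 + L2_inner k1 f3 f3))"
proof -
  define L where "L = 2 * pi / k1"
  have L: "0 < L" by (simp add: L_def period_pos)
  define q q1 q3 where "q x = f x \<bullet> f x" and "q1 x = 2 * (f x \<bullet> f1 x)" and "q3 x = 2 * (f x \<bullet> f3 x)" for x
  have "q1 = (\<lambda>x. f x \<bullet> f1 x + f1 x \<bullet> f x)" "q3 = (\<lambda>x. f x \<bullet> f3 x + f3 x \<bullet> f x)" "q = (\<lambda>x. f x \<bullet> f x)"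
    by (auto simp: q1_def q3_def q_def inner_commute)
  then have q: "hasd q q1 q3"
    using hasd_inner[OF f f] by simp
  note qc = hasd_continuous[OF q]
  note fc = hasd_continuous[OF f]
  define A where "A x3 = integral {0..L} (\<lambda>x1. q (x1, x3)) / L + integral {0..L} (\<lambda>x1. \<bar>q1 (x1, x3)\<bar>)" for x3
  define B where "B x1 = integral {0..pi} (\<lambda>x3. q (x1, x3)) / pi + integral {0..pi} (\<lambda>x3. \<bar>q3 (x1, x3)\<bar>)" for x1
  have pc: "continuous_on {0..L} (\<lambda>x1. h (x1, x3))" if "continuous_on strip h" "x3 \<in> {0..pi}" for h :: "point \<Rightarrow> real" and x3
    by (rule continuous_on_compose2[OF that(1), where f = "\<lambda>x1. (x1, x3)"])
      (use that(2) in \<open>auto intro!: continuous_intros simp: strip_def\<close>)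
  have pc3: "continuous_on {0..pi} (\<lambda>x3. h (x1, x3))" if "continuous_on strip h" for h :: "point \<Rightarrow> real" and x1
    by (rule continuous_on_compose2[OF that(1), where f = "\<lambda>x3. (x1, x3)"])
      (auto intro!: continuous_intros simp: strip_def)
  have a1: "continuous_on strip (\<lambda>x. \<bar>q1 x\<bar>)" "continuous_on strip (\<lambda>x. \<bar>q3 x\<bar>)"
    by (intro continuous_intros qc)+
  have qA: "q (x1, x3) \<le> A x3" if "x1 \<in> {0..L}" "x3 \<in> {0..pi}" for x1 x3
    using sup_le_average_plus_variation[OF L, of "\<lambda>s. q (s, x3)" "\<lambda>s. q1 (s, x3)" x1] that
      hasd_derivs(1)[OF q that(2)] pc[OF qc(2) that(2)]
    by (auto simp: A_def intro: has_vector_derivative_at_within)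
  have qB: "q (x1, x3) \<le> B x1" if "x3 \<in> {0..pi}" for x1 x3
    using sup_le_average_plus_variation[of 0 pi "\<lambda>s. q (x1, s)" "\<lambda>s. q3 (x1, s)" x3] that
      hasd_derivs(2)[OF q] pc3[OF qc(3)]
    by (auto simp: B_def)
  have Ac: "continuous_on {0..pi} A"
    unfolding A_def using L
    by (intro continuous_on_add continuous_on_divide continuous_on_integral_x1[folded L_def] qc a1 continuous_on_const) auto
  have Bc: "continuous_on {0..L} B"
    unfolding B_def
    by (intro continuous_on_add continuous_on_divide continuous_on_integral_x3[folded L_def] qc a1 continuous_on_const) auto
  have q0: "0 \<le> q x" for x by (simp add: q_def)
  have qq: "continuous_on strip (\<lambda>x. (q x)\<^sup>2)"
    by (intro continuous_intros qc)
  have "(LINT x|mC. (q x)\<^sup>2) = integral {0..L} (\<lambda>x1. integral {0..pi} (\<lambda>x3. (q (x1, x3))\<^sup>2))"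
    unfolding LINT_iterated(1)[OF qq] by (simp add: L_def)
  also have "\<dots> \<le> integral {0..L} (\<lambda>x1. integral {0..pi} A * B x1)"
  proof (rule integral_le)
    show "(\<lambda>x1. integral {0..pi} (\<lambda>x3. (q (x1, x3))\<^sup>2)) integrable_on {0..L}"
      unfolding L_def by (intro integrable_continuous_real continuous_on_integral_x3 qq)
    show "(\<lambda>x1. integral {0..pi} A * B x1) integrable_on {0..L}"
      by (intro integrable_continuous_real continuous_intros Bc)
    fix x1 assume x1: "x1 \<in> {0..L}"
    have "integral {0..pi} (\<lambda>x3. (q (x1, x3))\<^sup>2) \<le> integral {0..pi} (\<lambda>x3. A x3 * B x1)"
    proof (rule integral_le)
      show "(\<lambda>x3. (q (x1, x3))\<^sup>2) integrable_on {0..pi}"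
        by (intro integrable_continuous_real pc3 qq)
      show "(\<lambda>x3. A x3 * B x1) integrable_on {0..pi}"
        by (intro integrable_continuous_real continuous_intros Ac)
      show "(q (x1, x3))\<^sup>2 \<le> A x3 * B x1" if "x3 \<in> {0..pi}" for x3
        unfolding power2_eq_square using qA[OF x1 that] qB[OF that, of x1] q0
        by (intro mult_mono) (auto intro: order_trans[OF q0])
    qed
    then show "integral {0..pi} (\<lambda>x3. (q (x1, x3))\<^sup>2) \<le> integral {0..pi} A * B x1"
      by simp
  qed
  also have "\<dots> = integral {0..pi} A * integral {0..L} B"
    by simp
  also have "integral {0..pi} A = (LINT x|mC. q x) / L + (LINT x|mC. \<bar>q1 x\<bar>)"
    unfolding A_def LINT_iterated(2)[OF qc(1), folded L_def] LINT_iterated(2)[OF a1(1), folded L_def]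
    by (subst Henstock_Kurzweil_Integration.integral_add)
      (auto intro!: integrable_continuous_real continuous_on_integral_x1[folded L_def] qc a1 integrable_on_divide)
  also have "integral {0..L} B = (LINT x|mC. q x) / pi + (LINT x|mC. \<bar>q3 x\<bar>)"
    unfolding B_def LINT_iterated(1)[OF qc(1), folded L_def] LINT_iterated(1)[OF a1(2), folded L_def]
    by (subst Henstock_Kurzweil_Integration.integral_add)
      (auto intro!: integrable_continuous_real continuous_on_integral_x3[folded L_def] qc a1 integrable_on_divide)
  finally have main: "(LINT x|mC. (q x)\<^sup>2) \<le> ((LINT x|mC. q x) / L + (LINT x|mC. \<bar>q1 x\<bar>)) * ((LINT x|mC. q x) / pi + (LINT x|mC. \<bar>q3 x\<bar>))" .
  define n n1 n3 where "n = L2_norm k1 f" and "n1 = L2_norm k1 f1" and "n3 = L2_norm k1 f3"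
  \<comment> \<open>The H1 norm. It dominates \<open>n\<close>, \<open>n1\<close> and
    \<open>n3\<close>, so each of the two factors is at most a constant times
    \<open>n * H\<close>.\<close>
  define H where "H = sqrt (n\<^sup>2 + (n1\<^sup>2 + n3\<^sup>2))"
  have nn: "0 \<le> n" "0 \<le> n1" "0 \<le> n3" by (simp_all add: n_def n1_def n3_def L2_norm_nonneg)
  have H: "n \<le> H" "n1 \<le> H" "n3 \<le> H" unfolding H_def
    by (intro real_le_rsqrt; simp)+
  have H0: "0 \<le> H" using H(1) nn(1) by simp
  have qn: "(LINT x|mC. q x) = n\<^sup>2"
    by (simp add: n_def L2_norm_sq L2_inner_def q_def)
  have q1n: "(LINT x|mC. \<bar>q1 x\<bar>) \<le> 2 * (n * n1)" "(LINT x|mC. \<bar>q3 x\<bar>) \<le> 2 * (n * n3)"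
    using LINT_abs_inner_le[OF fc(1) fc(2)] LINT_abs_inner_le[OF fc(1) fc(3)]
    by (simp_all add: q1_def q3_def abs_mult n_def n1_def n3_def)
  have pos: "0 \<le> (LINT x|mC. \<bar>q1 x\<bar>)" "0 \<le> (LINT x|mC. \<bar>q3 x\<bar>)" by simp_all
  have e1: "(LINT x|mC. q x) / L + (LINT x|mC. \<bar>q1 x\<bar>) \<le> (1 / L + 2) * (n * H)"
  proof -
    have "n\<^sup>2 / L \<le> n * H / L" using H(1) nn L by (intro divide_right_mono) (auto simp: power2_eq_square mult_left_mono)
    moreover have "2 * (n * n1) \<le> 2 * (n * H)" using H(2) nn by (simp add: mult_left_mono)
    ultimately show ?thesis using q1n(1) qn by (simp add: algebra_simps)
  qed
  have e3: "(LINT x|mC. q x) / pi + (LINT x|mC. \<bar>q3 x\<bar>) \<le> (1 / pi + 2) * (n * H)"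
  proof -
    have "n\<^sup>2 / pi \<le> n * H / pi" using H(1) nn by (intro divide_right_mono) (auto simp: power2_eq_square mult_left_mono)
    moreover have "2 * (n * n3) \<le> 2 * (n * H)" using H(3) nn by (simp add: mult_left_mono)
    ultimately show ?thesis using q1n(2) qn by (simp add: algebra_simps)
  qed
  have "(LINT x|mC. (q x)\<^sup>2) \<le> ((1 / L + 2) * (n * H)) * ((1 / pi + 2) * (n * H))"
    by (rule order_trans[OF main]) (intro mult_mono e1 e3, use pos qn L nn H0 in auto)
  also have "\<dots> = lady_const * n\<^sup>2 * H\<^sup>2"
    unfolding lady_const_def L_def[symmetric] power2_eq_square by (simp only: mult_ac)
  also have "H\<^sup>2 = n\<^sup>2 + (n1\<^sup>2 + n3\<^sup>2)" by (simp add: H_def)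
  finally show ?thesis by (simp add: q_def n_def n1_def n3_def L2_norm_sq)
qed

subsection \<open>The trilinear form\<close>

text \<open>Velocity and temperature as one field: solenoidal, no flow through the walls, zero
  temperature there. That the velocity lies in \<open>L2_sigma\<close> is asked for separately,
  where the pressure is removed.\<close>

definition admfield :: "(point \<Rightarrow> (real^3) \<times> real) \<Rightarrow> (point \<Rightarrow> (real^3) \<times> real) \<Rightarrow> (point \<Rightarrow> (real^3) \<times> real) \<Rightarrow> bool" where
  "admfield w w1 w3 \<longleftrightarrow> hasd w w1 w3 \<and> (\<forall>x\<in>strip. fst (w1 x) $ 1 + fst (w3 x) $ 3 = 0) \<and>
    (\<forall>x1. \<forall>b\<in>{0, pi}. fst (w (x1, b)) $ 3 = 0 \<and> snd (w (x1, b)) = 0)"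

text \<open>The advected field enters through its derivatives b1, b3 alone, and all its components
  are advected alike; thus the nonlinearities of both equations form one expression.\<close>

definition adv :: "(point \<Rightarrow> (real^3) \<times> real) \<Rightarrow> (point \<Rightarrow> (real^3) \<times> real) \<Rightarrow> (point \<Rightarrow> (real^3) \<times> real) \<Rightarrow> point \<Rightarrow> (real^3) \<times> real" where
  "adv a b1 b3 = (\<lambda>x. (fst (a x) $ 1) *\<^sub>R b1 x + (fst (a x) $ 3) *\<^sub>R b3 x)"

lemma admfield_hasd: "admfield w w1 w3 \<Longrightarrow> hasd w w1 w3"
  by (simp add: admfield_def)

lemma admfield_add:
  assumes "admfield v v1 v3" "admfield w w1 w3"
  shows "admfield (\<lambda>x. v x + w x) (\<lambda>x. v1 x + w1 x) (\<lambda>x. v3 x + w3 x)"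
proof -
  have "fst (v1 x) $ 1 + fst (w1 x) $ 1 + (fst (v3 x) $ 3 + fst (w3 x) $ 3) = 0" if "x \<in> strip" for x
    using assms that unfolding admfield_def by (smt (verit))
  then show ?thesis
    using assms by (auto simp: admfield_def intro: hasd_add)
qed

lemma admfield_scaleR:
  assumes "admfield w w1 w3"
  shows "admfield (\<lambda>x. c *\<^sub>R w x) (\<lambda>x. c *\<^sub>R w1 x) (\<lambda>x. c *\<^sub>R w3 x)"
  using assms by (auto simp: admfield_def hasd_scaleR simp flip: distrib_left)

lemma admfield_diff:
  assumes "admfield v v1 v3" "admfield w w1 w3"
  shows "admfield (\<lambda>x. v x - w x) (\<lambda>x. v1 x - w1 x) (\<lambda>x. v3 x - w3 x)"
  using admfield_add[OF assms(1) admfield_scaleR[OF assms(2), of "-1"]] by simp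

lemma admfield_zero: "admfield (\<lambda>x. 0) (\<lambda>x. 0) (\<lambda>x. 0)"
  by (simp add: admfield_def hasd_const)

lemma admfield_sum:
  assumes "\<And>n. n \<in> A \<Longrightarrow> admfield (f n) (f1 n) (f3 n)"
  shows "admfield (\<lambda>x. \<Sum>n\<in>A. f n x) (\<lambda>x. \<Sum>n\<in>A. f1 n x) (\<lambda>x. \<Sum>n\<in>A. f3 n x)"
  using assms by (induction A rule: infinite_finite_induct) (auto intro: admfield_zero admfield_add)

lemma continuous_adv:
  assumes "continuous_on strip a" "continuous_on strip b1" "continuous_on strip b3"
  shows "continuous_on strip (adv a b1 b3)"
  unfolding adv_def
  by (intro continuous_on_add continuous_on_scaleR assms
      bounded_linear.continuous_on[OF bounded_linear_vec_nth] bounded_linear.continuous_on[OF bounded_linear_fst])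

text \<open>For solenoidal a, the sum of both sides is the integral of the divergence of a (b
  \<bullet> c), and a does not cross the walls.\<close>

lemma tri_antisym:
  assumes a: "admfield a a1 a3" and b: "hasd b b1 b3" and c: "hasd c c1 c3"
  shows "L2_inner k1 (adv a b1 b3) c = - L2_inner k1 (adv a c1 c3) b"
proof -
  note ah = admfield_hasd[OF a]
  note bc = hasd_inner[OF b c]
  have h1: "hasd (\<lambda>x. fst (a x) $ 1 * (b x \<bullet> c x))
    (\<lambda>x. fst (a x) $ 1 * (b x \<bullet> c1 x + b1 x \<bullet> c x) + fst (a1 x) $ 1 * (b x \<bullet> c x))
    (\<lambda>x. fst (a x) $ 1 * (b x \<bullet> c3 x + b3 x \<bullet> c x) + fst (a3 x) $ 1 * (b x \<bullet> c x))"
    by (rule hasd_mult[OF hasd_nth[OF hasd_fst[OF ah]] bc])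
  have h3: "hasd (\<lambda>x. fst (a x) $ 3 * (b x \<bullet> c x))
    (\<lambda>x. fst (a x) $ 3 * (b x \<bullet> c1 x + b1 x \<bullet> c x) + fst (a1 x) $ 3 * (b x \<bullet> c x))
    (\<lambda>x. fst (a x) $ 3 * (b x \<bullet> c3 x + b3 x \<bullet> c x) + fst (a3 x) $ 3 * (b x \<bullet> c x))"
    by (rule hasd_mult[OF hasd_nth[OF hasd_fst[OF ah]] bc])
  let ?g = "\<lambda>x. fst (a x) $ 1 * (b x \<bullet> c1 x + b1 x \<bullet> c x) + fst (a1 x) $ 1 * (b x \<bullet> c x)"
  let ?h = "\<lambda>x. fst (a x) $ 3 * (b x \<bullet> c3 x + b3 x \<bullet> c x) + fst (a3 x) $ 3 * (b x \<bullet> c x)"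
  have 1: "(LINT x|mC. ?g x) = 0" by (rule LINT_d1[OF h1])
  have 3: "(LINT x|mC. ?h x) = 0" using a by (intro LINT_d3[OF h3]) (auto simp: admfield_def)
  have "(LINT x|mC. ?g x + ?h x) = 0"
    using 1 3 continuous_integrable_cell[OF hasd_continuous(2)[OF h1]] continuous_integrable_cell[OF hasd_continuous(3)[OF h3]]
    by simp
  also have "(LINT x|mC. ?g x + ?h x) = (LINT x|mC. adv a b1 b3 x \<bullet> c x + adv a c1 c3 x \<bullet> b x)"
  proof (rule Bochner_Integration.integral_cong[OF refl])
    fix x assume "x \<in> space mC"
    then have "x \<in> strip" using cell_subset_strip by auto
    then have "fst (a3 x) $ 3 = - fst (a1 x) $ 1" using a unfolding admfield_def by (smt (verit))
    then show "?g x + ?h x = adv a b1 b3 x \<bullet> c x + adv a c1 c3 x \<bullet> b x"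
      by (simp add: adv_def inner_add_left algebra_simps inner_commute)
  qed
  also have "\<dots> = L2_inner k1 (adv a b1 b3) c + L2_inner k1 (adv a c1 c3) b"
    unfolding L2_inner_def
    by (intro Bochner_Integration.integral_add L2_inner_integrable continuous_L2 continuous_adv
        hasd_continuous[OF ah] hasd_continuous[OF b] hasd_continuous[OF c])
  finally show ?thesis by simp
qed

lemma adv_norm_le:
  "(norm (adv a b1 b3 x))\<^sup>2 \<le> (a x \<bullet> a x) * (b1 x \<bullet> b1 x + b3 x \<bullet> b3 x)"
proof -
  define p r where "p = fst (a x) $ 1" and "r = fst (a x) $ 3"
  have pr: "p\<^sup>2 + r\<^sup>2 \<le> a x \<bullet> a x"
    by (cases "a x") (simp add: p_def r_def inner_vec_def sum_3 power2_eq_square)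
  have "norm (adv a b1 b3 x) \<le> \<bar>p\<bar> * norm (b1 x) + \<bar>r\<bar> * norm (b3 x)"
    unfolding adv_def p_def[symmetric] r_def[symmetric] by (metis norm_scaleR norm_triangle_ineq)
  then have "(norm (adv a b1 b3 x))\<^sup>2 \<le> (\<bar>p\<bar> * norm (b1 x) + \<bar>r\<bar> * norm (b3 x))\<^sup>2"
    by (intro power_mono) auto
  also have "\<dots> \<le> (p\<^sup>2 + r\<^sup>2) * ((norm (b1 x))\<^sup>2 + (norm (b3 x))\<^sup>2)"
  proof -
    \<comment> \<open>Lagrange's identity: this square is the defect in the planar Cauchy-Schwarz
      inequality.\<close>
    have "0 \<le> (\<bar>p\<bar> * norm (b3 x) - \<bar>r\<bar> * norm (b1 x))\<^sup>2" by simp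
    moreover have "(p\<^sup>2 + r\<^sup>2) * ((norm (b1 x))\<^sup>2 + (norm (b3 x))\<^sup>2) - (\<bar>p\<bar> * norm (b1 x) + \<bar>r\<bar> * norm (b3 x))\<^sup>2
      = (\<bar>p\<bar> * norm (b3 x) - \<bar>r\<bar> * norm (b1 x))\<^sup>2"
      by (simp add: power2_sum power2_diff power_mult_distrib algebra_simps)
    ultimately show ?thesis by linarith
  qed
  also have "\<dots> \<le> (a x \<bullet> a x) * (b1 x \<bullet> b1 x + b3 x \<bullet> b3 x)"
    using pr by (simp add: power2_norm_eq_inner mult_right_mono)
  finally show ?thesis .
qed

text \<open>Hoelder with exponents 2, 4, 4: the derivatives of b in L2, a and c in L4 by way of
  Ladyzhenskaya. The square on the left and a single root on the right avoid fractional powers; it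
  is also the form in which \<open>young\<close> takes it.\<close>

lemma tri_bound:
  assumes a: "hasd a a1 a3" and b: "hasd b b1 b3" and c: "hasd c c1 c3"
  shows "(L2_inner k1 (adv a b1 b3) c)\<^sup>2 \<le> (L2_inner k1 b1 b1 + L2_inner k1 b3 b3) *
    (lady_const * sqrt ((L2_inner k1 a a * (L2_inner k1 a a + (L2_inner k1 a1 a1 + L2_inner k1 a3 a3))) *
      (L2_inner k1 c c * (L2_inner k1 c c + (L2_inner k1 c1 c1 + L2_inner k1 c3 c3)))))"
proof -
  note ac = hasd_continuous[OF a] note bc = hasd_continuous[OF b] note cc = hasd_continuous[OF c]
  define be where "be x = sqrt (b1 x \<bullet> b1 x + b3 x \<bullet> b3 x)" for x
  define ac' where "ac' x = norm (a x) * norm (c x)" for x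
  have cbe: "continuous_on strip be" unfolding be_def by (intro continuous_intros bc)
  have cac: "continuous_on strip ac'" unfolding ac'_def by (intro continuous_intros ac cc)
  have cadv: "continuous_on strip (adv a b1 b3)" by (intro continuous_adv ac bc)
  have pt: "\<bar>adv a b1 b3 x \<bullet> c x\<bar> \<le> be x * ac' x" for x
  proof -
    have "norm (adv a b1 b3 x) \<le> norm (a x) * be x"
      using adv_norm_le[of a b1 b3 x]
      by (intro power2_le_imp_le[of "norm (adv a b1 b3 x)"])
        (auto simp: power_mult_distrib be_def power2_norm_eq_inner)
    then have "norm (adv a b1 b3 x) * norm (c x) \<le> norm (a x) * be x * norm (c x)"
      by (intro mult_right_mono) auto
    then show ?thesis
      using Cauchy_Schwarz_ineq2[of "adv a b1 b3 x" "c x"] by (simp add: ac'_def algebra_simps)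
  qed
  have "\<bar>L2_inner k1 (adv a b1 b3) c\<bar> \<le> (LINT x|mC. \<bar>adv a b1 b3 x \<bullet> c x\<bar>)"
    unfolding L2_inner_def using integral_norm_bound[of mC "\<lambda>x. adv a b1 b3 x \<bullet> c x"] by simp
  also have "\<dots> \<le> L2_inner k1 be ac'"
    unfolding L2_inner_def inner_real_def
    by (intro integral_mono continuous_integrable_cell continuous_intros cadv cc cbe cac pt)
  finally have "(L2_inner k1 (adv a b1 b3) c)\<^sup>2 \<le> (L2_inner k1 be ac')\<^sup>2"
    by (metis abs_ge_zero power2_abs power_mono)
  also have "\<dots> \<le> L2_inner k1 be be * L2_inner k1 ac' ac'"
    by (intro L2_Cauchy_Schwarz_sq continuous_L2 cbe cac)
  also have "L2_inner k1 be be = L2_inner k1 b1 b1 + L2_inner k1 b3 b3"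
  proof -
    have "L2_inner k1 be be = (LINT x|mC. b1 x \<bullet> b1 x + b3 x \<bullet> b3 x)"
      by (simp add: L2_inner_def be_def)
    then show ?thesis using hasd_L2[OF b] by (simp add: L2_inner_def L2_inner_integrable)
  qed
  finally have 1: "(L2_inner k1 (adv a b1 b3) c)\<^sup>2 \<le> (L2_inner k1 b1 b1 + L2_inner k1 b3 b3) * L2_inner k1 ac' ac'" .
  define X Y where "X = L2_inner k1 a a * (L2_inner k1 a a + (L2_inner k1 a1 a1 + L2_inner k1 a3 a3))"
    and "Y = L2_inner k1 c c * (L2_inner k1 c c + (L2_inner k1 c1 c1 + L2_inner k1 c3 c3))"
  have X0: "0 \<le> X" "0 \<le> Y" by (simp_all add: X_def Y_def L2_inner_self_nonneg)
  have "L2_inner k1 ac' ac' = L2_inner k1 (\<lambda>x. a x \<bullet> a x) (\<lambda>x. c x \<bullet> c x)"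
    by (simp add: L2_inner_def ac'_def dot_square_norm power2_eq_square algebra_simps)
  moreover have "(L2_inner k1 (\<lambda>x. a x \<bullet> a x) (\<lambda>x. c x \<bullet> c x))\<^sup>2 \<le> (lady_const * X) * (lady_const * Y)"
  proof -
    have "(L2_inner k1 (\<lambda>x. a x \<bullet> a x) (\<lambda>x. c x \<bullet> c x))\<^sup>2
      \<le> L2_inner k1 (\<lambda>x. a x \<bullet> a x) (\<lambda>x. a x \<bullet> a x) * L2_inner k1 (\<lambda>x. c x \<bullet> c x) (\<lambda>x. c x \<bullet> c x)"
      by (intro L2_Cauchy_Schwarz_sq continuous_L2 continuous_intros ac cc)
    also have "\<dots> \<le> (lady_const * X) * (lady_const * Y)"
      using Ladyzhenskaya[OF a] Ladyzhenskaya[OF c] X0 lady_const_pos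
      by (intro mult_mono) (auto simp: X_def Y_def L2_inner_def power2_eq_square mult.assoc)
    finally show ?thesis .
  qed
  then have "L2_inner k1 (\<lambda>x. a x \<bullet> a x) (\<lambda>x. c x \<bullet> c x) \<le> sqrt ((lady_const * X) * (lady_const * Y))"
    by (intro real_le_rsqrt)
  moreover have "sqrt ((lady_const * X) * (lady_const * Y)) = lady_const * sqrt (X * Y)"
    using lady_const_pos by (simp add: real_sqrt_mult)
  ultimately have "L2_inner k1 ac' ac' \<le> lady_const * sqrt (X * Y)" by simp
  then have "(L2_inner k1 b1 b1 + L2_inner k1 b3 b3) * L2_inner k1 ac' ac'
    \<le> (L2_inner k1 b1 b1 + L2_inner k1 b3 b3) * (lady_const * sqrt (X * Y))"
    by (intro mult_left_mono) (auto simp: L2_inner_self_nonneg add_nonneg_nonneg)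
  with 1 show ?thesis by (simp add: X_def Y_def)
qed


subsection \<open>Trigonometric fields\<close>

text \<open>Coefficients of cos cos, cos sin, sin cos and sin sin, with values in any Euclidean
  space. For a fixed wave vector these functions are closed under differentiation, so that calculus
  on the basis reduces to algebra of coefficients.\<close>

definition trig :: "real \<Rightarrow> real \<Rightarrow> 'b::euclidean_space \<Rightarrow> 'b \<Rightarrow> 'b \<Rightarrow> 'b \<Rightarrow> point \<Rightarrow> 'b" where
  "trig \<alpha> \<beta> a b c d x = (cos (\<alpha> * fst x) * cos (\<beta> * snd x)) *\<^sub>R a + (cos (\<alpha> * fst x) * sin (\<beta> * snd x)) *\<^sub>R b
    + (sin (\<alpha> * fst x) * cos (\<beta> * snd x)) *\<^sub>R c + (sin (\<alpha> * fst x) * sin (\<beta> * snd x)) *\<^sub>R d"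

lemma trig_nth: "trig \<alpha> \<beta> a b c d x $ j = trig \<alpha> \<beta> (a $ j) (b $ j) (c $ j) (d $ j) x"
  for a b c d :: "real^3"
  by (simp add: trig_def)

lemma trig_fst: "fst (trig \<alpha> \<beta> a b c d x) = trig \<alpha> \<beta> (fst a) (fst b) (fst c) (fst d) x"
  by (simp add: trig_def)

lemma trig_snd: "snd (trig \<alpha> \<beta> a b c d x) = trig \<alpha> \<beta> (snd a) (snd b) (snd c) (snd d) x"
  by (simp add: trig_def)

lemma trig_add: "trig \<alpha> \<beta> a b c d x + trig \<alpha> \<beta> a' b' c' d' x = trig \<alpha> \<beta> (a + a') (b + b') (c + c') (d + d') x"
  by (simp add: trig_def algebra_simps)

lemma trig_scaleR: "r *\<^sub>R trig \<alpha> \<beta> a b c d x = trig \<alpha> \<beta> (r *\<^sub>R a) (r *\<^sub>R b) (r *\<^sub>R c) (r *\<^sub>R d) x"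
  by (simp add: trig_def algebra_simps)

text \<open>The nested coefficients are exactly what two applications of the differentiation rule in
  \<open>hasd_trig\<close> leave behind.\<close>

lemma trig_laplacian:
  "trig \<alpha> \<beta> (\<alpha> *\<^sub>R - (\<alpha> *\<^sub>R a)) (\<alpha> *\<^sub>R - (\<alpha> *\<^sub>R b)) (- (\<alpha> *\<^sub>R (\<alpha> *\<^sub>R c))) (- (\<alpha> *\<^sub>R (\<alpha> *\<^sub>R d))) x
    + trig \<alpha> \<beta> (\<beta> *\<^sub>R - (\<beta> *\<^sub>R a)) (- (\<beta> *\<^sub>R (\<beta> *\<^sub>R b))) (\<beta> *\<^sub>R - (\<beta> *\<^sub>R c)) (- (\<beta> *\<^sub>R (\<beta> *\<^sub>R d))) x
   = (- (\<alpha> * \<alpha> + \<beta> * \<beta>)) *\<^sub>R trig \<alpha> \<beta> a b c d x"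
  unfolding trig_def by (simp add: algebra_simps)

lemma trig_has_derivative:
  "(trig \<alpha> \<beta> a b c d has_derivative
     (\<lambda>h. trig \<alpha> \<beta> (fst h *\<^sub>R \<alpha> *\<^sub>R c + snd h *\<^sub>R \<beta> *\<^sub>R b) (fst h *\<^sub>R \<alpha> *\<^sub>R d - snd h *\<^sub>R \<beta> *\<^sub>R a)
        (- (fst h *\<^sub>R \<alpha> *\<^sub>R a) + snd h *\<^sub>R \<beta> *\<^sub>R d) (- (fst h *\<^sub>R \<alpha> *\<^sub>R b) - snd h *\<^sub>R \<beta> *\<^sub>R c) x)) (at x within D)"
  unfolding trig_def
  by (auto intro!: derivative_eq_intros simp: algebra_simps)

text \<open>A directional derivative is again of the form \<open>trig\<close> with the same
  frequencies, hence the induction with arbitrary coefficients.\<close>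

lemma smooth_trig: "smooth_on D (trig \<alpha> \<beta> a b c d)"
proof -
  have "Ck_on n D (trig \<alpha> \<beta> a b c d)" for n
  proof (induction n arbitrary: a b c d)
    case 0
    show ?case
      using trig_has_derivative by (auto intro!: continuous_on_eq_continuous_within[THEN iffD2] has_derivative_continuous)
  next
    case (Suc n)
    show ?case
      unfolding Ck_on.simps by (rule exI, intro conjI ballI allI, rule trig_has_derivative, rule Suc.IH)
  qed
  then show ?thesis by (simp add: smooth_on_def)
qed

lemma cos_period_multiple: "cos (k1 * real m * (s + 2 * pi / k1)) = cos (k1 * real m * s)"
  and sin_period_multiple: "sin (k1 * real m * (s + 2 * pi / k1)) = sin (k1 * real m * s)"
proof -
  have "k1 * real m * (s + 2 * pi / k1) = k1 * real m * s + 2 * real m * pi"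
    using k1_pos by (simp add: field_simps)
  then show "cos (k1 * real m * (s + 2 * pi / k1)) = cos (k1 * real m * s)"
    "sin (k1 * real m * (s + 2 * pi / k1)) = sin (k1 * real m * s)"
    by (simp_all add: cos_add sin_add)
qed

lemma periodic_trig: "periodic_x1 k1 (trig (k1 * real m) \<beta> a b c d)"
  unfolding periodic_x1_def trig_def fst_conv snd_conv cos_period_multiple sin_period_multiple by simp

lemma continuous_trig: "continuous_on D (trig \<alpha> \<beta> a b c d)"
  unfolding trig_def by (intro continuous_intros)

lemma hasd_trig:
  "hasd (trig (k1 * real m) \<beta> a b c d)
    (trig (k1 * real m) \<beta> ((k1 * real m) *\<^sub>R c) ((k1 * real m) *\<^sub>R d) (- ((k1 * real m) *\<^sub>R a)) (- ((k1 * real m) *\<^sub>R b)))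
    (trig (k1 * real m) \<beta> (\<beta> *\<^sub>R b) (- (\<beta> *\<^sub>R a)) (\<beta> *\<^sub>R d) (- (\<beta> *\<^sub>R c)))"
  unfolding hasd_def
proof (intro conjI allI ballI continuous_trig periodic_trig)
  fix x1 x3 :: real
  show "((\<lambda>s. trig (k1 * real m) \<beta> a b c d (s, x3)) has_vector_derivative
    trig (k1 * real m) \<beta> ((k1 * real m) *\<^sub>R c) ((k1 * real m) *\<^sub>R d) (- ((k1 * real m) *\<^sub>R a)) (- ((k1 * real m) *\<^sub>R b)) (x1, x3)) (at x1)"
    unfolding trig_def fst_conv snd_conv
    by (auto intro!: derivative_eq_intros simp: algebra_simps)
  show "((\<lambda>s. trig (k1 * real m) \<beta> a b c d (x1, s)) has_vector_derivative
    trig (k1 * real m) \<beta> (\<beta> *\<^sub>R b) (- (\<beta> *\<^sub>R a)) (\<beta> *\<^sub>R d) (- (\<beta> *\<^sub>R c)) (x1, x3)) (at x3 within {0..pi})"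
    unfolding trig_def fst_conv snd_conv
    by (auto intro!: derivative_eq_intros simp: algebra_simps)
qed

lemma trig_boundary: "x3 \<in> {0, pi} \<Longrightarrow> trig \<alpha> (real m) 0 b 0 d (x1, x3) = 0"
  by (auto simp: trig_def)

text \<open>By \<open>hv\<close> the horizontal components carry cos(m3 x3) and the vertical one
  sin(m3 x3), which yields the wall conditions; the two equations \<open>dv\<close> are the
  coefficients of cos cos and sin cos in the divergence.\<close>

lemma trig_solenoidal:
  fixes a b c d :: "real^3"
  assumes hv: "a $ 3 = 0" "c $ 3 = 0" "b $ 1 = 0" "b $ 2 = 0" "d $ 1 = 0" "d $ 2 = 0"
    and dv: "k1 * real m1 * c $ 1 + real m3 * b $ 3 = 0" "real m3 * d $ 3 = k1 * real m1 * a $ 1"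
    and nz: "(m1, m3) \<noteq> (0, 0)"
    and mean: "\<And>j. j \<in> {1, 2} \<Longrightarrow> (LINT x|mC. trig (k1 * real m1) (real m3) a b c d x $ j) = 0"
  shows "trig (k1 * real m1) (real m3) a b c d \<in> smooth_solenoidal k1"
proof -
  let ?u = "trig (k1 * real m1) (real m3) a b c d"
  note h = hasd_trig[of m1 "real m3" a b c d]
  have e0: "x \<in> strip" if "snd x \<in> {0, pi}" for x using that by (cases x) (auto simp: strip_def)
  have "divergence ?u x = 0" if x: "x \<in> strip" for x
  proof -
    have "divergence ?u x = cos (k1 * real m1 * fst x) * cos (real m3 * snd x) * (k1 * real m1 * c $ 1 + real m3 * b $ 3)
       + sin (k1 * real m1 * fst x) * cos (real m3 * snd x) * (real m3 * d $ 3 - k1 * real m1 * a $ 1)"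
      unfolding divergence_def hasd_d1[OF hasd_nth[OF h] x, of 1] hasd_d3[OF hasd_nth[OF h] x, of 3]
      by (simp add: trig_def hv algebra_simps)
    then show ?thesis by (simp add: dv)
  qed
  moreover have "velocity_bc ?u"
    unfolding velocity_bc_def
  proof (intro allI ballI)
    fix x1 b' assume b': "b' \<in> {0, pi}"
    then have x: "(x1, b') \<in> strip" by (auto simp: strip_def)
    show "?u (x1, b') $ 3 = 0 \<and> d3 (\<lambda>x. ?u x $ 1) (x1, b') = 0 \<and> d3 (\<lambda>x. ?u x $ 2) (x1, b') = 0"
      using hasd_d3[OF hasd_nth[OF h] x, of 1] hasd_d3[OF hasd_nth[OF h] x, of 2] hv
      by (simp only: trig_nth vector_minus_component vector_scaleR_component) (simp add: trig_boundary[OF b'])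
  qed
  ultimately show ?thesis
    using mean by (simp add: smooth_solenoidal_def smooth_periodic_def smooth_trig periodic_trig)
qed

subsection \<open>Integrals of products\<close>

lemma LINT_product:
  fixes f g :: "real \<Rightarrow> real"
  assumes "continuous_on UNIV f" "continuous_on UNIV g"
  shows "has_bochner_integral mC (\<lambda>x. f (fst x) * g (snd x)) (integral {0..2 * pi / k1} f * integral {0..pi} g)"
proof -
  have c: "continuous_on strip (\<lambda>x. f (fst x) * g (snd x))"
    by (intro continuous_intros continuous_on_compose2[OF assms(1)] continuous_on_compose2[OF assms(2)]) auto
  show ?thesis
    unfolding has_bochner_integral_iff
    using continuous_integrable_cell[OF c] by (simp add: LINT_iterated(1)[OF c])
qed

lemma integral_cos_multiple:
  assumes "0 < \<kappa>" "0 \<le> B" "sin (\<kappa> * real_of_int r * B) = 0"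
  shows "integral {0..B} (\<lambda>x. cos (\<kappa> * real_of_int r * x)) = (if r = 0 then B else 0)"
proof (cases "r = 0")
  case False
  then have nz: "\<kappa> * real_of_int r \<noteq> 0" using assms(1) by simp
  have "((\<lambda>x. cos (\<kappa> * real_of_int r * x)) has_integral
      (sin (\<kappa> * real_of_int r * B) / (\<kappa> * real_of_int r) - sin (\<kappa> * real_of_int r * 0) / (\<kappa> * real_of_int r))) {0..B}"
    using nz assms(2)
    by (intro fundamental_theorem_of_calculus)
      (auto intro!: derivative_eq_intros simp flip: has_real_derivative_iff_has_vector_derivative)
  then show ?thesis using assms(3) False by (simp add: integral_unique)
qed (use assms(2) in simp)

lemma integral_sin_multiple:
  assumes "0 < \<kappa>" "0 \<le> B" "cos (\<kappa> * real_of_int r * B) = 1"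
  shows "integral {0..B} (\<lambda>x. sin (\<kappa> * real_of_int r * x)) = 0"
proof (cases "r = 0")
  case False
  then have nz: "\<kappa> * real_of_int r \<noteq> 0" using assms(1) by simp
  have "((\<lambda>x. sin (\<kappa> * real_of_int r * x)) has_integral
      (- cos (\<kappa> * real_of_int r * B) / (\<kappa> * real_of_int r) - (- cos (\<kappa> * real_of_int r * 0) / (\<kappa> * real_of_int r)))) {0..B}"
    using nz assms(2)
    by (intro fundamental_theorem_of_calculus)
      (auto intro!: derivative_eq_intros simp flip: has_real_derivative_iff_has_vector_derivative)
  then show ?thesis using assms(3) False by (simp add: integral_unique)
qed simp

lemma integral_cos_cos_sin_sin:
  assumes k: "0 < \<kappa>" "0 \<le> B" and s: "\<And>r. sin (\<kappa> * real_of_int r * B) = 0"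
  shows "integral {0..B} (\<lambda>x. cos (\<kappa> * real m * x) * cos (\<kappa> * real n * x)) = (if m = n then (if m = 0 then B else B / 2) else 0)"
    and "integral {0..B} (\<lambda>x. sin (\<kappa> * real m * x) * sin (\<kappa> * real n * x)) = (if m = n then (if m = 0 then 0 else B / 2) else 0)"
proof -
  define c where "c r x = cos (\<kappa> * real_of_int r * x)" for r x
  have ci: "(c r) integrable_on {0..B}" for r
    unfolding c_def by (intro integrable_continuous_real continuous_intros)
  have I: "integral {0..B} (c r) = (if r = 0 then B else 0)" for r
    using integral_cos_multiple[OF k s] by (simp add: c_def[abs_def])
  have cc: "cos (\<kappa> * real m * x) * cos (\<kappa> * real n * x) = (c (int m - int n) x + c (int m + int n) x) / 2" for x
    unfolding c_def by (simp add: cos_add cos_diff algebra_simps)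
  have ss: "sin (\<kappa> * real m * x) * sin (\<kappa> * real n * x) = (c (int m - int n) x - c (int m + int n) x) / 2" for x
    unfolding c_def by (simp add: cos_add cos_diff algebra_simps)
  show "integral {0..B} (\<lambda>x. cos (\<kappa> * real m * x) * cos (\<kappa> * real n * x)) = (if m = n then (if m = 0 then B else B / 2) else 0)"
    unfolding cc by (simp add: Henstock_Kurzweil_Integration.integral_add ci I)
  show "integral {0..B} (\<lambda>x. sin (\<kappa> * real m * x) * sin (\<kappa> * real n * x)) = (if m = n then (if m = 0 then 0 else B / 2) else 0)"
    unfolding ss by (simp add: Henstock_Kurzweil_Integration.integral_diff ci I)
qed

lemma integral_cos_sin:
  assumes k: "0 < \<kappa>" "0 \<le> B" and s: "\<And>r. cos (\<kappa> * real_of_int r * B) = 1"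
  shows "integral {0..B} (\<lambda>x. cos (\<kappa> * real m * x) * sin (\<kappa> * real n * x)) = 0"
proof -
  define c where "c r x = sin (\<kappa> * real_of_int r * x)" for r x
  have ci: "(c r) integrable_on {0..B}" for r
    unfolding c_def by (intro integrable_continuous_real continuous_intros)
  have I: "integral {0..B} (c r) = 0" for r
    using integral_sin_multiple[OF k s] by (simp add: c_def[abs_def])
  have cs: "cos (\<kappa> * real m * x) * sin (\<kappa> * real n * x) = (c (int m + int n) x - c (int m - int n) x) / 2" for x
    unfolding c_def by (simp add: sin_add sin_diff algebra_simps)
  show ?thesis
    unfolding cs by (simp add: Henstock_Kurzweil_Integration.integral_diff ci I)
qed

lemma period_trig_values: "sin (k1 * real_of_int r * (2 * pi / k1)) = 0" "cos (k1 * real_of_int r * (2 * pi / k1)) = 1"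
proof -
  have "k1 * real_of_int r * (2 * pi / k1) = 2 * pi * real_of_int r" using k1_pos by simp
  then show "sin (k1 * real_of_int r * (2 * pi / k1)) = 0" "cos (k1 * real_of_int r * (2 * pi / k1)) = 1"
    by (simp_all add: sin_integer_2pi cos_integer_2pi)
qed

lemma pi_trig_values: "sin (1 * real_of_int r * pi) = 0"
  by (simp add: sin_zero_iff_int2)

lemmas x1_integrals = integral_cos_cos_sin_sin[OF k1_pos less_imp_le[OF period_pos] period_trig_values(1)]
  integral_cos_sin[OF k1_pos less_imp_le[OF period_pos] period_trig_values(2)]

lemmas x3_integrals = integral_cos_cos_sin_sin[of 1 pi, OF zero_less_one pi_ge_zero pi_trig_values, unfolded mult_1]

text \<open>In x1 a full period is integrated and mixed products vanish. In x3 only a half period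
  is, where cos times sin has in general a nonzero integral; the orthogonality assumptions remove
  these products pointwise.\<close>

lemma L2_inner_trig:
  fixes a b c d a' b' c' d' :: "'b::euclidean_space"
  assumes orth: "a \<bullet> b' = 0" "a \<bullet> d' = 0" "c \<bullet> b' = 0" "c \<bullet> d' = 0" "b \<bullet> a' = 0" "b \<bullet> c' = 0" "d \<bullet> a' = 0" "d \<bullet> c' = 0"
  shows "L2_inner k1 (trig (k1 * real m1) (real m3) a b c d) (trig (k1 * real n1) (real n3) a' b' c' d') =
    (if m1 = n1 \<and> m3 = n3 then
      (a \<bullet> a') * ((if m1 = 0 then 2 * pi / k1 else pi / k1) * (if m3 = 0 then pi else pi / 2))
      + (b \<bullet> b') * ((if m1 = 0 then 2 * pi / k1 else pi / k1) * (if m3 = 0 then 0 else pi / 2))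
      + (c \<bullet> c') * ((if m1 = 0 then 0 else pi / k1) * (if m3 = 0 then pi else pi / 2))
      + (d \<bullet> d') * ((if m1 = 0 then 0 else pi / k1) * (if m3 = 0 then 0 else pi / 2)) else 0)"
proof -
  define C1 S1 C3 S3 C1' S1' C3' S3' where
    "C1 s = cos (k1 * real m1 * s)" and "S1 s = sin (k1 * real m1 * s)"
    and "C3 s = cos (real m3 * s)" and "S3 s = sin (real m3 * s)"
    and "C1' s = cos (k1 * real n1 * s)" and "S1' s = sin (k1 * real n1 * s)"
    and "C3' s = cos (real n3 * s)" and "S3' s = sin (real n3 * s)" for s
  note defs = C1_def S1_def C3_def S3_def C1'_def S1'_def C3'_def S3'_def
  have orth': "b' \<bullet> a = 0" "d' \<bullet> a = 0" "b' \<bullet> c = 0" "d' \<bullet> c = 0" "a' \<bullet> b = 0" "c' \<bullet> b = 0" "a' \<bullet> d = 0" "c' \<bullet> d = 0"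
    using orth by (simp_all add: inner_commute)
  have eq: "trig (k1 * real m1) (real m3) a b c d x \<bullet> trig (k1 * real n1) (real n3) a' b' c' d' x =
     (a \<bullet> a') * ((C1 (fst x) * C1' (fst x)) * (C3 (snd x) * C3' (snd x)))
     + (b \<bullet> b') * ((C1 (fst x) * C1' (fst x)) * (S3 (snd x) * S3' (snd x)))
     + (c \<bullet> c') * ((S1 (fst x) * S1' (fst x)) * (C3 (snd x) * C3' (snd x)))
     + (d \<bullet> d') * ((S1 (fst x) * S1' (fst x)) * (S3 (snd x) * S3' (snd x)))
     + (a \<bullet> c') * ((C1 (fst x) * S1' (fst x)) * (C3 (snd x) * C3' (snd x)))
     + (c \<bullet> a') * ((C1' (fst x) * S1 (fst x)) * (C3 (snd x) * C3' (snd x)))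
     + (b \<bullet> d') * ((C1 (fst x) * S1' (fst x)) * (S3 (snd x) * S3' (snd x)))
     + (d \<bullet> b') * ((C1' (fst x) * S1 (fst x)) * (S3 (snd x) * S3' (snd x)))" for x
    unfolding trig_def defs by (simp add: inner_add_left inner_add_right orth orth' algebra_simps)
  have cont: "continuous_on UNIV C1" "continuous_on UNIV S1" "continuous_on UNIV C3" "continuous_on UNIV S3"
    "continuous_on UNIV C1'" "continuous_on UNIV S1'" "continuous_on UNIV C3'" "continuous_on UNIV S3'"
    unfolding defs[abs_def] by (intro continuous_intros)+
  have P: "has_bochner_integral mC (\<lambda>x. (f (fst x) * g (fst x)) * (h (snd x) * k (snd x)))
      (integral {0..2 * pi / k1} (\<lambda>s. f s * g s) * integral {0..pi} (\<lambda>s. h s * k s))"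
    if "continuous_on UNIV f" "continuous_on UNIV g" "continuous_on UNIV h" "continuous_on UNIV k" for f g h k :: "real \<Rightarrow> real"
    by (rule LINT_product) (intro continuous_on_mult that)+
  have i1: "integral {0..2 * pi / k1} (\<lambda>s. C1 s * C1' s) = (if m1 = n1 then (if m1 = 0 then 2 * pi / k1 else pi / k1) else 0)"
    "integral {0..2 * pi / k1} (\<lambda>s. S1 s * S1' s) = (if m1 = n1 then (if m1 = 0 then 0 else pi / k1) else 0)"
    "integral {0..2 * pi / k1} (\<lambda>s. C1 s * S1' s) = 0" "integral {0..2 * pi / k1} (\<lambda>s. C1' s * S1 s) = 0"
    "integral {0..pi} (\<lambda>s. C3 s * C3' s) = (if m3 = n3 then (if m3 = 0 then pi else pi / 2) else 0)"
    "integral {0..pi} (\<lambda>s. S3 s * S3' s) = (if m3 = n3 then (if m3 = 0 then 0 else pi / 2) else 0)"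
    unfolding defs x1_integrals x3_integrals by simp_all
  have "has_bochner_integral mC (\<lambda>x. trig (k1 * real m1) (real m3) a b c d x \<bullet> trig (k1 * real n1) (real n3) a' b' c' d' x)
     ((a \<bullet> a') * (integral {0..2 * pi / k1} (\<lambda>s. C1 s * C1' s) * integral {0..pi} (\<lambda>s. C3 s * C3' s))
     + (b \<bullet> b') * (integral {0..2 * pi / k1} (\<lambda>s. C1 s * C1' s) * integral {0..pi} (\<lambda>s. S3 s * S3' s))
     + (c \<bullet> c') * (integral {0..2 * pi / k1} (\<lambda>s. S1 s * S1' s) * integral {0..pi} (\<lambda>s. C3 s * C3' s))
     + (d \<bullet> d') * (integral {0..2 * pi / k1} (\<lambda>s. S1 s * S1' s) * integral {0..pi} (\<lambda>s. S3 s * S3' s))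
     + (a \<bullet> c') * (integral {0..2 * pi / k1} (\<lambda>s. C1 s * S1' s) * integral {0..pi} (\<lambda>s. C3 s * C3' s))
     + (c \<bullet> a') * (integral {0..2 * pi / k1} (\<lambda>s. C1' s * S1 s) * integral {0..pi} (\<lambda>s. C3 s * C3' s))
     + (b \<bullet> d') * (integral {0..2 * pi / k1} (\<lambda>s. C1 s * S1' s) * integral {0..pi} (\<lambda>s. S3 s * S3' s))
     + (d \<bullet> b') * (integral {0..2 * pi / k1} (\<lambda>s. C1' s * S1 s) * integral {0..pi} (\<lambda>s. S3 s * S3' s)))"
    unfolding eq by (intro has_bochner_integral_add has_bochner_integral_mult_right P cont)
  then show ?thesis
    unfolding L2_inner_def i1 by (auto dest: has_bochner_integral_integral_eq)
qed

text \<open>The mean is the pairing with the constant 1, the trigonometric function of wave vector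
  zero.\<close>

lemma LINT_trig_scalar:
  fixes a b c d :: real
  assumes "(m1, m3) \<noteq> (0, 0)" "b = 0"
  shows "(LINT x|mC. trig (k1 * real m1) (real m3) a b c 0 x) = 0"
proof -
  have "(LINT x|mC. trig (k1 * real m1) (real m3) a b c 0 x) =
    L2_inner k1 (trig (k1 * real m1) (real m3) a 0 c 0) (trig (k1 * real 0) (real 0) 1 0 0 0)"
    using assms(2) by (simp add: L2_inner_def trig_def)
  also have "\<dots> = 0" using assms(1) by (subst L2_inner_trig) auto
  finally show ?thesis .
qed

subsection \<open>The combined basis\<close>

text \<open>Indices carry a flag: True for the velocity basis, False for the temperature basis.
  \<open>cA\<close>, \<open>cB\<close>, \<open>cC\<close>, \<open>cD\<close> are the coefficients of
  cos cos, cos sin, sin cos and sin sin in the basis function, seen as a field with values in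
  velocity times temperature.\<close>

definition cA :: "bool \<times> mode \<Rightarrow> (real^3) \<times> real" where
  "cA = (\<lambda>(b, m1, m3, p, c). if b \<and> p \<noteq> 1 then
     (if c = 1 then (basis_scale k1 m1 m3 / wave_norm k1 m1 m3 * real m3) *\<^sub>R axis 1 1 else basis_scale k1 m1 m3 *\<^sub>R e2, 0) else 0)"

definition cB :: "bool \<times> mode \<Rightarrow> (real^3) \<times> real" where
  "cB = (\<lambda>(b, m1, m3, p, c). if p = 1 then
     (if b then (if c = 1 then (- (basis_scale k1 m1 m3 / wave_norm k1 m1 m3 * (k1 * real m1))) *\<^sub>R e3 else 0, 0)
      else (0, basis_scale k1 m1 m3)) else 0)"

definition cC :: "bool \<times> mode \<Rightarrow> (real^3) \<times> real" where
  "cC = (\<lambda>(b, m1, m3, p, c). if b \<and> p = 1 then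
     (if c = 1 then (basis_scale k1 m1 m3 / wave_norm k1 m1 m3 * real m3) *\<^sub>R axis 1 1 else basis_scale k1 m1 m3 *\<^sub>R e2, 0) else 0)"

definition cD :: "bool \<times> mode \<Rightarrow> (real^3) \<times> real" where
  "cD = (\<lambda>(b, m1, m3, p, c). if p \<noteq> 1 then
     (if b then (if c = 1 then (basis_scale k1 m1 m3 / wave_norm k1 m1 m3 * (k1 * real m1)) *\<^sub>R e3 else 0, 0)
      else (0, basis_scale k1 m1 m3)) else 0)"

fun kx :: "bool \<times> mode \<Rightarrow> nat" where "kx (b, m1, m3, p, c) = m1"
fun kz :: "bool \<times> mode \<Rightarrow> nat" where "kz (b, m1, m3, p, c) = m3"

definition ebas :: "bool \<times> mode \<Rightarrow> point \<Rightarrow> (real^3) \<times> real" where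
  "ebas i = trig (k1 * real (kx i)) (real (kz i)) (cA i) (cB i) (cC i) (cD i)"

definition ebas1 :: "bool \<times> mode \<Rightarrow> point \<Rightarrow> (real^3) \<times> real" where
  "ebas1 i = trig (k1 * real (kx i)) (real (kz i)) ((k1 * real (kx i)) *\<^sub>R cC i) ((k1 * real (kx i)) *\<^sub>R cD i)
     (- ((k1 * real (kx i)) *\<^sub>R cA i)) (- ((k1 * real (kx i)) *\<^sub>R cB i))"

definition ebas3 :: "bool \<times> mode \<Rightarrow> point \<Rightarrow> (real^3) \<times> real" where
  "ebas3 i = trig (k1 * real (kx i)) (real (kz i)) (real (kz i) *\<^sub>R cB i) (- (real (kz i) *\<^sub>R cA i))
     (real (kz i) *\<^sub>R cD i) (- (real (kz i) *\<^sub>R cC i))"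

lemma ebas_u: "ebas (True, n) x = (u_basis k1 n x, 0)"
proof -
  obtain m1 m3 p c where n: "n = (m1, m3, p, c)" by (cases n) auto
  obtain x1 x3 where x: "x = (x1, x3)" by (cases x)
  have "fst (ebas (True, n) x) = u_basis k1 n x"
    unfolding ebas_def trig_fst n x
    by (simp add: vec_eq_iff forall_3 trig_def cA_def cB_def cC_def cD_def axis_def vector_3)
  moreover have "snd (ebas (True, n) x) = 0"
    unfolding ebas_def trig_snd n by (simp add: trig_def cA_def cB_def cC_def cD_def)
  ultimately show ?thesis by (metis prod.collapse)
qed

lemma ebas_theta: "ebas (False, n) x = (0, theta_basis k1 n x)"
proof -
  obtain m1 m3 p c where n: "n = (m1, m3, p, c)" by (cases n) auto
  obtain x1 x3 where x: "x = (x1, x3)" by (cases x)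
  show ?thesis
    unfolding ebas_def n x by (simp add: trig_def cA_def cB_def cC_def cD_def prod_eq_iff)
qed

definition NN :: "(bool \<times> mode) set" where
  "NN = {True} \<times> N_u \<union> {False} \<times> N_theta"

lemma coef_shape:
  "fst (cA i) $ 3 = 0" "snd (cA i) = 0" "fst (cC i) $ 3 = 0" "snd (cC i) = 0"
  "fst (cB i) $ 1 = 0" "fst (cB i) $ 2 = 0" "fst (cD i) $ 1 = 0" "fst (cD i) $ 2 = 0"
  by (auto simp: cA_def cB_def cC_def cD_def axis_def split: prod.splits)

lemma coef_orth: "cA i \<bullet> cB j = 0" "cA i \<bullet> cD j = 0" "cC i \<bullet> cB j = 0" "cC i \<bullet> cD j = 0"
  "cB i \<bullet> cA j = 0" "cB i \<bullet> cC j = 0" "cD i \<bullet> cA j = 0" "cD i \<bullet> cC j = 0"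
  by (simp_all add: inner_prod_def inner_vec_def sum_3 coef_shape)

lemma coef_div:
  "k1 * real (kx i) * fst (cC i) $ 1 + real (kz i) * fst (cB i) $ 3 = 0"
  "real (kz i) * fst (cD i) $ 3 = k1 * real (kx i) * fst (cA i) $ 1"
  by (cases i rule: kx.cases; simp add: cA_def cB_def cC_def cD_def axis_def)+

lemma hasd_ebas: "hasd (ebas i) (ebas1 i) (ebas3 i)"
  unfolding ebas_def ebas1_def ebas3_def by (rule hasd_trig)

lemma admfield_ebas: "admfield (ebas i) (ebas1 i) (ebas3 i)"
  unfolding admfield_def
proof (intro conjI hasd_ebas ballI allI)
  fix x
  show "fst (ebas1 i x) $ 1 + fst (ebas3 i x) $ 3 = 0"
    unfolding ebas1_def ebas3_def trig_fst trig_nth trig_add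
    using coef_div[of i] by (simp add: trig_def coef_shape)
next
  fix x1 b assume b: "b \<in> {0::real, pi}"
  show "fst (ebas i (x1, b)) $ 3 = 0" "snd (ebas i (x1, b)) = 0"
    unfolding ebas_def trig_fst trig_snd trig_nth using trig_boundary[OF b] by (simp_all add: coef_shape)
qed

lemma wave_norm_sq: "(wave_norm k1 m1 m3)\<^sup>2 = k1\<^sup>2 * (real m1)\<^sup>2 + (real m3)\<^sup>2"
  by (simp add: wave_norm_def)

text \<open>The basis fields are eigenfunctions of the Laplacian. The mixed derivatives
  \<open>w13\<close> and \<open>w31\<close> come along because \<open>hasd\<close> always names both
  partial derivatives.\<close>

lemma ebas_second:
  "\<exists>w11 w13 w31 w33. hasd (ebas1 i) w11 w13 \<and> hasd (ebas3 i) w31 w33 \<and>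
    (\<forall>x. w11 x + w33 x = (- (wave_norm k1 (kx i) (kz i))\<^sup>2) *\<^sub>R ebas i x)"
proof -
  have "(wave_norm k1 (kx i) (kz i))\<^sup>2 = (k1 * real (kx i)) * (k1 * real (kx i)) + real (kz i) * real (kz i)"
    unfolding wave_norm_sq by (simp add: power2_eq_square algebra_simps)
  moreover note lap = trig_laplacian[of "k1 * real (kx i)" "real (kz i)" "cA i" "cB i" "cC i" "cD i"]
  ultimately have "\<forall>x. trig (k1 * real (kx i)) (real (kz i)) ((k1 * real (kx i)) *\<^sub>R - ((k1 * real (kx i)) *\<^sub>R cA i))
      ((k1 * real (kx i)) *\<^sub>R - ((k1 * real (kx i)) *\<^sub>R cB i)) (- ((k1 * real (kx i)) *\<^sub>R ((k1 * real (kx i)) *\<^sub>R cC i)))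
      (- ((k1 * real (kx i)) *\<^sub>R ((k1 * real (kx i)) *\<^sub>R cD i))) x
    + trig (k1 * real (kx i)) (real (kz i)) (real (kz i) *\<^sub>R - (real (kz i) *\<^sub>R cA i))
      (- (real (kz i) *\<^sub>R (real (kz i) *\<^sub>R cB i))) (real (kz i) *\<^sub>R - (real (kz i) *\<^sub>R cC i))
      (- (real (kz i) *\<^sub>R (real (kz i) *\<^sub>R cD i))) x
    = (- (wave_norm k1 (kx i) (kz i))\<^sup>2) *\<^sub>R ebas i x"
    by (simp only: ebas_def) simp
  then show ?thesis
    unfolding ebas1_def ebas3_def using hasd_trig by blast
qed

text \<open>The horizontal components carry cos(m3 x3), whose derivative vanishes at both walls: the
  free-slip condition.\<close>

lemma ebas3_boundary:
  assumes "b \<in> {0, pi}" "j \<in> {1, 2}"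
  shows "fst (ebas3 i (x1, b)) $ j = 0"
  unfolding ebas3_def trig_fst trig_nth using trig_boundary[OF assms(1)] assms(2)
  by (auto simp: coef_shape)

lemma basis_scale_sq: "(basis_scale k1 m1 m3)\<^sup>2 = (eta m1)\<^sup>2 * (eta m3)\<^sup>2 * (2 * k1 / pi\<^sup>2)"
  using k1_pos by (simp add: basis_scale_def power_mult_distrib power_divide)

lemma eta_sq: "(eta m)\<^sup>2 = (if m > 0 then 1 else 1 / 2)"
  by (simp add: eta_def power_divide)

lemma wave_norm_pos: "(m1, m3) \<noteq> (0, 0) \<Longrightarrow> wave_norm k1 m1 m3 > 0"
  using k1_pos by (auto simp: wave_norm_def add_pos_nonneg add_nonneg_pos)

text \<open>Different indices with equal wave vectors have orthogonal coefficients, because they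
  occupy different slots or different components. On the diagonal, \<open>eta\<close> compensates
  for the doubled integral of a cosine with wave number zero. For c = 1 the two components
  contribute m3^2 and (k1 m1)^2, whose sum cancels the squared wave norm.\<close>

lemma L2_inner_ebas:
  assumes "i \<in> NN" "j \<in> NN"
  shows "L2_inner k1 (ebas i) (ebas j) = (if i = j then 1 else 0)"
proof -
  obtain b m1 m3 p c where i: "i = (b, m1, m3, p, c)" by (cases i) auto
  obtain b' n1 n3 p' c' where j: "j = (b', n1, n3, p', c')" by (cases j) auto
  have pr: "p = 1 \<or> p = 2" "p' = 1 \<or> p' = 2" "c = 1 \<or> c = 2" "c' = 1 \<or> c' = 2"
    using assms by (auto simp: i j NN_def N_u_def N_theta_def split: if_splits)
  have F: "L2_inner k1 (ebas i) (ebas j) =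
    (if m1 = n1 \<and> m3 = n3 then
      (cA i \<bullet> cA j) * ((if m1 = 0 then 2 * pi / k1 else pi / k1) * (if m3 = 0 then pi else pi / 2))
      + (cB i \<bullet> cB j) * ((if m1 = 0 then 2 * pi / k1 else pi / k1) * (if m3 = 0 then 0 else pi / 2))
      + (cC i \<bullet> cC j) * ((if m1 = 0 then 0 else pi / k1) * (if m3 = 0 then pi else pi / 2))
      + (cD i \<bullet> cD j) * ((if m1 = 0 then 0 else pi / k1) * (if m3 = 0 then 0 else pi / 2)) else 0)"
    unfolding ebas_def by (subst L2_inner_trig[OF coef_orth]) (simp add: i j)
  show ?thesis
  proof (cases "i = j")
    case False
    have "cA i \<bullet> cA j = 0 \<and> cB i \<bullet> cB j = 0 \<and> cC i \<bullet> cC j = 0 \<and> cD i \<bullet> cD j = 0" if "m1 = n1" "m3 = n3"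
    proof -
      have t: "\<not> b \<Longrightarrow> c = 1" "\<not> b' \<Longrightarrow> c' = 1"
        using assms by (auto simp: i j NN_def N_theta_def)
      show ?thesis
        unfolding i j
        by (insert pr t False[unfolded i j] that, cases b; cases b'; elim disjE;
            simp add: cA_def cB_def cC_def cD_def inner_axis_axis)
    qed
    then have "L2_inner k1 (ebas i) (ebas j) = 0"
      unfolding F by simp
    then show ?thesis using False by simp
  next
    case True
    have jj: "n1 = m1" "n3 = m3" using True by (simp_all add: i j)
    note F2 = F[folded True, unfolded jj]
    define ss sc wn where "ss = basis_scale k1 m1 m3 / wave_norm k1 m1 m3" and "sc = basis_scale k1 m1 m3"
      and "wn = (wave_norm k1 m1 m3)\<^sup>2"
    have sc2: "sc * sc = (eta m1)\<^sup>2 * (eta m3)\<^sup>2 * (2 * k1 / pi\<^sup>2)"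
      using basis_scale_sq[of m1 m3] by (simp add: sc_def power2_eq_square)
    have q: "pi * pi / k1 * (k1 / pi\<^sup>2) = 1" using k1_pos by (simp add: power2_eq_square)
    show ?thesis
    proof (cases "b \<and> c = 1")
      case bc: True
      then have m3: "m3 > 0" using assms(1) by (auto simp: i NN_def N_u_def split: if_splits)
      have p2: "m1 = 0 \<Longrightarrow> p = 2" using assms(1) bc by (auto simp: i NN_def N_u_def split: if_splits)
      have wpos: "wn > 0" using wave_norm_pos[of m1 m3] m3 by (simp add: wn_def)
      have ss2: "ss * ss = sc * sc / wn" by (simp add: ss_def sc_def wn_def power2_eq_square)
      have wn: "wn = k1 * k1 * real m1 * real m1 + real m3 * real m3"
        unfolding wn_def wave_norm_sq by (simp add: power2_eq_square)
      have A: "cA i \<bullet> cA i = (if p = 1 then 0 else ss * ss * (real m3 * real m3))"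
        "cB i \<bullet> cB i = (if p = 1 then ss * ss * (k1 * k1 * real m1 * real m1) else 0)"
        "cC i \<bullet> cC i = (if p = 1 then ss * ss * (real m3 * real m3) else 0)"
        "cD i \<bullet> cD i = (if p = 1 then 0 else ss * ss * (k1 * k1 * real m1 * real m1))"
        using bc by (simp_all add: i cA_def cB_def cC_def cD_def inner_axis_axis ss_def)
      have "L2_inner k1 (ebas i) (ebas i) = (if m1 = 0 then 2 else 1) * (pi * pi / k1 / 2) * (ss * ss * wn)"
        using m3 p2 pr(1) by (cases "m1 = 0") (auto simp: F2 A wn algebra_simps)
      also have "ss * ss * wn = sc * sc" using wpos by (simp add: ss2)
      also have "(if m1 = 0 then 2 else 1) * (pi * pi / k1 / 2) * (sc * sc) = 1"
        unfolding sc2 eta_sq using m3 k1_pos by (auto simp: power2_eq_square)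
      finally show ?thesis using True by simp
    next
      case bc: False
      have A: "cA i \<bullet> cA i = (if b \<and> p \<noteq> 1 then sc * sc else 0)"
        "cB i \<bullet> cB i = (if \<not> b \<and> p = 1 then sc * sc else 0)"
        "cC i \<bullet> cC i = (if b \<and> p = 1 then sc * sc else 0)"
        "cD i \<bullet> cD i = (if \<not> b \<and> p \<noteq> 1 then sc * sc else 0)"
        using bc by (auto simp: i cA_def cB_def cC_def cD_def inner_axis_axis sc_def zero_prod_def)
      have cond: "m1 = 0 \<Longrightarrow> (if b then p = 2 else p = 1)" "\<not> b \<Longrightarrow> m3 > 0" "b \<Longrightarrow> (m1, m3) \<noteq> (0, 0)"
        using assms(1) by (auto simp: i NN_def N_u_def N_theta_def split: if_splits)
      have "L2_inner k1 (ebas i) (ebas i) = (if m1 = 0 then 2 else 1) * (if m3 = 0 then 2 else 1) * (pi * pi / k1 / 2) * (sc * sc)"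
        using cond pr(1) by (cases b; cases "m1 = 0"; cases "m3 = 0") (auto simp: F2 A)
      also have "\<dots> = 1"
        unfolding sc2 eta_sq using k1_pos by (auto simp: power2_eq_square)
      finally show ?thesis using True by simp
    qed
  qed
qed

lemma orthonormal_ebas: "orthonormal ebas NN"
  unfolding orthonormal_def using L2_inner_ebas hasd_L2(1)[OF hasd_ebas] by blast

lemma u_basis_eq: "u_basis k1 n = trig (k1 * real (kx (True, n))) (real (kz (True, n)))
   (fst (cA (True, n))) (fst (cB (True, n))) (fst (cC (True, n))) (fst (cD (True, n)))"
proof (rule ext)
  fix x show "u_basis k1 n x = trig (k1 * real (kx (True, n))) (real (kz (True, n)))
   (fst (cA (True, n))) (fst (cB (True, n))) (fst (cC (True, n))) (fst (cD (True, n))) x"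
    using arg_cong[OF ebas_u[of n x], of fst] by (simp only: ebas_def trig_fst fst_conv)
qed

lemma theta_basis_eq: "theta_basis k1 n = trig (k1 * real (kx (False, n))) (real (kz (False, n)))
   (snd (cA (False, n))) (snd (cB (False, n))) (snd (cC (False, n))) (snd (cD (False, n)))"
proof (rule ext)
  fix x show "theta_basis k1 n x = trig (k1 * real (kx (False, n))) (real (kz (False, n)))
   (snd (cA (False, n))) (snd (cB (False, n))) (snd (cC (False, n))) (snd (cD (False, n))) x"
    using arg_cong[OF ebas_theta[of n x], of snd] by (simp only: ebas_def trig_snd snd_conv)
qed

lemma u_basis_solenoidal:
  assumes "n \<in> N_u"
  shows "u_basis k1 n \<in> smooth_solenoidal k1"
proof -
  obtain m1 m3 p c where n: "n = (m1, m3, p, c)" by (cases n) auto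
  have nz: "(m1, m3) \<noteq> (0, 0)" using assms by (auto simp: n N_u_def)
  have "(LINT x|mC. trig (k1 * real m1) (real m3) (fst (cA (True, n))) (fst (cB (True, n))) (fst (cC (True, n))) (fst (cD (True, n))) x $ j) = 0"
    if "j \<in> {1, 2}" for j
  proof -
    have "fst (cB (True, n)) $ j = 0" "fst (cD (True, n)) $ j = 0"
      using that coef_shape[of "(True, n)"] by auto
    then show ?thesis by (simp only: trig_nth LINT_trig_scalar[OF nz refl])
  qed
  then show ?thesis
    unfolding u_basis_eq
    using coef_shape coef_div[of "(True, n)"] nz
    by (intro trig_solenoidal) (auto simp: n)
qed

lemma orthonormal_u_basis: "orthonormal (u_basis k1) N_u"
proof -
  have "L2_inner k1 (u_basis k1 n) (u_basis k1 m) = L2_inner k1 (ebas (True, n)) (ebas (True, m))" for n m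
    by (simp add: L2_inner_def ebas_u)
  moreover have "u_basis k1 n \<in> L2_space k1" for n
    unfolding u_basis_eq by (intro continuous_L2 continuous_trig)
  ultimately show ?thesis
    unfolding orthonormal_def by (auto simp: L2_inner_ebas NN_def)
qed

lemma orthonormal_theta_basis: "orthonormal (theta_basis k1) N_theta"
proof -
  have "L2_inner k1 (theta_basis k1 n) (theta_basis k1 m) = L2_inner k1 (ebas (False, n)) (ebas (False, m))" for n m
    by (simp add: L2_inner_def ebas_theta)
  moreover have "theta_basis k1 n \<in> L2_space k1" for n
    unfolding theta_basis_eq by (intro continuous_L2 continuous_trig)
  ultimately show ?thesis
    unfolding orthonormal_def by (auto simp: L2_inner_ebas NN_def)
qed


subsection \<open>Trigonometric polynomials are dense\<close>

definition lspan :: "'n set \<Rightarrow> ('n \<Rightarrow> point \<Rightarrow> 'b::euclidean_space) \<Rightarrow> (point \<Rightarrow> 'b) set" where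
  "lspan N e = {\<lambda>x. \<Sum>n\<in>A. c n *\<^sub>R e n x | A c. finite A \<and> A \<subseteq> N}"

lemma lspanI: "finite A \<Longrightarrow> A \<subseteq> N \<Longrightarrow> f = (\<lambda>x. \<Sum>n\<in>A. c n *\<^sub>R e n x) \<Longrightarrow> f \<in> lspan N e"
  unfolding lspan_def by blast

lemma lspan_base: "n \<in> N \<Longrightarrow> (\<lambda>x. r *\<^sub>R e n x) \<in> lspan N e"
  unfolding lspan_def by (intro CollectI exI[of _ "{n}"] exI[of _ "\<lambda>_. r"]) auto

lemma lspan_zero: "(\<lambda>x. 0) \<in> lspan N e"
  unfolding lspan_def by (intro CollectI exI[of _ "{}"]) auto

lemma lspan_add:
  assumes "f \<in> lspan N e" "g \<in> lspan N e"
  shows "(\<lambda>x. f x + g x) \<in> lspan N e"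
proof -
  obtain A c where A: "finite A" "A \<subseteq> N" "f = (\<lambda>x. \<Sum>n\<in>A. c n *\<^sub>R e n x)"
    using assms(1) by (auto simp: lspan_def)
  obtain B d where B: "finite B" "B \<subseteq> N" "g = (\<lambda>x. \<Sum>n\<in>B. d n *\<^sub>R e n x)"
    using assms(2) by (auto simp: lspan_def)
  have "f x = (\<Sum>n\<in>A \<union> B. (if n \<in> A then c n else 0) *\<^sub>R e n x)" for x
    unfolding A(3) using A(1) B(1) by (intro sum.mono_neutral_cong_left) auto
  moreover have "g x = (\<Sum>n\<in>A \<union> B. (if n \<in> B then d n else 0) *\<^sub>R e n x)" for x
    unfolding B(3) using A(1) B(1) by (intro sum.mono_neutral_cong_left) auto
  ultimately have "(\<lambda>x. f x + g x) = (\<lambda>x. \<Sum>n\<in>A \<union> B. ((if n \<in> A then c n else 0) + (if n \<in> B then d n else 0)) *\<^sub>R e n x)"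
    by (simp add: sum.distrib scaleR_add_left)
  then show ?thesis
    using A B by (intro lspanI[of "A \<union> B"]) auto
qed

lemma lspan_sum:
  assumes "\<And>n. n \<in> A \<Longrightarrow> f n \<in> lspan N e"
  shows "(\<lambda>x. \<Sum>n\<in>A. f n x) \<in> lspan N e"
  using assms by (induction A rule: infinite_finite_induct) (auto intro: lspan_zero lspan_add)

text \<open>Trigonometric polynomials in x1 with cosines only in x3. They already form an algebra
  that separates the points of the cell up to the identification of its vertical edges, since cos is
  injective on [0,pi].\<close>

inductive_set TP :: "(point \<Rightarrow> real) set" where
  TP_base: "trig (k1 * real m1) (real m3) a 0 c 0 \<in> TP"
| TP_add: "f \<in> TP \<Longrightarrow> g \<in> TP \<Longrightarrow> (\<lambda>x. f x + g x) \<in> TP"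

lemma trig_even: "trig \<alpha> \<beta> a 0 c 0 x = (a * cos (\<alpha> * fst x) + c * sin (\<alpha> * fst x)) * cos (\<beta> * snd x)"
  for a c :: real
  by (simp add: trig_def algebra_simps)

text \<open>Product-to-sum formulas in both variables. Wave numbers are natural, so the difference
  frequencies \<open>d1\<close>, \<open>d3\<close> are absolute differences; \<open>s\<close>
  restores the sign that the sine loses thereby.\<close>

lemma TP_mult_base:
  "(\<lambda>x. trig (k1 * real m1) (real m3) a 0 c 0 x * trig (k1 * real n1) (real n3) a' 0 c' 0 x) \<in> TP"
proof -
  define s :: real where "s = (if m1 \<ge> n1 then 1 else - 1)"
  define d1 where "d1 = (if m1 \<ge> n1 then m1 - n1 else n1 - m1)"
  define d3 where "d3 = (if m3 \<ge> n3 then m3 - n3 else n3 - m3)"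
  let ?A = "(a * a' - c * c') / 4" and ?C = "(a * c' + c * a') / 4"
  let ?B = "(a * a' + c * c') / 4" and ?D = "s * (c * a' - a * c') / 4"
  have c3: "cos (real m3 * y) * cos (real n3 * y) = (cos (real (m3 + n3) * y) + cos (real d3 * y)) / 2" for y
  proof -
    have "cos (real d3 * y) = cos (real m3 * y - real n3 * y)"
    proof (cases "m3 \<ge> n3")
      case False
      then have "real d3 * y = - (real m3 * y - real n3 * y)" by (simp add: d3_def of_nat_diff algebra_simps)
      then show ?thesis by (simp only: cos_minus)
    qed (simp add: d3_def of_nat_diff algebra_simps)
    then show ?thesis by (simp add: cos_add cos_diff algebra_simps)
  qed
  have e1: "cos (k1 * real d1 * y) = cos (k1 * real m1 * y - k1 * real n1 * y)"
    "sin (k1 * real d1 * y) = s * sin (k1 * real m1 * y - k1 * real n1 * y)" for y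
  proof -
    have "k1 * real d1 * y = s * (k1 * real m1 * y - k1 * real n1 * y)"
      by (simp add: d1_def s_def of_nat_diff algebra_simps)
    then show "cos (k1 * real d1 * y) = cos (k1 * real m1 * y - k1 * real n1 * y)"
      "sin (k1 * real d1 * y) = s * sin (k1 * real m1 * y - k1 * real n1 * y)"
      by (auto simp: s_def simp flip: cos_minus[of "k1 * real m1 * y - k1 * real n1 * y"] sin_minus[of "k1 * real m1 * y - k1 * real n1 * y"])
  qed
  have ss: "s * s = 1" by (simp add: s_def)
  have h1: "(a * cos (k1 * real m1 * y) + c * sin (k1 * real m1 * y)) * (a' * cos (k1 * real n1 * y) + c' * sin (k1 * real n1 * y))
    = 2 * (?A * cos (k1 * real (m1 + n1) * y) + ?C * sin (k1 * real (m1 + n1) * y) + ?B * cos (k1 * real d1 * y) + ?D * sin (k1 * real d1 * y))" for y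
  proof -
    have "?D * sin (k1 * real d1 * y) = (s * s) * ((c * a' - a * c') / 4) * sin (k1 * real m1 * y - k1 * real n1 * y)"
      unfolding e1 by simp
    then show ?thesis
      unfolding ss e1(1) by (simp add: cos_add cos_diff sin_add sin_diff field_simps)
  qed
  have eq: "trig (k1 * real m1) (real m3) a 0 c 0 x * trig (k1 * real n1) (real n3) a' 0 c' 0 x =
     trig (k1 * real (m1 + n1)) (real (m3 + n3)) ?A 0 ?C 0 x + trig (k1 * real (m1 + n1)) (real d3) ?A 0 ?C 0 x
     + (trig (k1 * real d1) (real (m3 + n3)) ?B 0 ?D 0 x + trig (k1 * real d1) (real d3) ?B 0 ?D 0 x)" for x
  proof -
    have "trig (k1 * real m1) (real m3) a 0 c 0 x * trig (k1 * real n1) (real n3) a' 0 c' 0 x =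
      ((a * cos (k1 * real m1 * fst x) + c * sin (k1 * real m1 * fst x)) * (a' * cos (k1 * real n1 * fst x) + c' * sin (k1 * real n1 * fst x)))
      * (cos (real m3 * snd x) * cos (real n3 * snd x))"
      by (simp add: trig_def algebra_simps)
    also have "\<dots> = (?A * cos (k1 * real (m1 + n1) * fst x) + ?C * sin (k1 * real (m1 + n1) * fst x) + ?B * cos (k1 * real d1 * fst x) + ?D * sin (k1 * real d1 * fst x))
       * (cos (real (m3 + n3) * snd x) + cos (real d3 * snd x))"
      unfolding h1 c3 by simp
    finally show ?thesis unfolding trig_even by (simp only: ring_distribs mult_ac add_ac)
  qed
  show ?thesis unfolding eq by (intro TP_add TP_base)
qed

lemma TP_mult:
  assumes "f \<in> TP" "g \<in> TP"
  shows "(\<lambda>x. f x * g x) \<in> TP"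
  using assms
proof (induction f)
  case (TP_base m1 m3 a c)
  from TP_base show ?case
    by (induction g) (auto intro: TP_mult_base TP_add simp: distrib_left)
next
  case (TP_add f f')
  then show ?case by (simp add: distrib_right TP.TP_add)
qed

lemma continuous_TP: "f \<in> TP \<Longrightarrow> continuous_on D f"
  by (induction f rule: TP.induct) (auto intro: continuous_trig continuous_intros)

text \<open>Stone-Weierstrass on the image \<open>K\<close> of the cell under \<phi>, a piece of a
  cylinder on which the two vertical edges are glued. A periodic f descends to the function
  \<open>F\<close> on \<open>K\<close>.\<close>

lemma TP_dense:
  assumes cf: "continuous_on strip f" and per: "periodic_x1 k1 f" and e: "0 < e"
  shows "\<exists>g\<in>TP. \<forall>x\<in>cell k1. \<bar>f x - g x\<bar> < e"
proof -
  define \<phi> :: "point \<Rightarrow> real \<times> real \<times> real" where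
    "\<phi> x = (cos (k1 * fst x), sin (k1 * fst x), cos (snd x))" for x
  define K where "K = \<phi> ` cell k1"
  define F where "F z = f (SOME x. x \<in> cell k1 \<and> \<phi> x = z)" for z
  have c\<phi>: "continuous_on D \<phi>" for D unfolding \<phi>_def by (intro continuous_intros)
  have inj: "f x = f y" if x: "x \<in> cell k1" and y: "y \<in> cell k1" and eq: "\<phi> x = \<phi> y" for x y
  proof -
    obtain x1 x3 y1 y3 where xy: "x = (x1, x3)" "y = (y1, y3)" by (cases x; cases y)
    have r: "0 \<le> x1" "x1 \<le> 2 * pi / k1" "0 \<le> y1" "y1 \<le> 2 * pi / k1" "x3 \<in> {0..pi}" "y3 \<in> {0..pi}"
      using x y by (auto simp: xy cell_def)
    have "x3 = y3" using eq r(5,6) by (auto simp: xy \<phi>_def intro: cos_inj_pi)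
    have "sin (k1 * x1) = sin (k1 * y1) \<and> cos (k1 * x1) = cos (k1 * y1)"
      using eq by (simp add: xy \<phi>_def)
    then obtain n :: int where n: "k1 * x1 = k1 * y1 + 2 * pi * of_int n"
      by (auto simp: sin_cos_eq_iff)
    then have n': "x1 = y1 + 2 * pi / k1 * of_int n" using k1_pos by (simp add: field_simps)
    \<comment> \<open>Both abscissae lie in one closed period, so they differ by at most one period;
      the sole nontrivial identification is that of the two edges, where f agrees by
      periodicity.\<close>
    have "n = 0 \<or> n = 1 \<or> n = -1"
    proof (rule ccontr)
      assume "\<not> ?thesis"
      then have "2 \<le> n \<or> n \<le> -2" by auto
      then have "2 * pi / k1 * of_int n \<ge> 2 * pi / k1 * 2 \<or> 2 * pi / k1 * of_int n \<le> 2 * pi / k1 * (-2)"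
        using period_pos by (metis less_imp_le mult_left_mono of_int_le_iff of_int_numeral of_int_neg_numeral)
      then show False using n' r period_pos by auto
    qed
    moreover have "f (0, x3) = f (2 * pi / k1, x3)"
      using per r(5) by (auto simp: periodic_x1_def dest: spec[of _ 0])
    ultimately consider "x1 = y1" | "x1 = 2 * pi / k1" "y1 = 0" | "x1 = 0" "y1 = 2 * pi / k1"
      using n' r(1-4) by fastforce
    then show ?thesis
      using \<open>f (0, x3) = f (2 * pi / k1, x3)\<close> by cases (simp_all add: xy \<open>x3 = y3\<close>)
  qed
  have F\<phi>: "F (\<phi> x) = f x" if "x \<in> cell k1" for x
  proof -
    have "(SOME y. y \<in> cell k1 \<and> \<phi> y = \<phi> x) \<in> cell k1 \<and> \<phi> (SOME y. y \<in> cell k1 \<and> \<phi> y = \<phi> x) = \<phi> x"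
      by (rule someI[of _ x]) (use that in simp)
    then show ?thesis unfolding F_def using inj that by blast
  qed
  have cK: "compact K" unfolding K_def by (intro compact_continuous_image c\<phi> compact_cell)
  \<comment> \<open>\<phi> is a closed map on the compact cell: the preimage of a closed set under
    \<open>F\<close> is the compact image of a closed set.\<close>
  have cF: "continuous_on K F"
  proof -
    have "closed (F -` B \<inter> K)" if B: "closed B" for B
    proof -
      have "F -` B \<inter> K = \<phi> ` (f -` B \<inter> cell k1)"
        unfolding K_def using F\<phi> by auto
      moreover have "closed (f -` B \<inter> cell k1)"
        using continuous_on_closed_vimage[OF compact_imp_closed[OF compact_cell], of f]
          continuous_on_subset[OF cf cell_subset_strip] B by blast
      then have "compact (f -` B \<inter> cell k1)"
        using compact_Int_closed[OF compact_cell] by (metis inf.absorb_iff2 inf_le2)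
      ultimately show ?thesis
        using compact_continuous_image[OF c\<phi>] compact_imp_closed by metis
    qed
    then show ?thesis
      using continuous_on_closed_vimage[OF compact_imp_closed[OF cK]] by blast
  qed
  \<comment> \<open>The algebra for Stone-Weierstrass: continuous functions on \<open>K\<close>
    whose pullback to the cell is a trigonometric polynomial. The three coordinates belong to it and
    separate points.\<close>
  define P where "P g \<longleftrightarrow> continuous_on K g \<and> (\<exists>h\<in>TP. \<forall>x\<in>cell k1. g (\<phi> x) = h x)" for g
  have "\<exists>g. P g \<and> (\<forall>z\<in>K. \<bar>F z - g z\<bar> < e)"
  proof (rule Stone_Weierstrass_HOL[OF cK])
    fix c show "P (\<lambda>x. c)"
      unfolding P_def using TP_base[of 0 0 c 0] by (auto simp: trig_def intro!: bexI[of _ "trig (k1 * real 0) (real 0) c 0 0 0"])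
  next
    fix g h assume "P g \<and> P h"
    then show "P (\<lambda>x. g x + h x)" "P (\<lambda>x. g x * h x)"
      unfolding P_def by (auto intro!: continuous_intros intro: TP_add TP_mult bexI[rotated])
  next
    fix z w assume "z \<in> K \<and> w \<in> K \<and> z \<noteq> w"
    then have "fst z \<noteq> fst w \<or> fst (snd z) \<noteq> fst (snd w) \<or> snd (snd z) \<noteq> snd (snd w)"
      by (auto simp: prod_eq_iff)
    moreover have "P fst"
      unfolding P_def using TP_base[of 1 0 1 0] by (auto simp: trig_def \<phi>_def intro!: continuous_intros bexI[of _ "trig (k1 * real 1) (real 0) 1 0 0 0"])
    moreover have "P (\<lambda>z. fst (snd z))"
      unfolding P_def using TP_base[of 1 0 0 1] by (auto simp: trig_def \<phi>_def intro!: continuous_intros bexI[of _ "trig (k1 * real 1) (real 0) 0 0 1 0"])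
    moreover have "P (\<lambda>z. snd (snd z))"
      unfolding P_def using TP_base[of 0 1 1 0] by (auto simp: trig_def \<phi>_def intro!: continuous_intros bexI[of _ "trig (k1 * real 0) (real 1) 1 0 0 0"])
    ultimately show "\<exists>g. P g \<and> g z \<noteq> g w" by metis
  qed (auto simp: P_def cF e)
  then obtain g h where h: "h \<in> TP" "\<forall>x\<in>cell k1. g (\<phi> x) = h x" and g: "\<forall>z\<in>K. \<bar>F z - g z\<bar> < e"
    unfolding P_def by blast
  have "\<bar>f x - h x\<bar> < e" if "x \<in> cell k1" for x
    using g[rule_format, of "\<phi> x"] that h(2) F\<phi>[OF that] by (auto simp: K_def)
  with h(1) show ?thesis by blast
qed

text \<open>The added 1 makes it evidently positive, so that one may divide by it without computing
  the area.\<close>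

definition cell_const :: real where "cell_const = L2_norm k1 (\<lambda>x. 1::real) + 1"

lemma cell_const_pos: "0 < cell_const"
  using L2_norm_nonneg[of "\<lambda>x. 1::real"] by (simp add: cell_const_def)

lemma L2_norm_uniform_le:
  fixes f :: "point \<Rightarrow> real"
  assumes c: "continuous_on strip f" and "\<And>x. x \<in> cell k1 \<Longrightarrow> \<bar>f x\<bar> \<le> e" and e: "0 \<le> e"
  shows "L2_norm k1 f \<le> e * cell_const"
proof -
  have "L2_inner k1 f f \<le> (LINT x|mC. e\<^sup>2)"
    unfolding L2_inner_def
  proof (rule integral_mono)
    show "integrable mC (\<lambda>x. f x \<bullet> f x)" "integrable mC (\<lambda>x. e\<^sup>2)"
      by (intro continuous_integrable_cell continuous_intros c)+
    show "f x \<bullet> f x \<le> e\<^sup>2" if "x \<in> space mC" for x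
      using power_mono[OF assms(2)[of x], of 2] that by (simp add: power2_eq_square)
  qed
  also have "\<dots> = (e * L2_norm k1 (\<lambda>x. 1::real))\<^sup>2"
    by (simp add: power_mult_distrib L2_norm_sq L2_inner_def)
  also have "\<dots> \<le> (e * cell_const)\<^sup>2"
    using e L2_norm_nonneg[of "\<lambda>x. 1::real"]
    by (intro power_mono mult_left_mono) (auto simp: cell_const_def)
  finally show ?thesis using e cell_const_pos by (intro L2_norm_le_of_sq) auto
qed

subsection \<open>Completeness of the temperature basis\<close>

lemma sine_in_span: "trig (k1 * real m1) (real n) 0 a 0 c \<in> lspan N_theta (theta_basis k1)"
proof (cases "n = 0")
  case True
  then have "trig (k1 * real m1) (real n) 0 a 0 c = (\<lambda>x. 0)" by (auto simp: trig_def)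
  then show ?thesis by (simp add: lspan_zero)
next
  case False
  let ?s = "basis_scale k1 m1 n"
  have s: "?s \<noteq> 0" using k1_pos by (simp add: basis_scale_def eta_def)
  have 1: "(\<lambda>x. (a / ?s) *\<^sub>R theta_basis k1 (m1, n, 1, 1) x) \<in> lspan N_theta (theta_basis k1)"
    using False by (intro lspan_base) (auto simp: N_theta_def)
  show ?thesis
  proof (cases "m1 = 0")
    case True
    have "trig (k1 * real m1) (real n) 0 a 0 c = (\<lambda>x. (a / ?s) *\<^sub>R theta_basis k1 (m1, n, 1, 1) x)"
      using s True by (auto simp: trig_def)
    then show ?thesis using 1 by simp
  next
    case m: False
    have 2: "(\<lambda>x. (c / ?s) *\<^sub>R theta_basis k1 (m1, n, 2, 1) x) \<in> lspan N_theta (theta_basis k1)"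
      using False m by (intro lspan_base) (auto simp: N_theta_def)
    have "trig (k1 * real m1) (real n) 0 a 0 c =
      (\<lambda>x. (a / ?s) *\<^sub>R theta_basis k1 (m1, n, 1, 1) x + (c / ?s) *\<^sub>R theta_basis k1 (m1, n, 2, 1) x)"
      using s by (auto simp: trig_def)
    then show ?thesis using lspan_add[OF 1 2] by simp
  qed
qed

text \<open>Multiplication by sin x3 turns cosines in x3 into differences of sines. The frequency
  zero is separate because \<open>m3 - 1\<close> is a subtraction of natural numbers.\<close>

lemma sin_TP_in_span:
  assumes "g \<in> TP"
  shows "(\<lambda>x. sin (snd x) * g x) \<in> lspan N_theta (theta_basis k1)"
  using assms
proof (induction g)
  case (TP_base m1 m3 a c)
  show ?case
  proof (cases "m3 = 0")
    case True
    have "(\<lambda>x. sin (snd x) * trig (k1 * real m1) (real m3) a 0 c 0 x) = trig (k1 * real m1) (real 1) 0 a 0 c"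
      using True by (auto simp: trig_def algebra_simps)
    then show ?thesis using sine_in_span[of m1 1 a c] by simp
  next
    case False
    have "sin y * cos (real m3 * y) = (sin (real (m3 + 1) * y) - sin (real (m3 - 1) * y)) / 2" for y
      using False by (simp add: of_nat_diff algebra_simps sin_add sin_diff)
    note sc = this
    have "sin (snd x) * trig (k1 * real m1) (real m3) a 0 c 0 x =
       trig (k1 * real m1) (real (m3 + 1)) 0 (a / 2) 0 (c / 2) x + trig (k1 * real m1) (real (m3 - 1)) 0 (- a / 2) 0 (- c / 2) x" for x
    proof -
      have "sin (snd x) * trig (k1 * real m1) (real m3) a 0 c 0 x =
         (cos (k1 * real m1 * fst x) * a + sin (k1 * real m1 * fst x) * c) * (sin (snd x) * cos (real m3 * snd x))"
        by (simp add: trig_def algebra_simps)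
      also have "\<dots> = (cos (k1 * real m1 * fst x) * a + sin (k1 * real m1 * fst x) * c) * ((sin (real (m3 + 1) * snd x) - sin (real (m3 - 1) * snd x)) / 2)"
        by (simp only: sc)
      finally show ?thesis by (simp add: trig_def algebra_simps)
    qed
    then show ?thesis by (simp only:) (intro lspan_add sine_in_span)
  qed
next
  case (TP_add f g)
  then show ?case using lspan_add by (fastforce simp: distrib_left)
qed

text \<open>Dividing f by sin x3 would be singular at the walls. With a parameter d > 0, f is sin x3
  times the continuous function \<open>h\<close> = f sin / (sin^2 + d) plus the remainder
  \<open>r\<close> = f d / (sin^2 + d). Cosine polynomials approximate \<open>h\<close> uniformly.
  The remainder is zero on the walls, where f vanishes, and tends to zero with d elsewhere, hence is
  small in L2 by dominated convergence.\<close>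

lemma theta_dense:
  fixes f :: temperature
  assumes cf: "continuous_on strip f" and per: "periodic_x1 k1 f"
    and bc: "\<And>x1 b. b \<in> {0, pi} \<Longrightarrow> f (x1, b) = 0" and e: "0 < e"
  shows "\<exists>g\<in>lspan N_theta (theta_basis k1). L2_norm k1 (\<lambda>x. f x - g x) < e"
proof -
  define d where "d n = 1 / (real n + 1)" for n
  have dpos: "0 < d n" for n by (simp add: d_def)
  have dlim: "d \<longlonglongrightarrow> 0" unfolding d_def using LIMSEQ_inverse_real_of_nat by (simp add: inverse_eq_divide add.commute)
  define r where "r n x = f x * (d n / ((sin (snd x))\<^sup>2 + d n))" for n x
  have den: "(sin y)\<^sup>2 + d n \<noteq> 0" for n y
    using dpos[of n] by (metis add_nonneg_pos less_irrefl zero_le_power2)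
  have rc: "continuous_on strip (r n)" for n
    unfolding r_def by (intro continuous_intros cf ballI den)
  have "(\<lambda>n. LINT x|mC. r n x * r n x) \<longlonglongrightarrow> (LINT x|mC. 0)"
  proof (rule integral_dominated_convergence)
    show "integrable mC (\<lambda>x. f x * f x)"
      by (intro continuous_integrable_cell continuous_intros cf)
    show "(\<lambda>x. r n x * r n x) \<in> borel_measurable mC" for n
      by (rule borel_measurable_integrable) (intro continuous_integrable_cell continuous_intros rc)
    show "AE x in mC. norm (r n x * r n x) \<le> f x * f x" for n
    proof (rule AE_I2)
      fix x :: point
      have "\<bar>d n / ((sin (snd x))\<^sup>2 + d n)\<bar> \<le> 1"
        using dpos[of n] by (simp add: divide_le_eq_1 add_nonneg_pos abs_of_pos)
      then have "\<bar>r n x\<bar> \<le> \<bar>f x\<bar> * 1" unfolding r_def abs_mult by (rule mult_left_mono) simp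
      then have "\<bar>r n x\<bar> * \<bar>r n x\<bar> \<le> \<bar>f x\<bar> * \<bar>f x\<bar>" by (intro mult_mono) auto
      then show "norm (r n x * r n x) \<le> f x * f x" by (simp add: abs_mult)
    qed
    show "AE x in mC. (\<lambda>n. r n x * r n x) \<longlonglongrightarrow> 0"
    proof (rule AE_I2)
      fix x assume "x \<in> space mC"
      then obtain x1 x3 where x: "x = (x1, x3)" "0 \<le> x3" "x3 \<le> pi" by (cases x) (auto simp: cell_def)
      have "(\<lambda>n. r n x) \<longlonglongrightarrow> 0"
      proof (cases "x3 = 0 \<or> x3 = pi")
        case True
        then have "f x = 0" using bc by (auto simp: x)
        then show ?thesis by (simp add: r_def)
      next
        case False
        then have "sin x3 > 0" using x by (intro sin_gt_zero) auto
        then have "(\<lambda>n. f x * (d n / ((sin (snd x))\<^sup>2 + d n))) \<longlonglongrightarrow> f x * (0 / ((sin (snd x))\<^sup>2 + 0))"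
          by (intro tendsto_intros dlim) (simp add: x)
        then show ?thesis by (simp add: r_def)
      qed
      from tendsto_mult[OF this this] show "(\<lambda>n. r n x * r n x) \<longlonglongrightarrow> 0" by simp
    qed
  qed simp
  then have "(\<lambda>n. L2_inner k1 (r n) (r n)) \<longlonglongrightarrow> 0" by (simp add: L2_inner_def)
  then obtain n where n: "L2_inner k1 (r n) (r n) < (e / 2)\<^sup>2"
    using e by (metis (no_types, lifting) LIMSEQ_iff_nz abs_less_iff diff_zero half_gt_zero_iff lessI less_imp_le real_norm_def zero_less_power order_tendstoD(2) eventually_sequentially order_refl)
  then have rn: "L2_norm k1 (r n) \<le> e / 2" using e by (intro L2_norm_le_of_sq) auto
  define h where "h x = f x * (sin (snd x) / ((sin (snd x))\<^sup>2 + d n))" for x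
  have ch: "continuous_on strip h" unfolding h_def by (intro continuous_intros cf ballI den)
  have ph: "periodic_x1 k1 h" using per by (simp add: h_def periodic_x1_def)
  \<comment> \<open>Chosen so that the uniform error costs e/4 in L2, on top of the e/2 of the
    remainder.\<close>
  define \<eta> where "\<eta> = e / (4 * cell_const)"
  have \<eta>: "0 < \<eta>" using e cell_const_pos by (simp add: \<eta>_def)
  obtain p where p: "p \<in> TP" "\<And>x. x \<in> cell k1 \<Longrightarrow> \<bar>h x - p x\<bar> < \<eta>"
    using TP_dense[OF ch ph \<eta>] by blast
  note cp = continuous_TP[OF p(1)]
  have eq: "f x - sin (snd x) * p x = r n x + sin (snd x) * (h x - p x)" for x
  proof -
    have "f x = r n x + sin (snd x) * h x"
    proof -
      define D where "D = (sin (snd x))\<^sup>2 + d n"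
      have D: "D \<noteq> 0" "d n = D - sin (snd x) * sin (snd x)"
        using den[of "snd x" n] by (simp_all add: D_def power2_eq_square)
      have A: "D * r n x = f x * d n" "D * h x = f x * sin (snd x)"
        using D(1) by (simp_all add: r_def h_def flip: D_def)
      have "D * (r n x + sin (snd x) * h x) = D * r n x + sin (snd x) * (D * h x)"
        by (simp only: distrib_left mult.left_commute)
      also have "\<dots> = D * f x" unfolding A D(2) by (simp add: algebra_simps)
      finally show ?thesis using D(1) by simp
    qed
    then show ?thesis by (simp add: algebra_simps)
  qed
  have cs: "continuous_on strip (\<lambda>x. sin (snd x) * (h x - p x))" by (intro continuous_intros ch cp)
  have "L2_norm k1 (\<lambda>x. f x - sin (snd x) * p x) \<le> L2_norm k1 (r n) + L2_norm k1 (\<lambda>x. sin (snd x) * (h x - p x))"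
    unfolding eq by (intro L2_triangle continuous_L2 rc cs)
  also have "L2_norm k1 (\<lambda>x. sin (snd x) * (h x - p x)) \<le> \<eta> * cell_const"
  proof (rule L2_norm_uniform_le[OF cs])
    fix x assume x: "x \<in> cell k1"
    have "\<bar>sin (snd x)\<bar> * \<bar>h x - p x\<bar> \<le> 1 * \<eta>"
      using p(2)[OF x] by (intro mult_mono) (auto intro: less_imp_le)
    then show "\<bar>sin (snd x) * (h x - p x)\<bar> \<le> \<eta>" by (simp add: abs_mult)
  qed (use \<eta> in simp)
  also have "\<eta> * cell_const = e / 4" using cell_const_pos by (simp add: \<eta>_def)
  finally have "L2_norm k1 (\<lambda>x. f x - sin (snd x) * p x) < e" using rn e by simp
  then show ?thesis
    by (rule bexI[where x = "\<lambda>x. sin (snd x) * p x"]) (rule sin_TP_in_span[OF p(1)])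
qed


subsection \<open>Smooth functions\<close>

lemma Ck_on_continuous:
  assumes "Ck_on m D g"
  shows "continuous_on D g"
proof (cases m)
  case (Suc n)
  then obtain f' where "\<And>x. x \<in> D \<Longrightarrow> (g has_derivative f' x) (at x within D)"
    using assms by auto
  then show ?thesis
    unfolding continuous_on_eq_continuous_within using has_derivative_continuous by blast
qed (use assms in simp)

text \<open>The partial derivatives are the total derivative applied to the unit vectors, hence
  inherit its smoothness; they are periodic because a derivative is unique.\<close>

lemma hasd_exists:
  fixes f :: "point \<Rightarrow> 'b::euclidean_space"
  assumes "Ck_on (Suc n) strip f" and per: "periodic_x1 k1 f"
  shows "\<exists>f1 f3. hasd f f1 f3 \<and> Ck_on n strip f1 \<and> Ck_on n strip f3 \<and> periodic_x1 k1 f1 \<and> periodic_x1 k1 f3"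
proof -
  obtain f' where f': "\<And>x. x \<in> strip \<Longrightarrow> (f has_derivative f' x) (at x within strip)"
    and ck: "\<And>h. Ck_on n strip (\<lambda>x. f' x h)"
    using assms(1) by auto
  define f1 f3 where "f1 x = f' x (1, 0)" and "f3 x = f' x (0, 1)" for x
  have c: "continuous_on strip f" using Ck_on_continuous[OF assms(1)] .
  have cs: "continuous_on strip f1" "continuous_on strip f3"
    unfolding f1_def f3_def using Ck_on_continuous[OF ck] by auto
  have p1: "((\<lambda>s. f (s, x3)) has_vector_derivative f1 (x1, x3)) (at x1)" if x3: "x3 \<in> {0..pi}" for x1 x3
  proof -
    have "(f \<circ> (\<lambda>s. (s, x3)) has_derivative f' (x1, x3) \<circ> (\<lambda>h. (h, 0))) (at x1 within UNIV)"
      using x3 by (intro diff_chain_within has_derivative_subset[OF f'])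
        (auto intro!: derivative_eq_intros simp: strip_def)
    moreover have "linear (f' (x1, x3))"
      using f'[of "(x1, x3)"] x3 by (auto simp: strip_def has_derivative_def bounded_linear.linear)
    then have "f' (x1, x3) (h, 0) = h *\<^sub>R f1 (x1, x3)" for h
      using linear_scale[of "f' (x1, x3)" h "(1, 0)"] by (simp add: f1_def)
    ultimately show ?thesis by (simp add: has_vector_derivative_def o_def)
  qed
  have p3: "((\<lambda>s. f (x1, s)) has_vector_derivative f3 (x1, x3)) (at x3 within {0..pi})" if x3: "x3 \<in> {0..pi}" for x1 x3
  proof -
    have "(f \<circ> (\<lambda>s. (x1, s)) has_derivative f' (x1, x3) \<circ> (\<lambda>h. (0, h))) (at x3 within {0..pi})"
      using x3 by (intro diff_chain_within has_derivative_subset[OF f'])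
        (auto intro!: derivative_eq_intros simp: strip_def)
    moreover have "linear (f' (x1, x3))"
      using f'[of "(x1, x3)"] x3 by (auto simp: strip_def has_derivative_def bounded_linear.linear)
    then have "f' (x1, x3) (0, h) = h *\<^sub>R f3 (x1, x3)" for h
      using linear_scale[of "f' (x1, x3)" h "(0, 1)"] by (simp add: f3_def)
    ultimately show ?thesis by (simp add: has_vector_derivative_def o_def)
  qed
  have h: "hasd f f1 f3" unfolding hasd_def using per c cs p1 p3 by blast
  have "periodic_x1 k1 f1" unfolding periodic_x1_def
  proof (intro allI ballI)
    fix x1 x3 assume x3: "x3 \<in> {0..pi}"
    have "((\<lambda>s. f (s, x3)) \<circ> (\<lambda>s. s + 2 * pi / k1) has_vector_derivative 1 *\<^sub>R f1 (x1 + 2 * pi / k1, x3)) (at x1)"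
      by (intro vector_diff_chain_at p1[OF x3]) (auto intro!: derivative_eq_intros)
    then have "((\<lambda>s. f (s + 2 * pi / k1, x3)) has_vector_derivative f1 (x1 + 2 * pi / k1, x3)) (at x1)"
      by (simp add: o_def)
    moreover have "(\<lambda>s. f (s + 2 * pi / k1, x3)) = (\<lambda>s. f (s, x3))"
      using per x3 by (auto simp: periodic_x1_def)
    ultimately show "f1 (x1 + 2 * pi / k1, x3) = f1 (x1, x3)"
      using p1[OF x3, of x1] vector_derivative_unique_at by metis
  qed
  moreover have "periodic_x1 k1 f3" unfolding periodic_x1_def
  proof (intro allI ballI)
    fix x1 x3 assume x3: "x3 \<in> {0..pi}"
    have "((\<lambda>s. f (x1, s)) has_vector_derivative f3 (x1 + 2 * pi / k1, x3)) (at x3 within {0..pi})"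
      by (rule has_vector_derivative_transform[OF x3 _ p3[OF x3, of "x1 + 2 * pi / k1"]])
        (use per in \<open>auto simp: periodic_x1_def\<close>)
    then show "f3 (x1 + 2 * pi / k1, x3) = f3 (x1, x3)"
      using p3[OF x3, of x1] x3 vector_derivative_unique_within_closed_interval[of 0 pi x3] by auto
  qed
  ultimately show ?thesis
    using h ck unfolding f1_def f3_def by blast
qed

lemma smooth_periodic_hasd:
  fixes f :: "point \<Rightarrow> 'b::euclidean_space"
  assumes "f \<in> smooth_periodic k1"
  shows "\<exists>f1 f3. hasd f f1 f3"
  using hasd_exists[of 0 f] assms by (auto simp: smooth_periodic_def smooth_on_def simp del: Ck_on.simps)

subsection \<open>Completeness of the velocity basis\<close>

text \<open>Integrate p in x3 from the lower wall. By the divergence condition the x1-derivative is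
  minus the integral of r3, which is -r since r vanishes on the lower wall.\<close>

lemma stream_function:
  assumes p: "hasd p p1 p3" and r: "hasd r r1 r3"
    and dv: "\<And>x. x \<in> strip \<Longrightarrow> p1 x + r3 x = 0"
    and bc: "\<And>x1 b. b \<in> {0, pi} \<Longrightarrow> r (x1, b) = (0::real)"
    and mean: "(LINT x|mC. p x) = 0"
  shows "\<exists>\<psi>. hasd \<psi> (\<lambda>x. - r x) p \<and> (\<forall>x1. \<forall>b\<in>{0, pi}. \<psi> (x1, b) = 0)"
proof -
  note pc = hasd_continuous[OF p] and rc = hasd_continuous[OF r]
  \<comment> \<open>The integral of p from 0 to x3, rescaled to the fixed interval [0,1], where
    joint continuity follows from continuity under the integral sign.\<close>
  define \<psi> where "\<psi> x = snd x * integral (cbox 0 1) (\<lambda>\<sigma>. p (fst x, snd x * \<sigma>))" for x :: point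
  have pline: "continuous_on {0..pi} (\<lambda>s. g (x1, s))" if "continuous_on strip g" for x1 and g :: "point \<Rightarrow> real"
    by (rule continuous_on_compose2[OF that]) (auto intro!: continuous_intros simp: strip_def)
  have \<psi>_eq: "\<psi> (x1, x3) = integral {0..x3} (\<lambda>s. p (x1, s))" if x3: "x3 \<in> {0..pi}" for x1 x3
  proof (cases "x3 = 0")
    case False
    then have "x3 > 0" using x3 by auto
    have i: "(\<lambda>s. p (x1, s)) integrable_on {0..x3}"
      using x3 by (intro integrable_continuous_real continuous_on_subset[OF pline[OF pc(1)]]) auto
    then have "((\<lambda>s. p (x1, s)) has_integral integral {0..x3} (\<lambda>s. p (x1, s))) (cbox 0 x3)"
      by (simp add: has_integral_iff)
    from has_integral_affinity[OF this, of x3 0]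
    have "((\<lambda>\<sigma>. p (x1, x3 * \<sigma>)) has_integral (1 / x3) * integral {0..x3} (\<lambda>s. p (x1, s))) ((\<lambda>x. x / x3) ` {0..x3})"
      using \<open>x3 > 0\<close> by (simp add: image_affinity_atLeastAtMost_div_diff divide_inverse_commute)
    moreover have "(\<lambda>x. x / x3) ` {0..x3} = {0..1}"
      using \<open>x3 > 0\<close> image_affinity_atLeastAtMost_div[of x3 0 0 x3] by simp
    ultimately show ?thesis using \<open>x3 > 0\<close> by (simp add: \<psi>_def integral_unique)
  qed (simp add: \<psi>_def)
  have "continuous_on strip (\<lambda>x. integral (cbox 0 1) (\<lambda>\<sigma>. p (fst x, snd x * \<sigma>)))"
  proof (rule integral_continuous_on_param)
    show "continuous_on (strip \<times> cbox 0 1) (\<lambda>(x, \<sigma>). p (fst x, snd x * \<sigma>))"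
      unfolding split_beta
    proof (rule continuous_on_compose2[OF pc(1)])
      show "continuous_on (strip \<times> cbox 0 1) (\<lambda>z. (fst (fst z), snd (fst z) * snd z))"
        by (intro continuous_intros)
      show "(\<lambda>z. (fst (fst z), snd (fst z) * snd z)) ` (strip \<times> cbox 0 1) \<subseteq> strip"
      proof clarsimp
        fix a b s :: real assume "(a, b) \<in> strip" "0 \<le> s" "s \<le> 1"
        then show "(a, b * s) \<in> strip"
          using mult_left_le[of s b] by (auto simp: strip_def)
      qed
    qed
  qed
  then have c\<psi>: "continuous_on strip \<psi>" unfolding \<psi>_def by (intro continuous_intros)
  have per: "periodic_x1 k1 \<psi>" unfolding periodic_x1_def
  proof (intro allI ballI)
    fix x1 x3 assume x3: "x3 \<in> {0..pi}"
    have "integral {0..x3} (\<lambda>s. p (x1 + 2 * pi / k1, s)) = integral {0..x3} (\<lambda>s. p (x1, s))"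
      using p x3 by (intro Henstock_Kurzweil_Integration.integral_cong) (auto simp: hasd_def periodic_x1_def)
    then show "\<psi> (x1 + 2 * pi / k1, x3) = \<psi> (x1, x3)" by (simp add: \<psi>_eq[OF x3])
  qed
  have D3: "((\<lambda>s. \<psi> (x1, s)) has_vector_derivative p (x1, x3)) (at x3 within {0..pi})" if x3: "x3 \<in> {0..pi}" for x1 x3
    by (rule has_vector_derivative_transform[OF x3 _ integral_has_vector_derivative[OF pline[OF pc(1)] x3]])
      (simp add: \<psi>_eq)
  have D1: "((\<lambda>s. \<psi> (s, x3)) has_vector_derivative - r (x1, x3)) (at x1)" if x3: "x3 \<in> {0..pi}" for x1 x3
  proof -
    have sub: "{0..x3} \<subseteq> {0..pi}" using x3 by auto
    have "((\<lambda>x1. integral (cbox 0 x3) (\<lambda>s. p (x1, s))) has_vector_derivative integral (cbox 0 x3) (\<lambda>s. p1 (x1, s))) (at x1 within UNIV)"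
    proof (rule leibniz_rule_vector_derivative)
      show "((\<lambda>x. p (x, s)) has_vector_derivative p1 (x, s)) (at x within UNIV)" if "s \<in> cbox 0 x3" for x s
        using hasd_derivs(1)[OF p, of s x] that x3 by auto
      show "(\<lambda>s. p (x, s)) integrable_on cbox 0 x3" for x
        using continuous_on_subset[OF pline[OF pc(1)] sub] by (simp add: integrable_continuous_real)
      show "continuous_on (UNIV \<times> cbox 0 x3) (\<lambda>(x, s). p1 (x, s))"
        using sub by (simp add: split_beta) (rule continuous_on_subset[OF pc(2)], auto simp: strip_def)
    qed auto
    moreover have "integral {0..x3} (\<lambda>s. p1 (x1, s)) = - r (x1, x3)"
    proof -
      have "((\<lambda>s. r3 (x1, s)) has_integral (r (x1, x3) - r (x1, 0))) {0..x3}"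
        using x3 sub by (intro fundamental_theorem_of_calculus)
          (auto intro!: has_vector_derivative_within_subset[OF hasd_derivs(2)[OF r] sub])
      then have "integral {0..x3} (\<lambda>s. r3 (x1, s)) = r (x1, x3)" by (simp add: integral_unique bc)
      moreover have "integral {0..x3} (\<lambda>s. p1 (x1, s)) = integral {0..x3} (\<lambda>s. - r3 (x1, s))"
        using dv sub by (intro Henstock_Kurzweil_Integration.integral_cong) (force simp: strip_def eq_neg_iff_add_eq_0)
      ultimately show ?thesis by simp
    qed
    ultimately show ?thesis by (simp add: \<psi>_eq[OF x3])
  qed
  have h: "hasd \<psi> (\<lambda>x. - r x) p"
    unfolding hasd_def using per c\<psi> pc(1) rc(1) D1 D3 by (auto intro: continuous_on_minus)
  have z0: "\<psi> (x1, 0) = 0" for x1 by (simp add: \<psi>_def)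
  \<comment> \<open>r vanishes on the upper wall, so there \<psi> does not depend on x1. Its
    constant value is the flux of p through a vertical section, which the zero mean of p makes
    zero.\<close>
  have zpi: "\<psi> (x1, pi) = 0" for x1
  proof -
    have "((\<lambda>s. \<psi> (s, pi)) has_vector_derivative 0) (at x within UNIV)" for x
      using D1[of pi x] bc[of pi x] by simp
    then obtain c where c: "\<And>s. \<psi> (s, pi) = c"
      using has_vector_derivative_zero_constant[of UNIV "\<lambda>s. \<psi> (s, pi)"] by auto
    have "0 = (LINT x|mC. p x)" by (simp add: mean)
    also have "\<dots> = integral {0..2 * pi / k1} (\<lambda>x1. integral {0..pi} (\<lambda>x3. p (x1, x3)))"
      by (rule LINT_iterated(1)[OF pc(1)])
    also have "\<dots> = integral {0..2 * pi / k1} (\<lambda>x1. c)"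
      using \<psi>_eq[of pi] c by simp
    also have "\<dots> = (2 * pi / k1) * c" using k1_pos by simp
    finally have "c = 0" using k1_pos by simp
    then show ?thesis by (simp add: c)
  qed
  show ?thesis using h z0 zpi by blast
qed

lemma theta_basis_hasd:
  shows "hasd (theta_basis k1 n) (\<lambda>x. snd (ebas1 (False, n) x)) (\<lambda>x. snd (ebas3 (False, n) x))"
    and "\<exists>w11 w13 w31 w33. hasd (\<lambda>x. snd (ebas1 (False, n) x)) w11 w13 \<and> hasd (\<lambda>x. snd (ebas3 (False, n) x)) w31 w33 \<and>
    (\<forall>x. w11 x + w33 x = (- (wave_norm k1 (kx (False, n)) (kz (False, n)))\<^sup>2) * theta_basis k1 n x)"
    and "b \<in> {0, pi} \<Longrightarrow> theta_basis k1 n (x1, b) = 0"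
proof -
  have e: "theta_basis k1 n = (\<lambda>x. snd (ebas (False, n) x))" by (simp add: ebas_theta fun_eq_iff)
  show "hasd (theta_basis k1 n) (\<lambda>x. snd (ebas1 (False, n) x)) (\<lambda>x. snd (ebas3 (False, n) x))"
    unfolding e by (rule hasd_snd[OF hasd_ebas])
  show "theta_basis k1 n (x1, b) = 0" if "b \<in> {0, pi}"
    using admfield_ebas[of "(False, n)"] that by (auto simp: admfield_def e)
  obtain w11 w13 w31 w33 where w: "hasd (ebas1 (False, n)) w11 w13" "hasd (ebas3 (False, n)) w31 w33"
    "\<forall>x. w11 x + w33 x = (- (wave_norm k1 (kx (False, n)) (kz (False, n)))\<^sup>2) *\<^sub>R ebas (False, n) x"
    using ebas_second by blast
  have "snd (w11 x) + snd (w33 x) = (- (wave_norm k1 (kx (False, n)) (kz (False, n)))\<^sup>2) * theta_basis k1 n x" for x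
    using arg_cong[OF w(3)[rule_format, of x], of snd] by (simp add: e)
  then show "\<exists>w11 w13 w31 w33. hasd (\<lambda>x. snd (ebas1 (False, n) x)) w11 w13 \<and> hasd (\<lambda>x. snd (ebas3 (False, n) x)) w31 w33 \<and>
    (\<forall>x. w11 x + w33 x = (- (wave_norm k1 (kx (False, n)) (kz (False, n)))\<^sup>2) * theta_basis k1 n x)"
    using hasd_snd[OF w(1)] hasd_snd[OF w(2)] by blast
qed

text \<open>Differentiation exchanges sine and cosine, so the phase becomes 3 - p, and the
  normalisation leaves the wave norm as factor. This turns the sine basis of the stream functions
  into the planar part of the velocity basis.\<close>

lemma curl_theta_basis:
  assumes "n \<in> N_theta"
  shows "\<exists>m\<in>N_u. \<exists>r. \<forall>x. vector [snd (ebas3 (False, n) x), 0, - snd (ebas1 (False, n) x)] = r *\<^sub>R u_basis k1 m x"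
proof -
  obtain m1 m3 p c where n: "n = (m1, m3, p, c)" by (cases n) auto
  have m: "m3 \<ge> 1" "c = 1" "p = 1 \<or> p = 2" "m1 = 0 \<Longrightarrow> p = 1"
    using assms by (auto simp: n N_theta_def split: if_splits)
  have wn: "wave_norm k1 m1 m3 > 0" using m(1) by (intro wave_norm_pos) auto
  define q where "q = (m1, m3, 3 - p, 1::nat)"
  have q: "q \<in> N_u" using m by (auto simp: q_def N_u_def)
  have "\<forall>x. vector [snd (ebas3 (False, n) x), 0, - snd (ebas1 (False, n) x)] = wave_norm k1 m1 m3 *\<^sub>R u_basis k1 q x"
  proof
    fix x :: point
    obtain x1 x3 where x: "x = (x1, x3)" by (cases x)
    show "vector [snd (ebas3 (False, n) x), 0, - snd (ebas1 (False, n) x)] = wave_norm k1 m1 m3 *\<^sub>R u_basis k1 q x"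
      unfolding ebas3_def ebas1_def trig_snd using m(3) wn
      by (auto simp: vec_eq_iff forall_3 n q_def x trig_def cA_def cB_def cC_def cD_def vector_3)
  qed
  with q show ?thesis by blast
qed

text \<open>The sine series approximates the stream function \<psi> in L2, whereas its gradient is
  what has to converge. Let \<open>q\<close> be the projection of \<psi> and \<phi> the error. By
  Green's formula ||grad \<phi>||^2 is minus the pairing of \<phi> with its Laplacian. The Laplacian
  of \<open>q\<close> stays in the span, to which \<phi> is orthogonal, so only the vorticity
  \<omega>, the Laplacian of \<psi>, remains: ||grad \<phi>||^2 \<le> ||\<omega>||
  ||\<phi>||.\<close>

lemma planar_dense:
  assumes p: "hasd p p1 p3" and r: "hasd r r1 r3"
    and dv: "\<And>x. x \<in> strip \<Longrightarrow> p1 x + r3 x = 0"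
    and bc: "\<And>x1 b. b \<in> {0, pi} \<Longrightarrow> r (x1, b) = (0::real)"
    and mean: "(LINT x|mC. p x) = 0" and e: "0 < e"
  shows "\<exists>g\<in>lspan N_u (u_basis k1). continuous_on strip g \<and> (\<forall>x. g x $ 2 = 0) \<and>
    L2_inner k1 (\<lambda>x. p x - g x $ 1) (\<lambda>x. p x - g x $ 1) + L2_inner k1 (\<lambda>x. r x - g x $ 3) (\<lambda>x. r x - g x $ 3) \<le> e"
proof -
  obtain \<psi> where \<psi>: "hasd \<psi> (\<lambda>x. - r x) p" and b\<psi>: "\<And>x1 b. b \<in> {0, pi} \<Longrightarrow> \<psi> (x1, b) = 0"
    using stream_function[OF p r dv bc mean] by blast
  note c = hasd_continuous[OF p] hasd_continuous[OF r]
  define \<omega> where "\<omega> x = p3 x - r1 x" for x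
  have c\<omega>: "continuous_on strip \<omega>" unfolding \<omega>_def by (intro continuous_intros c)
  \<comment> \<open>The closeness in L2 that the bound by the norm of \<omega> times the norm of
    \<phi> turns into e; the added 1 covers \<omega> = 0.\<close>
  define \<eta> where "\<eta> = e / (L2_norm k1 \<omega> + 1)"
  have \<omega>0: "0 < L2_norm k1 \<omega> + 1" using L2_norm_nonneg[of \<omega>] by linarith
  have \<eta>: "0 < \<eta>" using e \<omega>0 by (simp add: \<eta>_def)
  obtain g where "g \<in> lspan N_theta (theta_basis k1)" and g: "L2_norm k1 (\<lambda>x. \<psi> x - g x) < \<eta>"
    using theta_dense[OF hasd_continuous(1)[OF \<psi>] _ b\<psi> \<eta>] \<psi> by (auto simp: hasd_def)
  then obtain A a where A: "finite A" "A \<subseteq> N_theta" "g = (\<lambda>x. \<Sum>n\<in>A. a n *\<^sub>R theta_basis k1 n x)"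
    by (auto simp: lspan_def)
  note o = orthonormal_subset[OF orthonormal_theta_basis A(2)]
  have L\<psi>: "\<psi> \<in> L2_space k1" by (rule hasd_L2(1)[OF \<psi>])
  define k where "k n = L2_inner k1 \<psi> (theta_basis k1 n)" for n
  define q where "q x = (\<Sum>n\<in>A. k n *\<^sub>R theta_basis k1 n x)" for x
  define q1 where "q1 x = (\<Sum>n\<in>A. k n *\<^sub>R snd (ebas1 (False, n) x))" for x
  define q3 where "q3 x = (\<Sum>n\<in>A. k n *\<^sub>R snd (ebas3 (False, n) x))" for x
  have qps: "q = partial_sum (theta_basis k1) A \<psi>" by (simp add: q_def[abs_def] partial_sum_def k_def)
  have best: "L2_norm k1 (\<lambda>x. \<psi> x - q x) \<le> \<eta>"
    using partial_sum_best[OF o A(1) L\<psi>, of a] g by (simp add: qps A(3))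
  have q: "hasd q q1 q3"
    unfolding q_def q1_def q3_def by (intro hasd_sum hasd_scaleR theta_basis_hasd)
  obtain w11 w13 w31 w33 where w: "\<And>n. hasd (\<lambda>x. snd (ebas1 (False, n) x)) (w11 n) (w13 n)"
      "\<And>n. hasd (\<lambda>x. snd (ebas3 (False, n) x)) (w31 n) (w33 n)"
      "\<And>n x. w11 n x + w33 n x = (- (wave_norm k1 (kx (False, n)) (kz (False, n)))\<^sup>2) * theta_basis k1 n x"
    using theta_basis_hasd(2) by metis
  have q1: "hasd q1 (\<lambda>x. \<Sum>n\<in>A. k n *\<^sub>R w11 n x) (\<lambda>x. \<Sum>n\<in>A. k n *\<^sub>R w13 n x)"
    unfolding q1_def by (intro hasd_sum hasd_scaleR w)
  have q3: "hasd q3 (\<lambda>x. \<Sum>n\<in>A. k n *\<^sub>R w31 n x) (\<lambda>x. \<Sum>n\<in>A. k n *\<^sub>R w33 n x)"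
    unfolding q3_def by (intro hasd_sum hasd_scaleR w)
  have lap: "(\<Sum>n\<in>A. k n *\<^sub>R w11 n x) + (\<Sum>n\<in>A. k n *\<^sub>R w33 n x)
      = (\<Sum>n\<in>A. (k n * - (wave_norm k1 (kx (False, n)) (kz (False, n)))\<^sup>2) *\<^sub>R theta_basis k1 n x)" for x
    unfolding sum.distrib[symmetric] by (intro sum.cong refl) (simp add: w(3) flip: distrib_left)
  define \<phi> where "\<phi> x = \<psi> x - q x" for x
  define \<phi>1 where "\<phi>1 x = - r x - q1 x" for x
  define \<phi>3 where "\<phi>3 x = p x - q3 x" for x
  have h: "hasd \<phi> \<phi>1 \<phi>3" unfolding \<phi>_def \<phi>1_def \<phi>3_def by (rule hasd_diff[OF \<psi> q])
  have r': "hasd (\<lambda>x. - r x) (\<lambda>x. - r1 x) (\<lambda>x. - r3 x)"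
    using hasd_linear[OF bounded_linear_minus[OF bounded_linear_ident] r] by simp
  note h1 = hasd_diff[OF r' q1, folded \<phi>1_def] and h3 = hasd_diff[OF p q3, folded \<phi>3_def]
  have b\<phi>: "\<phi> (x1, b) = 0" if "b \<in> {0, pi}" for x1 b
    unfolding \<phi>_def q_def using b\<psi>[OF that] theta_basis_hasd(3)[OF that] by simp
  have "L2_inner k1 (\<lambda>x. (- r1 x - (\<Sum>n\<in>A. k n *\<^sub>R w11 n x)) + (p3 x - (\<Sum>n\<in>A. k n *\<^sub>R w33 n x))) \<phi>
      = - (L2_inner k1 \<phi>1 \<phi>1 + L2_inner k1 \<phi>3 \<phi>3)"
    by (rule green[OF h1 h3 h]) (simp add: b\<phi>)
  moreover have "(\<lambda>x. (- r1 x - (\<Sum>n\<in>A. k n *\<^sub>R w11 n x)) + (p3 x - (\<Sum>n\<in>A. k n *\<^sub>R w33 n x)))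
     = (\<lambda>x. \<omega> x - (\<Sum>n\<in>A. (k n * - (wave_norm k1 (kx (False, n)) (kz (False, n)))\<^sup>2) *\<^sub>R theta_basis k1 n x))"
    unfolding lap[symmetric] by (auto simp: \<omega>_def)
  ultimately have "L2_inner k1 \<phi>1 \<phi>1 + L2_inner k1 \<phi>3 \<phi>3 =
     - L2_inner k1 (\<lambda>x. \<omega> x - (\<Sum>n\<in>A. (k n * - (wave_norm k1 (kx (False, n)) (kz (False, n)))\<^sup>2) *\<^sub>R theta_basis k1 n x)) \<phi>"
    by simp
  \<comment> \<open>The eigenfunction property is used here: the subtracted sum is again a
    combination of the same basis functions.\<close>
  also have "\<dots> = - L2_inner k1 \<omega> \<phi>"
  proof -
    have "L2_inner k1 (\<lambda>x. \<Sum>n\<in>A. (k n * - (wave_norm k1 (kx (False, n)) (kz (False, n)))\<^sup>2) *\<^sub>R theta_basis k1 n x) \<phi> = 0"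
      using partial_sum_orth[OF o A(1) L\<psi>, of "\<lambda>n. k n * - (wave_norm k1 (kx (False, n)) (kz (False, n)))\<^sup>2"]
      by (subst L2_inner_commute) (simp only: \<phi>_def[abs_def] qps)
    then show ?thesis
      using L2_inner_diff_left[OF continuous_L2[OF c\<omega>] L2_combination[OF o A(1)] hasd_L2(1)[OF h],
          of "\<lambda>n. k n * - (wave_norm k1 (kx (False, n)) (kz (False, n)))\<^sup>2"]
      by (simp only: diff_zero)
  qed
  also have "\<dots> \<le> L2_norm k1 \<omega> * L2_norm k1 \<phi>"
    using L2_Cauchy_Schwarz[OF continuous_L2[OF c\<omega>] hasd_L2(1)[OF h]] by linarith
  also have "\<dots> \<le> (L2_norm k1 \<omega> + 1) * \<eta>"
    using best \<eta> L2_norm_nonneg[of \<omega>] L2_norm_nonneg[of \<phi>] by (intro mult_mono) (auto simp: \<phi>_def[abs_def])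
  also have "\<dots> = e" using \<omega>0 by (simp add: \<eta>_def)
  finally have main: "L2_inner k1 \<phi>1 \<phi>1 + L2_inner k1 \<phi>3 \<phi>3 \<le> e" .
  obtain m s where ms: "\<And>n. n \<in> N_theta \<Longrightarrow> m n \<in> N_u"
      "\<And>n x. n \<in> N_theta \<Longrightarrow> vector [snd (ebas3 (False, n) x), 0, - snd (ebas1 (False, n) x)] = s n *\<^sub>R u_basis k1 (m n) x"
    using curl_theta_basis by metis
  define G where "G x = (\<Sum>n\<in>A. (k n * s n) *\<^sub>R u_basis k1 (m n) x)" for x
  have "G \<in> lspan N_u (u_basis k1)"
    unfolding G_def using A(2) ms(1) by (intro lspan_sum lspan_base) auto
  moreover have "continuous_on strip G"
    unfolding G_def u_basis_eq by (intro continuous_intros continuous_trig)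
  moreover have G: "G x = vector [q3 x, 0, - q1 x]" for x
  proof -
    have "G x = (\<Sum>n\<in>A. k n *\<^sub>R vector [snd (ebas3 (False, n) x), 0, - snd (ebas1 (False, n) x)])"
      unfolding G_def using A(2) by (intro sum.cong refl) (auto simp: ms(2))
    then show ?thesis
      by (simp add: vec_eq_iff forall_3 vector_3 q1_def q3_def sum_negf)
  qed
  moreover have "L2_inner k1 (\<lambda>x. r x - G x $ 3) (\<lambda>x. r x - G x $ 3) = L2_inner k1 \<phi>1 \<phi>1"
    by (rule L2_inner_cong) (simp add: G vector_3 \<phi>1_def algebra_simps)
  moreover have "L2_inner k1 (\<lambda>x. p x - G x $ 1) (\<lambda>x. p x - G x $ 1) = L2_inner k1 \<phi>3 \<phi>3"
    by (rule L2_inner_cong) (simp add: G vector_3 \<phi>3_def algebra_simps)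
  ultimately show ?thesis using main by (intro bexI[of _ G]) (auto simp: vector_3)
qed

text \<open>The horizontal velocities have zero mean, so wave vector zero is missing from
  \<open>N_u\<close>; the constant c collects that part.\<close>

lemma TP_e2_in_span:
  assumes "g \<in> TP"
  shows "\<exists>h\<in>lspan N_u (u_basis k1). \<exists>c. \<forall>x. g x *\<^sub>R e2 = h x + c *\<^sub>R e2"
  using assms
proof (induction g)
  case (TP_base m1 m3 a c)
  show ?case
  proof (cases "(m1, m3) = (0, 0)")
    case True
    then have "trig (k1 * real m1) (real m3) a 0 c 0 x *\<^sub>R e2 = 0 + a *\<^sub>R e2" for x
      by (simp add: trig_def)
    then show ?thesis by (intro bexI[of _ "\<lambda>x. 0"] exI[of _ a] lspan_zero) simp
  next
    case False
    let ?s = "basis_scale k1 m1 m3"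
    have s: "?s \<noteq> 0" using k1_pos by (simp add: basis_scale_def eta_def)
    define h where "h x = (a / ?s) *\<^sub>R u_basis k1 (m1, m3, 2, 2) x
      + (if m1 = 0 then 0 else (c / ?s) *\<^sub>R u_basis k1 (m1, m3, 1, 2) x)" for x
    have "(\<lambda>x. (a / ?s) *\<^sub>R u_basis k1 (m1, m3, 2, 2) x) \<in> lspan N_u (u_basis k1)"
      using False by (intro lspan_base) (auto simp: N_u_def)
    moreover have "(\<lambda>x. (if m1 = 0 then 0 else (c / ?s) *\<^sub>R u_basis k1 (m1, m3, 1, 2) x)) \<in> lspan N_u (u_basis k1)"
      using False by (cases "m1 = 0") (auto intro!: lspan_base lspan_zero simp: N_u_def)
    ultimately have "h \<in> lspan N_u (u_basis k1)" unfolding h_def by (rule lspan_add)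
    moreover have "trig (k1 * real m1) (real m3) a 0 c 0 x *\<^sub>R e2 = h x + 0 *\<^sub>R e2" for x
      using s by (cases x) (simp add: h_def trig_def algebra_simps)
    ultimately show ?thesis by blast
  qed
next
  case (TP_add f g)
  then obtain hf cf hg cg where "hf \<in> lspan N_u (u_basis k1)" "\<And>x. f x *\<^sub>R e2 = hf x + cf *\<^sub>R e2"
    "hg \<in> lspan N_u (u_basis k1)" "\<And>x. g x *\<^sub>R e2 = hg x + cg *\<^sub>R e2"
    by blast
  then show ?case
    by (intro bexI[of _ "\<lambda>x. hf x + hg x"] exI[of _ "cf + cg"]) (auto simp: lspan_add scaleR_add_left)
qed

lemma lspan_u_solenoidal:
  assumes "g \<in> lspan N_u (u_basis k1)"
  shows "g \<in> L2_space k1" "continuous_on strip g" "\<And>j. j \<in> {1, 2} \<Longrightarrow> (LINT x|mC. g x $ j) = 0"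
proof -
  obtain A c where A: "finite A" "A \<subseteq> N_u" "g = (\<lambda>x. \<Sum>n\<in>A. c n *\<^sub>R u_basis k1 n x)"
    using assms by (auto simp: lspan_def)
  show c: "continuous_on strip g"
    unfolding A(3) u_basis_eq by (intro continuous_intros continuous_trig)
  then show "g \<in> L2_space k1" by (rule continuous_L2)
  fix j :: 3 assume j: "j \<in> {1, 2}"
  have i: "integrable mC (\<lambda>x. u_basis k1 n x $ j)" for n
    unfolding u_basis_eq trig_nth by (intro continuous_integrable_cell continuous_trig)
  have "(LINT x|mC. u_basis k1 n x $ j) = 0" if "n \<in> A" for n
    using u_basis_solenoidal[of n] A(2) that j by (auto simp: smooth_solenoidal_def)
  then show "(LINT x|mC. g x $ j) = 0"
    using i by (simp add: A(3))
qed

lemma L2_inner_vec3: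
  fixes f :: velocity
  assumes "continuous_on strip f"
  shows "L2_inner k1 f f = L2_inner k1 (\<lambda>x. f x $ 1) (\<lambda>x. f x $ 1) + L2_inner k1 (\<lambda>x. f x $ 2) (\<lambda>x. f x $ 2)
    + L2_inner k1 (\<lambda>x. f x $ 3) (\<lambda>x. f x $ 3)"
proof -
  have "integrable mC (\<lambda>x. f x $ j * f x $ j)" for j
    by (intro continuous_integrable_cell continuous_intros assms)
  then show ?thesis
    by (simp add: L2_inner_def inner_vec_def sum_3)
qed

text \<open>With no dependence on x2 the divergence condition involves the first and third
  components only. These are approximated through the stream function, the second one separately by
  trigonometric polynomials.\<close>

lemma smooth_solenoidal_dense:
  assumes u: "u \<in> smooth_solenoidal k1" and e: "0 < e"
  shows "\<exists>g\<in>lspan N_u (u_basis k1). L2_norm k1 (\<lambda>x. u x - g x) < e"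
proof -
  obtain u1 u3 where h: "hasd u u1 u3"
    using smooth_periodic_hasd[of u] u by (auto simp: smooth_solenoidal_def)
  define e' where "e' = e\<^sup>2 / 4"
  have e': "0 < e'" using e by (simp add: e'_def)
  have dv: "u1 x $ 1 + u3 x $ 3 = 0" if "x \<in> strip" for x
    using u hasd_d1[OF hasd_nth[OF h] that, of 1] hasd_d3[OF hasd_nth[OF h] that, of 3] that
    by (auto simp: smooth_solenoidal_def divergence_def)
  have bc: "u (x1, b) $ 3 = 0" if "b \<in> {0, pi}" for x1 b
    using u that by (auto simp: smooth_solenoidal_def velocity_bc_def)
  have mean: "(LINT x|mC. u x $ j) = 0" if "j \<in> {1, 2}" for j
    using u that by (auto simp: smooth_solenoidal_def)
  obtain g where g: "g \<in> lspan N_u (u_basis k1)" "continuous_on strip g" "\<And>x. g x $ 2 = 0"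
    "L2_inner k1 (\<lambda>x. u x $ 1 - g x $ 1) (\<lambda>x. u x $ 1 - g x $ 1) + L2_inner k1 (\<lambda>x. u x $ 3 - g x $ 3) (\<lambda>x. u x $ 3 - g x $ 3) \<le> e'"
    using planar_dense[OF hasd_nth[OF h] hasd_nth[OF h] dv bc mean e'] by auto
  define \<eta> where "\<eta> = e / (2 * cell_const)"
  have \<eta>: "0 < \<eta>" using e cell_const_pos by (simp add: \<eta>_def)
  note h2 = hasd_nth[OF h, of 2]
  obtain t where t: "t \<in> TP" "\<And>x. x \<in> cell k1 \<Longrightarrow> \<bar>u x $ 2 - t x\<bar> < \<eta>"
    using TP_dense[OF hasd_continuous(1)[OF h2] _ \<eta>] h2 by (auto simp: hasd_def)
  obtain k c where k: "k \<in> lspan N_u (u_basis k1)" "\<And>x. t x *\<^sub>R e2 = k x + c *\<^sub>R e2"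
    using TP_e2_in_span[OF t(1)] by blast
  note kc = lspan_u_solenoidal[OF k(1)]
  have kk: "k x $ 1 = 0" "k x $ 3 = 0" "k x $ 2 = t x - c" for x
    using arg_cong[OF k(2)[of x], of "\<lambda>v. v $ 1"] arg_cong[OF k(2)[of x], of "\<lambda>v. v $ 2"] arg_cong[OF k(2)[of x], of "\<lambda>v. v $ 3"]
    by (simp_all add: axis_def)
  define v where "v x = u x $ 2 - k x $ 2" for x
  have cv: "continuous_on strip v"
    unfolding v_def by (intro continuous_intros hasd_continuous[OF h] kc)
  have v0: "(LINT x|mC. v x) = 0"
    unfolding v_def using mean[of 2] kc(3)[of 2]
    by (subst Bochner_Integration.integral_diff)
      (auto intro!: continuous_integrable_cell continuous_intros hasd_continuous[OF h] kc)
  have L: "v \<in> L2_space k1" "(\<lambda>x. c) \<in> L2_space k1" by (intro continuous_L2 continuous_intros cv)+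
  \<comment> \<open>v has zero mean and is orthogonal to constants, so dropping the constant c can
    only decrease the norm.\<close>
  have "L2_inner k1 v v \<le> L2_inner k1 (\<lambda>x. v x - c) (\<lambda>x. v x - c)"
  proof -
    have "L2_inner k1 v (\<lambda>x. c) = 0" using v0 by (simp add: L2_inner_def)
    then show ?thesis using L2_inner_self_nonneg[of "\<lambda>x. c"] by (simp add: L2_norm_sq_diff[OF L])
  qed
  also have "(\<lambda>x. v x - c) = (\<lambda>x. u x $ 2 - t x)" by (simp add: v_def kk)
  also have "L2_inner k1 (\<lambda>x. u x $ 2 - t x) (\<lambda>x. u x $ 2 - t x) \<le> (e / 2)\<^sup>2"
  proof -
    have "L2_norm k1 (\<lambda>x. u x $ 2 - t x) \<le> \<eta> * cell_const"
      using t(2) \<eta> by (intro L2_norm_uniform_le continuous_intros hasd_continuous[OF h] continuous_TP[OF t(1)])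
        (auto intro: less_imp_le)
    also have "\<dots> = e / 2" using cell_const_pos by (simp add: \<eta>_def)
    finally show ?thesis unfolding L2_norm_sq[symmetric] by (intro power_mono) (auto simp: L2_norm_nonneg)
  qed
  finally have v: "L2_inner k1 v v \<le> e\<^sup>2 / 4" by (simp add: power_divide)
  define G where "G x = g x + k x" for x
  have G: "G \<in> lspan N_u (u_basis k1)" unfolding G_def by (intro lspan_add g k)
  have cd: "continuous_on strip (\<lambda>x. u x - G x)"
    by (intro continuous_intros hasd_continuous[OF h] lspan_u_solenoidal[OF G])
  have "L2_inner k1 (\<lambda>x. u x - G x) (\<lambda>x. u x - G x) \<le> e' + e\<^sup>2 / 4"
    unfolding L2_inner_vec3[OF cd] using g(4) v by (simp add: G_def kk g(3) v_def[abs_def])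
  also have "\<dots> < e\<^sup>2" using e by (simp add: e'_def)
  finally have "L2_norm k1 (\<lambda>x. u x - G x) < e"
    using e by (simp add: L2_norm_eq_sqrt real_less_lsqrt)
  with G show ?thesis by blast
qed

lemma L2_sigma_dense:
  assumes u: "u \<in> L2_sigma k1" and e: "0 < e"
  shows "\<exists>g\<in>lspan N_u (u_basis k1). L2_norm k1 (\<lambda>x. u x - g x) < e"
proof -
  have e2: "0 < e / 2" using e by simp
  obtain v where v: "v \<in> smooth_solenoidal k1" "L2_norm k1 (\<lambda>x. v x - u x) < e / 2"
    using u e2 unfolding L2_sigma_def fun_diff_def by blast
  obtain g where g: "g \<in> lspan N_u (u_basis k1)" "L2_norm k1 (\<lambda>x. v x - g x) < e / 2"
    using smooth_solenoidal_dense[OF v(1) e2] by blast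
  obtain v1 v3 where "hasd v v1 v3"
    using smooth_periodic_hasd[of v] v(1) by (auto simp: smooth_solenoidal_def)
  then have vL: "v \<in> L2_space k1" by (rule hasd_L2)
  have uL: "u \<in> L2_space k1" using u by (simp add: L2_sigma_def)
  have "L2_norm k1 (\<lambda>x. u x - g x) \<le> L2_norm k1 (\<lambda>x. u x - v x) + L2_norm k1 (\<lambda>x. v x - g x)"
    by (rule L2_triangle_diff[OF uL vL lspan_u_solenoidal(1)[OF g(1)]])
  also have "\<dots> < e" using v(2) g(2) L2_norm_minus_commute[of u v] by simp
  finally show ?thesis using g(1) by blast
qed


subsection \<open>The Leray projection\<close>

lemma Ck_on_lincomb:
  assumes "Ck_on n D f" "Ck_on n D g"
  shows "Ck_on n D (\<lambda>x. f x + r *\<^sub>R g x)"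
  using assms
proof (induction n arbitrary: f g)
  case 0
  then show ?case by (auto intro!: continuous_intros)
next
  case (Suc n)
  obtain f' where f': "\<And>x. x \<in> D \<Longrightarrow> (f has_derivative f' x) (at x within D)" "\<And>h. Ck_on n D (\<lambda>x. f' x h)"
    using Suc.prems(1) by auto
  obtain g' where g': "\<And>x. x \<in> D \<Longrightarrow> (g has_derivative g' x) (at x within D)" "\<And>h. Ck_on n D (\<lambda>x. g' x h)"
    using Suc.prems(2) by auto
  have "((\<lambda>x. f x + r *\<^sub>R g x) has_derivative (\<lambda>h. f' x h + r *\<^sub>R g' x h)) (at x within D)" if "x \<in> D" for x
    by (intro has_derivative_add has_derivative_scaleR_right f' g' that)
  moreover have "Ck_on n D (\<lambda>x. f' x h + r *\<^sub>R g' x h)" for h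
    by (rule Suc.IH[OF f'(2) g'(2)])
  ultimately show ?case
    unfolding Ck_on.simps by (intro exI[of _ "\<lambda>x h. f' x h + r *\<^sub>R g' x h"]) auto
qed

lemma smooth_solenoidal_lincomb:
  assumes f: "f \<in> smooth_solenoidal k1" and g: "g \<in> smooth_solenoidal k1"
  shows "(\<lambda>x. f x + r *\<^sub>R g x) \<in> smooth_solenoidal k1"
proof -
  obtain f1 f3 where hf: "hasd f f1 f3"
    using smooth_periodic_hasd[of f] f by (auto simp: smooth_solenoidal_def)
  obtain g1 g3 where hg: "hasd g g1 g3"
    using smooth_periodic_hasd[of g] g by (auto simp: smooth_solenoidal_def)
  note h = hasd_add[OF hf hasd_scaleR[OF hg, of r]]
  have s: "(\<lambda>x. f x + r *\<^sub>R g x) \<in> smooth_periodic k1"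
    using f g by (auto simp: smooth_solenoidal_def smooth_periodic_def smooth_on_def periodic_x1_def intro: Ck_on_lincomb)
  have "divergence (\<lambda>x. f x + r *\<^sub>R g x) x = 0" if x: "x \<in> strip" for x
  proof -
    have "divergence f x = 0" "divergence g x = 0" using f g x by (auto simp: smooth_solenoidal_def)
    then have "f1 x $ 1 + f3 x $ 3 = 0" "g1 x $ 1 + g3 x $ 3 = 0"
      using hasd_d1[OF hasd_nth[OF hf] x, of 1] hasd_d3[OF hasd_nth[OF hf] x, of 3]
        hasd_d1[OF hasd_nth[OF hg] x, of 1] hasd_d3[OF hasd_nth[OF hg] x, of 3] by (simp_all only: divergence_def)
    moreover have "f1 x $ 1 + r * g1 x $ 1 + (f3 x $ 3 + r * g3 x $ 3)
       = (f1 x $ 1 + f3 x $ 3) + r * (g1 x $ 1 + g3 x $ 3)" by (simp add: algebra_simps)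
    ultimately show ?thesis
      using hasd_d1[OF hasd_nth[OF h] x, of 1] hasd_d3[OF hasd_nth[OF h] x, of 3]
      by (simp only: divergence_def vector_add_component vector_scaleR_component real_scaleR_def)
  qed
  moreover have "velocity_bc (\<lambda>x. f x + r *\<^sub>R g x)" unfolding velocity_bc_def
  proof (intro allI ballI)
    fix x1 b assume b: "b \<in> {0::real, pi}"
    then have x: "(x1, b) \<in> strip" by (auto simp: strip_def)
    have "f (x1, b) $ 3 = 0" "d3 (\<lambda>x. f x $ 1) (x1, b) = 0" "d3 (\<lambda>x. f x $ 2) (x1, b) = 0"
      "g (x1, b) $ 3 = 0" "d3 (\<lambda>x. g x $ 1) (x1, b) = 0" "d3 (\<lambda>x. g x $ 2) (x1, b) = 0"
      using f g b by (auto simp: smooth_solenoidal_def velocity_bc_def)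
    then have "f (x1, b) $ 3 = 0" "f3 (x1, b) $ 1 = 0" "f3 (x1, b) $ 2 = 0"
      "g (x1, b) $ 3 = 0" "g3 (x1, b) $ 1 = 0" "g3 (x1, b) $ 2 = 0"
      by (simp_all only: hasd_d3[OF hasd_nth[OF hf] x] hasd_d3[OF hasd_nth[OF hg] x])
    then show "(f (x1, b) + r *\<^sub>R g (x1, b)) $ 3 = 0 \<and> d3 (\<lambda>x. (f x + r *\<^sub>R g x) $ 1) (x1, b) = 0 \<and>
      d3 (\<lambda>x. (f x + r *\<^sub>R g x) $ 2) (x1, b) = 0"
      by (simp only: hasd_d3[OF hasd_nth[OF h] x]) simp
  qed
  moreover have "(LINT x|mC. (f x + r *\<^sub>R g x) $ j) = 0" if "j \<in> {1, 2}" for j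
  proof -
    have "integrable mC (\<lambda>x. f x $ j)" "integrable mC (\<lambda>x. g x $ j)"
      by (intro continuous_integrable_cell continuous_intros hasd_continuous[OF hf] hasd_continuous[OF hg])+
    then show ?thesis using f g that by (auto simp: smooth_solenoidal_def)
  qed
  ultimately show ?thesis using s by (simp add: smooth_solenoidal_def)
qed

lemma smooth_solenoidal_zero: "(\<lambda>x. 0) \<in> smooth_solenoidal k1"
proof -
  have u: "u_basis k1 (1, 0, 1, 2) \<in> smooth_solenoidal k1"
    by (rule u_basis_solenoidal) (simp add: N_u_def)
  from smooth_solenoidal_lincomb[OF this this, of "-1"] show ?thesis by simp
qed

lemma lspan_u_smooth_solenoidal:
  assumes "g \<in> lspan N_u (u_basis k1)"
  shows "g \<in> smooth_solenoidal k1"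
proof -
  obtain A c where A: "finite A" "A \<subseteq> N_u" "g = (\<lambda>x. \<Sum>n\<in>A. c n *\<^sub>R u_basis k1 n x)"
    using assms by (auto simp: lspan_def)
  have "(\<lambda>x. \<Sum>n\<in>A. c n *\<^sub>R u_basis k1 n x) \<in> smooth_solenoidal k1"
    using A(1,2)
  proof (induction A)
    case empty
    then show ?case by (simp add: smooth_solenoidal_zero)
  next
    case (insert m B)
    then have "(\<lambda>x. (\<Sum>n\<in>B. c n *\<^sub>R u_basis k1 n x) + c m *\<^sub>R u_basis k1 m x) \<in> smooth_solenoidal k1"
      by (intro smooth_solenoidal_lincomb u_basis_solenoidal) auto
    then show ?case using insert.hyps by (simp add: add.commute)
  qed
  then show ?thesis by (simp add: A(3))
qed

lemma smooth_solenoidal_L2_sigma: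
  assumes "g \<in> smooth_solenoidal k1"
  shows "g \<in> L2_sigma k1"
proof -
  obtain g1 g3 where "hasd g g1 g3"
    using smooth_periodic_hasd[of g] assms by (auto simp: smooth_solenoidal_def)
  then have "g \<in> L2_space k1" by (rule hasd_L2)
  moreover have "L2_norm k1 (g - g) = 0" by (simp add: L2_norm_def)
  ultimately show ?thesis
    using assms unfolding L2_sigma_def by (auto intro!: bexI[of _ g])
qed

definition N_u_upto :: "nat \<Rightarrow> mode set" where
  "N_u_upto M = {(m1, m3, p, c) \<in> N_u. m1 \<le> M \<and> m3 \<le> M}"

lemma N_u_phase_component: "(m1, m3, p, c) \<in> N_u \<Longrightarrow> p \<le> 2 \<and> c \<le> 2"
  unfolding N_u_def by (simp split: if_splits) linarith+

lemma N_u_upto: "finite (N_u_upto M)" "N_u_upto M \<subseteq> N_u"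
proof -
  have "N_u_upto M \<subseteq> {..M} \<times> {..M} \<times> {..2} \<times> {..2}"
    unfolding N_u_upto_def using N_u_phase_component by fastforce
  then show "finite (N_u_upto M)" by (rule finite_subset) auto
qed (auto simp: N_u_upto_def)

lemma N_u_upto_mono: "i \<le> j \<Longrightarrow> N_u_upto i \<subseteq> N_u_upto j"
  by (auto simp: N_u_upto_def)

lemma N_u_upto_cover: "n \<in> N_u \<Longrightarrow> \<exists>M. n \<in> N_u_upto M"
proof -
  assume n: "n \<in> N_u"
  obtain m1 m3 p c where e: "n = (m1, m3, p, c)" by (cases n) auto
  show ?thesis using n by (intro exI[of _ "max m1 m3"]) (simp add: e N_u_upto_def)
qed

text \<open>The Fourier partial sums converge in L2. The limit lies in \<open>L2_sigma\<close>
  because the partial sums are smooth and solenoidal; the defect is orthogonal to every basis field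
  and hence, by density, to all of \<open>L2_sigma\<close>.\<close>

lemma leray_exists:
  assumes F: "F \<in> L2_space k1"
  shows "\<exists>G\<in>L2_sigma k1. \<forall>v\<in>L2_sigma k1. L2_inner k1 (\<lambda>x. F x - G x) v = 0"
proof -
  define S where "S M = partial_sum (u_basis k1) (N_u_upto M) F" for M
  define b where "b M = (\<Sum>n\<in>N_u_upto M. (L2_inner k1 F (u_basis k1 n))\<^sup>2)" for M
  note o = orthonormal_subset[OF orthonormal_u_basis N_u_upto(2)] and fin = N_u_upto(1)
  have SL: "S M \<in> L2_space k1" for M unfolding S_def by (rule partial_sum_L2[OF o fin])
  have coeff: "L2_inner k1 (S M) (u_basis k1 n) = L2_inner k1 F (u_basis k1 n)" if "n \<in> N_u_upto M" for n M
    unfolding S_def partial_sum_def by (rule combination_coeff[OF o fin that])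
  \<comment> \<open>Pythagoras for nested partial sums. The increasing sequence \<open>b\<close> is
    bounded by Bessel's inequality, so it is Cauchy and the partial sums are too.\<close>
  have diff: "L2_inner k1 (\<lambda>x. S i x - S j x) (\<lambda>x. S i x - S j x) = b i - b j" if ij: "j \<le> i" for i j
  proof -
    have "L2_inner k1 (S i) (S j) = (\<Sum>n\<in>N_u_upto j. L2_inner k1 F (u_basis k1 n) * L2_inner k1 (S i) (u_basis k1 n))"
      unfolding S_def[of j] partial_sum_def by (rule L2_inner_combination_right[OF o fin SL])
    also have "\<dots> = b j"
      unfolding b_def using N_u_upto_mono[OF ij] by (intro sum.cong) (auto simp: coeff power2_eq_square)
    finally have "L2_inner k1 (S i) (S j) = b j" .
    moreover have "L2_inner k1 (S M) (S M) = b M" for M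
      using partial_sum_inner(2)[OF o fin F] by (simp add: S_def b_def)
    ultimately show ?thesis by (simp add: L2_norm_sq_diff[OF SL SL])
  qed
  have "incseq b" unfolding incseq_def
  proof (intro allI impI)
    fix m n :: nat assume "m \<le> n"
    then show "b m \<le> b n"
      unfolding b_def by (intro sum_mono2 fin N_u_upto_mono) auto
  qed
  moreover have "b M \<le> L2_inner k1 F F" for M unfolding b_def by (rule Bessel[OF o fin F])
  ultimately obtain l where "b \<longlonglongrightarrow> l"
    using incseq_convergent by blast
  then have "Cauchy b" by (rule LIMSEQ_imp_Cauchy)
  have "\<exists>N. \<forall>i\<ge>N. \<forall>j\<ge>N. L2_norm k1 (\<lambda>x. S i x - S j x) < e" if e: "e > 0" for e
  proof -
    obtain N where N: "\<And>i j. i \<ge> N \<Longrightarrow> j \<ge> N \<Longrightarrow> \<bar>b i - b j\<bar> < e\<^sup>2"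
      using CauchyD[OF \<open>Cauchy b\<close>, of "e\<^sup>2"] e by auto
    have "L2_norm k1 (\<lambda>x. S i x - S j x) < e" if "j \<le> i" "i \<ge> N" "j \<ge> N" for i j
      using N[OF that(2,3)] e by (simp add: L2_norm_eq_sqrt diff[OF that(1)] real_less_lsqrt)
    then have "L2_norm k1 (\<lambda>x. S i x - S j x) < e" if "i \<ge> N" "j \<ge> N" for i j
      using that L2_norm_minus_commute[of "S i" "S j"] by (metis nle_le)
    then show ?thesis by blast
  qed
  from L2_complete[OF SL this] obtain G where G: "G \<in> L2_space k1"
    and lim: "\<And>e. e > 0 \<Longrightarrow> \<exists>N. \<forall>n\<ge>N. L2_norm k1 (\<lambda>x. S n x - G x) \<le> e" by blast
  have D: "(\<lambda>x. F x - G x) \<in> L2_space k1" by (rule L2_diff[OF F G])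
  have Gs: "G \<in> L2_sigma k1"
    unfolding L2_sigma_def
  proof (intro CollectI conjI G allI impI)
    fix e :: real assume e: "e > 0"
    then obtain N where N: "\<And>n. n \<ge> N \<Longrightarrow> L2_norm k1 (\<lambda>x. S n x - G x) \<le> e / 2"
      using lim[of "e / 2"] by auto
    have "S N \<in> lspan N_u (u_basis k1)"
      unfolding S_def partial_sum_def by (rule lspanI[OF fin N_u_upto(2) refl])
    then have "S N \<in> smooth_solenoidal k1" by (rule lspan_u_smooth_solenoidal)
    moreover have "L2_norm k1 (S N - G) < e" using N[of N] e by (simp add: fun_diff_def)
    ultimately show "\<exists>v\<in>smooth_solenoidal k1. L2_norm k1 (v - G) < e" by blast
  qed
  have ortho: "L2_inner k1 (\<lambda>x. F x - G x) (u_basis k1 n) = 0" if n: "n \<in> N_u" for n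
  proof -
    obtain M where M: "n \<in> N_u_upto M" using N_u_upto_cover[OF n] by blast
    have uL: "u_basis k1 n \<in> L2_space k1" by (rule orthonormal_L2[OF orthonormal_u_basis n])
    have u1: "L2_norm k1 (u_basis k1 n) = 1"
      using orthonormal_u_basis n by (simp add: orthonormal_def L2_norm_eq_sqrt)
    have "\<bar>L2_inner k1 (\<lambda>x. F x - G x) (u_basis k1 n)\<bar> \<le> e" if e: "e > 0" for e
    proof -
      obtain N where N: "\<And>n. n \<ge> N \<Longrightarrow> L2_norm k1 (\<lambda>x. S n x - G x) \<le> e" using lim[OF e] by auto
      define K where "K = max M N"
      have "n \<in> N_u_upto K" using M N_u_upto_mono[of M K] by (auto simp: K_def)
      then have "L2_inner k1 (\<lambda>x. F x - G x) (u_basis k1 n) = L2_inner k1 (\<lambda>x. S K x - G x) (u_basis k1 n)"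
        using coeff[of n K] by (simp add: L2_inner_diff_left F G uL SL)
      also have "\<bar>\<dots>\<bar> \<le> L2_norm k1 (\<lambda>x. S K x - G x) * 1"
        using L2_Cauchy_Schwarz[OF L2_diff[OF SL G] uL] by (simp add: u1)
      also have "\<dots> \<le> e" using N[of K] by (simp add: K_def)
      finally show ?thesis .
    qed
    then show ?thesis by (meson abs_le_zero_iff dense_ge)
  qed
  have "L2_inner k1 (\<lambda>x. F x - G x) v = 0" if v: "v \<in> L2_sigma k1" for v
  proof -
    have vL: "v \<in> L2_space k1" using v by (simp add: L2_sigma_def)
    define K where "K = L2_norm k1 (\<lambda>x. F x - G x) + 1"
    have K: "0 < K" "L2_norm k1 (\<lambda>x. F x - G x) \<le> K"
      using L2_norm_nonneg[of "\<lambda>x. F x - G x"] unfolding K_def by linarith+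
    have "\<bar>L2_inner k1 (\<lambda>x. F x - G x) v\<bar> \<le> e" if e: "e > 0" for e
    proof -
      have "e / K > 0" using e K by simp
      from L2_sigma_dense[OF v this] obtain g where g: "g \<in> lspan N_u (u_basis k1)" "L2_norm k1 (\<lambda>x. v x - g x) < e / K"
        by blast
      then obtain A c where A: "finite A" "A \<subseteq> N_u" "g = (\<lambda>x. \<Sum>n\<in>A. c n *\<^sub>R u_basis k1 n x)"
        by (auto simp: lspan_def)
      have gL: "g \<in> L2_space k1" by (rule lspan_u_solenoidal[OF g(1)])
      have "L2_inner k1 (\<lambda>x. F x - G x) g = 0"
        unfolding A(3) L2_inner_combination_right[OF orthonormal_subset[OF orthonormal_u_basis A(2)] A(1) D]
        using A(2) ortho by (intro sum.neutral) auto
      then have "L2_inner k1 (\<lambda>x. F x - G x) v = L2_inner k1 (\<lambda>x. F x - G x) (\<lambda>x. v x - g x)"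
        by (simp add: L2_inner_diff_right D vL gL)
      also have "\<bar>\<dots>\<bar> \<le> L2_norm k1 (\<lambda>x. F x - G x) * L2_norm k1 (\<lambda>x. v x - g x)"
        by (rule L2_Cauchy_Schwarz[OF D L2_diff[OF vL gL]])
      also have "\<dots> \<le> K * (e / K)"
        using g(2) K by (intro mult_mono) (auto simp: L2_norm_nonneg)
      also have "\<dots> = e" using K by simp
      finally show ?thesis .
    qed
    then show ?thesis by (meson abs_le_zero_iff dense_ge)
  qed
  with Gs show ?thesis by blast
qed

lemma leray:
  assumes "F \<in> L2_space k1"
  shows "leray k1 F \<in> L2_sigma k1" "v \<in> L2_sigma k1 \<Longrightarrow> L2_inner k1 (leray k1 F) v = L2_inner k1 F v"
proof -
  have "\<exists>G. G \<in> L2_sigma k1 \<and> (\<forall>v\<in>L2_sigma k1. L2_inner k1 (F - G) v = 0)"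
    using leray_exists[OF assms] by (auto simp: fun_diff_def)
  from someI_ex[OF this] have 1: "leray k1 F \<in> L2_sigma k1"
    and 2: "\<And>v. v \<in> L2_sigma k1 \<Longrightarrow> L2_inner k1 (\<lambda>x. F x - leray k1 F x) v = 0"
    by (auto simp: leray_def orth_proj_def fun_diff_def)
  show "leray k1 F \<in> L2_sigma k1" by (rule 1)
  assume v: "v \<in> L2_sigma k1"
  have "leray k1 F \<in> L2_space k1" "v \<in> L2_space k1" using 1 v by (auto simp: L2_sigma_def)
  then show "L2_inner k1 (leray k1 F) v = L2_inner k1 F v"
    using 2[OF v] assms by (simp add: L2_inner_diff_left)
qed

subsection \<open>Classical solutions in weak form\<close>

lemma Ck_slice:
  fixes F :: "real \<times> point \<Rightarrow> 'b::euclidean_space"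
  assumes "Ck_on n ({0<..} \<times> strip) F" "0 < t"
  shows "Ck_on n strip (\<lambda>x. F (t, x))"
  using assms(1)
proof (induction n arbitrary: F)
  case 0
  then show ?case
    using assms(2) by (auto intro!: continuous_on_compose2[of "{0<..} \<times> strip" F] continuous_intros)
next
  case (Suc n)
  obtain F' where F': "\<And>z. z \<in> {0<..} \<times> strip \<Longrightarrow> (F has_derivative F' z) (at z within {0<..} \<times> strip)"
    "\<And>h. Ck_on n ({0<..} \<times> strip) (\<lambda>z. F' z h)"
    using Suc.prems by auto
  have "(F \<circ> (\<lambda>x. (t, x)) has_derivative F' (t, x) \<circ> (\<lambda>h. (0, h))) (at x within strip)" if "x \<in> strip" for x
    using that assms(2) by (intro diff_chain_within has_derivative_subset[OF F'(1)])
      (auto intro!: derivative_eq_intros)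
  moreover have "Ck_on n strip (\<lambda>x. F' (t, x) (0, h))" for h
    by (rule Suc.IH[OF F'(2)])
  ultimately show ?case
    unfolding Ck_on.simps by (intro exI[of _ "\<lambda>x h. F' (t, x) (0, h)"]) (auto simp: o_def)
qed

lemma Ck_time_derivative:
  fixes F :: "real \<times> point \<Rightarrow> 'b::euclidean_space"
  assumes "Ck_on (Suc n) ({0<..} \<times> strip) F"
  shows "\<exists>Ft. continuous_on ({0<..} \<times> strip) Ft \<and>
    (\<forall>t>0. \<forall>x\<in>strip. ((\<lambda>s. F (s, x)) has_vector_derivative Ft (t, x)) (at t))"
proof -
  obtain F' where F': "\<And>z. z \<in> {0<..} \<times> strip \<Longrightarrow> (F has_derivative F' z) (at z within {0<..} \<times> strip)"
    "\<And>h. Ck_on n ({0<..} \<times> strip) (\<lambda>z. F' z h)"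
    using assms by auto
  have "((\<lambda>s. F (s, x)) has_vector_derivative F' (t, x) (1, 0)) (at t)" if t: "0 < t" and x: "x \<in> strip" for t x
  proof -
    have "(F \<circ> (\<lambda>s. (s, x)) has_derivative F' (t, x) \<circ> (\<lambda>h. (h, 0))) (at t within {0<..})"
      using t x by (intro diff_chain_within has_derivative_subset[OF F'(1)])
        (auto intro!: derivative_eq_intros)
    moreover have "linear (F' (t, x))"
      using F'(1)[of "(t, x)"] t x by (auto simp: has_derivative_def bounded_linear.linear)
    define D where "D = F' (t, x) (1, 0)"
    have "F' (t, x) (h, 0) = h *\<^sub>R D" for h
      using linear_scale[OF \<open>linear (F' (t, x))\<close>, of h "(1, 0)"] by (simp add: D_def)
    ultimately have "((\<lambda>s. F (s, x)) has_vector_derivative D) (at t within {0<..})"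
      by (simp add: has_vector_derivative_def o_def)
    then show ?thesis using t by (simp add: at_within_open[of t "{0<..}"] D_def)
  qed
  moreover have "continuous_on ({0<..} \<times> strip) (\<lambda>z. F' z (1, 0))"
    by (rule Ck_on_continuous[OF F'(2)])
  ultimately show ?thesis by (intro exI[of _ "\<lambda>z. F' z (1, 0)"]) auto
qed

text \<open>Differentiation under the integral over a compact cell, on the open half line t > 0
  where the time derivative is jointly continuous.\<close>

lemma time_derivative_integral:
  fixes f ft :: "real \<Rightarrow> point \<Rightarrow> real"
  assumes c: "continuous_on ({0<..} \<times> strip) (\<lambda>(t, x). f t x)" "continuous_on ({0<..} \<times> strip) (\<lambda>(t, x). ft t x)"
    and d: "\<And>t x. 0 < t \<Longrightarrow> x \<in> strip \<Longrightarrow> ((\<lambda>s. f s x) has_vector_derivative ft t x) (at t)"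
    and t: "0 < t"
  shows "((\<lambda>s. LINT x|mC. f s x) has_real_derivative (LINT x|mC. ft t x)) (at t)"
proof -
  have slice: "continuous_on strip (g s)" if "continuous_on ({0<..} \<times> strip) (\<lambda>(t, x). g t x)" "0 < s" for g :: "real \<Rightarrow> point \<Rightarrow> real" and s
  proof -
    have "continuous_on strip (\<lambda>x. case (s, x) of (t, x) \<Rightarrow> g t x)"
      by (rule continuous_on_compose2[OF that(1)]) (use that(2) in \<open>auto intro!: continuous_intros\<close>)
    then show ?thesis by simp
  qed
  have "((\<lambda>s. integral (cbox (0, 0) (2 * pi / k1, pi)) (f s)) has_vector_derivative
     integral (cbox (0, 0) (2 * pi / k1, pi)) (ft t)) (at t within {0<..})"
  proof (rule leibniz_rule_vector_derivative)
    show "((\<lambda>s. f s x) has_vector_derivative ft s x) (at s within {0<..})"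
      if "s \<in> {0<..}" "x \<in> cbox (0, 0) (2 * pi / k1, pi)" for s x
      using d[of s x] that cell_subset_strip cell_cbox by (auto intro: has_vector_derivative_at_within)
    show "f s integrable_on cbox (0, 0) (2 * pi / k1, pi)" if "s \<in> {0<..}" for s
      using continuous_on_subset[OF slice[OF c(1)] cell_subset_strip, of s] that
      by (intro integrable_continuous) (auto simp: cell_cbox)
    show "continuous_on ({0<..} \<times> cbox (0, 0) (2 * pi / k1, pi)) (\<lambda>(t, x). ft t x)"
      using cell_subset_strip by (intro continuous_on_subset[OF c(2)]) (auto simp: cell_cbox)
  qed (use t in auto)
  then have "((\<lambda>s. integral (cbox (0, 0) (2 * pi / k1, pi)) (f s)) has_real_derivative
     integral (cbox (0, 0) (2 * pi / k1, pi)) (ft t)) (at t)"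
    unfolding has_real_derivative_iff_has_vector_derivative
    using at_within_open[of t "{0<..}"] t by auto
  then have "((\<lambda>s. integral (cbox (0, 0) (2 * pi / k1, pi)) (f s)) has_real_derivative (LINT x|mC. ft t x)) (at t)"
    by (simp add: LINT_eq_integral[OF slice[OF c(2) t]])
  then show ?thesis
    by (rule has_field_derivative_transform_within_open[of _ _ _ "{0<..}"])
      (use t in \<open>auto simp: LINT_eq_integral[OF slice[OF c(1)]]\<close>)
qed

text \<open>The diffusivities: P for the velocity, 1 for the temperature.\<close>

definition Diff :: "real \<Rightarrow> (real^3) \<times> real \<Rightarrow> (real^3) \<times> real" where
  "Diff P z = (P *\<^sub>R fst z, snd z)"

text \<open>The zero-order coupling: buoyancy and Coriolis force in the momentum equation, vertical
  transport of the background temperature in the other.\<close>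

definition Lin :: "real \<Rightarrow> real \<Rightarrow> real \<Rightarrow> (real^3) \<times> real \<Rightarrow> (real^3) \<times> real" where
  "Lin R S P z = ((P * R * snd z) *\<^sub>R e3 - (P * S) *\<^sub>R cross3 e3 (fst z), fst z $ 3)"

lemma bounded_linear_Diff: "bounded_linear (Diff P)"
proof -
  have "linear (Diff P)"
    by (rule linearI) (simp_all add: Diff_def algebra_simps prod_eq_iff)
  then show ?thesis by (rule linear_conv_bounded_linear[THEN iffD1])
qed

lemma bounded_linear_Lin: "bounded_linear (Lin R S P)"
proof -
  have "linear (Lin R S P)"
    by (rule linearI) (simp_all add: Lin_def cross3_def vec_eq_iff forall_3 vector_3 algebra_simps prod_eq_iff)
  then show ?thesis by (rule linear_conv_bounded_linear[THEN iffD1])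
qed

lemma L2_inner_Pair:
  fixes f :: velocity and g :: temperature and v :: "point \<Rightarrow> (real^3) \<times> real"
  assumes "f \<in> L2_space k1" "g \<in> L2_space k1" "v \<in> L2_space k1"
  shows "L2_inner k1 (\<lambda>x. (f x, g x)) v = L2_inner k1 f (\<lambda>x. fst (v x)) + L2_inner k1 g (\<lambda>x. snd (v x))"
proof -
  have "(\<lambda>x. fst (v x)) \<in> L2_space k1" "(\<lambda>x. snd (v x)) \<in> L2_space k1"
    using L2_bounded_linear[OF bounded_linear_fst assms(3)] L2_bounded_linear[OF bounded_linear_snd assms(3)] by auto
  from L2_inner_integrable[OF assms(1) this(1)] L2_inner_integrable[OF assms(2) this(2)]
  show ?thesis
    by (simp add: L2_inner_def inner_prod_def)
qed

definition fld :: "state \<Rightarrow> point \<Rightarrow> (real^3) \<times> real" where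
  "fld X x = (fst X x, snd X x)"

text \<open>The weak form pairs the pressure-free equation with arbitrary solenoidal test fields.\<close>

definition weak_rhs where
  "weak_rhs R S P w w1 w3 v v1 v3 =
     - (L2_inner k1 (\<lambda>x. Diff P (w1 x)) v1 + L2_inner k1 (\<lambda>x. Diff P (w3 x)) v3)
     + L2_inner k1 (\<lambda>x. Lin R S P (w x)) v - L2_inner k1 (adv w w1 w3) v"

text \<open>The wall term in Green's formula vanishes component by component: the normal derivative
  of w for the horizontal velocity, the test field v for the vertical velocity and the
  temperature.\<close>

lemma weak_rhs_strong:
  assumes w: "hasd w w1 w3" and h1: "hasd w1 w11 w13" and h3: "hasd w3 w31 w33" and v: "admfield v v1 v3"
    and bc: "\<And>x1 b. b \<in> {0, pi} \<Longrightarrow> fst (w3 (x1, b)) $ 1 = 0 \<and> fst (w3 (x1, b)) $ 2 = 0"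
  shows "weak_rhs R S P w w1 w3 v v1 v3 =
    L2_inner k1 (\<lambda>x. Diff P (w11 x + w33 x) + Lin R S P (w x) - adv w w1 w3 x) v"
proof -
  note vh = admfield_hasd[OF v]
  have "L2_inner k1 (\<lambda>x. Diff P (w11 x) + Diff P (w33 x)) v = - (L2_inner k1 (\<lambda>x. Diff P (w1 x)) v1 + L2_inner k1 (\<lambda>x. Diff P (w3 x)) v3)"
  proof (rule green[OF hasd_linear[OF bounded_linear_Diff h1] hasd_linear[OF bounded_linear_Diff h3] vh])
    fix x1 b assume b: "b \<in> {0::real, pi}"
    have "fst (v (x1, b)) $ 3 = 0" "snd (v (x1, b)) = 0" using v b by (auto simp: admfield_def)
    then show "Diff P (w3 (x1, b)) \<bullet> v (x1, b) = 0"
      using bc[OF b, of x1] by (simp add: Diff_def inner_prod_def inner_vec_def sum_3)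
  qed
  moreover have "Diff P (w11 x + w33 x) = Diff P (w11 x) + Diff P (w33 x)" for x
    by (simp add: Diff_def scaleR_add_right)
  moreover have L: "(\<lambda>x. Diff P (w11 x) + Diff P (w33 x)) \<in> L2_space k1" "(\<lambda>x. Lin R S P (w x)) \<in> L2_space k1" "adv w w1 w3 \<in> L2_space k1"
    by (intro L2_add L2_bounded_linear[OF bounded_linear_Diff] L2_bounded_linear[OF bounded_linear_Lin]
        hasd_L2[OF w] hasd_L2[OF h1] hasd_L2[OF h3] continuous_L2 continuous_adv hasd_continuous[OF w])+
  ultimately show ?thesis
    using L2_inner_diff_left[OF L2_add[OF L(1,2)] L(3) hasd_L2(1)[OF vh]] L2_inner_add_left[OF L(1,2) hasd_L2(1)[OF vh]]
    by (simp only: weak_rhs_def)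
qed


lemma bounded_linear_cross3: "bounded_linear (cross3 a)"
proof -
  have "linear (cross3 a)"
    by (rule linearI) (simp_all add: cross_add_right cross_mult_right)
  then show ?thesis by (rule linear_conv_bounded_linear[THEN iffD1])
qed

text \<open>Against a test field with velocity in \<open>L2_sigma\<close> the Leray projection may
  be dropped, and diffusion is integrated by parts. \<open>leray\<close> is a representative modulo
  null sets, so the equation holds almost everywhere and is exploited in pairings alone.\<close>

lemma exact_solution_slice:
  assumes sol: "bc_solution R S P k1 X0 X" and t: "0 < t"
    and Ut: "\<And>x. x \<in> strip \<Longrightarrow> ((\<lambda>s. fst (X s) x) has_vector_derivative Ut x) (at t)"
    and Tt: "\<And>x. x \<in> strip \<Longrightarrow> ((\<lambda>s. snd (X s) x) has_vector_derivative Tt x) (at t)"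
    and cU: "continuous_on strip Ut" and cT: "continuous_on strip Tt"
  shows "\<exists>w1 w3. admfield (fld (X t)) w1 w3 \<and>
    (\<forall>v v1 v3. admfield v v1 v3 \<longrightarrow> (\<lambda>x. fst (v x)) \<in> L2_sigma k1 \<longrightarrow>
      L2_inner k1 (\<lambda>x. (Ut x, Tt x)) v = weak_rhs R S P (fld (X t)) w1 w3 v v1 v3)"
proof -
  define u \<theta> where "u = fst (X t)" and "\<theta> = snd (X t)"
  have sm: "smooth_on ({0<..} \<times> strip) (\<lambda>(t, x). fst (X t) x)" "smooth_on ({0<..} \<times> strip) (\<lambda>(t, x). snd (X t) x)"
    and per: "periodic_x1 k1 u" "periodic_x1 k1 \<theta>"
    and dv: "\<And>x. x \<in> strip \<Longrightarrow> divergence u x = 0" and vbc: "velocity_bc u" and tbc: "temperature_bc \<theta>"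
    and eqU: "AE x in mC. vector_derivative (\<lambda>s. fst (X s) x) (at t) = P *\<^sub>R laplacian u x +
            leray k1 (\<lambda>y. (P * R * \<theta> y) *\<^sub>R e3 - (P * S) *\<^sub>R cross3 e3 (u y) - advect u u y) x"
    and eqT: "AE x in mC. vector_derivative (\<lambda>s. snd (X s) x) (at t) =
            laplacian \<theta> x + u x $ 3 - advect u \<theta> x"
    using sol t unfolding bc_solution_def Let_def u_def \<theta>_def by auto
  have "Ck_on (Suc (Suc 0)) strip (\<lambda>x. (case (t, x) of (t, x) \<Rightarrow> fst (X t) x))"
    using sm(1) by (intro Ck_slice t) (simp add: smooth_on_def del: Ck_on.simps)
  then have "Ck_on (Suc (Suc 0)) strip u" by (simp add: u_def del: Ck_on.simps)
  from hasd_exists[OF this per(1)] obtain u1 u3 where hu: "hasd u u1 u3"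
    and "Ck_on (Suc 0) strip u1" "Ck_on (Suc 0) strip u3" "periodic_x1 k1 u1" "periodic_x1 k1 u3" by blast
  then obtain u11 u13 u31 u33 where hu1: "hasd u1 u11 u13" and hu3: "hasd u3 u31 u33"
    using hasd_exists[of 0 u1] hasd_exists[of 0 u3] by blast
  have "Ck_on (Suc (Suc 0)) strip (\<lambda>x. (case (t, x) of (t, x) \<Rightarrow> snd (X t) x))"
    using sm(2) by (intro Ck_slice t) (simp add: smooth_on_def del: Ck_on.simps)
  then have "Ck_on (Suc (Suc 0)) strip \<theta>" by (simp add: \<theta>_def del: Ck_on.simps)
  from hasd_exists[OF this per(2)] obtain \<theta>1 \<theta>3 where ht: "hasd \<theta> \<theta>1 \<theta>3"
    and "Ck_on (Suc 0) strip \<theta>1" "Ck_on (Suc 0) strip \<theta>3" "periodic_x1 k1 \<theta>1" "periodic_x1 k1 \<theta>3" by blast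
  then obtain \<theta>11 \<theta>13 \<theta>31 \<theta>33 where ht1: "hasd \<theta>1 \<theta>11 \<theta>13" and ht3: "hasd \<theta>3 \<theta>31 \<theta>33"
    using hasd_exists[of 0 \<theta>1] hasd_exists[of 0 \<theta>3] by blast
  have lapU: "laplacian u x = u11 x + u33 x" and advU: "advect u u x = (u x $ 1) *\<^sub>R u1 x + (u x $ 3) *\<^sub>R u3 x"
    and lapT: "laplacian \<theta> x = \<theta>11 x + \<theta>33 x" and advT: "advect u \<theta> x = (u x $ 1) *\<^sub>R \<theta>1 x + (u x $ 3) *\<^sub>R \<theta>3 x"
    if x: "x \<in> strip" for x
  proof -
    have "hasd (d1 u) u11 u13" "hasd (d3 u) u31 u33" "hasd (d1 \<theta>) \<theta>11 \<theta>13" "hasd (d3 \<theta>) \<theta>31 \<theta>33"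
      using hasd_d1[OF hu] hasd_d3[OF hu] hasd_d1[OF ht] hasd_d3[OF ht]
      by (auto intro: hasd_cong[OF hu1] hasd_cong[OF hu3] hasd_cong[OF ht1] hasd_cong[OF ht3])
    then show "laplacian u x = u11 x + u33 x" "laplacian \<theta> x = \<theta>11 x + \<theta>33 x"
      unfolding laplacian_def using hasd_d1 hasd_d3 x by metis+
    show "advect u u x = (u x $ 1) *\<^sub>R u1 x + (u x $ 3) *\<^sub>R u3 x"
      "advect u \<theta> x = (u x $ 1) *\<^sub>R \<theta>1 x + (u x $ 3) *\<^sub>R \<theta>3 x"
      unfolding advect_def using hasd_d1[OF hu x] hasd_d3[OF hu x] hasd_d1[OF ht x] hasd_d3[OF ht x] by simp_all
  qed
  define w w1 w3 where "w x = (u x, \<theta> x)" and "w1 x = (u1 x, \<theta>1 x)" and "w3 x = (u3 x, \<theta>3 x)" for x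
  have fw: "fld (X t) = w" by (simp add: fun_eq_iff fld_def w_def u_def \<theta>_def)
  have hw: "hasd w w1 w3" unfolding w_def w1_def w3_def by (rule hasd_Pair[OF hu ht])
  have hw1: "hasd w1 (\<lambda>x. (u11 x, \<theta>11 x)) (\<lambda>x. (u13 x, \<theta>13 x))" unfolding w1_def by (rule hasd_Pair[OF hu1 ht1])
  have hw3: "hasd w3 (\<lambda>x. (u31 x, \<theta>31 x)) (\<lambda>x. (u33 x, \<theta>33 x))" unfolding w3_def by (rule hasd_Pair[OF hu3 ht3])
  have str: "(x1, b) \<in> strip" if "b \<in> {0, pi}" for x1 b using that by (auto simp: strip_def)
  have bcs: "u (x1, b) $ 3 = 0" "u3 (x1, b) $ 1 = 0" "u3 (x1, b) $ 2 = 0" "\<theta> (x1, b) = 0" if "b \<in> {0, pi}" for x1 b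
    using vbc tbc that hasd_d3[OF hasd_nth[OF hu] str[OF that], of 1 x1] hasd_d3[OF hasd_nth[OF hu] str[OF that], of 2 x1]
    by (auto simp: velocity_bc_def temperature_bc_def)
  have adm: "admfield w w1 w3"
    unfolding admfield_def
  proof (intro conjI hw ballI allI)
    fix x assume x: "x \<in> strip"
    show "fst (w1 x) $ 1 + fst (w3 x) $ 3 = 0"
      using dv[OF x] hasd_d1[OF hasd_nth[OF hu] x, of 1] hasd_d3[OF hasd_nth[OF hu] x, of 3]
      by (simp add: divergence_def w1_def w3_def)
  qed (auto simp: w_def bcs)
  define F where "F y = (P * R * \<theta> y) *\<^sub>R e3 - (P * S) *\<^sub>R cross3 e3 (u y) - advect u u y" for y
  \<comment> \<open>The same forcing written with the named derivatives, which are continuous on the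
    strip by construction; the two versions agree there.\<close>
  define F' where "F' y = (P * R * \<theta> y) *\<^sub>R e3 - (P * S) *\<^sub>R cross3 e3 (u y) - ((u y $ 1) *\<^sub>R u1 y + (u y $ 3) *\<^sub>R u3 y)" for y
  have FF': "F y = F' y" if "y \<in> strip" for y by (simp add: F_def F'_def advU[OF that])
  have blc: "bounded_linear (cross3 e3)"
    by (rule bounded_linear_cross3)
  have cF': "continuous_on strip F'"
    unfolding F'_def
    by (intro continuous_intros hasd_continuous[OF hu] hasd_continuous[OF ht] bounded_linear.continuous_on[OF blc])
  then have "continuous_on strip F"
    by (rule continuous_on_eq) (simp add: FF')
  then have FL: "F \<in> L2_space k1" by (rule continuous_L2)
  note G = leray[OF FL]
  have GL: "leray k1 F \<in> L2_space k1" using G(1) by (simp add: L2_sigma_def)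
  define lu where "lu x = P *\<^sub>R (u11 x + u33 x)" for x
  have luL: "lu \<in> L2_space k1"
    unfolding lu_def by (intro continuous_L2 continuous_intros hasd_continuous[OF hu1] hasd_continuous[OF hu3])
  define rt where "rt x = \<theta>11 x + \<theta>33 x + u x $ 3 - ((u x $ 1) *\<^sub>R \<theta>1 x + (u x $ 3) *\<^sub>R \<theta>3 x)" for x
  have crt: "continuous_on strip rt"
    unfolding rt_def by (intro continuous_intros hasd_continuous[OF hu] hasd_continuous[OF ht] hasd_continuous[OF ht1] hasd_continuous[OF ht3])
  have AEU: "AE x in mC. Ut x = lu x + leray k1 F x"
    using eqU
  proof (rule AE_mp, intro AE_I2 impI)
    fix x assume "x \<in> space mC" and e: "vector_derivative (\<lambda>s. fst (X s) x) (at t) = P *\<^sub>R laplacian u x +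
            leray k1 (\<lambda>y. (P * R * \<theta> y) *\<^sub>R e3 - (P * S) *\<^sub>R cross3 e3 (u y) - advect u u y) x"
    then have x: "x \<in> strip" using cell_subset_strip by auto
    show "Ut x = lu x + leray k1 F x"
      using e vector_derivative_at[OF Ut[OF x]] by (simp add: lu_def lapU[OF x] F_def[abs_def])
  qed
  have AET: "AE x in mC. Tt x = rt x"
    using eqT
  proof (rule AE_mp, intro AE_I2 impI)
    fix x assume "x \<in> space mC" and e: "vector_derivative (\<lambda>s. snd (X s) x) (at t) = laplacian \<theta> x + u x $ 3 - advect u \<theta> x"
    then have x: "x \<in> strip" using cell_subset_strip by auto
    show "Tt x = rt x"
      using e vector_derivative_at[OF Tt[OF x]] by (simp add: rt_def lapT[OF x] advT[OF x])
  qed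
  have "L2_inner k1 (\<lambda>x. (Ut x, Tt x)) v = weak_rhs R S P w w1 w3 v v1 v3"
    if v: "admfield v v1 v3" and vs: "(\<lambda>x. fst (v x)) \<in> L2_sigma k1" for v v1 v3
  proof -
    have vL: "v \<in> L2_space k1" by (rule hasd_L2(1)[OF admfield_hasd[OF v]])
    have vuL: "(\<lambda>x. fst (v x)) \<in> L2_space k1" using vs by (simp add: L2_sigma_def)
    have vtL: "(\<lambda>x. snd (v x)) \<in> L2_space k1" by (rule L2_bounded_linear[OF bounded_linear_snd vL])
    have F'L: "F' \<in> L2_space k1" by (rule continuous_L2[OF cF'])
    have "L2_inner k1 Ut (\<lambda>x. fst (v x)) = L2_inner k1 (\<lambda>x. lu x + leray k1 F x) (\<lambda>x. fst (v x))"
      using AEU by (intro L2_inner_cong_AE L2_measurable continuous_L2 cU L2_add luL GL vuL)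
    also have "\<dots> = L2_inner k1 lu (\<lambda>x. fst (v x)) + L2_inner k1 F (\<lambda>x. fst (v x))"
      by (simp add: L2_inner_add_left luL GL vuL G(2)[OF vs])
    also have "L2_inner k1 F (\<lambda>x. fst (v x)) = L2_inner k1 F' (\<lambda>x. fst (v x))"
      by (rule L2_inner_cong) (simp add: FF')
    also have "L2_inner k1 lu (\<lambda>x. fst (v x)) + \<dots> = L2_inner k1 (\<lambda>x. lu x + F' x) (\<lambda>x. fst (v x))"
      by (simp add: L2_inner_add_left luL F'L vuL)
    finally have U: "L2_inner k1 Ut (\<lambda>x. fst (v x)) = L2_inner k1 (\<lambda>x. lu x + F' x) (\<lambda>x. fst (v x))" .
    have T: "L2_inner k1 Tt (\<lambda>x. snd (v x)) = L2_inner k1 rt (\<lambda>x. snd (v x))"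
      using AET by (intro L2_inner_cong_AE L2_measurable continuous_L2 cT crt vtL)
    have "L2_inner k1 (\<lambda>x. (Ut x, Tt x)) v = L2_inner k1 (\<lambda>x. (lu x + F' x, rt x)) v"
      using U T by (simp add: L2_inner_Pair vL continuous_L2 cU cT crt L2_add luL F'L)
    also have "(\<lambda>x. (lu x + F' x, rt x)) = (\<lambda>x. Diff P ((u11 x, \<theta>11 x) + (u33 x, \<theta>33 x)) + Lin R S P (w x) - adv w w1 w3 x)"
      by (simp add: fun_eq_iff lu_def F'_def rt_def Diff_def Lin_def w_def w1_def w3_def adv_def)
    also have "L2_inner k1 \<dots> v = weak_rhs R S P w w1 w3 v v1 v3"
      by (rule weak_rhs_strong[OF hw hw1 hw3 v, symmetric]) (simp add: w3_def bcs)
    finally show ?thesis .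
  qed
  then show ?thesis unfolding fw using adm by blast
qed

text \<open>The gradients found at each time are collected into functions of t; at t \<le> 0 they
  carry no information.\<close>

lemma exact_solution_weak:
  assumes sol: "bc_solution R S P k1 X0 X"
  shows "\<exists>Wt W1 W3. continuous_on ({0<..} \<times> strip) (\<lambda>(t, x). fld (X t) x) \<and>
    continuous_on ({0<..} \<times> strip) (\<lambda>(t, x). Wt t x) \<and>
    (\<forall>t>0. \<forall>x\<in>strip. ((\<lambda>s. fld (X s) x) has_vector_derivative Wt t x) (at t)) \<and>
    (\<forall>t>0. admfield (fld (X t)) (W1 t) (W3 t) \<and>
      (\<forall>v v1 v3. admfield v v1 v3 \<longrightarrow> (\<lambda>x. fst (v x)) \<in> L2_sigma k1 \<longrightarrow>
        L2_inner k1 (Wt t) v = weak_rhs R S P (fld (X t)) (W1 t) (W3 t) v v1 v3))"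
proof -
  have sm: "smooth_on ({0<..} \<times> strip) (\<lambda>(t, x). fst (X t) x)" "smooth_on ({0<..} \<times> strip) (\<lambda>(t, x). snd (X t) x)"
    using sol unfolding bc_solution_def Let_def by auto
  have ck: "Ck_on (Suc 0) ({0<..} \<times> strip) (\<lambda>(t, x). fst (X t) x)" "Ck_on (Suc 0) ({0<..} \<times> strip) (\<lambda>(t, x). snd (X t) x)"
    using sm by (simp_all add: smooth_on_def del: Ck_on.simps)
  obtain Ut where Ut: "continuous_on ({0<..} \<times> strip) Ut"
    "\<And>t x. 0 < t \<Longrightarrow> x \<in> strip \<Longrightarrow> ((\<lambda>s. fst (X s) x) has_vector_derivative Ut (t, x)) (at t)"
    using Ck_time_derivative[OF ck(1)] by auto
  obtain Tt where Tt: "continuous_on ({0<..} \<times> strip) Tt"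
    "\<And>t x. 0 < t \<Longrightarrow> x \<in> strip \<Longrightarrow> ((\<lambda>s. snd (X s) x) has_vector_derivative Tt (t, x)) (at t)"
    using Ck_time_derivative[OF ck(2)] by auto
  have sl: "continuous_on strip (\<lambda>x. g (t, x))" if "continuous_on ({0<..} \<times> strip) g" "0 < t" for g :: "real \<times> point \<Rightarrow> 'c::euclidean_space" and t
    by (rule continuous_on_compose2[OF that(1)]) (use that(2) in \<open>auto intro!: continuous_intros\<close>)
  define Wt where "Wt t x = (Ut (t, x), Tt (t, x))" for t x
  have "\<forall>t. \<exists>w1 w3. 0 < t \<longrightarrow> admfield (fld (X t)) w1 w3 \<and>
    (\<forall>v v1 v3. admfield v v1 v3 \<longrightarrow> (\<lambda>x. fst (v x)) \<in> L2_sigma k1 \<longrightarrow>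
      L2_inner k1 (Wt t) v = weak_rhs R S P (fld (X t)) w1 w3 v v1 v3)"
    unfolding Wt_def[abs_def]
    using exact_solution_slice[OF sol _ Ut(2) Tt(2) sl[OF Ut(1)] sl[OF Tt(1)]] by blast
  then obtain W1 W3 where W: "\<forall>t>0. admfield (fld (X t)) (W1 t) (W3 t) \<and>
    (\<forall>v v1 v3. admfield v v1 v3 \<longrightarrow> (\<lambda>x. fst (v x)) \<in> L2_sigma k1 \<longrightarrow>
      L2_inner k1 (Wt t) v = weak_rhs R S P (fld (X t)) (W1 t) (W3 t) v v1 v3)"
    by metis
  have "continuous_on ({0<..} \<times> strip) (\<lambda>(t, x). fld (X t) x)"
    using continuous_on_Pair[OF Ck_on_continuous[OF ck(1)] Ck_on_continuous[OF ck(2)]]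
    by (simp add: fld_def split_beta)
  moreover have "continuous_on ({0<..} \<times> strip) (\<lambda>(t, x). Wt t x)"
    using continuous_on_Pair[OF Ut(1) Tt(1)] by (simp add: Wt_def split_beta)
  moreover have "\<forall>t>0. \<forall>x\<in>strip. ((\<lambda>s. fld (X s) x) has_vector_derivative Wt t x) (at t)"
    unfolding fld_def Wt_def by (intro allI impI ballI has_vector_derivative_Pair Ut Tt)
  ultimately show ?thesis using W by blast
qed

subsection \<open>The mode sets of the hierarchy\<close>

lemma wave_Suc: "wave (Suc (Suc n)) = next_wave (wave (Suc n))"
  by (simp add: wave_def)

lemma wave_pos: "fst (wave (Suc n)) \<ge> 1 \<and> snd (wave (Suc n)) \<ge> 1"
proof (induction n)
  case 0
  show ?case by (simp add: wave_def)
next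
  case (Suc n)
  then show ?case unfolding wave_Suc by (cases "wave (Suc n)") auto
qed

text \<open>After the initial (1,1), a wave vector with m1 = 1 has m3 \<ge> 2; so the adjoined mode
  (m3 - 1, 0) is never (0,0).\<close>

lemma wave_ge2: "fst (wave (Suc (Suc n))) \<ge> 2 \<or> snd (wave (Suc (Suc n))) \<ge> 2"
  unfolding wave_Suc using wave_pos[of n] by (cases "wave (Suc n)") auto

text \<open>Runs the enumeration backwards: (a, b) is preceded by (a + 1, b - 1) on the same
  diagonal, or by (1, a - 1) on the previous one when b = 1. The pair (a + b, b) decreases
  lexicographically.\<close>

lemma wave_surj: "a \<ge> 1 \<Longrightarrow> b \<ge> 1 \<Longrightarrow> \<exists>n. wave (Suc n) = (a, b)"
proof (induction "(a + b, b)" arbitrary: a b rule: wf_induct[OF wf_lex_prod[OF wf_less_than wf_less_than]])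
  case 1
  note IH = 1(1)
  show ?case
  proof (cases "b = 1")
    case True
    show ?thesis
    proof (cases "a = 1")
      case True
      then show ?thesis using \<open>b = 1\<close> by (intro exI[of _ 0]) (simp add: wave_def)
    next
      case False
      then have a: "a \<ge> 2" using 1 by simp
      have "\<exists>n. wave (Suc n) = (1, a - 1)"
        by (rule IH[rule_format, of "(1 + (a - 1), a - 1)" 1 "a - 1"]) (use a True in auto)
      then obtain n where "wave (Suc n) = (1, a - 1)" by blast
      then have "wave (Suc (Suc n)) = (a, b)" unfolding wave_Suc using a True by simp
      then show ?thesis by blast
    qed
  next
    case False
    then have b: "b \<ge> 2" using 1 by simp
    have "\<exists>n. wave (Suc n) = (a + 1, b - 1)"
      by (rule IH[rule_format, of "(a + 1 + (b - 1), b - 1)" "a + 1" "b - 1"]) (use b 1 in auto)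
    then obtain n where "wave (Suc n) = (a + 1, b - 1)" by blast
    then have "wave (Suc (Suc n)) = (a, b)" unfolding wave_Suc using b 1 by simp
    then show ?thesis by blast
  qed
qed

lemma M_sets_finite: "finite (M_u M)" "finite (M_w M)" "finite (M_theta M)"
proof -
  show "finite (M_u M)" by (induction M rule: M_u.induct) (simp_all add: Let_def split: prod.splits)
  show "finite (M_w M)" by (induction M rule: M_u.induct) (simp_all add: Let_def split: prod.splits)
  show "finite (M_theta M)" by (induction M rule: M_u.induct) (simp_all add: Let_def split: prod.splits)
qed

text \<open>The parity is what phase locking demands at m1 = 0: velocity modes then have phase 2,
  hence odd m3. For the temperature the phase is 1 and m3 is even.\<close>

lemma M_u_valid: "(a, b) \<in> M_u M \<Longrightarrow> b \<ge> 1 \<and> (a = 0 \<longrightarrow> odd b)"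
proof (induction M rule: M_u.induct)
  case (3 n)
  then show ?case
    using wave_pos[of "Suc n"] by (auto simp: Let_def split: prod.splits if_splits)
qed auto

lemma M_w_valid: "(a, b) \<in> M_w M \<Longrightarrow> (a, b) \<noteq> (0, 0) \<and> (a = 0 \<longrightarrow> odd b)"
proof (induction M rule: M_u.induct)
  case (3 n)
  then show ?case
    using wave_pos[of "Suc n"] wave_ge2[of n] by (auto simp: Let_def split: prod.splits if_splits)
qed auto

lemma M_theta_valid: "(a, b) \<in> M_theta M \<Longrightarrow> b \<ge> 1 \<and> (a = 0 \<longrightarrow> even b)"
proof (induction M rule: M_u.induct)
  case (3 n)
  then show ?case
    using wave_pos[of "Suc n"] by (auto simp: Let_def split: prod.splits if_splits)
qed auto

lemma M_sets_Suc: "M_u M \<subseteq> M_u (Suc M)" "M_w M \<subseteq> M_w (Suc M)" "M_theta M \<subseteq> M_theta (Suc M)"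
  by (cases M; auto simp: Let_def split: prod.splits)+

lemma M_sets_mono: "M \<le> M' \<Longrightarrow> M_u M \<subseteq> M_u M' \<and> M_w M \<subseteq> M_w M' \<and> M_theta M \<subseteq> M_theta M'"
  by (induction M' rule: dec_induct) (use M_sets_Suc in blast)+

lemma M_sets_positive: "a \<ge> 1 \<Longrightarrow> b \<ge> 1 \<Longrightarrow> \<exists>M. (a, b) \<in> M_u M \<and> (a, b) \<in> M_w M \<and> (a, b) \<in> M_theta M"
proof -
  assume "a \<ge> 1" "b \<ge> 1"
  then obtain n where n: "wave (Suc n) = (a, b)" using wave_surj by blast
  show ?thesis
  proof (cases n)
    case 0
    then have "a = 1" "b = 1" using n by (simp_all add: wave_def)
    then show ?thesis by (intro exI[of _ 1]) simp
  next
    case (Suc k)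
    then show ?thesis using n by (intro exI[of _ "Suc (Suc k)"]) (simp add: Let_def)
  qed
qed

lemma M_sets_axis:
  assumes "b \<ge> 1"
  shows "\<exists>M. (0, 2 * b - 1) \<in> M_u M \<and> (0, 2 * b - 1) \<in> M_w M \<and> (0, 2 * b) \<in> M_theta M"
    and "\<exists>M. (b, 0) \<in> M_w M"
proof -
  obtain n where n: "wave (Suc n) = (1, b)" using wave_surj[of 1 b] assms by auto
  show "\<exists>M. (0, 2 * b - 1) \<in> M_u M \<and> (0, 2 * b - 1) \<in> M_w M \<and> (0, 2 * b) \<in> M_theta M"
  proof (cases n)
    case 0
    then have "b = 1" using n by (simp add: wave_def)
    then show ?thesis by (intro exI[of _ 1]) simp
  next
    case (Suc k)
    then show ?thesis using n by (intro exI[of _ "Suc (Suc k)"]) (simp add: Let_def)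
  qed
  \<comment> \<open>The mode (m3 - 1, 0) is adjoined together with (1, m3), so (b, 0) enters with
    (1, b + 1).\<close>
  obtain n where n: "wave (Suc n) = (1, b + 1)" using wave_surj[of 1 "b + 1"] by auto
  then obtain k where "n = Suc k" using assms by (cases n) (auto simp: wave_def)
  then show "\<exists>M. (b, 0) \<in> M_w M" using n by (intro exI[of _ "Suc (Suc k)"]) (simp add: Let_def)
qed

definition HK :: "nat \<Rightarrow> (bool \<times> mode) set" where
  "HK M = {True} \<times> N_u_HKC M \<union> {False} \<times> N_theta_HKC M"

text \<open>All modes added to \<open>HK M\<close> have the wrong phase, so the locked part is still
  exactly that of the model. The bound M on both wave numbers keeps the set finite and increasing in
  M.\<close>

definition AA :: "nat \<Rightarrow> (bool \<times> mode) set" where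
  "AA M = HK M \<union> {i \<in> NN. \<not> locked_phase (snd i) \<and> kx i \<le> M \<and> kz i \<le> M}"

lemma HKC_sets: "finite (N_u_HKC M)" "finite (N_theta_HKC M)" "N_u_HKC M \<subseteq> N_u" "N_theta_HKC M \<subseteq> N_theta"
proof -
  have "N_u_HKC M \<subseteq> (\<lambda>((m1, m3), p, c). (m1, m3, p, c)) ` ((M_u M \<union> M_w M) \<times> {1, 2} \<times> {1, 2})"
    by (force simp: N_u_HKC_def image_iff)
  then show "finite (N_u_HKC M)" by (rule finite_subset) (simp add: M_sets_finite)
  have "N_theta_HKC M \<subseteq> (\<lambda>((m1, m3), p, c). (m1, m3, p, c)) ` (M_theta M \<times> {1, 2} \<times> {1, 2})"
    by (force simp: N_theta_HKC_def image_iff)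
  then show "finite (N_theta_HKC M)" by (rule finite_subset) (simp add: M_sets_finite)
  show "N_u_HKC M \<subseteq> N_u"
  proof
    fix n assume n: "n \<in> N_u_HKC M"
    obtain m1 m3 p c where e: "n = (m1, m3, p, c)" by (cases n) auto
    have p: "p = 1 \<or> p = 2" and l: "p mod 2 = (m1 + m3 + 1) mod 2"
      and c: "c = 1 \<and> (m1, m3) \<in> M_u M \<or> c = 2 \<and> (m1, m3) \<in> M_w M"
      using n unfolding e N_u_HKC_def by simp_all
    have o: "m1 = 0 \<Longrightarrow> odd m3" using c M_u_valid M_w_valid by blast
    have z: "(m1, m3) \<noteq> (0, 0)" using c M_u_valid[of m1 m3 M] M_w_valid[of m1 m3 M] by auto
    have c1: "c = 1 \<Longrightarrow> m3 \<ge> 1" using c M_u_valid[of m1 m3 M] by auto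
    have p0: "p = 2" if "m1 = 0" using o[OF that] l p that by presburger
    have c12: "c = 1 \<or> c = 2" using c by blast
    show "n \<in> N_u" unfolding e N_u_def using p p0 z c1 c12 by auto
  qed
  show "N_theta_HKC M \<subseteq> N_theta"
  proof
    fix n assume n: "n \<in> N_theta_HKC M"
    obtain m1 m3 p c where e: "n = (m1, m3, p, c)" by (cases n) auto
    have p: "p = 1 \<or> p = 2" and l: "p mod 2 = (m1 + m3 + 1) mod 2" and c: "c = 1" "(m1, m3) \<in> M_theta M"
      using n unfolding e N_theta_HKC_def by simp_all
    have o: "m1 = 0 \<Longrightarrow> even m3" "m3 \<ge> 1" using M_theta_valid[OF c(2)] by auto
    have p0: "p = 1" if "m1 = 0" using o(1)[OF that] l p that by presburger
    show "n \<in> N_theta" unfolding e N_theta_def using p p0 o c(1) by auto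
  qed
qed

lemma HK: "finite (HK M)" "HK M \<subseteq> NN"
proof -
  show "finite (HK M)" by (simp add: HK_def HKC_sets)
  show "HK M \<subseteq> NN" unfolding HK_def NN_def using HKC_sets(3,4)[of M] by blast
qed

lemma HK_locked: "i \<in> HK M \<Longrightarrow> locked_phase (snd i)"
  by (cases i) (auto simp: HK_def N_u_HKC_def N_theta_HKC_def simp del: locked_phase.simps)

lemma AA: "finite (AA M)" "AA M \<subseteq> NN" "HK M \<subseteq> AA M"
proof -
  have "{i \<in> NN. \<not> locked_phase (snd i) \<and> kx i \<le> M \<and> kz i \<le> M} \<subseteq> UNIV \<times> {..M} \<times> {..M} \<times> {..2} \<times> {..2}"
  proof
    fix i assume i: "i \<in> {i \<in> NN. \<not> locked_phase (snd i) \<and> kx i \<le> M \<and> kz i \<le> M}"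
    obtain b m1 m3 p c where e: "i = (b, m1, m3, p, c)" by (cases i) auto
    have "p \<le> 2" "c \<le> 2"
      using i N_u_phase_component[of m1 m3 p c] by (auto simp: e NN_def N_theta_def split: if_splits)
    then show "i \<in> UNIV \<times> {..M} \<times> {..M} \<times> {..2} \<times> {..2}"
      using i by (simp add: e)
  qed
  then have "finite {i \<in> NN. \<not> locked_phase (snd i) \<and> kx i \<le> M \<and> kz i \<le> M}"
    by (rule finite_subset) auto
  then show "finite (AA M)" by (simp add: AA_def HK)
  show "AA M \<subseteq> NN" "HK M \<subseteq> AA M" using HK by (auto simp: AA_def)
qed

lemma AA_unlocked: "i \<in> AA M - HK M \<Longrightarrow> \<not> locked_phase (snd i) \<and> i \<in> NN"
  by (auto simp: AA_def)

lemma AA_mono: "M \<le> M' \<Longrightarrow> AA M \<subseteq> AA M'"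
  using M_sets_mono[of M M'] by (auto simp: AA_def HK_def N_u_HKC_def N_theta_HKC_def)

text \<open>Locked modes with positive wave vector appear through the enumeration; on the axes the
  locking fixes the parity, and the adjoined modes run through precisely the values that it
  leaves.\<close>

lemma AA_cover:
  assumes "i \<in> NN"
  shows "\<exists>M. i \<in> AA M"
proof (cases "locked_phase (snd i)")
  case False
  then show ?thesis using assms by (intro exI[of _ "max (kx i) (kz i)"]) (auto simp: AA_def)
next
  case l: True
  obtain b m1 m3 p c where i: "i = (b, m1, m3, p, c)" by (cases i) auto
  have p: "p \<in> {1, 2}" using assms by (auto simp: i NN_def N_u_def N_theta_def split: if_splits)
  have lp: "p mod 2 = (m1 + m3 + 1) mod 2" using l by (simp add: i)
  show ?thesis
  proof (cases b)
    case True
    have n: "(m1, m3) \<noteq> (0, 0)" "m1 = 0 \<Longrightarrow> p = 2" "m3 = 0 \<Longrightarrow> c = 2" "c = 1 \<or> c = 2"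
      using assms True by (auto simp: i NN_def N_u_def split: if_splits)
    have "\<exists>M. c = 1 \<and> (m1, m3) \<in> M_u M \<or> c = 2 \<and> (m1, m3) \<in> M_w M"
    proof -
      consider "m1 \<ge> 1" "m3 \<ge> 1" | "m1 = 0" | "m1 \<ge> 1" "m3 = 0" by linarith
      then show ?thesis
      proof cases
        case 1
        then show ?thesis using M_sets_positive[of m1 m3] n(4) by blast
      next
        case 2
        then have "odd m3" using lp n(2) by (auto simp: mod_Suc split: if_splits)
        \<comment> \<open>The shift k + 1 matches the form 2 m3 - 1 with positive m3, in which odd
          modes are adjoined.\<close>
        then obtain k where k: "m3 = 2 * (k + 1) - 1" by (auto elim!: oddE)
        show ?thesis using M_sets_axis(1)[of "k + 1"] n(4) unfolding k 2 by auto
      next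
        case 3
        then show ?thesis using M_sets_axis(2)[of m1] n(3) by auto
      qed
    qed
    then show ?thesis using p lp True by (auto simp: i AA_def HK_def N_u_HKC_def)
  next
    case False
    have n: "m3 \<ge> 1" "m1 = 0 \<Longrightarrow> p = 1" "c = 1"
      using assms False by (auto simp: i NN_def N_theta_def split: if_splits)
    have "\<exists>M. (m1, m3) \<in> M_theta M"
    proof (cases "m1 = 0")
      case True
      then have "even m3" using lp n(2) by (auto simp: mod_Suc split: if_splits)
      then obtain k where k: "m3 = 2 * k" by (auto elim!: evenE)
      then show ?thesis using M_sets_axis(1)[of k] n(1) True by auto
    next
      case False
      then show ?thesis using M_sets_positive[of m1 m3] n(1) by auto
    qed
    then show ?thesis using p lp False n(3) by (auto simp: i AA_def HK_def N_theta_HKC_def)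
  qed
qed

end

section \<open>Coefficients of finite independent families, and reflection of integrals\<close>

lemma coefficients_tendsto_zero:
  fixes e :: "'n \<Rightarrow> 'x \<Rightarrow> real" and c :: "'s \<Rightarrow> 'n \<Rightarrow> real"
  assumes "finite A"
    and "\<And>k. (\<forall>x\<in>S. (\<Sum>n\<in>A. k n * e n x) = 0) \<Longrightarrow> \<forall>n\<in>A. k n = 0"
    and "\<And>x. x \<in> S \<Longrightarrow> ((\<lambda>s. \<Sum>n\<in>A. c s n * e n x) \<longlongrightarrow> 0) F"
  shows "\<forall>n\<in>A. ((\<lambda>s. c s n) \<longlongrightarrow> 0) F"
  using assms
proof (induction A arbitrary: e rule: finite_induct)
  case (insert m B)
  have "\<exists>x\<in>S. e m x \<noteq> 0"
  proof (rule ccontr)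
    assume z: "\<not> ?thesis"
    have "(\<Sum>n\<in>B. (if n = m then 1 else 0) * e n x) = 0" for x
      using insert.hyps by (intro sum.neutral) auto
    then have "\<forall>x\<in>S. (\<Sum>n\<in>insert m B. (if n = m then 1 else 0) * e n x) = 0"
      using insert.hyps z by simp
    from insert.prems(1)[OF this] show False by simp
  qed
  then obtain x0 where x0: "x0 \<in> S" "e m x0 \<noteq> 0" by blast
  \<comment> \<open>Gaussian elimination: subtracting multiples of \<open>e m\<close> makes all
    other functions vanish at x0. The new family is still independent, and its combinations arise
    from the old ones at x and at x0.\<close>
  define k where "k n = e n x0 / e m x0" for n
  define e' where "e' n x = e n x - k n * e m x" for n x
  have IH: "\<forall>n\<in>B. ((\<lambda>s. c s n) \<longlongrightarrow> 0) F"
  proof (rule insert.IH[of e'])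
    fix l assume z: "\<forall>x\<in>S. (\<Sum>n\<in>B. l n * e' n x) = 0"
    define l' where "l' n = (if n = m then - (\<Sum>n\<in>B. l n * k n) else l n)" for n
    have "(\<Sum>n\<in>insert m B. l' n * e n x) = (\<Sum>n\<in>B. l n * e' n x)" for x
    proof -
      have "(\<Sum>n\<in>B. l' n * e n x) = (\<Sum>n\<in>B. l n * e n x)"
        using insert.hyps by (intro sum.cong) (auto simp: l'_def)
      then have "(\<Sum>n\<in>insert m B. l' n * e n x) = - (\<Sum>n\<in>B. l n * k n) * e m x + (\<Sum>n\<in>B. l n * e n x)"
        using insert.hyps by (simp add: l'_def)
      then show ?thesis
        by (simp add: e'_def algebra_simps sum_subtractf sum_distrib_left)
    qed
    with z insert.prems(1)[of l'] have "\<forall>n\<in>insert m B. l' n = 0" by simp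
    then show "\<forall>n\<in>B. l n = 0" using insert.hyps by (metis insertCI l'_def)
  next
    fix x assume x: "x \<in> S"
    have "(\<Sum>n\<in>B. c s n * e' n x) = (\<Sum>n\<in>insert m B. c s n * e n x) - (e m x / e m x0) * (\<Sum>n\<in>insert m B. c s n * e n x0)" for s
    proof -
      have "(e m x / e m x0) * (\<Sum>n\<in>insert m B. c s n * e n x0) = c s m * e m x + (\<Sum>n\<in>B. c s n * (k n * e m x))"
        using insert.hyps x0 by (simp add: distrib_left sum_distrib_left k_def field_simps)
      then show ?thesis
        using insert.hyps by (simp add: e'_def right_diff_distrib sum_subtractf)
    qed
    moreover have "((\<lambda>s. (\<Sum>n\<in>insert m B. c s n * e n x) - (e m x / e m x0) * (\<Sum>n\<in>insert m B. c s n * e n x0)) \<longlongrightarrow> 0 - (e m x / e m x0) * 0) F"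
      by (intro tendsto_intros insert.prems(2) x x0(1))
    ultimately show "((\<lambda>s. \<Sum>n\<in>B. c s n * e' n x) \<longlongrightarrow> 0) F" by simp
  qed
  have "c s m = ((\<Sum>n\<in>insert m B. c s n * e n x0) - (\<Sum>n\<in>B. c s n * e n x0)) / e m x0" for s
    using insert.hyps x0 by simp
  moreover have "((\<lambda>s. ((\<Sum>n\<in>insert m B. c s n * e n x0) - (\<Sum>n\<in>B. c s n * e n x0)) / e m x0) \<longlongrightarrow>
     (0 - (\<Sum>n\<in>B. 0 * e n x0)) / e m x0) F"
    using IH by (intro tendsto_intros insert.prems(2) x0) auto
  ultimately have "((\<lambda>s. c s m) \<longlongrightarrow> 0) F" by simp
  with IH show ?case by simp
qed simp

lemma integral_reflect_interval:
  fixes g :: "real \<Rightarrow> real"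
  assumes "continuous_on {a..b} g"
  shows "integral {a..b} (\<lambda>s. g (a + b - s)) = integral {a..b} g"
proof -
  have "(g has_integral integral {a..b} g) (cbox a b)"
    using integrable_continuous_real[OF assms] by (simp add: has_integral_iff)
  from has_integral_affinity[OF this, of "-1" "a + b"]
  have "((\<lambda>s. g (a + b - s)) has_integral integral {a..b} g) ((\<lambda>x. a + b - x) ` {a..b})"
    by (simp add: algebra_simps)
  moreover have "(\<lambda>x. a + b - x) ` {a..b} = {a..b}"
    by (auto simp: image_iff intro: bexI[of _ "a + b - x" for x])
  ultimately show ?thesis by (simp add: integral_unique)
qed

context channel
begin

subsection \<open>The phase-locking symmetry\<close>

text \<open>The fixed point is (pi / (2 k1), pi / 2). Reflecting x1 in a quarter of the period, and
  not in its half, produces the factor (-1)^m1; with (-1)^m3 from x3 this detects the parity of m1 +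
  m3.\<close>

definition rot :: "point \<Rightarrow> point" where
  "rot x = (pi / k1 - fst x, pi - snd x)"

text \<open>The map does not preserve the cell. The left half of each horizontal line is reflected
  onto itself, while the image of the right half has to be moved by one period before it is a
  reflection too.\<close>

lemma LINT_rot:
  fixes h :: "point \<Rightarrow> real"
  assumes c: "continuous_on strip h" and per: "periodic_x1 k1 h"
  shows "(LINT x|mC. h (rot x)) = (LINT x|mC. h x)"
proof -
  define L where "L = 2 * pi / k1"
  have L: "0 < L" "pi / k1 = L / 2" using period_pos by (simp_all add: L_def)
  have crot: "continuous_on strip (\<lambda>x. h (rot x))"
    unfolding rot_def
    by (rule continuous_on_compose2[OF c]) (auto intro!: continuous_intros simp: strip_def)
  have inner: "integral {0..L} (\<lambda>s. h (L / 2 - s, y)) = integral {0..L} (\<lambda>s. h (s, y))" if y: "y \<in> {0..pi}" for y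
  proof -
    have g: "continuous_on A (\<lambda>s. h (s, y))" for A
      by (rule continuous_on_compose2[OF c]) (use y in \<open>auto intro!: continuous_intros simp: strip_def\<close>)
    have g': "continuous_on A (\<lambda>s. h (L / 2 - s, y))" for A
      by (rule continuous_on_compose2[OF c]) (use y in \<open>auto intro!: continuous_intros simp: strip_def\<close>)
    have "integral {0..L} (\<lambda>s. h (L / 2 - s, y)) = integral {0..L/2} (\<lambda>s. h (L / 2 - s, y)) + integral {L/2..L} (\<lambda>s. h (L / 2 - s, y))"
      using L by (intro Henstock_Kurzweil_Integration.integral_combine[symmetric] integrable_continuous_real g') auto
    also have "integral {0..L/2} (\<lambda>s. h (L / 2 - s, y)) = integral {0..L/2} (\<lambda>s. h (s, y))"
      using integral_reflect_interval[OF g, of 0 "L / 2"] by simp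
    also have "integral {L/2..L} (\<lambda>s. h (L / 2 - s, y)) = integral {L/2..L} (\<lambda>s. h (L / 2 + L - s, y))"
    proof (rule Henstock_Kurzweil_Integration.integral_cong)
      fix s
      have "h (L / 2 - s + L, y) = h (L / 2 - s, y)"
        using per y unfolding periodic_x1_def L_def by blast
      then show "h (L / 2 - s, y) = h (L / 2 + L - s, y)" by (simp add: algebra_simps)
    qed
    also have "\<dots> = integral {L/2..L} (\<lambda>s. h (s, y))"
      by (rule integral_reflect_interval[OF g])
    also have "integral {0..L/2} (\<lambda>s. h (s, y)) + integral {L/2..L} (\<lambda>s. h (s, y)) = integral {0..L} (\<lambda>s. h (s, y))"
      using L by (intro Henstock_Kurzweil_Integration.integral_combine integrable_continuous_real g) auto
    finally show ?thesis .
  qed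
  have "(LINT x|mC. h (rot x)) = integral {0..pi} (\<lambda>x3. integral {0..L} (\<lambda>x1. h (L / 2 - x1, pi - x3)))"
    unfolding LINT_iterated(2)[OF crot] by (simp add: rot_def L L_def[symmetric])
  also have "\<dots> = integral {0..pi} (\<lambda>x3. integral {0..L} (\<lambda>x1. h (x1, pi - x3)))"
    by (intro Henstock_Kurzweil_Integration.integral_cong inner) auto
  also have "\<dots> = integral {0..pi} (\<lambda>x3. integral {0..L} (\<lambda>x1. h (x1, x3)))"
    using integral_reflect_interval[OF continuous_on_integral_x1[OF c]] by (simp add: L_def)
  also have "\<dots> = (LINT x|mC. h x)"
    unfolding LINT_iterated(2)[OF c] by (simp add: L_def)
  finally show ?thesis .
qed

lemma L2_inner_odd:
  fixes f g :: "point \<Rightarrow> 'b::euclidean_space"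
  assumes "continuous_on strip f" "continuous_on strip g" "periodic_x1 k1 f" "periodic_x1 k1 g"
    and odd: "\<And>x. f (rot x) \<bullet> g (rot x) = - (f x \<bullet> g x)"
  shows "L2_inner k1 f g = 0"
proof -
  have "continuous_on strip (\<lambda>x. f x \<bullet> g x)" "periodic_x1 k1 (\<lambda>x. f x \<bullet> g x)"
    using assms by (auto intro: continuous_intros simp: periodic_x1_def)
  from LINT_rot[OF this] show ?thesis by (simp add: odd L2_inner_def)
qed

lemma trig_rot:
  "trig (k1 * real m) (real n) a b c d (rot x) = trig (k1 * real m) (real n) ((-1) ^ (m + n) *\<^sub>R a)
     (- ((-1) ^ (m + n) *\<^sub>R b)) (- ((-1) ^ (m + n) *\<^sub>R c)) ((-1) ^ (m + n) *\<^sub>R d) x"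
proof -
  have e: "k1 * real m * (pi / k1 - s) = real m * pi - k1 * real m * s" "real n * (pi - s) = real n * pi - real n * s" for s
    using k1_pos by (simp_all add: field_simps)
  have "cos (k1 * real m * (pi / k1 - s)) = (-1) ^ m * cos (k1 * real m * s)"
    "sin (k1 * real m * (pi / k1 - s)) = - ((-1) ^ m * sin (k1 * real m * s))"
    "cos (real n * (pi - s)) = (-1) ^ n * cos (real n * s)"
    "sin (real n * (pi - s)) = - ((-1) ^ n * sin (real n * s))" for s
    unfolding e cos_diff sin_diff cos_npi sin_npi by simp_all
  then show ?thesis
    by (simp add: trig_def rot_def power_add mult_ac)
qed

text \<open>Phase 2 fields get the factor (-1)^(m1 + m3). Phase 1 fields consist of cos sin and sin
  cos and get one sign more. The outcome is -1 exactly for locked modes, and the chain rule adds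
  another sign to the derivatives.\<close>

lemma ebas_rot:
  assumes i: "i \<in> NN"
  defines "\<sigma> \<equiv> (if locked_phase (snd i) then - 1 else 1 :: real)"
  shows "ebas i (rot x) = \<sigma> *\<^sub>R ebas i x" "ebas1 i (rot x) = (- \<sigma>) *\<^sub>R ebas1 i x" "ebas3 i (rot x) = (- \<sigma>) *\<^sub>R ebas3 i x"
proof -
  obtain b m1 m3 p c where e: "i = (b, m1, m3, p, c)" by (cases i) auto
  define \<epsilon> :: real where "\<epsilon> = (-1) ^ (m1 + m3)"
  have p: "p = 1 \<or> p = 2" using i by (auto simp: e NN_def N_u_def N_theta_def split: if_splits)
  have s: "\<sigma> = (if p = 1 then - \<epsilon> else \<epsilon>)"
    using p by (auto simp: \<sigma>_def \<epsilon>_def e minus_one_power_iff mod_Suc even_iff_mod_2_eq_zero odd_iff_mod_2_eq_one simp del: add_is_0 split: if_splits)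
  have z: "p = 1 \<Longrightarrow> cA i = 0 \<and> cD i = 0" "p \<noteq> 1 \<Longrightarrow> cB i = 0 \<and> cC i = 0"
    by (auto simp: e cA_def cB_def cC_def cD_def)
  show "ebas i (rot x) = \<sigma> *\<^sub>R ebas i x"
    unfolding ebas_def trig_rot trig_scaleR using z s by (cases "p = 1") (simp_all add: e \<epsilon>_def)
  show "ebas1 i (rot x) = (- \<sigma>) *\<^sub>R ebas1 i x"
    unfolding ebas1_def trig_rot trig_scaleR using z s by (cases "p = 1") (simp_all add: e \<epsilon>_def)
  show "ebas3 i (rot x) = (- \<sigma>) *\<^sub>R ebas3 i x"
    unfolding ebas3_def trig_rot trig_scaleR using z s by (cases "p = 1") (simp_all add: e \<epsilon>_def)
qed

definition comb :: "(bool \<times> mode) set \<Rightarrow> (bool \<times> mode \<Rightarrow> real) \<Rightarrow> (bool \<times> mode \<Rightarrow> point \<Rightarrow> (real^3) \<times> real) \<Rightarrow> point \<Rightarrow> (real^3) \<times> real" where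
  "comb A a e = (\<lambda>x. \<Sum>i\<in>A. a i *\<^sub>R e i x)"

lemma admfield_comb: "admfield (comb A a ebas) (comb A a ebas1) (comb A a ebas3)"
  unfolding comb_def by (intro admfield_sum admfield_scaleR admfield_ebas)

lemma hasd_comb: "hasd (comb A a ebas) (comb A a ebas1) (comb A a ebas3)"
  by (rule admfield_hasd[OF admfield_comb])

lemma periodic_ebas: "periodic_x1 k1 (ebas i)" "periodic_x1 k1 (ebas1 i)" "periodic_x1 k1 (ebas3 i)"
  unfolding ebas_def ebas1_def ebas3_def by (rule periodic_trig)+

lemma periodic_comb: "(\<And>i. periodic_x1 k1 (e i)) \<Longrightarrow> periodic_x1 k1 (comb A a e)"
  by (simp add: periodic_x1_def comb_def)

text \<open>Every pairing has an odd integrand. For the nonlinear term this rests on the fact that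
  an odd field has an even gradient, so that the advection of an odd field by itself is odd
  again.\<close>

lemma weak_rhs_unlocked:
  assumes A: "\<And>i. i \<in> A \<Longrightarrow> i \<in> NN \<and> locked_phase (snd i)" and j: "j \<in> NN" "\<not> locked_phase (snd j)"
  shows "weak_rhs R S P (comb A a ebas) (comb A a ebas1) (comb A a ebas3) (ebas j) (ebas1 j) (ebas3 j) = 0"
proof -
  define w w1 w3 where "w = comb A a ebas" and "w1 = comb A a ebas1" and "w3 = comb A a ebas3"
  note hw = hasd_comb[of A a, folded w_def w1_def w3_def]
  note c = hasd_continuous[OF hw] hasd_continuous[OF hasd_ebas[of j]]
  have per: "periodic_x1 k1 w" "periodic_x1 k1 w1" "periodic_x1 k1 w3"
    unfolding w_def w1_def w3_def by (intro periodic_comb periodic_ebas)+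
  have r: "w (rot x) = - w x" "w1 (rot x) = w1 x" "w3 (rot x) = w3 x" for x
    unfolding w_def w1_def w3_def comb_def using A by (simp_all add: ebas_rot flip: sum_negf)
  have rj: "ebas j (rot x) = ebas j x" "ebas1 j (rot x) = - ebas1 j x" "ebas3 j (rot x) = - ebas3 j x" for x
    using ebas_rot[OF j(1), of x] j(2) by simp_all
  note lin = linear_neg[OF bounded_linear.linear[OF bounded_linear_Lin[of R S P]]]
  have cL: "continuous_on strip (\<lambda>x. Diff P (w1 x))" "continuous_on strip (\<lambda>x. Diff P (w3 x))" "continuous_on strip (\<lambda>x. Lin R S P (w x))"
    by (intro bounded_linear.continuous_on[OF bounded_linear_Diff] bounded_linear.continuous_on[OF bounded_linear_Lin] c)+
  have "L2_inner k1 (\<lambda>x. Diff P (w1 x)) (ebas1 j) = 0" "L2_inner k1 (\<lambda>x. Diff P (w3 x)) (ebas3 j) = 0"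
    "L2_inner k1 (\<lambda>x. Lin R S P (w x)) (ebas j) = 0"
    using per by (intro L2_inner_odd cL c periodic_ebas; simp add: r rj lin periodic_x1_def)+
  moreover have "L2_inner k1 (adv w w1 w3) (ebas j) = 0"
    using per by (intro L2_inner_odd continuous_adv c periodic_ebas)
      (simp_all add: adv_def r rj periodic_x1_def inner_add_left inner_diff_left)
  ultimately show ?thesis by (simp add: weak_rhs_def w_def w1_def w3_def)
qed

subsection \<open>The hierarchy as a Galerkin system\<close>

lemma laplacian_hasd:
  assumes f: "hasd f f1 f3" and f1: "hasd f1 f11 f13" and f3: "hasd f3 f31 f33" and x: "x \<in> strip"
  shows "laplacian f x = f11 x + f33 x"
proof -
  have "hasd (d1 f) f11 f13" "hasd (d3 f) f31 f33"
    using hasd_d1[OF f] hasd_d3[OF f] by (auto intro: hasd_cong[OF f1] hasd_cong[OF f3])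
  then show ?thesis unfolding laplacian_def using hasd_d1 hasd_d3 x by metis
qed

lemma sum_HK: "(\<Sum>i\<in>HK M. f i) = (\<Sum>n\<in>N_u_HKC M. f (True, n)) + (\<Sum>n\<in>N_theta_HKC M. f (False, n))"
  for f :: "bool \<times> mode \<Rightarrow> 'c::comm_monoid_add"
proof -
  have "HK M = Pair True ` N_u_HKC M \<union> Pair False ` N_theta_HKC M" by (auto simp: HK_def)
  moreover have "Pair True ` N_u_HKC M \<inter> Pair False ` N_theta_HKC M = {}" by auto
  ultimately show ?thesis
    using HKC_sets by (simp add: sum.union_disjoint sum.reindex inj_on_def)
qed

lemma proj_u_inner:
  assumes G: "G \<in> L2_space k1"
  shows "\<exists>c. proj_u k1 M G = (\<lambda>x. \<Sum>n\<in>N_u_HKC M. c n *\<^sub>R u_basis k1 n x)"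
    and "proj_u k1 M G \<in> L2_space k1"
    and "n \<in> N_u_HKC M \<Longrightarrow> L2_inner k1 (proj_u k1 M G) (u_basis k1 n) = L2_inner k1 G (u_basis k1 n)"
proof -
  note o = orthonormal_subset[OF orthonormal_u_basis HKC_sets(3)[of M]] and fin = HKC_sets(1)[of M]
  note p = orth_proj_span[OF o fin G, folded span_u_def proj_u_def]
  show ex: "\<exists>c. proj_u k1 M G = (\<lambda>x. \<Sum>n\<in>N_u_HKC M. c n *\<^sub>R u_basis k1 n x)"
    using p by (auto simp: span_u_def)
  then show L: "proj_u k1 M G \<in> L2_space k1"
    using L2_combination[OF o fin] by auto
  assume n: "n \<in> N_u_HKC M"
  have "u_basis k1 n \<in> span_u k1 M"
    unfolding span_u_def
  proof (intro CollectI exI conjI)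
    show "u_basis k1 n = (\<lambda>x. \<Sum>m\<in>N_u_HKC M. (if m = n then 1 else 0) *\<^sub>R u_basis k1 m x)"
    proof
      fix x
      have "(\<Sum>m\<in>N_u_HKC M. (if m = n then 1 else 0) *\<^sub>R u_basis k1 m x) = (\<Sum>m\<in>N_u_HKC M. if m = n then u_basis k1 m x else 0)"
        by (intro sum.cong) auto
      then show "u_basis k1 n x = (\<Sum>m\<in>N_u_HKC M. (if m = n then 1 else 0) *\<^sub>R u_basis k1 m x)"
        using n fin by simp
    qed
  qed simp
  then show "L2_inner k1 (proj_u k1 M G) (u_basis k1 n) = L2_inner k1 G (u_basis k1 n)"
    using p L2_inner_diff_left[OF G L orthonormal_L2[OF o n]] by auto
qed

lemma proj_theta_inner:
  assumes G: "G \<in> L2_space k1"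
  shows "\<exists>c. proj_theta k1 M G = (\<lambda>x. \<Sum>n\<in>N_theta_HKC M. c n *\<^sub>R theta_basis k1 n x)"
    and "proj_theta k1 M G \<in> L2_space k1"
    and "n \<in> N_theta_HKC M \<Longrightarrow> L2_inner k1 (proj_theta k1 M G) (theta_basis k1 n) = L2_inner k1 G (theta_basis k1 n)"
proof -
  note o = orthonormal_subset[OF orthonormal_theta_basis HKC_sets(4)[of M]] and fin = HKC_sets(2)[of M]
  note p = orth_proj_span[OF o fin G, folded span_theta_def proj_theta_def]
  show ex: "\<exists>c. proj_theta k1 M G = (\<lambda>x. \<Sum>n\<in>N_theta_HKC M. c n *\<^sub>R theta_basis k1 n x)"
    using p by (auto simp: span_theta_def)
  then show L: "proj_theta k1 M G \<in> L2_space k1"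
    using L2_combination[OF o fin] by auto
  assume n: "n \<in> N_theta_HKC M"
  have "theta_basis k1 n \<in> span_theta k1 M"
    unfolding span_theta_def
  proof (intro CollectI exI conjI)
    show "theta_basis k1 n = (\<lambda>x. \<Sum>m\<in>N_theta_HKC M. (if m = n then 1 else 0) *\<^sub>R theta_basis k1 m x)"
    proof
      fix x
      have "(\<Sum>m\<in>N_theta_HKC M. (if m = n then 1 else 0) *\<^sub>R theta_basis k1 m x) = (\<Sum>m\<in>N_theta_HKC M. if m = n then theta_basis k1 m x else 0)"
        by (intro sum.cong) auto
      then show "theta_basis k1 n x = (\<Sum>m\<in>N_theta_HKC M. (if m = n then 1 else 0) *\<^sub>R theta_basis k1 m x)"
        using n fin by simp
    qed
  qed simp
  then show "L2_inner k1 (proj_theta k1 M G) (theta_basis k1 n) = L2_inner k1 G (theta_basis k1 n)"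
    using p L2_inner_diff_left[OF G L orthonormal_L2[OF o n]] by auto
qed

lemma L2_inner_lincomb4:
  fixes f1 f2 f3 f4 v :: "point \<Rightarrow> 'b::euclidean_space"
  assumes "f1 \<in> L2_space k1" "f2 \<in> L2_space k1" "f3 \<in> L2_space k1" "f4 \<in> L2_space k1" "v \<in> L2_space k1"
  shows "L2_inner k1 (\<lambda>x. a *\<^sub>R f1 x + b *\<^sub>R f2 x - c *\<^sub>R f3 x - f4 x) v
    = a * L2_inner k1 f1 v + b * L2_inner k1 f2 v - c * L2_inner k1 f3 v - L2_inner k1 f4 v"
proof -
  note s = L2_scaleR[OF assms(1), of a] L2_scaleR[OF assms(2), of b] L2_scaleR[OF assms(3), of c]
  show ?thesis
    using L2_inner_diff_left[OF L2_diff[OF L2_add[OF s(1,2)] s(3)] assms(4,5)]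
      L2_inner_diff_left[OF L2_add[OF s(1,2)] s(3) assms(5)] L2_inner_add_left[OF s(1,2) assms(5)]
    by (simp only: L2_inner_scaleR_left)
qed

lemma orthonormal_cell_independent:
  assumes "finite A" "A \<subseteq> NN" and "\<And>x. x \<in> cell k1 \<Longrightarrow> comb A c ebas x = 0" and "i \<in> A"
  shows "c i = 0"
proof -
  have "c i = L2_inner k1 (comb A c ebas) (ebas i)"
    unfolding comb_def by (rule combination_coeff[OF orthonormal_subset[OF orthonormal_ebas assms(2)] assms(1,4), symmetric])
  also have "\<dots> = L2_inner k1 (\<lambda>x. 0) (ebas i)"
    unfolding L2_inner_def by (rule Bochner_Integration.integral_cong) (auto simp: assms(3))
  finally show ?thesis by (simp add: L2_inner_def)
qed

text \<open>The model equations hold pointwise in x. Difference quotients minus the claimed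
  derivative tend to zero at each point of the cell, and the basis fields are independent there, so
  the coefficients converge.\<close>

lemma coefficient_derivative:
  assumes A: "finite A" "A \<subseteq> NN"
    and d: "\<And>x. x \<in> cell k1 \<Longrightarrow> ((\<lambda>s. comb A (a s) ebas x) has_vector_derivative comb A b ebas x) (at t within U)"
    and i: "i \<in> A"
  shows "((\<lambda>s. a s i) has_real_derivative b i) (at t within U)"
proof -
  \<comment> \<open>Vector-valued fields become scalar functions of a point and a direction, as
    \<open>coefficients_tendsto_zero\<close> expects.\<close>
  define e where "e n z = ebas n (fst z) \<bullet> snd z" for n and z :: "point \<times> (real^3) \<times> real"
  have ce: "(\<Sum>n\<in>A. k n * e n (x, z)) = comb A k ebas x \<bullet> z" for k x z
    by (simp add: e_def comb_def inner_sum_left)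
  have "\<forall>n\<in>A. ((\<lambda>s. (a s n - a t n) / (s - t) - b n) \<longlongrightarrow> 0) (at t within U)"
  proof (rule coefficients_tendsto_zero[OF A(1), where S = "cell k1 \<times> Basis" and e = e])
    fix k assume z: "\<forall>x\<in>cell k1 \<times> Basis. (\<Sum>n\<in>A. k n * e n x) = 0"
    have "comb A k ebas x = 0" if "x \<in> cell k1" for x
    proof (rule euclidean_eqI)
      fix \<beta> :: "(real^3) \<times> real" assume "\<beta> \<in> Basis"
      then have "(\<Sum>n\<in>A. k n * e n (x, \<beta>)) = 0" using z that by blast
      then show "comb A k ebas x \<bullet> \<beta> = 0 \<bullet> \<beta>" unfolding ce by simp
    qed
    then show "\<forall>n\<in>A. k n = 0" using orthonormal_cell_independent[OF A] by blast
  next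
    fix z assume "z \<in> cell k1 \<times> (Basis :: ((real^3) \<times> real) set)"
    then obtain x \<beta> where z: "z = (x, \<beta>)" "x \<in> cell k1" by auto
    have eq: "(\<Sum>n\<in>A. ((a s n - a t n) / (s - t) - b n) * e n z)
      = (comb A (a s) ebas x \<bullet> \<beta> - comb A (a t) ebas x \<bullet> \<beta>) / (s - t) - comb A b ebas x \<bullet> \<beta>" for s
      unfolding ce[symmetric] z(1)
      by (simp add: left_diff_distrib sum_subtractf sum_divide_distrib diff_divide_distrib)
    have "((\<lambda>s. comb A (a s) ebas x \<bullet> \<beta>) has_vector_derivative comb A b ebas x \<bullet> \<beta>) (at t within U)"
      by (rule bounded_linear.has_vector_derivative[OF bounded_linear_inner_left d[OF z(2)]])
    then have "((\<lambda>s. comb A (a s) ebas x \<bullet> \<beta>) has_real_derivative comb A b ebas x \<bullet> \<beta>) (at t within U)"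
      by (simp add: has_real_derivative_iff_has_vector_derivative)
    then have "((\<lambda>s. (comb A (a s) ebas x \<bullet> \<beta> - comb A (a t) ebas x \<bullet> \<beta>) / (s - t)) \<longlongrightarrow> comb A b ebas x \<bullet> \<beta>) (at t within U)"
      unfolding has_field_derivative_iff .
    from tendsto_diff[OF this tendsto_const[of "comb A b ebas x \<bullet> \<beta>"]]
    show "((\<lambda>s. \<Sum>n\<in>A. ((a s n - a t n) / (s - t) - b n) * e n z) \<longlongrightarrow> 0) (at t within U)"
      unfolding eq by simp
  qed
  with i have "((\<lambda>s. (a s i - a t i) / (s - t) - b i) \<longlongrightarrow> 0) (at t within U)" by blast
  then have "((\<lambda>s. (a s i - a t i) / (s - t)) \<longlongrightarrow> b i) (at t within U)"
    using LIM_zero_iff by blast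
  then show ?thesis unfolding has_field_derivative_iff .
qed


lemma comb_HK: "comb (HK M) k ebas x =
   (\<Sum>n\<in>N_u_HKC M. k (True, n) *\<^sub>R u_basis k1 n x, \<Sum>n\<in>N_theta_HKC M. k (False, n) *\<^sub>R theta_basis k1 n x)"
  unfolding comb_def sum_HK ebas_u ebas_theta by (simp add: prod_eq_iff fst_sum snd_sum)

text \<open>Both sides are combinations of the model's basis fields, so it suffices to compare
  coefficients, that is, pairings with basis fields; in these the projections disappear and Green's
  formula yields the weak form.\<close>

lemma hkc_rhs:
  fixes R S P :: real
  assumes u: "\<And>x. fst Z x = fst (comb (HK M) a ebas x)" and \<theta>: "\<And>x. snd Z x = snd (comb (HK M) a ebas x)"
  defines "W \<equiv> \<lambda>i. weak_rhs R S P (comb (HK M) a ebas) (comb (HK M) a ebas1) (comb (HK M) a ebas3) (ebas i) (ebas1 i) (ebas3 i)"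
  assumes x: "x \<in> strip"
  shows "(P *\<^sub>R laplacian (fst Z) x
             + (P * R) *\<^sub>R proj_u k1 M (\<lambda>y. snd Z y *\<^sub>R e3) x
             - (P * S) *\<^sub>R proj_u k1 M (\<lambda>y. cross3 e3 (fst Z y)) x
             - proj_u k1 M (advect (fst Z) (fst Z)) x,
          laplacian (snd Z) x + proj_theta k1 M (\<lambda>y. fst Z y $ 3) x - proj_theta k1 M (advect (fst Z) (snd Z)) x)
    = comb (HK M) W ebas x"
proof -
  let ?H = "HK M"
  define w w1 w3 where "w = comb ?H a ebas" and "w1 = comb ?H a ebas1" and "w3 = comb ?H a ebas3"
  define lam where "lam i = a i * - (wave_norm k1 (kx i) (kz i))\<^sup>2" for i
  note hw = hasd_comb[of ?H a, folded w_def w1_def w3_def]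
  obtain v11 v13 v31 v33 where v: "\<And>i. hasd (ebas1 i) (v11 i) (v13 i)" "\<And>i. hasd (ebas3 i) (v31 i) (v33 i)"
    "\<And>i x. v11 i x + v33 i x = (- (wave_norm k1 (kx i) (kz i))\<^sup>2) *\<^sub>R ebas i x"
    using ebas_second by metis
  define w11 w33 where "w11 = comb ?H a v11" and "w33 = comb ?H a v33"
  have hw1: "hasd w1 w11 (comb ?H a v13)" and hw3: "hasd w3 (comb ?H a v31) w33"
    unfolding w1_def w3_def w11_def w33_def comb_def by (intro hasd_sum hasd_scaleR v)+
  have lap: "w11 x + w33 x = comb ?H lam ebas x" for x
  proof -
    have "w11 x + w33 x = (\<Sum>i\<in>?H. a i *\<^sub>R (v11 i x + v33 i x))"
      by (simp add: w11_def w33_def comb_def sum.distrib scaleR_add_right)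
    then show ?thesis by (simp add: v(3) comb_def lam_def)
  qed
  have fu: "fst Z = (\<lambda>x. fst (w x))" and ft: "snd Z = (\<lambda>x. snd (w x))"
    using u \<theta> by (auto simp: w_def)
  note hu = hasd_fst[OF hw] and ht = hasd_snd[OF hw]
  define u where "u = fst Z"
  define \<theta> where "\<theta> = snd Z"
  have lapu: "laplacian u x = fst (w11 x + w33 x)" and lapt: "laplacian \<theta> x = snd (w11 x + w33 x)" if "x \<in> strip" for x
    using laplacian_hasd[OF hu hasd_fst[OF hw1] hasd_fst[OF hw3] that] laplacian_hasd[OF ht hasd_snd[OF hw1] hasd_snd[OF hw3] that]
    by (simp_all add: u_def \<theta>_def fu ft)
  have advu: "advect u u x = fst (adv w w1 w3 x)" and advt: "advect u \<theta> x = snd (adv w w1 w3 x)" if "x \<in> strip" for x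
    unfolding advect_def u_def \<theta>_def fu ft hasd_d1[OF hu that] hasd_d3[OF hu that] hasd_d1[OF ht that] hasd_d3[OF ht that]
    by (simp_all add: adv_def)
  note c = hasd_continuous[OF hw]
  have cadv: "continuous_on strip (adv w w1 w3)" by (intro continuous_adv c)
  have cG3: "continuous_on strip (advect u u)"
    by (rule continuous_on_eq[of _ "\<lambda>x. fst (adv w w1 w3 x)"]) (simp_all add: advu cadv continuous_on_fst)
  have cH2: "continuous_on strip (advect u \<theta>)"
    by (rule continuous_on_eq[of _ "\<lambda>x. snd (adv w w1 w3 x)"]) (simp_all add: advt cadv continuous_on_snd)
  have cu: "continuous_on strip u" and ct: "continuous_on strip \<theta>"
    unfolding u_def \<theta>_def fu ft by (intro continuous_intros c)+
  define G1 where "G1 y = \<theta> y *\<^sub>R e3" for y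
  define G2 where "G2 y = cross3 e3 (u y)" for y
  define H1 where "H1 y = u y $ 3" for y
  have G: "G1 \<in> L2_space k1" "G2 \<in> L2_space k1" "advect u u \<in> L2_space k1"
    unfolding G1_def G2_def
    by (intro continuous_L2 continuous_intros ct cG3 bounded_linear.continuous_on[OF bounded_linear_cross3] cu)+
  have H: "H1 \<in> L2_space k1" "advect u \<theta> \<in> L2_space k1"
    unfolding H1_def by (intro continuous_L2 continuous_intros cu cH2)+
  obtain c1 where c1: "proj_u k1 M G1 = (\<lambda>x. \<Sum>n\<in>N_u_HKC M. c1 n *\<^sub>R u_basis k1 n x)"
    using proj_u_inner(1)[OF G(1)] by (rule exE)
  obtain c2 where c2: "proj_u k1 M G2 = (\<lambda>x. \<Sum>n\<in>N_u_HKC M. c2 n *\<^sub>R u_basis k1 n x)"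
    using proj_u_inner(1)[OF G(2)] by (rule exE)
  obtain c3 where c3: "proj_u k1 M (advect u u) = (\<lambda>x. \<Sum>n\<in>N_u_HKC M. c3 n *\<^sub>R u_basis k1 n x)"
    using proj_u_inner(1)[OF G(3)] by (rule exE)
  note cs = c1 c2 c3
  obtain k1' where k1': "proj_theta k1 M H1 = (\<lambda>x. \<Sum>n\<in>N_theta_HKC M. k1' n *\<^sub>R theta_basis k1 n x)"
    using proj_theta_inner(1)[OF H(1)] by (rule exE)
  obtain k2' where k2': "proj_theta k1 M (advect u \<theta>) = (\<lambda>x. \<Sum>n\<in>N_theta_HKC M. k2' n *\<^sub>R theta_basis k1 n x)"
    using proj_theta_inner(1)[OF H(2)] by (rule exE)
  note ks = k1' k2'
  \<comment> \<open>The coefficients of the projected right-hand side: diffusion acts diagonally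
    through \<open>lam\<close>, the other terms through the coefficients of their
    projections.\<close>
  define b where "b i = (if fst i then P * lam i + P * R * c1 (snd i) - P * S * c2 (snd i) - c3 (snd i)
      else lam i + k1' (snd i) - k2' (snd i))" for i
  define rU where "rU x = P *\<^sub>R fst (w11 x + w33 x) + (P * R) *\<^sub>R proj_u k1 M G1 x - (P * S) *\<^sub>R proj_u k1 M G2 x - proj_u k1 M (advect u u) x" for x
  define rT where "rT x = snd (w11 x + w33 x) + proj_theta k1 M H1 x - proj_theta k1 M (advect u \<theta>) x" for x
  have rU: "rU x = fst (comb ?H b ebas x)" for x
    unfolding rU_def cs lap comb_HK fst_conv
    by (simp add: b_def scaleR_diff_left scaleR_add_left sum.distrib sum_subtractf scaleR_sum_right)
  have rT: "rT x = snd (comb ?H b ebas x)" for x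
    unfolding rT_def ks lap comb_HK snd_conv
    by (simp add: b_def left_diff_distrib distrib_right sum.distrib sum_subtractf)
  have Lw: "w11 \<in> L2_space k1" "w33 \<in> L2_space k1" by (rule hasd_L2(2)[OF hw1], rule hasd_L2(3)[OF hw3])
  have lapL: "(\<lambda>x. w11 x + w33 x) \<in> L2_space k1" by (rule L2_add[OF Lw])
  have LU: "(\<lambda>x. fst (w11 x + w33 x)) \<in> L2_space k1" by (rule L2_bounded_linear[OF bounded_linear_fst lapL])
  have LT: "(\<lambda>x. snd (w11 x + w33 x)) \<in> L2_space k1" by (rule L2_bounded_linear[OF bounded_linear_snd lapL])
  have "b i = W i" if i: "i \<in> ?H" for i
  proof -
    have "b i = L2_inner k1 (comb ?H b ebas) (ebas i)"
      unfolding comb_def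
      by (rule combination_coeff[OF orthonormal_subset[OF orthonormal_ebas HK(2)] HK(1) i, symmetric])
    also have "\<dots> = L2_inner k1 (\<lambda>x. Diff P (w11 x + w33 x) + Lin R S P (w x) - adv w w1 w3 x) (ebas i)"
    proof (cases "fst i")
      case True
      then obtain n where n: "i = (True, n)" by (cases i) auto
      have nH: "n \<in> N_u_HKC M" using i by (auto simp: n HK_def)
      have vL: "u_basis k1 n \<in> L2_space k1"
        using orthonormal_L2[OF orthonormal_u_basis] HKC_sets(3) nH by blast
      have "L2_inner k1 (comb ?H b ebas) (ebas i) = L2_inner k1 rU (u_basis k1 n)"
        by (rule L2_inner_cong) (simp add: n ebas_u inner_prod_def rU)
      also have "\<dots> = P * L2_inner k1 (\<lambda>x. fst (w11 x + w33 x)) (u_basis k1 n) + P * R * L2_inner k1 G1 (u_basis k1 n)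
          - P * S * L2_inner k1 G2 (u_basis k1 n) - L2_inner k1 (advect u u) (u_basis k1 n)"
        unfolding rU_def[abs_def] L2_inner_lincomb4[OF LU proj_u_inner(2)[OF G(1)] proj_u_inner(2)[OF G(2)] proj_u_inner(2)[OF G(3)] vL]
          proj_u_inner(3)[OF G(1) nH] proj_u_inner(3)[OF G(2) nH] proj_u_inner(3)[OF G(3) nH] ..
      also have "\<dots> = L2_inner k1 (\<lambda>x. P *\<^sub>R fst (w11 x + w33 x) + (P * R) *\<^sub>R G1 x - (P * S) *\<^sub>R G2 x - advect u u x) (u_basis k1 n)"
        by (rule L2_inner_lincomb4[OF LU G vL, symmetric])
      also have "\<dots> = L2_inner k1 (\<lambda>x. Diff P (w11 x + w33 x) + Lin R S P (w x) - adv w w1 w3 x) (ebas i)"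
      proof (rule L2_inner_cong)
        fix x assume x: "x \<in> strip"
        have "u x = fst (w x)" "\<theta> x = snd (w x)" by (simp_all add: u_def \<theta>_def fu ft)
        then show "(P *\<^sub>R fst (w11 x + w33 x) + (P * R) *\<^sub>R G1 x - (P * S) *\<^sub>R G2 x - advect u u x) \<bullet> u_basis k1 n x
          = (Diff P (w11 x + w33 x) + Lin R S P (w x) - adv w w1 w3 x) \<bullet> ebas i x"
          by (simp add: n ebas_u inner_prod_def Diff_def Lin_def G1_def G2_def advu[OF x] algebra_simps)
      qed
      finally show ?thesis .
    next
      case False
      then obtain n where n: "i = (False, n)" by (cases i) auto
      have nH: "n \<in> N_theta_HKC M" using i by (auto simp: n HK_def)
      have vL: "theta_basis k1 n \<in> L2_space k1"
        using orthonormal_L2[OF orthonormal_theta_basis] HKC_sets(4) nH by blast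
      \<comment> \<open>The temperature equation has three terms; a summand with factor 0 fills the
        fourth slot of \<open>L2_inner_lincomb4\<close>.\<close>
      have "L2_inner k1 (comb ?H b ebas) (ebas i) =
         L2_inner k1 (\<lambda>x. 1 *\<^sub>R snd (w11 x + w33 x) + 1 *\<^sub>R proj_theta k1 M H1 x - 0 *\<^sub>R H1 x - proj_theta k1 M (advect u \<theta>) x) (theta_basis k1 n)"
        by (rule L2_inner_cong) (simp add: n ebas_theta inner_prod_def rT[symmetric] rT_def)
      also have "\<dots> = 1 * L2_inner k1 (\<lambda>x. snd (w11 x + w33 x)) (theta_basis k1 n) + 1 * L2_inner k1 H1 (theta_basis k1 n)
          - 0 * L2_inner k1 H1 (theta_basis k1 n) - L2_inner k1 (advect u \<theta>) (theta_basis k1 n)"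
        unfolding L2_inner_lincomb4[OF LT proj_theta_inner(2)[OF H(1)] H(1) proj_theta_inner(2)[OF H(2)] vL]
          proj_theta_inner(3)[OF H(1) nH] proj_theta_inner(3)[OF H(2) nH] ..
      also have "\<dots> = L2_inner k1 (\<lambda>x. 1 *\<^sub>R snd (w11 x + w33 x) + 1 *\<^sub>R H1 x - 0 *\<^sub>R H1 x - advect u \<theta> x) (theta_basis k1 n)"
        by (rule L2_inner_lincomb4[OF LT H(1) H(1) H(2) vL, symmetric])
      also have "\<dots> = L2_inner k1 (\<lambda>x. Diff P (w11 x + w33 x) + Lin R S P (w x) - adv w w1 w3 x) (ebas i)"
      proof (rule L2_inner_cong)
        fix x assume x: "x \<in> strip"
        have "u x = fst (w x)" by (simp add: u_def fu)
        then show "(1 *\<^sub>R snd (w11 x + w33 x) + 1 *\<^sub>R H1 x - 0 *\<^sub>R H1 x - advect u \<theta> x) \<bullet> theta_basis k1 n x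
          = (Diff P (w11 x + w33 x) + Lin R S P (w x) - adv w w1 w3 x) \<bullet> ebas i x"
          by (simp add: n ebas_theta inner_prod_def Diff_def Lin_def H1_def advt[OF x] algebra_simps)
      qed
      finally show ?thesis .
    qed
    also have "\<dots> = W i"
      unfolding W_def w_def[symmetric] w1_def[symmetric] w3_def[symmetric]
    proof (rule weak_rhs_strong[OF hw hw1 hw3 admfield_ebas, symmetric])
      fix x1 b assume b: "b \<in> {0::real, pi}"
      show "fst (w3 (x1, b)) $ 1 = 0 \<and> fst (w3 (x1, b)) $ 2 = 0"
        unfolding w3_def comb_def by (simp add: fst_sum ebas3_boundary[OF b])
    qed
    finally show ?thesis .
  qed
  then have "comb ?H b ebas x = comb ?H W ebas x" for x
    unfolding comb_def by (intro sum.cong) auto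
  moreover have "(P *\<^sub>R laplacian u x + (P * R) *\<^sub>R proj_u k1 M G1 x - (P * S) *\<^sub>R proj_u k1 M G2 x
       - proj_u k1 M (advect u u) x, laplacian \<theta> x + proj_theta k1 M H1 x - proj_theta k1 M (advect u \<theta>) x) = comb ?H b ebas x"
    using rU[of x] rT[of x] unfolding lapu[OF x] lapt[OF x] rU_def rT_def by (simp add: prod_eq_iff)
  ultimately show ?thesis
    unfolding G1_def[abs_def] G2_def[abs_def] H1_def[abs_def] u_def \<theta>_def by simp
qed

text \<open>For modes outside \<open>HK M\<close> the coefficient is identically zero, and by the
  rotation symmetry so is the right-hand side of its Galerkin equation.\<close>

lemma hkc_galerkin:
  assumes sol: "hkc_solution R S P k1 M X0 Y"
  shows "\<exists>a. (\<forall>t\<ge>0. fld (Y t) = comb (AA M) (a t) ebas) \<and> (\<forall>t i. i \<notin> HK M \<longrightarrow> a t i = 0) \<and>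
    (\<forall>t\<ge>0. \<forall>i\<in>AA M. ((\<lambda>s. a s i) has_real_derivative
      weak_rhs R S P (comb (AA M) (a t) ebas) (comb (AA M) (a t) ebas1) (comb (AA M) (a t) ebas3) (ebas i) (ebas1 i) (ebas3 i)) (at t within {0..}))"
proof -
  have su: "fst (Y t) \<in> span_u k1 M" "snd (Y t) \<in> span_theta k1 M" if "t \<ge> 0" for t
    using sol that by (auto simp: hkc_solution_def Let_def)
  have "\<forall>t. \<exists>\<alpha>. t \<ge> 0 \<longrightarrow> fst (Y t) = (\<lambda>x. \<Sum>n\<in>N_u_HKC M. \<alpha> n *\<^sub>R u_basis k1 n x)"
    using su(1) unfolding span_u_def by blast
  from choice[OF this] obtain \<alpha> where ca: "\<forall>t. t \<ge> 0 \<longrightarrow> fst (Y t) = (\<lambda>x. \<Sum>n\<in>N_u_HKC M. \<alpha> t n *\<^sub>R u_basis k1 n x)"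
    by (rule exE)
  note \<alpha> = ca[rule_format]
  have "\<forall>t. \<exists>\<beta>. t \<ge> 0 \<longrightarrow> snd (Y t) = (\<lambda>x. \<Sum>n\<in>N_theta_HKC M. \<beta> n *\<^sub>R theta_basis k1 n x)"
    using su(2) unfolding span_theta_def by blast
  from choice[OF this] obtain \<beta> where cb: "\<forall>t. t \<ge> 0 \<longrightarrow> snd (Y t) = (\<lambda>x. \<Sum>n\<in>N_theta_HKC M. \<beta> t n *\<^sub>R theta_basis k1 n x)"
    by (rule exE)
  note \<beta> = cb[rule_format]
  \<comment> \<open>Zero outside \<open>HK M\<close>, so that sums over \<open>AA M\<close> and over
    \<open>HK M\<close> coincide, for the fields and for their derivatives.\<close>
  define a where "a t i = (if i \<in> HK M then (if fst i then \<alpha> t (snd i) else \<beta> t (snd i)) else 0)" for t i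
  have az: "a t i = 0" if "i \<notin> HK M" for t i using that by (simp add: a_def)
  have fY: "fst (Y t) x = fst (comb (HK M) (a t) ebas x)" "snd (Y t) x = snd (comb (HK M) (a t) ebas x)" if "t \<ge> 0" for t x
    unfolding comb_HK fst_conv snd_conv \<alpha>[OF that] \<beta>[OF that]
    by (auto intro!: sum.cong simp: a_def HK_def)
  have ext: "comb (AA M) (a t) e = comb (HK M) (a t) e" for t e
    unfolding comb_def using AA(1)[of M] AA(3)[of M] az by (intro ext sum.mono_neutral_right) auto
  have fl: "fld (Y t) = comb (HK M) (a t) ebas" if "t \<ge> 0" for t
    using fY[OF that] by (auto simp: fld_def prod_eq_iff)
  define W where "W t i = weak_rhs R S P (comb (HK M) (a t) ebas) (comb (HK M) (a t) ebas1) (comb (HK M) (a t) ebas3) (ebas i) (ebas1 i) (ebas3 i)" for t i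
  have der: "((\<lambda>s. a s i) has_real_derivative W t i) (at t within {0..})" if t: "t \<ge> 0" and i: "i \<in> AA M" for t i
  proof (cases "i \<in> HK M")
    case True
    show ?thesis
    proof (rule coefficient_derivative[OF HK(1,2) _ True])
      fix x assume x: "x \<in> cell k1"
      then have xs: "x \<in> strip" using cell_subset_strip by auto
      have d: "((\<lambda>s. (fst (Y s) x, snd (Y s) x)) has_vector_derivative
        (P *\<^sub>R laplacian (fst (Y t)) x + (P * R) *\<^sub>R proj_u k1 M (\<lambda>y. snd (Y t) y *\<^sub>R e3) x
             - (P * S) *\<^sub>R proj_u k1 M (\<lambda>y. cross3 e3 (fst (Y t) y)) x - proj_u k1 M (advect (fst (Y t)) (fst (Y t))) x,
          laplacian (snd (Y t)) x + proj_theta k1 M (\<lambda>y. fst (Y t) y $ 3) x - proj_theta k1 M (advect (fst (Y t)) (snd (Y t))) x)) (at t within {0..})"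
        using sol t x by (intro has_vector_derivative_Pair) (auto simp: hkc_solution_def Let_def)
      note d' = d[unfolded hkc_rhs[OF fY[OF t] xs, of P R S], folded W_def]
      show "((\<lambda>s. comb (HK M) (a s) ebas x) has_vector_derivative comb (HK M) (W t) ebas x) (at t within {0..})"
        by (rule has_vector_derivative_transform[OF _ _ d']) (use t fY in \<open>auto simp: prod_eq_iff\<close>)
    qed
  next
    case False
    have "W t i = 0"
      unfolding W_def using AA_unlocked[of i M] i False HK(2)[of M] HK_locked by (intro weak_rhs_unlocked) auto
    moreover have "(\<lambda>s. a s i) = (\<lambda>s. 0)" using az[OF False] by auto
    ultimately show ?thesis by simp
  qed
  show ?thesis
    using fl az der unfolding W_def by (intro exI[of _ a]) (simp add: ext)
qed

end

section \<open>Scalar inequalities: absorption into the dissipation, and Gronwall\<close>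

lemma young:
  fixes d B e :: real
  assumes "0 < e" "0 \<le> d" "0 \<le> B" "T\<^sup>2 \<le> d * B"
  shows "T \<le> e * d + B / (4 * e)"
proof -
  \<comment> \<open>The product d B is 4 (e d) (B / (4 e)), so it lies below the square of the sum;
    this avoids taking roots of d and B.\<close>
  have "4 * p * q \<le> (p + q)\<^sup>2" for p q :: real
    using zero_le_power2[of "p - q"] by (simp add: power2_eq_square algebra_simps)
  then have "4 * (e * d) * (B / (4 * e)) \<le> (e * d + B / (4 * e))\<^sup>2" .
  moreover have "4 * (e * d) * (B / (4 * e)) = d * B" using assms(1) by simp
  ultimately have "T\<^sup>2 \<le> (e * d + B / (4 * e))\<^sup>2" using assms(4) by linarith
  then show ?thesis using assms(1-3) by (intro power2_le_imp_le[of T]) auto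
qed

text \<open>Here z is the squared distance inside the span and d the squared norm of its gradient, r
  bounds the projection error, Y bounds the energy of w, and g is ||grad w||^2. Dissipation pays for
  the three transport terms: \<open>T1\<close> costs two shares of \<kappa>/4, \<open>T2\<close> and
  \<open>T3\<close> cost \<kappa>/8 each, which is less than the available \<kappa>.\<close>

lemma error_inequality:
  fixes \<kappa> K l z d r Y g T1 T2 T3 :: real
  assumes pos: "0 < \<kappa>" "0 \<le> K" "0 < l" "0 \<le> z" "0 \<le> d" "0 \<le> r" "r \<le> 1" "0 \<le> Y" "0 \<le> g"
    and T1: "T1\<^sup>2 \<le> d * (l * sqrt ((z * (z + d)) * (Y * (Y + g))))"
    and T2: "T2\<^sup>2 \<le> d * (l * sqrt ((r\<^sup>2 * (Y + g)) * (Y * (Y + g))))"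
    and T3: "T3\<^sup>2 \<le> d * (l * sqrt ((Y * (Y + g)) * (r\<^sup>2 * (Y + g))))"
    and L: "Lt \<le> K * (sqrt z + r) * sqrt z"
  shows "- \<kappa> * d + Lt + (T1 + T2 + T3) \<le>
    (3 * K + \<kappa> + l\<^sup>2 * Y * (Y + 1) / \<kappa>^3 + 4 / \<kappa> * l * sqrt Y * (Y + 1)) * (1 + g) * (z + r)"
proof -
  define B where "B = l * (r * sqrt Y * (Y + g))"
  have B0: "0 \<le> B" using pos by (simp add: B_def)
  have sB: "sqrt ((r\<^sup>2 * (Y + g)) * (Y * (Y + g))) = r * sqrt Y * (Y + g)"
    "sqrt ((Y * (Y + g)) * (r\<^sup>2 * (Y + g))) = r * sqrt Y * (Y + g)"
  proof -
    have "(r\<^sup>2 * (Y + g)) * (Y * (Y + g)) = r\<^sup>2 * (Y * (Y + g)\<^sup>2)" by (simp add: power2_eq_square)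
    then show "sqrt ((r\<^sup>2 * (Y + g)) * (Y * (Y + g))) = r * sqrt Y * (Y + g)"
      using pos by (simp add: real_sqrt_mult)
    then show "sqrt ((Y * (Y + g)) * (r\<^sup>2 * (Y + g))) = r * sqrt Y * (Y + g)"
      by (simp add: mult.commute)
  qed
  have t2: "T2 \<le> \<kappa> / 8 * d + B / (4 * (\<kappa> / 8))" "T3 \<le> \<kappa> / 8 * d + B / (4 * (\<kappa> / 8))"
    using pos B0 T2 T3 unfolding sB B_def[symmetric] by (intro young; simp)+
  define A where "A = l * sqrt ((z * (z + d)) * (Y * (Y + g)))"
  have A0: "0 \<le> A" using pos by (simp add: A_def)
  \<comment> \<open>\<open>A\<close> still contains d under its root, since the difference occurs in
    \<open>T1\<close> both as the advecting field and under the derivative.\<close>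
  have t1: "T1 \<le> \<kappa> / 4 * d + A / (4 * (\<kappa> / 4))"
    using pos A0 T1 unfolding A_def[symmetric] by (intro young) simp_all
  have "A\<^sup>2 = (z + d) * (z * (l\<^sup>2 * Y * (Y + g)))"
    using pos by (simp add: A_def power_mult_distrib mult_ac)
  then have "(A / \<kappa>)\<^sup>2 \<le> (z + d) * (z * (l\<^sup>2 * Y * (Y + g)) / \<kappa>\<^sup>2)"
    by (simp add: power_divide)
  \<comment> \<open>A second use of Young's inequality removes that d and leaves z times Y + g.
    Hence the power \<kappa>^3 in the constant, and the extra \<kappa>/4 times z.\<close>
  then have a: "A / \<kappa> \<le> \<kappa> / 4 * (z + d) + (z * (l\<^sup>2 * Y * (Y + g)) / \<kappa>\<^sup>2) / (4 * (\<kappa> / 4))"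
    using pos by (intro young) simp_all
  have b: "(z * (l\<^sup>2 * Y * (Y + g)) / \<kappa>\<^sup>2) / (4 * (\<kappa> / 4)) = l\<^sup>2 * Y * (Y + g) / \<kappa>^3 * z"
    by (simp add: power2_eq_square power3_eq_cube mult_ac)
  have sz: "K * (sqrt z + r) * sqrt z \<le> 2 * K * (z + r)"
  proof -
    have "2 * (r * sqrt z) \<le> r\<^sup>2 + z" using sum_squares_bound[of r "sqrt z"] pos by (simp add: mult.assoc)
    \<comment> \<open>The bound r \<le> 1 makes the linear term fit into a multiple of z +
      r.\<close>
    moreover have "r\<^sup>2 \<le> r" using pos by (simp add: power2_eq_square mult_left_le)
    ultimately have "r * sqrt z \<le> z + r" using pos by linarith
    then have "(sqrt z + r) * sqrt z \<le> 2 * (z + r)"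
      using pos by (simp add: distrib_right)
    then have "K * ((sqrt z + r) * sqrt z) \<le> K * (2 * (z + r))" using pos by (intro mult_left_mono)
    then show ?thesis by (simp add: mult_ac)
  qed
  define G where "G = 1 + g"
  \<comment> \<open>\<open>p\<close> is the constant of the twofold Young inequality for
    \<open>T1\<close>; \<open>q\<close> collects the equal remainders of \<open>T2\<close> and
    \<open>T3\<close>, 2/\<kappa> times \<open>B\<close> each. Both absorb Y + g through Y + g \<le>
    (Y + 1) (1 + g).\<close>
  define p where "p = l\<^sup>2 * Y * (Y + 1) / \<kappa>^3"
  define q where "q = 4 / \<kappa> * l * sqrt Y * (Y + 1)"
  have p0: "0 \<le> p" "0 \<le> q" using pos by (simp_all add: p_def q_def)
  have YG: "Y + g \<le> (Y + 1) * G" using pos by (simp add: G_def algebra_simps)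
  have "l\<^sup>2 * Y * (Y + g) / \<kappa>^3 \<le> l\<^sup>2 * Y * ((Y + 1) * G) / \<kappa>^3"
    using pos YG by (intro divide_right_mono mult_left_mono) auto
  then have c1: "l\<^sup>2 * Y * (Y + g) / \<kappa>^3 * z \<le> p * G * z"
    using pos by (intro mult_right_mono) (simp_all add: p_def mult_ac)
  have "4 / \<kappa> * l * sqrt Y * (Y + g) \<le> 4 / \<kappa> * l * sqrt Y * ((Y + 1) * G)"
    using pos YG by (intro mult_left_mono) auto
  then have "4 / \<kappa> * l * sqrt Y * (Y + g) * r \<le> q * G * r"
    using pos by (intro mult_right_mono) (simp_all add: q_def mult_ac)
  moreover have "4 / \<kappa> * B = 4 / \<kappa> * l * sqrt Y * (Y + g) * r" by (simp add: B_def mult_ac)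
  ultimately have c2: "4 / \<kappa> * B \<le> q * G * r" by (simp only:)
  have e1: "B / (4 * (\<kappa> / 8)) = 2 / \<kappa> * B" by simp
  have e2: "A / (4 * (\<kappa> / 4)) = A / \<kappa>" by simp
  have h: "\<kappa> / 8 * d + \<kappa> / 8 * d + \<kappa> / 4 * d + \<kappa> / 4 * d \<le> \<kappa> * d" using pos by simp
  have "4 / \<kappa> * B = 2 / \<kappa> * B + 2 / \<kappa> * B" by simp
  then have "- \<kappa> * d + Lt + (T1 + T2 + T3) \<le> 2 * K * (z + r) + \<kappa> / 4 * z + p * G * z + q * G * r"
    using t1 t2 a b c1 c2 sz L h unfolding e1 e2 by (simp only: distrib_left)
  also have "\<dots> \<le> (3 * K + \<kappa>) * G * (z + r) + (p * G * (z + r) + q * G * (z + r))"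
  proof -
    have Gz: "z + r \<le> G * (z + r)" using pos by (simp add: G_def algebra_simps)
    have "2 * K * (z + r) \<le> 3 * K * (G * (z + r))"
      using pos Gz by (intro mult_mono) auto
    moreover have "\<kappa> / 4 * z \<le> \<kappa> * (G * (z + r))"
      using pos Gz by (intro mult_mono) auto
    moreover have "p * G * z \<le> p * G * (z + r)" "q * G * r \<le> q * G * (z + r)"
      using pos p0 by (auto intro!: mult_left_mono simp: G_def)
    ultimately show ?thesis by (simp add: algebra_simps)
  qed
  also have "\<dots> = (3 * K + \<kappa> + p + q) * G * (z + r)" by (simp add: algebra_simps)
  finally show ?thesis by (simp add: G_def p_def q_def)
qed

text \<open>The dissipation \<open>g\<close> is not integrated: the energy inequality bounds it by \<open>-y'\<close> up to a
  constant, so \<open>y\<close> itself supplies the integrating factor, which stays bounded down to \<open>t = 0\<close>.\<close>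

lemma gronwall_by_energy:
  fixes z y z' y' g :: "real \<Rightarrow> real"
  assumes \<tau>: "0 < \<tau>" and par: "0 < \<kappa>" "0 \<le> K" "0 \<le> C" "0 \<le> r"
    and cont: "continuous_on {0..\<tau>} z" "continuous_on {0..\<tau>} y"
    and z0: "z 0 = 0" and zpos: "\<And>t. t \<in> {0..\<tau>} \<Longrightarrow> 0 \<le> z t"
    and y: "\<And>t. t \<in> {0..\<tau>} \<Longrightarrow> 0 \<le> y t \<and> y t \<le> Y"
    and dz: "\<And>t. 0 < t \<Longrightarrow> t < \<tau> \<Longrightarrow> (z has_real_derivative z' t) (at t)"
    and dy: "\<And>t. 0 < t \<Longrightarrow> t < \<tau> \<Longrightarrow> (y has_real_derivative y' t) (at t)"
    and g: "\<And>t. 0 < t \<Longrightarrow> t < \<tau> \<Longrightarrow> y' t \<le> - 2 * \<kappa> * g t + 2 * K * y t"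
    and z': "\<And>t. 0 < t \<Longrightarrow> t < \<tau> \<Longrightarrow> z' t \<le> C * (1 + g t) * (z t + r)"
    and t: "t \<in> {0..\<tau>}"
  shows "z t \<le> r * exp (C * (\<tau> + (2 * K * Y * \<tau> + Y) / (2 * \<kappa>)))"
proof -
  \<comment> \<open>An exponent with derivative at least C (1 + g): the energy inequality yields g
    \<le> (2 K Y - y') / (2 \<kappa>), and the right-hand side is a derivative.\<close>
  define \<Phi> where "\<Phi> s = C * (s + (2 * K * Y * s - y s) / (2 * \<kappa>))" for s
  define h where "h s = (z s + r) * exp (- \<Phi> s)" for s
  have Y0: "0 \<le> Y" using y[of 0] \<tau> by auto
  have hh: "h t \<le> h 0"
  proof (cases "t = 0")
    case False
    then have t0: "0 < t" "t \<le> \<tau>" using t by auto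
    \<comment> \<open>Derivatives are available on the open interval only; continuity of z and y
      carries the monotonicity of \<open>h\<close> down to 0.\<close>
    show ?thesis
    proof (rule DERIV_nonpos_imp_decreasing_open[OF less_imp_le[OF t0(1)]])
      fix s assume s: "0 < s" "s < t"
      then have s': "0 < s" "s < \<tau>" using t0 by auto
      define p where "p = C * (1 + (2 * K * Y - y' s) / (2 * \<kappa>))"
      have d\<Phi>: "(\<Phi> has_real_derivative p) (at s)"
        unfolding \<Phi>_def p_def using par by (auto intro!: derivative_eq_intros dy[OF s'] simp: field_simps)
      have "(h has_real_derivative (z' s * exp (- \<Phi> s) + (z s + r) * (exp (- \<Phi> s) * - p))) (at s)"
        unfolding h_def by (auto intro!: derivative_eq_intros dz[OF s'] d\<Phi>)
      moreover have "z' s * exp (- \<Phi> s) + (z s + r) * (exp (- \<Phi> s) * - p) = (z' s - p * (z s + r)) * exp (- \<Phi> s)"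
        by (simp add: algebra_simps)
      moreover have "z' s \<le> p * (z s + r)"
      proof -
        have "2 * K * y s \<le> 2 * K * Y" using par y[of s] s' by (intro mult_left_mono) auto
        then have "2 * \<kappa> * g s \<le> 2 * K * Y - y' s" using g[OF s'] by linarith
        then have "g s \<le> (2 * K * Y - y' s) / (2 * \<kappa>)" using par by (simp add: field_simps)
        then have "C * (1 + g s) \<le> p" unfolding p_def using par by (intro mult_left_mono) auto
        then have "C * (1 + g s) * (z s + r) \<le> p * (z s + r)"
          using zpos[of s] s' par by (intro mult_right_mono) auto
        then show ?thesis using z'[OF s'] by linarith
      qed
      ultimately show "\<exists>d. (h has_real_derivative d) (at s) \<and> d \<le> 0"
        by (intro exI[of _ "(z' s - p * (z s + r)) * exp (- \<Phi> s)"]) (simp add: mult_nonpos_nonneg)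
    next
      have sub: "{0..t} \<subseteq> {0..\<tau>}" using t by auto
      show "continuous_on {0..t} h"
        unfolding h_def \<Phi>_def using par
        by (intro continuous_intros continuous_on_subset[OF cont(1) sub] continuous_on_subset[OF cont(2) sub]) auto
    qed
  qed simp
  have "z t + r = h t * exp (\<Phi> t)" by (simp add: h_def exp_minus)
  also have "\<dots> \<le> h 0 * exp (\<Phi> t)" using hh by (intro mult_right_mono) auto
  also have "\<dots> = r * exp (\<Phi> t - \<Phi> 0)" by (simp add: h_def z0 exp_diff exp_minus field_simps)
  also have "\<dots> \<le> r * exp (C * (\<tau> + (2 * K * Y * \<tau> + Y) / (2 * \<kappa>)))"
  proof -
    have "\<Phi> t - \<Phi> 0 = C * (t + (2 * K * Y * t - y t + y 0) / (2 * \<kappa>))"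
      by (simp add: \<Phi>_def algebra_simps diff_divide_distrib add_divide_distrib)
    \<comment> \<open>The difference y 0 - y t is at most Y, because y stays between 0 and
      Y.\<close>
    also have "\<dots> \<le> C * (\<tau> + (2 * K * Y * \<tau> + Y) / (2 * \<kappa>))"
    proof -
      have "2 * K * Y * t \<le> 2 * K * Y * \<tau>" using par Y0 t by (intro mult_left_mono) auto
      then have "2 * K * Y * t - y t + y 0 \<le> 2 * K * Y * \<tau> + Y" using y[OF t] y[of 0] \<tau> by auto
      then have "(2 * K * Y * t - y t + y 0) / (2 * \<kappa>) \<le> (2 * K * Y * \<tau> + Y) / (2 * \<kappa>)"
        using par by (intro divide_right_mono) auto
      then show ?thesis using par t by (intro mult_left_mono) auto
    qed
    finally show ?thesis using par by (intro mult_left_mono) auto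
  qed
  finally show ?thesis using par by simp
qed

section \<open>Energy inequality and error estimate for the Galerkin comparison\<close>

context channel
begin

text \<open>The operator norm of the pointwise map, hence one constant for all fields, all times and
  all M.\<close>

lemma Lin_bound:
  obtains K where "0 \<le> K" "\<And>w v. w \<in> L2_space k1 \<Longrightarrow> v \<in> L2_space k1 \<Longrightarrow>
    L2_inner k1 (\<lambda>x. Lin R S P (w x)) v \<le> K * L2_norm k1 w * L2_norm k1 v"
proof -
  obtain K where K: "0 < K" "\<And>z. norm (Lin R S P z) \<le> norm z * K"
    using bounded_linear.pos_bounded[OF bounded_linear_Lin] by blast
  show ?thesis
  proof (rule that[of K])
    fix w v :: "point \<Rightarrow> (real^3) \<times> real"
    assume w: "w \<in> L2_space k1" and v: "v \<in> L2_space k1"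
    have L: "(\<lambda>x. Lin R S P (w x)) \<in> L2_space k1" by (rule L2_bounded_linear[OF bounded_linear_Lin w])
    have "L2_inner k1 (\<lambda>x. Lin R S P (w x)) (\<lambda>x. Lin R S P (w x)) \<le> (LINT x|mC. K\<^sup>2 * (norm (w x))\<^sup>2)"
      unfolding L2_inner_def
    proof (rule integral_mono)
      show "integrable mC (\<lambda>x. Lin R S P (w x) \<bullet> Lin R S P (w x))" by (rule L2_inner_integrable[OF L L])
      show "integrable mC (\<lambda>x. K\<^sup>2 * (norm (w x))\<^sup>2)" using L2_integrable_sq[OF w] by simp
      show "Lin R S P (w x) \<bullet> Lin R S P (w x) \<le> K\<^sup>2 * (norm (w x))\<^sup>2" for x
        using power_mono[OF K(2)[of "w x"], of 2] by (simp add: power_mult_distrib dot_square_norm mult.commute)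
    qed
    also have "\<dots> = (K * L2_norm k1 w)\<^sup>2"
      by (simp add: power_mult_distrib L2_norm_sq L2_inner_def power2_norm_eq_inner)
    finally have "L2_norm k1 (\<lambda>x. Lin R S P (w x)) \<le> K * L2_norm k1 w"
      using K L2_norm_nonneg[of w] by (intro L2_norm_le_of_sq) auto
    then have "L2_norm k1 (\<lambda>x. Lin R S P (w x)) * L2_norm k1 v \<le> K * L2_norm k1 w * L2_norm k1 v"
      by (intro mult_right_mono L2_norm_nonneg)
    then show "L2_inner k1 (\<lambda>x. Lin R S P (w x)) v \<le> K * L2_norm k1 w * L2_norm k1 v"
      using L2_Cauchy_Schwarz[OF L v] by linarith
  qed (use K in simp)
qed

text \<open>min P 1 is the smaller of the two diffusivities; this is the \<kappa> of the
  estimates.\<close>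

lemma Diff_coercive:
  assumes w: "w \<in> L2_space k1"
  shows "min P 1 * L2_inner k1 w w \<le> L2_inner k1 (\<lambda>x. Diff P (w x)) w"
proof -
  have L: "(\<lambda>x. Diff P (w x)) \<in> L2_space k1" by (rule L2_bounded_linear[OF bounded_linear_Diff w])
  have pt: "min P 1 * (z \<bullet> z) \<le> Diff P z \<bullet> z" for z
  proof -
    have "min P 1 * (fst z \<bullet> fst z) \<le> P * (fst z \<bullet> fst z)" "min P 1 * (snd z * snd z) \<le> 1 * (snd z * snd z)"
      by (intro mult_right_mono; simp)+
    then show ?thesis by (simp add: Diff_def inner_prod_def distrib_left)
  qed
  have "min P 1 * L2_inner k1 w w = (LINT x|mC. min P 1 * (w x \<bullet> w x))" by (simp add: L2_inner_def)
  also have "\<dots> \<le> (LINT x|mC. Diff P (w x) \<bullet> w x)"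
    using L2_inner_integrable[OF w w] L2_inner_integrable[OF L w] pt by (intro integral_mono) auto
  finally show ?thesis by (simp add: L2_inner_def)
qed

lemma Diff_self_adjoint: "L2_inner k1 (\<lambda>x. Diff P (v x)) w = L2_inner k1 v (\<lambda>x. Diff P (w x))"
  by (simp add: L2_inner_def Diff_def inner_prod_def)

lemma tri_self: "admfield a a1 a3 \<Longrightarrow> hasd b b1 b3 \<Longrightarrow> L2_inner k1 (adv a b1 b3) b = 0"
  using tri_antisym[of a a1 a3 b b1 b3 b b1 b3] by simp

lemma adv_add: "adv (\<lambda>x. a x + a' x) b1 b3 x = adv a b1 b3 x + adv a' b1 b3 x"
  by (simp add: adv_def algebra_simps)

text \<open>The transport term vanishes when tested with the advected field itself.\<close>

lemma energy_inequality:
  assumes w: "admfield w w1 w3"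
    and K: "\<And>w v. w \<in> L2_space k1 \<Longrightarrow> v \<in> L2_space k1 \<Longrightarrow>
      L2_inner k1 (\<lambda>x. Lin R S P (w x)) v \<le> K * L2_norm k1 w * L2_norm k1 v"
  shows "weak_rhs R S P w w1 w3 w w1 w3 \<le> - min P 1 * (L2_inner k1 w1 w1 + L2_inner k1 w3 w3) + K * L2_inner k1 w w"
proof -
  note h = admfield_hasd[OF w] note L = hasd_L2[OF h]
  have "L2_inner k1 (\<lambda>x. Lin R S P (w x)) w \<le> K * L2_inner k1 w w"
    using K[OF L(1) L(1)] by (simp add: L2_norm_sq[symmetric] power2_eq_square mult.assoc)
  then show ?thesis
    using Diff_coercive[OF L(2), of P] Diff_coercive[OF L(3), of P] tri_self[OF w h]
    by (simp add: weak_rhs_def distrib_left)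
qed

lemma weak_rhs_comb:
  assumes A: "finite A" and w: "hasd w w1 w3"
  shows "weak_rhs R S P w w1 w3 (comb A c ebas) (comb A c ebas1) (comb A c ebas3)
    = (\<Sum>i\<in>A. c i * weak_rhs R S P w w1 w3 (ebas i) (ebas1 i) (ebas3 i))"
proof -
  have lin: "L2_inner k1 f (comb A c e) = (\<Sum>i\<in>A. c i * L2_inner k1 f (e i))"
    if "f \<in> L2_space k1" "\<And>i. e i \<in> L2_space k1" for f e
    unfolding comb_def using that by (subst L2_inner_sum_right) (auto simp: L2_inner_scaleR_right intro: L2_scaleR)
  have L: "(\<lambda>x. Diff P (w1 x)) \<in> L2_space k1" "(\<lambda>x. Diff P (w3 x)) \<in> L2_space k1"
    "(\<lambda>x. Lin R S P (w x)) \<in> L2_space k1" "adv w w1 w3 \<in> L2_space k1"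
    by (intro L2_bounded_linear[OF bounded_linear_Diff] L2_bounded_linear[OF bounded_linear_Lin]
        hasd_L2[OF w] continuous_L2 continuous_adv hasd_continuous[OF w])+
  show ?thesis
    unfolding weak_rhs_def lin[OF L(1) hasd_L2(2)[OF hasd_ebas]] lin[OF L(2) hasd_L2(3)[OF hasd_ebas]]
      lin[OF L(3) hasd_L2(1)[OF hasd_ebas]] lin[OF L(4) hasd_L2(1)[OF hasd_ebas]]
    by (simp add: sum.distrib sum_subtractf right_diff_distrib distrib_left sum_negf)
qed

text \<open>Green's formula moves both derivatives onto the basis fields, and these are
  eigenfunctions of the Laplacian, also after weighting by \<open>Diff Q\<close>, which multiplies
  each of them by Q or 1. With Q = 1 this gives Pythagoras for gradients, with Q = P it removes the
  projection error from the diffusion term.\<close>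

lemma gradient_orthogonal:
  assumes A: "finite A" and v: "admfield v v1 v3" and o: "\<And>i. i \<in> A \<Longrightarrow> L2_inner k1 (ebas i) v = 0"
  shows "L2_inner k1 (\<lambda>x. Diff Q (comb A c ebas1 x)) v1 + L2_inner k1 (\<lambda>x. Diff Q (comb A c ebas3 x)) v3 = 0"
proof -
  obtain v11 v13 v31 v33 where e: "\<And>i. hasd (ebas1 i) (v11 i) (v13 i)" "\<And>i. hasd (ebas3 i) (v31 i) (v33 i)"
    "\<And>i x. v11 i x + v33 i x = (- (wave_norm k1 (kx i) (kz i))\<^sup>2) *\<^sub>R ebas i x"
    using ebas_second by metis
  have h1: "hasd (comb A c ebas1) (comb A c v11) (comb A c v13)" and h3: "hasd (comb A c ebas3) (comb A c v31) (comb A c v33)"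
    unfolding comb_def by (intro hasd_sum hasd_scaleR e)+
  have De: "Diff Q (ebas i x) = (if fst i then Q else 1) *\<^sub>R ebas i x" for i x
    by (cases i; cases "fst i") (simp_all add: ebas_u ebas_theta Diff_def)
  have "L2_inner k1 (\<lambda>x. Diff Q (comb A c v11 x) + Diff Q (comb A c v33 x)) v =
    - (L2_inner k1 (\<lambda>x. Diff Q (comb A c ebas1 x)) v1 + L2_inner k1 (\<lambda>x. Diff Q (comb A c ebas3 x)) v3)"
  proof (rule green[OF hasd_linear[OF bounded_linear_Diff h1] hasd_linear[OF bounded_linear_Diff h3] admfield_hasd[OF v]])
    fix x1 b assume b: "b \<in> {0::real, pi}"
    have "fst (v (x1, b)) $ 3 = 0" "snd (v (x1, b)) = 0" using v b by (auto simp: admfield_def)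
    moreover have "fst (comb A c ebas3 (x1, b)) $ 1 = 0" "fst (comb A c ebas3 (x1, b)) $ 2 = 0"
      unfolding comb_def by (simp_all add: fst_sum ebas3_boundary[OF b])
    ultimately show "Diff Q (comb A c ebas3 (x1, b)) \<bullet> v (x1, b) = 0"
      by (simp add: Diff_def inner_prod_def inner_vec_def sum_3)
  qed
  moreover have "Diff Q (comb A c v11 x) + Diff Q (comb A c v33 x) =
     (\<Sum>i\<in>A. (c i * - (wave_norm k1 (kx i) (kz i))\<^sup>2 * (if fst i then Q else 1)) *\<^sub>R ebas i x)" for x
  proof -
    note l = bounded_linear.linear[OF bounded_linear_Diff[of Q]]
    have "Diff Q (comb A c v11 x) + Diff Q (comb A c v33 x) = Diff Q (\<Sum>i\<in>A. c i *\<^sub>R (v11 i x + v33 i x))"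
      by (simp add: comb_def linear_add[OF l, symmetric] sum.distrib scaleR_add_right)
    also have "\<dots> = (\<Sum>i\<in>A. (c i * - (wave_norm k1 (kx i) (kz i))\<^sup>2) *\<^sub>R Diff Q (ebas i x))"
      by (simp only: e(3) scaleR_scaleR linear_sum[OF l] linear_scale[OF l])
    finally show ?thesis by (simp only: De scaleR_scaleR)
  qed
  moreover have "L2_inner k1 (\<lambda>x. \<Sum>i\<in>A. (c i * - (wave_norm k1 (kx i) (kz i))\<^sup>2 * (if fst i then Q else 1)) *\<^sub>R ebas i x) v = 0"
  proof -
    have "L2_inner k1 (\<lambda>x. \<Sum>i\<in>A. b i *\<^sub>R ebas i x) v = (\<Sum>i\<in>A. b i * L2_inner k1 (ebas i) v)" for b
      by (subst L2_inner_sum_left)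
        (auto intro: L2_scaleR hasd_L2(1)[OF hasd_ebas] hasd_L2(1)[OF admfield_hasd[OF v]] simp: L2_inner_scaleR_left)
    then have "L2_inner k1 (\<lambda>x. \<Sum>i\<in>A. b i *\<^sub>R ebas i x) v = 0" for b by (simp add: o)
    then show ?thesis .
  qed
  ultimately show ?thesis by simp
qed

text \<open>The model field is split as X = w + \<rho> + \<xi>, with \<rho> the projection error and
  \<xi> the difference inside the span. The sum is half the derivative of z along the two
  evolutions. Diffusion yields -\<kappa> d, its cross term with \<rho> vanishes by orthogonality,
  and after antisymmetry every derivative in the transport terms rests on \<xi>.\<close>

lemma error_estimate:
  fixes a :: "bool \<times> mode \<Rightarrow> real"
  assumes P: "0 < P" and A: "finite A" "A \<subseteq> NN" and w: "admfield w w1 w3"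
    and K0: "0 \<le> K" and K: "\<And>w v. w \<in> L2_space k1 \<Longrightarrow> v \<in> L2_space k1 \<Longrightarrow>
      L2_inner k1 (\<lambda>x. Lin R S P (w x)) v \<le> K * L2_norm k1 w * L2_norm k1 v"
    and r: "L2_norm k1 (\<lambda>x. w x - partial_sum ebas A w x) \<le> r" "r \<le> 1"
    and Y: "L2_inner k1 w w \<le> Y"
  defines "k \<equiv> \<lambda>i. L2_inner k1 w (ebas i)"
  defines "z \<equiv> (\<Sum>i\<in>A. (a i - k i)\<^sup>2)"
  shows "(\<Sum>i\<in>A. (a i - k i) *
      (weak_rhs R S P (comb A a ebas) (comb A a ebas1) (comb A a ebas3) (ebas i) (ebas1 i) (ebas3 i)
       - weak_rhs R S P w w1 w3 (ebas i) (ebas1 i) (ebas3 i)))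
    \<le> (3 * K + min P 1 + lady_const\<^sup>2 * Y * (Y + 1) / (min P 1)^3 + 4 / min P 1 * lady_const * sqrt Y * (Y + 1))
      * (1 + (L2_inner k1 w1 w1 + L2_inner k1 w3 w3)) * (z + r)"
proof -
  define \<kappa> where "\<kappa> = min P 1"
  define g where "g = L2_inner k1 w1 w1 + L2_inner k1 w3 w3"
  note o = orthonormal_subset[OF orthonormal_ebas A(2)]
  define c where "c i = a i - k i" for i
  define X X1 X3 where "X = comb A a ebas" and "X1 = comb A a ebas1" and "X3 = comb A a ebas3"
  define q q1 q3 where "q = comb A k ebas" and "q1 = comb A k ebas1" and "q3 = comb A k ebas3"
  define \<xi> \<xi>1 \<xi>3 where "\<xi> = comb A c ebas" and "\<xi>1 = comb A c ebas1" and "\<xi>3 = comb A c ebas3"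
  \<comment> \<open>Projection minus field, so that the model field is the sum of w, \<rho> and
    \<xi>.\<close>
  define \<rho> \<rho>1 \<rho>3 where "\<rho> x = q x - w x" and "\<rho>1 x = q1 x - w1 x" and "\<rho>3 x = q3 x - w3 x" for x
  have aX: "admfield X X1 X3" unfolding X_def X1_def X3_def by (rule admfield_comb)
  have aq: "admfield q q1 q3" unfolding q_def q1_def q3_def by (rule admfield_comb)
  have a\<xi>: "admfield \<xi> \<xi>1 \<xi>3" unfolding \<xi>_def \<xi>1_def \<xi>3_def by (rule admfield_comb)
  have a\<rho>: "admfield \<rho> \<rho>1 \<rho>3" unfolding \<rho>_def \<rho>1_def \<rho>3_def by (rule admfield_diff[OF aq w])
  note hX = admfield_hasd[OF aX] and hq = admfield_hasd[OF aq] and h\<xi> = admfield_hasd[OF a\<xi>]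
    and h\<rho> = admfield_hasd[OF a\<rho>] and hw = admfield_hasd[OF w]
  note LX = hasd_L2[OF hX] and Lq = hasd_L2[OF hq] and L\<xi> = hasd_L2[OF h\<xi>] and L\<rho> = hasd_L2[OF h\<rho>] and Lw = hasd_L2[OF hw]
  have Xs: "comb A a e x = comb A k e x + comb A c e x" for e x
    by (simp add: comb_def c_def scaleR_diff_left sum_subtractf)
  have X_eq: "X = (\<lambda>x. q x + \<xi> x)" "X1 = (\<lambda>x. q1 x + \<xi>1 x)" "X3 = (\<lambda>x. q3 x + \<xi>3 x)"
    unfolding X_def X1_def X3_def q_def q1_def q3_def \<xi>_def \<xi>1_def \<xi>3_def by (rule ext, rule Xs)+
  have q_eq: "q = (\<lambda>x. w x + \<rho> x)" "q1 = (\<lambda>x. w1 x + \<rho>1 x)" "q3 = (\<lambda>x. w3 x + \<rho>3 x)"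
    by (simp_all add: \<rho>_def \<rho>1_def \<rho>3_def)
  have qps: "q = partial_sum ebas A w" by (simp add: q_def comb_def partial_sum_def k_def)
  have zz: "L2_inner k1 \<xi> \<xi> = z"
    unfolding \<xi>_def comb_def L2_inner_combinations[OF o A(1)] z_def c_def by (simp add: power2_eq_square)
  have o\<rho>: "L2_inner k1 (ebas i) \<rho> = 0" if "i \<in> A" for i
  proof -
    have "L2_inner k1 q (ebas i) = k i"
      unfolding q_def comb_def by (rule combination_coeff[OF o A(1) that])
    then have "L2_inner k1 \<rho> (ebas i) = 0"
      unfolding \<rho>_def using L2_inner_diff_left[OF Lq(1) Lw(1) hasd_L2(1)[OF hasd_ebas]] by (simp add: k_def)
    then show ?thesis by (simp add: L2_inner_commute)
  qed
  have rn: "L2_norm k1 \<rho> \<le> r"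
    using r(1) L2_norm_minus_commute[of w q] by (simp add: \<rho>_def[abs_def] qps)
  then have r0: "0 \<le> r" using L2_norm_nonneg[of \<rho>] by linarith
  have \<rho>r: "L2_inner k1 \<rho> \<rho> \<le> r\<^sup>2"
    unfolding L2_norm_sq[symmetric] using rn by (intro power_mono L2_norm_nonneg)
  have Y0: "0 \<le> Y" using Y L2_inner_self_nonneg[of w] by linarith
  have qY: "L2_inner k1 q q \<le> Y"
    unfolding qps using Bessel[OF o A(1) Lw(1)] partial_sum_inner(2)[OF o A(1) Lw(1)] Y by simp
  \<comment> \<open>Both bounds on \<rho> are used: r^2 for the small factor in Ladyzhenskaya's
    inequality, Y for the zero-order term beside the gradient.\<close>
  have \<rho>Y: "L2_inner k1 \<rho> \<rho> \<le> Y"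
  proof -
    have "L2_inner k1 (\<lambda>x. w x - q x) (\<lambda>x. w x - q x) \<le> L2_inner k1 w w"
      unfolding qps partial_sum_residual[OF o A(1) Lw(1)] by (simp add: sum_nonneg)
    moreover have "L2_inner k1 \<rho> \<rho> = L2_inner k1 (\<lambda>x. w x - q x) (\<lambda>x. w x - q x)"
      unfolding L2_norm_sq[symmetric] \<rho>_def[abs_def] by (simp only: L2_norm_minus_commute[of q w])
    ultimately show ?thesis using Y by linarith
  qed
  have D1: "Diff 1 = (\<lambda>z. z)" by (simp add: fun_eq_iff Diff_def)
  \<comment> \<open>With Q = 1 the diffusivities disappear and the gradients themselves are seen to
    be orthogonal.\<close>
  have orth1: "L2_inner k1 q1 \<rho>1 + L2_inner k1 q3 \<rho>3 = 0"
    using gradient_orthogonal[OF A(1) a\<rho> o\<rho>, of 1 k] unfolding D1 q1_def q3_def .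
  have orthP: "L2_inner k1 (\<lambda>x. Diff P (\<rho>1 x)) \<xi>1 + L2_inner k1 (\<lambda>x. Diff P (\<rho>3 x)) \<xi>3 = 0"
  proof -
    have "L2_inner k1 (\<lambda>x. Diff P (\<xi>1 x)) \<rho>1 + L2_inner k1 (\<lambda>x. Diff P (\<xi>3 x)) \<rho>3 = 0"
      unfolding \<xi>1_def \<xi>3_def by (rule gradient_orthogonal[OF A(1) a\<rho> o\<rho>])
    then show ?thesis
      unfolding Diff_self_adjoint[of P \<rho>1] Diff_self_adjoint[of P \<rho>3]
      by (simp only: L2_inner_commute[of \<rho>1] L2_inner_commute[of \<rho>3])
  qed
  \<comment> \<open>Pythagoras for gradients bounds those of the projection and of the projection
    error by g alone, uniformly in the set A.\<close>
  have gsum: "g = (L2_inner k1 q1 q1 + L2_inner k1 q3 q3) + (L2_inner k1 \<rho>1 \<rho>1 + L2_inner k1 \<rho>3 \<rho>3)"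
  proof -
    have "w1 = (\<lambda>x. q1 x - \<rho>1 x)" "w3 = (\<lambda>x. q3 x - \<rho>3 x)" by (simp_all add: \<rho>1_def \<rho>3_def)
    then show ?thesis
      using orth1 L2_norm_sq_diff[OF Lq(2) L\<rho>(2)] L2_norm_sq_diff[OF Lq(3) L\<rho>(3)] by (simp add: g_def)
  qed
  have nn: "0 \<le> L2_inner k1 f f" for f :: "point \<Rightarrow> (real^3) \<times> real" by (rule L2_inner_self_nonneg)
  have gq: "L2_inner k1 q1 q1 + L2_inner k1 q3 q3 \<le> g" and g\<rho>: "L2_inner k1 \<rho>1 \<rho>1 + L2_inner k1 \<rho>3 \<rho>3 \<le> g"
    using gsum nn[of q1] nn[of q3] nn[of \<rho>1] nn[of \<rho>3] by linarith+
  have g0: "0 \<le> g" unfolding g_def using nn[of w1] nn[of w3] by linarith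
  define d where "d = L2_inner k1 \<xi>1 \<xi>1 + L2_inner k1 \<xi>3 \<xi>3"
  have d0: "0 \<le> d" unfolding d_def using nn[of \<xi>1] nn[of \<xi>3] by linarith
  have z0: "0 \<le> z" unfolding zz[symmetric] by (rule nn)
  \<comment> \<open>The field under the derivative is fixed as \<xi>; the advecting field and the
    test field are the variable arguments.\<close>
  define T where "T f h = L2_inner k1 (adv f \<xi>1 \<xi>3) h" for f h
  have cadv: "adv f \<xi>1 \<xi>3 \<in> L2_space k1" if "hasd f f1 f3" for f f1 f3
    by (intro continuous_L2 continuous_adv hasd_continuous[OF that] hasd_continuous[OF h\<xi>])
  have Tl: "T (\<lambda>x. f x + f' x) h = T f h + T f' h" if "hasd f f1 f3" "hasd f' f1' f3'" "h \<in> L2_space k1" for f f1 f3 f' f1' f3' h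
    unfolding T_def adv_add[abs_def] by (rule L2_inner_add_left[OF cadv[OF that(1)] cadv[OF that(2)] that(3)])
  have Tr: "T f (\<lambda>x. h x + h' x) = T f h + T f h'" if "hasd f f1 f3" "h \<in> L2_space k1" "h' \<in> L2_space k1" for f f1 f3 h h'
    unfolding T_def by (rule L2_inner_add_right[OF that(2,3) cadv[OF that(1)]])
  \<comment> \<open>Expanding both arguments leaves \<open>T w w\<close>, which cancels against the
    exact equation, and three terms each of which contains \<xi> or \<rho> as an argument;
    \<open>T X \<xi>\<close> is zero by antisymmetry.\<close>
  have "L2_inner k1 (adv X X1 X3) \<xi> = - T X X"
    unfolding T_def by (rule tri_antisym[OF aX hX h\<xi>])
  also have "T X X = T X q + T X \<xi>" by (subst (2) X_eq(1)) (rule Tr[OF hX Lq(1) L\<xi>(1)])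
  also have "T X \<xi> = 0" unfolding T_def by (rule tri_self[OF aX h\<xi>])
  also have "T X q = T q q + T \<xi> q" by (subst X_eq(1)) (rule Tl[OF hq h\<xi> Lq(1)])
  also have "T q q = T w q + T \<rho> q" by (subst q_eq(1)) (rule Tl[OF hw h\<rho> Lq(1)])
  also have "T w q = T w w + T w \<rho>" by (subst q_eq(1)) (rule Tr[OF hw Lw(1) L\<rho>(1)])
  finally have nonlin: "L2_inner k1 (adv w w1 w3) \<xi> - L2_inner k1 (adv X X1 X3) \<xi> = T \<xi> q + T \<rho> q + T w \<rho>"
    using tri_antisym[OF w hw h\<xi>] by (simp add: T_def)
  have DL: "(\<lambda>x. Diff P (f x)) \<in> L2_space k1" if "f \<in> L2_space k1" for f
    by (rule L2_bounded_linear[OF bounded_linear_Diff that])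
  have LL: "(\<lambda>x. Lin R S P (f x)) \<in> L2_space k1" if "f \<in> L2_space k1" for f
    by (rule L2_bounded_linear[OF bounded_linear_Lin that])
  have split: "X x = w x + (\<rho> x + \<xi> x)" "X1 x = w1 x + (\<rho>1 x + \<xi>1 x)" "X3 x = w3 x + (\<rho>3 x + \<xi>3 x)" for x
    by (simp_all add: X_eq q_eq)
  note lD = linear_add[OF bounded_linear.linear[OF bounded_linear_Diff[of P]]]
  note lL = linear_add[OF bounded_linear.linear[OF bounded_linear_Lin[of R S P]]]
  have dif1: "L2_inner k1 (\<lambda>x. Diff P (X1 x)) \<xi>1 = L2_inner k1 (\<lambda>x. Diff P (w1 x)) \<xi>1 + (L2_inner k1 (\<lambda>x. Diff P (\<rho>1 x)) \<xi>1 + L2_inner k1 (\<lambda>x. Diff P (\<xi>1 x)) \<xi>1)"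
    unfolding split lD
    using L2_inner_add_left[OF DL[OF Lw(2)] L2_add[OF DL[OF L\<rho>(2)] DL[OF L\<xi>(2)]] L\<xi>(2)]
      L2_inner_add_left[OF DL[OF L\<rho>(2)] DL[OF L\<xi>(2)] L\<xi>(2)] by simp
  have dif3: "L2_inner k1 (\<lambda>x. Diff P (X3 x)) \<xi>3 = L2_inner k1 (\<lambda>x. Diff P (w3 x)) \<xi>3 + (L2_inner k1 (\<lambda>x. Diff P (\<rho>3 x)) \<xi>3 + L2_inner k1 (\<lambda>x. Diff P (\<xi>3 x)) \<xi>3)"
    unfolding split lD
    using L2_inner_add_left[OF DL[OF Lw(3)] L2_add[OF DL[OF L\<rho>(3)] DL[OF L\<xi>(3)]] L\<xi>(3)]
      L2_inner_add_left[OF DL[OF L\<rho>(3)] DL[OF L\<xi>(3)] L\<xi>(3)] by simp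
  have lin: "L2_inner k1 (\<lambda>x. Lin R S P (X x)) \<xi> = L2_inner k1 (\<lambda>x. Lin R S P (w x)) \<xi> + (L2_inner k1 (\<lambda>x. Lin R S P (\<rho> x)) \<xi> + L2_inner k1 (\<lambda>x. Lin R S P (\<xi> x)) \<xi>)"
    unfolding split lL
    using L2_inner_add_left[OF LL[OF Lw(1)] L2_add[OF LL[OF L\<rho>(1)] LL[OF L\<xi>(1)]] L\<xi>(1)]
      L2_inner_add_left[OF LL[OF L\<rho>(1)] LL[OF L\<xi>(1)] L\<xi>(1)] by simp
  define Lt where "Lt = L2_inner k1 (\<lambda>x. Lin R S P (\<rho> x)) \<xi> + L2_inner k1 (\<lambda>x. Lin R S P (\<xi> x)) \<xi>"
  have sz: "L2_norm k1 \<xi> = sqrt z" by (simp add: L2_norm_eq_sqrt zz)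
  have Lt: "Lt \<le> K * (sqrt z + r) * sqrt z"
  proof -
    have "Lt \<le> K * L2_norm k1 \<rho> * L2_norm k1 \<xi> + K * L2_norm k1 \<xi> * L2_norm k1 \<xi>"
      unfolding Lt_def using K[OF L\<rho>(1) L\<xi>(1)] K[OF L\<xi>(1) L\<xi>(1)] by linarith
    also have "\<dots> \<le> K * r * sqrt z + K * sqrt z * sqrt z"
      unfolding sz using rn K0 z0 by (intro add_right_mono mult_right_mono mult_left_mono) auto
    finally show ?thesis by (simp add: algebra_simps)
  qed
  have dis: "\<kappa> * d \<le> L2_inner k1 (\<lambda>x. Diff P (\<xi>1 x)) \<xi>1 + L2_inner k1 (\<lambda>x. Diff P (\<xi>3 x)) \<xi>3"
    unfolding d_def \<kappa>_def using Diff_coercive[OF L\<xi>(2), of P] Diff_coercive[OF L\<xi>(3), of P] by (simp add: distrib_left)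
  have "(\<Sum>i\<in>A. (a i - k i) * (weak_rhs R S P X X1 X3 (ebas i) (ebas1 i) (ebas3 i) - weak_rhs R S P w w1 w3 (ebas i) (ebas1 i) (ebas3 i)))
    = weak_rhs R S P X X1 X3 \<xi> \<xi>1 \<xi>3 - weak_rhs R S P w w1 w3 \<xi> \<xi>1 \<xi>3"
    unfolding \<xi>_def \<xi>1_def \<xi>3_def weak_rhs_comb[OF A(1) hX] weak_rhs_comb[OF A(1) hw]
    by (simp add: c_def right_diff_distrib sum_subtractf)
  also have "\<dots> \<le> - \<kappa> * d + Lt + (T \<xi> q + T \<rho> q + T w \<rho>)"
    using dis nonlin orthP unfolding weak_rhs_def dif1 dif3 lin Lt_def by linarith
  also have "\<dots> \<le> (3 * K + \<kappa> + lady_const\<^sup>2 * Y * (Y + 1) / \<kappa>^3 + 4 / \<kappa> * lady_const * sqrt Y * (Y + 1)) * (1 + g) * (z + r)"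
  proof (rule error_inequality)
    have mono: "d * (lady_const * sqrt s) \<le> d * (lady_const * sqrt t)" if "s \<le> t" for s t
      using that d0 lady_const_pos by (intro mult_left_mono) auto
    have Hq: "L2_inner k1 q q * (L2_inner k1 q q + (L2_inner k1 q1 q1 + L2_inner k1 q3 q3)) \<le> Y * (Y + g)"
      using qY gq nn by (intro mult_mono add_mono) (auto intro: add_nonneg_nonneg simp: Y0)
    have Hw: "L2_inner k1 w w * (L2_inner k1 w w + (L2_inner k1 w1 w1 + L2_inner k1 w3 w3)) \<le> Y * (Y + g)"
      using Y nn by (intro mult_mono add_mono) (auto intro: add_nonneg_nonneg simp: Y0 g_def)
    have H\<rho>: "L2_inner k1 \<rho> \<rho> * (L2_inner k1 \<rho> \<rho> + (L2_inner k1 \<rho>1 \<rho>1 + L2_inner k1 \<rho>3 \<rho>3)) \<le> r\<^sup>2 * (Y + g)"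
      using \<rho>r \<rho>Y g\<rho> nn by (intro mult_mono add_mono) (auto intro: add_nonneg_nonneg simp: Y0)
    have pos: "0 \<le> L2_inner k1 f f * (L2_inner k1 f f + (L2_inner k1 f1 f1 + L2_inner k1 f3 f3))" for f f1 f3 :: "point \<Rightarrow> (real^3) \<times> real"
      using nn by (intro mult_nonneg_nonneg add_nonneg_nonneg)
    have Yg: "0 \<le> Y * (Y + g)" "0 \<le> r\<^sup>2 * (Y + g)" "0 \<le> z * (z + d)" using Y0 g0 z0 d0 by auto
    show "(T \<xi> q)\<^sup>2 \<le> d * (lady_const * sqrt ((z * (z + d)) * (Y * (Y + g))))"
      unfolding T_def
      by (rule order_trans[OF tri_bound[OF h\<xi> h\<xi> hq]]) (unfold zz d_def[symmetric], intro mono mult_mono Hq order_refl pos Yg)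
    show "(T \<rho> q)\<^sup>2 \<le> d * (lady_const * sqrt ((r\<^sup>2 * (Y + g)) * (Y * (Y + g))))"
      unfolding T_def
      by (rule order_trans[OF tri_bound[OF h\<rho> h\<xi> hq]]) (unfold d_def[symmetric], intro mono mult_mono Hq H\<rho> pos Yg)
    show "(T w \<rho>)\<^sup>2 \<le> d * (lady_const * sqrt ((Y * (Y + g)) * (r\<^sup>2 * (Y + g))))"
      unfolding T_def
      by (rule order_trans[OF tri_bound[OF hw h\<xi> h\<rho>]]) (unfold d_def[symmetric], intro mono mult_mono Hw H\<rho> pos Yg)
  qed (use P K0 lady_const_pos z0 d0 r0 r(2) Y0 g0 Lt in \<open>auto simp: \<kappa>_def\<close>)
  finally show ?thesis
    unfolding X_def X1_def X3_def \<kappa>_def g_def .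
qed


section \<open>Pairs of velocity and temperature as fields in L2\<close>

lemma fld_L2:
  assumes "fst Z \<in> L2_space k1" "snd Z \<in> L2_space k1"
  shows "fld Z \<in> L2_space k1"
proof -
  have "bounded_linear (\<lambda>v::real^3. (v, 0::real))" "bounded_linear (\<lambda>v::real. (0::real^3, v))"
    by (auto intro!: linear_conv_bounded_linear[THEN iffD1] linearI)
  from L2_add[OF L2_bounded_linear[OF this(1) assms(1)] L2_bounded_linear[OF this(2) assms(2)]]
  show ?thesis by (simp add: fld_def[abs_def])
qed

lemma HH0_norm_fld:
  assumes "fst Z \<in> L2_space k1" "snd Z \<in> L2_space k1"
  shows "HH0_norm k1 Z = L2_norm k1 (fld Z)"
proof -
  have "L2_inner k1 (fld Z) (fld Z) = L2_inner k1 (fst Z) (fst Z) + L2_inner k1 (snd Z) (snd Z)"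
    using L2_inner_Pair[OF assms fld_L2[OF assms]] by (simp add: fld_def[abs_def])
  then show ?thesis
    unfolding HH0_norm_def L2_norm_sq by (simp add: L2_norm_eq_sqrt[of "fld Z"])
qed

lemma HH0_L2: "Z \<in> HH0 k1 \<Longrightarrow> fst Z \<in> L2_space k1 \<and> snd Z \<in> L2_space k1"
  by (auto simp: HH0_def L2_sigma_def)

lemma fld_minus: "fld (Z - Z') = (\<lambda>x. fld Z x - fld Z' x)"
  by (simp add: fld_def fun_eq_iff)

lemma HH0_norm_minus:
  assumes "fst Z \<in> L2_space k1" "snd Z \<in> L2_space k1" "fst Z' \<in> L2_space k1" "snd Z' \<in> L2_space k1"
  shows "HH0_norm k1 (Z - Z') = L2_norm k1 (\<lambda>x. fld Z x - fld Z' x)"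
proof -
  have "fst (Z - Z') \<in> L2_space k1" "snd (Z - Z') \<in> L2_space k1"
    using L2_diff[OF assms(1,3)] L2_diff[OF assms(2,4)] by (simp_all add: fun_diff_def)
  from HH0_norm_fld[OF this] show ?thesis by (simp add: fld_minus)
qed

lemma in_C_HH0_tendsto:
  assumes X: "in_C_HH0 k1 \<tau> X" and t: "t \<in> {0..\<tau>}"
  shows "((\<lambda>s. L2_norm k1 (\<lambda>x. fld (X s) x - fld (X t) x)) \<longlongrightarrow> 0) (at t within {0..\<tau>})"
proof (rule Lim_transform_eventually)
  show "((\<lambda>s. HH0_norm k1 (X s - X t)) \<longlongrightarrow> 0) (at t within {0..\<tau>})"
    using X t by (auto simp: in_C_HH0_def)
  have "HH0_norm k1 (X s - X t) = L2_norm k1 (\<lambda>x. fld (X s) x - fld (X t) x)" if "s \<in> {0..\<tau>}" for s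
    using X t that HH0_L2[of "X s"] HH0_L2[of "X t"] by (intro HH0_norm_minus) (auto simp: in_C_HH0_def)
  then show "\<forall>\<^sub>F s in at t within {0..\<tau>}. HH0_norm k1 (X s - X t) = L2_norm k1 (\<lambda>x. fld (X s) x - fld (X t) x)"
    by (auto simp: eventually_at_filter)
qed

subsection \<open>Uniform convergence of the projections\<close>

lemma AA_exhaust:
  assumes "finite B" "B \<subseteq> NN"
  shows "\<exists>M. \<forall>M'\<ge>M. B \<subseteq> AA M'"
  using assms
proof (induction B rule: finite_induct)
  case (insert i B)
  then obtain M where M: "\<forall>M'\<ge>M. B \<subseteq> AA M'" by auto
  obtain M1 where M1: "i \<in> AA M1" using AA_cover[of i] insert.prems by auto
  show ?case
  proof (intro exI[of _ "max M M1"] allI impI)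
    fix M' assume M': "max M M1 \<le> M'"
    have "i \<in> AA M'" using AA_mono[of M1 M'] M' M1 by auto
    moreover have "B \<subseteq> AA M'" using M M' by auto
    ultimately show "insert i B \<subseteq> AA M'" by simp
  qed
qed simp

text \<open>Density of the velocity basis and of the temperature basis combined. The temperature is
  continuous, periodic and zero on the walls here, as the solution is at positive times.\<close>

lemma comb_dense:
  assumes u: "u \<in> L2_sigma k1" and c: "continuous_on strip \<theta>" and per: "periodic_x1 k1 \<theta>"
    and bc: "temperature_bc \<theta>" and e: "0 < e"
  shows "\<exists>B c. finite B \<and> B \<subseteq> NN \<and> L2_norm k1 (\<lambda>x. fld (u, \<theta>) x - comb B c ebas x) < e"
proof -
  have e2: "0 < e / 2" using e by simp
  obtain g where g: "g \<in> lspan N_u (u_basis k1)" "L2_norm k1 (\<lambda>x. u x - g x) < e / 2"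
    using L2_sigma_dense[OF u e2] by blast
  obtain h where h: "h \<in> lspan N_theta (theta_basis k1)" "L2_norm k1 (\<lambda>x. \<theta> x - h x) < e / 2"
    using theta_dense[OF c per _ e2] bc by (auto simp: temperature_bc_def)
  obtain A a where A: "finite A" "A \<subseteq> N_u" "g = (\<lambda>x. \<Sum>n\<in>A. a n *\<^sub>R u_basis k1 n x)"
    using g(1) by (auto simp: lspan_def)
  obtain A' a' where A': "finite A'" "A' \<subseteq> N_theta" "h = (\<lambda>x. \<Sum>n\<in>A'. a' n *\<^sub>R theta_basis k1 n x)"
    using h(1) unfolding lspan_def by blast
  define B where "B = Pair True ` A \<union> Pair False ` A'"
  define k where "k i = (if fst i then a (snd i) else a' (snd i))" for i :: "bool \<times> mode"
  have B: "finite B" "B \<subseteq> NN" using A A' by (auto simp: B_def NN_def)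
  have "comb B k ebas x = (g x, h x)" for x
  proof -
    have "Pair True ` A \<inter> Pair False ` A' = {}" by auto
    then have "comb B k ebas x = (\<Sum>n\<in>A. k (True, n) *\<^sub>R ebas (True, n) x) + (\<Sum>n\<in>A'. k (False, n) *\<^sub>R ebas (False, n) x)"
      unfolding comb_def B_def using A(1) A'(1) by (simp add: sum.union_disjoint sum.reindex inj_on_def)
    then show ?thesis
      by (simp add: k_def ebas_u ebas_theta A(3) A'(3) prod_eq_iff fst_sum snd_sum)
  qed
  then have eq: "(\<lambda>x. fld (u, \<theta>) x - comb B k ebas x) = fld (\<lambda>x. u x - g x, \<lambda>x. \<theta> x - h x)"
    by (simp add: fun_eq_iff fld_def)
  have L: "(\<lambda>x. u x - g x) \<in> L2_space k1" "(\<lambda>x. \<theta> x - h x) \<in> L2_space k1"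
  proof -
    show "(\<lambda>x. u x - g x) \<in> L2_space k1"
      using u lspan_u_solenoidal(1)[OF g(1)] by (intro L2_diff) (auto simp: L2_sigma_def)
    show "(\<lambda>x. \<theta> x - h x) \<in> L2_space k1"
      unfolding A'(3)
      by (intro L2_diff continuous_L2[OF c] L2_combination[OF orthonormal_subset[OF orthonormal_theta_basis A'(2)] A'(1)])
  qed
  have "L2_norm k1 (fld (\<lambda>x. u x - g x, \<lambda>x. \<theta> x - h x)) = sqrt ((L2_norm k1 (\<lambda>x. u x - g x))\<^sup>2 + (L2_norm k1 (\<lambda>x. \<theta> x - h x))\<^sup>2)"
    using HH0_norm_fld[of "(\<lambda>x. u x - g x, \<lambda>x. \<theta> x - h x)"] L by (simp add: HH0_norm_def)
  also have "\<dots> \<le> L2_norm k1 (\<lambda>x. u x - g x) + L2_norm k1 (\<lambda>x. \<theta> x - h x)"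
    by (intro sqrt_sum_squares_le_sum L2_norm_nonneg)
  also have "\<dots> < e" using g(2) h(2) by simp
  finally show ?thesis using B unfolding eq[symmetric] by blast
qed

lemma L2_tendsto_ball:
  fixes W :: "real \<Rightarrow> point \<Rightarrow> 'b::euclidean_space"
  assumes "((\<lambda>s. L2_norm k1 (\<lambda>x. W s x - W t x)) \<longlongrightarrow> 0) (at t within U)" and "0 < e"
  obtains \<delta> where "\<delta> > 0" "\<And>s. s \<in> U \<Longrightarrow> s \<noteq> t \<Longrightarrow> dist s t < \<delta> \<Longrightarrow> L2_norm k1 (\<lambda>x. W s x - W t x) < e"
proof -
  obtain \<delta> where "\<delta> > 0" "\<forall>s\<in>U. s \<noteq> t \<and> dist s t < \<delta> \<longrightarrow> dist (L2_norm k1 (\<lambda>x. W s x - W t x)) 0 < e"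
    using tendstoD[OF assms] unfolding eventually_at by blast
  then show ?thesis by (intro that[of \<delta>]) (auto simp: dist_real_def)
qed

text \<open>A finite combination that is close to W t is also close to W s for s near t, and the
  partial sums over all larger sets of modes do at least as well. Compactness of [0,\<tau>] leaves
  finitely many thresholds, of which the maximum is taken.\<close>

lemma partial_sums_uniform:
  fixes W :: "real \<Rightarrow> point \<Rightarrow> (real^3) \<times> real"
  assumes W: "\<And>t. t \<in> {0..\<tau>} \<Longrightarrow> W t \<in> L2_space k1"
    and cont: "\<And>t. t \<in> {0..\<tau>} \<Longrightarrow> ((\<lambda>s. L2_norm k1 (\<lambda>x. W s x - W t x)) \<longlongrightarrow> 0) (at t within {0..\<tau>})"
    and dense: "\<And>t e. t \<in> {0..\<tau>} \<Longrightarrow> 0 < e \<Longrightarrow>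
      \<exists>B c. finite B \<and> B \<subseteq> NN \<and> L2_norm k1 (\<lambda>x. W t x - comb B c ebas x) < e"
    and e: "0 < (e::real)"
  shows "\<exists>M0. \<forall>M\<ge>M0. \<forall>t\<in>{0..\<tau>}. L2_norm k1 (\<lambda>x. W t x - partial_sum ebas (AA M) (W t) x) \<le> e"
proof -
  define Good where "Good s M \<longleftrightarrow> L2_norm k1 (\<lambda>x. W s x - partial_sum ebas (AA M) (W s) x) \<le> e" for s M
  have loc: "\<exists>p::real \<times> nat. 0 < fst p \<and> (\<forall>s\<in>{0..\<tau>}. dist t s < fst p \<longrightarrow> (\<forall>M\<ge>snd p. Good s M))"
    if t: "t \<in> {0..\<tau>}" for t
  proof -
    have e2: "0 < e / 2" using e by simp
    obtain B c where B: "finite B" "B \<subseteq> NN" "L2_norm k1 (\<lambda>x. W t x - comb B c ebas x) < e / 2"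
      using dense[OF t e2] by blast
    obtain M0 where M0: "\<forall>M\<ge>M0. B \<subseteq> AA M" using AA_exhaust[OF B(1,2)] by blast
    obtain \<delta> where \<delta>: "\<delta> > 0" "\<And>s. s \<in> {0..\<tau>} \<Longrightarrow> s \<noteq> t \<Longrightarrow> dist s t < \<delta> \<Longrightarrow> L2_norm k1 (\<lambda>x. W s x - W t x) < e / 2"
      using L2_tendsto_ball[OF cont[OF t] e2] by blast
    have "L2_norm k1 (\<lambda>x. W s x - partial_sum ebas (AA M) (W s) x) \<le> e"
      if s: "s \<in> {0..\<tau>}" "dist t s < \<delta>" and M: "M \<ge> M0" for s M
    proof -
      have cL: "(\<lambda>x. comb B c ebas x) \<in> L2_space k1" using hasd_L2(1)[OF hasd_comb] by simp
      have st: "L2_norm k1 (\<lambda>x. W s x - W t x) \<le> e / 2"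
      proof (cases "s = t")
        case True
        then show ?thesis using e by (simp add: L2_norm_def)
      next
        case False
        then show ?thesis using \<delta>(2)[OF s(1)] s(2) by (simp add: dist_commute less_imp_le)
      qed
      have "L2_norm k1 (\<lambda>x. W s x - partial_sum ebas (AA M) (W s) x) \<le> L2_norm k1 (\<lambda>x. W s x - comb B c ebas x)"
        unfolding comb_def
        by (rule partial_sum_mono[OF orthonormal_subset[OF orthonormal_ebas AA(2)] AA(1) _ W[OF s(1)]]) (use M0 M in blast)
      also have "\<dots> \<le> L2_norm k1 (\<lambda>x. W s x - W t x) + L2_norm k1 (\<lambda>x. W t x - comb B c ebas x)"
        by (rule L2_triangle_diff[OF W[OF s(1)] W[OF t] cL])
      also have "\<dots> \<le> e" using st B(3) by linarith
      finally show ?thesis .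
    qed
    then show ?thesis using \<delta>(1) unfolding Good_def by (intro exI[of _ "(\<delta>, M0)"]) simp
  qed
  have "\<exists>p. \<forall>t\<in>{0..\<tau>}. 0 < fst (p t) \<and> (\<forall>s\<in>{0..\<tau>}. dist t s < fst (p t) \<longrightarrow> (\<forall>M\<ge>snd (p t :: real \<times> nat). Good s M))"
    by (rule bchoice) (blast intro: loc)
  then obtain p :: "real \<Rightarrow> real \<times> nat" where p: "\<forall>t\<in>{0..\<tau>}. 0 < fst (p t) \<and> (\<forall>s\<in>{0..\<tau>}. dist t s < fst (p t) \<longrightarrow> (\<forall>M\<ge>snd (p t). Good s M))"
    by (rule exE)
  define \<delta> where "\<delta> t = fst (p t)" for t
  define N where "N t = snd (p t)" for t
  have \<delta>: "\<And>t. t \<in> {0..\<tau>} \<Longrightarrow> \<delta> t > 0"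
    and N: "\<And>t s M. t \<in> {0..\<tau>} \<Longrightarrow> s \<in> {0..\<tau>} \<Longrightarrow> dist t s < \<delta> t \<Longrightarrow> M \<ge> N t \<Longrightarrow> Good s M"
    using p unfolding \<delta>_def N_def by blast+
  have "{0..\<tau>} \<subseteq> (\<Union>t\<in>{0..\<tau>}. ball t (\<delta> t))" using \<delta> by force
  then obtain T where T: "T \<subseteq> {0..\<tau>}" "finite T" "{0..\<tau>} \<subseteq> (\<Union>t\<in>T. ball t (\<delta> t))"
    using compactE_image[of "{0..\<tau>}" "{0..\<tau>}" "\<lambda>t. ball t (\<delta> t)"] by auto
  show ?thesis
  proof (intro exI[of _ "Max (insert 0 (N ` T))"] allI impI ballI)
    fix M s assume M: "Max (insert 0 (N ` T)) \<le> M" and s: "s \<in> {0..\<tau>}"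
    obtain t where t: "t \<in> T" "dist t s < \<delta> t" using T(3) s by auto
    have "N t \<le> M" using M T(2) t(1) by auto
    then show "L2_norm k1 (\<lambda>x. W s x - partial_sum ebas (AA M) (W s) x) \<le> e"
      using N[of t s M] t T(1) s unfolding Good_def by blast
  qed
qed

subsection \<open>Convergence\<close>

lemma ebas_L2_sigma:
  assumes "i \<in> NN"
  shows "(\<lambda>x. fst (ebas i x)) \<in> L2_sigma k1"
proof -
  obtain b n where i: "i = (b, n)" by (cases i)
  show ?thesis
  proof (cases b)
    case True
    then have "(\<lambda>x. fst (ebas i x)) = u_basis k1 n" "n \<in> N_u"
      using assms by (auto simp: i ebas_u NN_def)
    then show ?thesis using smooth_solenoidal_L2_sigma[OF u_basis_solenoidal] by simp
  next
    case False
    then have "(\<lambda>x. fst (ebas i x)) = (\<lambda>x. 0)" by (simp add: i ebas_theta)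
    then show ?thesis using smooth_solenoidal_L2_sigma[OF smooth_solenoidal_zero] by simp
  qed
qed

text \<open>On \<open>HK M\<close> the projection keeps the coefficients. The remaining modes of
  \<open>AA M\<close> have the wrong phase: there the phase locking of X0 makes its coefficients
  zero, as are those of the model.\<close>

lemma initial_coefficients:
  assumes X0: "X0 \<in> HH0 k1" and locked: "phase_locked k1 X0"
    and a: "fld (proj_HKC k1 M X0) = comb (AA M) a ebas" and az: "\<And>i. i \<notin> HK M \<Longrightarrow> a i = 0" and i: "i \<in> AA M"
  shows "a i = L2_inner k1 (fld X0) (ebas i)"
proof -
  have L: "fst X0 \<in> L2_space k1" "snd X0 \<in> L2_space k1" using HH0_L2[OF X0] by auto
  have iN: "i \<in> NN" using i AA(2) by blast
  have T: "L2_inner k1 (fld Z) (ebas (True, n)) = L2_inner k1 (fst Z) (u_basis k1 n)" for Z n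
    by (rule L2_inner_cong) (simp add: fld_def ebas_u inner_prod_def)
  have F: "L2_inner k1 (fld Z) (ebas (False, n)) = L2_inner k1 (snd Z) (theta_basis k1 n)" for Z n
    by (rule L2_inner_cong) (simp add: fld_def ebas_theta inner_prod_def)
  obtain b n where bn: "i = (b, n)" by (cases i)
  show ?thesis
  proof (cases "i \<in> HK M")
    case True
    have "a i = L2_inner k1 (fld (proj_HKC k1 M X0)) (ebas i)"
      unfolding a comb_def
      by (rule combination_coeff[OF orthonormal_subset[OF orthonormal_ebas AA(2)] AA(1) i, symmetric])
    also have "\<dots> = L2_inner k1 (fld X0) (ebas i)"
    proof (cases b)
      case b: True
      then have "n \<in> N_u_HKC M" using True by (auto simp: bn HK_def)
      from proj_u_inner(3)[OF L(1) this] show ?thesis using b by (simp add: bn T proj_HKC_def)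
    next
      case b: False
      then have "n \<in> N_theta_HKC M" using True by (auto simp: bn HK_def)
      from proj_theta_inner(3)[OF L(2) this] show ?thesis using b by (simp add: bn F proj_HKC_def)
    qed
    finally show ?thesis .
  next
    case False
    then have "\<not> locked_phase n" using AA_unlocked[of i M] i by (auto simp: bn)
    then have "L2_inner k1 (fld X0) (ebas i) = 0"
      using locked iN unfolding phase_locked_def bn NN_def by (cases b) (auto simp: T F)
    then show ?thesis using az[OF False] by simp
  qed
qed

text \<open>The convergence is uniform in time: the distance is at most the projection error r plus
  the root of z, and each is kept below \<eta>/2.\<close>

lemma HH0_convergence:
  assumes P: "0 < P" and X0: "X0 \<in> HH0 k1" and locked: "phase_locked k1 X0"
    and X: "bc_solution R S P k1 X0 X"
    and XM: "\<And>M. M \<ge> 1 \<Longrightarrow> hkc_solution R S P k1 M (proj_HKC k1 M X0) (XM M)"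
    and \<tau>: "0 < \<tau>" and \<eta>: "0 < \<eta>"
  shows "\<exists>M0. \<forall>M>M0. \<forall>t\<in>{0..\<tau>}. HH0_norm k1 (X t - XM M t) \<le> \<eta>"
proof -
  define W where "W t = fld (X t)" for t
  have CX: "in_C_HH0 k1 \<tau> X" using X \<tau> unfolding bc_solution_def Let_def by blast
  have XH: "X t \<in> HH0 k1" if "t \<in> {0..\<tau>}" for t using CX that by (simp add: in_C_HH0_def)
  have WL: "W t \<in> L2_space k1" if "t \<in> {0..\<tau>}" for t
    using HH0_L2[OF XH[OF that]] unfolding W_def by (blast intro: fld_L2)
  note Wlim = in_C_HH0_tendsto[OF CX, folded W_def]
  obtain Wt W1 W3 where jc: "continuous_on ({0<..} \<times> strip) (\<lambda>(t, x). W t x)"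
      "continuous_on ({0<..} \<times> strip) (\<lambda>(t, x). Wt t x)"
    and dW: "\<And>t x. 0 < t \<Longrightarrow> x \<in> strip \<Longrightarrow> ((\<lambda>s. W s x) has_vector_derivative Wt t x) (at t)"
    and adm: "\<And>t. 0 < t \<Longrightarrow> admfield (W t) (W1 t) (W3 t)"
    and weak: "\<And>t v v1 v3. 0 < t \<Longrightarrow> admfield v v1 v3 \<Longrightarrow> (\<lambda>x. fst (v x)) \<in> L2_sigma k1 \<Longrightarrow>
        L2_inner k1 (Wt t) v = weak_rhs R S P (W t) (W1 t) (W3 t) v v1 v3"
    using exact_solution_weak[OF X, folded W_def] by blast
  define c where "c t i = L2_inner k1 (W t) (ebas i)" for t i
  define y where "y t = L2_inner k1 (W t) (W t)" for t
  have eN: "L2_norm k1 (ebas i) = 1" if "i \<in> NN" for i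
    using L2_inner_ebas[OF that that] by (simp add: L2_norm_eq_sqrt)
  have eL: "ebas i \<in> L2_space k1" for i by (rule hasd_L2(1)[OF hasd_ebas])
  have c_cont: "continuous_on {0..\<tau>} (\<lambda>t. c t i)" if i: "i \<in> NN" for i
    unfolding continuous_on_def
  proof
    fix t assume t: "t \<in> {0..\<tau>}"
    have "((\<lambda>s. c s i - c t i) \<longlongrightarrow> 0) (at t within {0..\<tau>})"
    proof (rule Lim_null_comparison[OF _ Wlim[OF t]])
      have "norm (c s i - c t i) \<le> L2_norm k1 (\<lambda>x. W s x - W t x)" if s: "s \<in> {0..\<tau>}" for s
        using L2_Cauchy_Schwarz[OF L2_diff[OF WL[OF s] WL[OF t]] eL[of i]] L2_inner_diff_left[OF WL[OF s] WL[OF t] eL[of i]]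
        by (simp add: c_def eN[OF i])
      then show "\<forall>\<^sub>F s in at t within {0..\<tau>}. norm (c s i - c t i) \<le> L2_norm k1 (\<lambda>x. W s x - W t x)"
        by (auto simp: eventually_at_filter)
    qed
    then show "((\<lambda>s. c s i) \<longlongrightarrow> c t i) (at t within {0..\<tau>})" by (rule LIM_zero_cancel)
  qed
  have n_cont: "continuous_on {0..\<tau>} (\<lambda>t. L2_norm k1 (W t))"
    unfolding continuous_on_def
  proof
    fix t assume t: "t \<in> {0..\<tau>}"
    have "((\<lambda>s. L2_norm k1 (W s) - L2_norm k1 (W t)) \<longlongrightarrow> 0) (at t within {0..\<tau>})"
    proof (rule Lim_null_comparison[OF _ Wlim[OF t]])
      show "\<forall>\<^sub>F s in at t within {0..\<tau>}. norm (L2_norm k1 (W s) - L2_norm k1 (W t)) \<le> L2_norm k1 (\<lambda>x. W s x - W t x)"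
        using L2_norm_abs_diff[OF WL WL[OF t]] by (auto simp: eventually_at_filter)
    qed
    then show "((\<lambda>s. L2_norm k1 (W s)) \<longlongrightarrow> L2_norm k1 (W t)) (at t within {0..\<tau>})" by (rule LIM_zero_cancel)
  qed
  have y_cont: "continuous_on {0..\<tau>} y"
  proof -
    have "y = (\<lambda>t. (L2_norm k1 (W t))\<^sup>2)" by (simp add: fun_eq_iff y_def L2_norm_sq)
    then show ?thesis by (simp only:) (intro continuous_intros n_cont)
  qed
  \<comment> \<open>The energy bound Y is the maximum of the continuous function y on [0,\<tau>]; it
    depends on the solution but not on M.\<close>
  obtain t1 where "\<forall>t\<in>{0..\<tau>}. y t \<le> y t1"
    using continuous_attains_sup[OF compact_Icc _ y_cont] \<tau> by auto
  then obtain Y where Y: "\<And>t. t \<in> {0..\<tau>} \<Longrightarrow> y t \<le> Y" by blast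
  have y0: "0 \<le> y t" for t unfolding y_def by (rule L2_inner_self_nonneg)
  have Y0: "0 \<le> Y" using Y[of 0] y0[of 0] \<tau> by auto
  have dc: "((\<lambda>s. c s i) has_real_derivative weak_rhs R S P (W t) (W1 t) (W3 t) (ebas i) (ebas1 i) (ebas3 i)) (at t)"
    if t: "0 < t" and i: "i \<in> NN" for t i
  proof -
    have ce: "continuous_on ({0<..} \<times> strip) (\<lambda>z. ebas i (snd z))"
      unfolding ebas_def by (rule continuous_on_compose2[OF continuous_trig[of UNIV]]) (auto intro: continuous_intros)
    have "((\<lambda>s. LINT x|mC. W s x \<bullet> ebas i x) has_real_derivative (LINT x|mC. Wt t x \<bullet> ebas i x)) (at t)"
    proof (rule time_derivative_integral[OF _ _ _ t])
      show "continuous_on ({0<..} \<times> strip) (\<lambda>(t, x). W t x \<bullet> ebas i x)"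
        using continuous_on_inner[OF jc(1) ce] by (simp add: split_beta)
      show "continuous_on ({0<..} \<times> strip) (\<lambda>(t, x). Wt t x \<bullet> ebas i x)"
        using continuous_on_inner[OF jc(2) ce] by (simp add: split_beta)
      show "((\<lambda>s. W s x \<bullet> ebas i x) has_vector_derivative Wt t x \<bullet> ebas i x) (at t)" if "0 < t" "x \<in> strip" for t x
        by (rule bounded_linear.has_vector_derivative[OF bounded_linear_inner_left dW[OF that]])
    qed
    then show ?thesis
      using weak[OF t admfield_ebas ebas_L2_sigma[OF i]] by (simp add: c_def L2_inner_def)
  qed
  have WS: "(\<lambda>x. fst (W t x)) \<in> L2_sigma k1" if "t \<in> {0..\<tau>}" for t
    using XH[OF that] by (simp add: W_def fld_def HH0_def mem_Times_iff)
  have dy: "(y has_real_derivative 2 * weak_rhs R S P (W t) (W1 t) (W3 t) (W t) (W1 t) (W3 t)) (at t)"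
    if t: "0 < t" "t < \<tau>" for t
  proof -
    have "((\<lambda>s. LINT x|mC. W s x \<bullet> W s x) has_real_derivative (LINT x|mC. W t x \<bullet> Wt t x + Wt t x \<bullet> W t x)) (at t)"
    proof (rule time_derivative_integral[OF _ _ _ t(1)])
      show "continuous_on ({0<..} \<times> strip) (\<lambda>(t, x). W t x \<bullet> W t x)"
        using continuous_on_inner[OF jc(1) jc(1)] by (simp add: split_beta)
      show "continuous_on ({0<..} \<times> strip) (\<lambda>(t, x). W t x \<bullet> Wt t x + Wt t x \<bullet> W t x)"
        using continuous_on_add[OF continuous_on_inner[OF jc(1) jc(2)] continuous_on_inner[OF jc(2) jc(1)]] by (simp add: split_beta)
      show "((\<lambda>s. W s x \<bullet> W s x) has_vector_derivative W t x \<bullet> Wt t x + Wt t x \<bullet> W t x) (at t)" if "0 < t" "x \<in> strip" for t x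
        by (rule bounded_bilinear.has_vector_derivative[OF bounded_bilinear_inner dW[OF that] dW[OF that]])
    qed
    moreover have "(LINT x|mC. W t x \<bullet> Wt t x + Wt t x \<bullet> W t x) = 2 * L2_inner k1 (Wt t) (W t)"
      by (simp add: L2_inner_def inner_commute[of "W t x" for x])
    moreover have "L2_inner k1 (Wt t) (W t) = weak_rhs R S P (W t) (W1 t) (W3 t) (W t) (W1 t) (W3 t)"
      by (rule weak[OF t(1) adm[OF t(1)] WS]) (use t in simp)
    ultimately show ?thesis by (simp add: y_def[abs_def] L2_inner_def)
  qed
  obtain K where K0: "0 \<le> K" and K: "\<And>w v. w \<in> L2_space k1 \<Longrightarrow> v \<in> L2_space k1 \<Longrightarrow>
    L2_inner k1 (\<lambda>x. Lin R S P (w x)) v \<le> K * L2_norm k1 w * L2_norm k1 v"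
    using Lin_bound[where R = R and S = S and P = P] by blast
  define \<kappa> where "\<kappa> = min P 1"
  have \<kappa>: "0 < \<kappa>" using P by (simp add: \<kappa>_def)
  \<comment> \<open>Twice the constant of \<open>error_estimate\<close>; the factor 2 comes from
    differentiating the squares in z.\<close>
  define C where "C = 2 * (3 * K + \<kappa> + lady_const\<^sup>2 * Y * (Y + 1) / \<kappa>^3 + 4 / \<kappa> * lady_const * sqrt Y * (Y + 1))"
  have C0: "0 \<le> C" using K0 \<kappa> Y0 lady_const_pos unfolding C_def by (intro mult_nonneg_nonneg add_nonneg_nonneg) auto
  define E where "E = exp (C * (\<tau> + (2 * K * Y * \<tau> + Y) / (2 * \<kappa>)))"
  have E: "0 < E" by (simp add: E_def)
  \<comment> \<open>The three bounds serve \<open>error_estimate\<close> (r \<le> 1), the projection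
    error (r \<le> \<eta>/2) and Gronwall's inequality (r E \<le> (\<eta>/2)^2).\<close>
  define r where "r = min (min 1 (\<eta> / 2)) ((\<eta> / 2)\<^sup>2 / E)"
  have r: "0 < r" "r \<le> 1" "r \<le> \<eta> / 2" "r * E \<le> (\<eta> / 2)\<^sup>2"
  proof -
    show "0 < r" using \<eta> E by (simp add: r_def)
    show "r \<le> 1" "r \<le> \<eta> / 2" unfolding r_def by (meson min.cobounded1 min.cobounded2 order_trans)+
    have "r \<le> (\<eta> / 2)\<^sup>2 / E" by (simp add: r_def)
    then show "r * E \<le> (\<eta> / 2)\<^sup>2" using E by (simp add: pos_le_divide_eq)
  qed
  have dpos: "\<exists>B c. finite B \<and> B \<subseteq> NN \<and> L2_norm k1 (\<lambda>x. W t x - comb B c ebas x) < e"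
    if t: "t \<in> {0..\<tau>}" "0 < t" and e: "0 < e" for t e
  proof -
    have sol: "periodic_x1 k1 (snd (X t))" "temperature_bc (snd (X t))"
      using X t(2) unfolding bc_solution_def Let_def by blast+
    have "continuous_on strip (W t)" by (rule hasd_continuous(1)[OF admfield_hasd[OF adm[OF t(2)]]])
    then have "continuous_on strip (\<lambda>x. snd (W t x))" by (rule continuous_on_snd)
    then have "continuous_on strip (snd (X t))" by (simp add: W_def fld_def)
    from comb_dense[OF _ this sol e, of "fst (X t)"] show ?thesis
      using XH[OF t(1)] by (simp add: W_def HH0_def mem_Times_iff)
  qed
  \<comment> \<open>At t = 0 the temperature is just square integrable, so \<open>comb_dense\<close>
    does not apply; continuity in L2 gives an approximation from a small positive time.\<close>
  have dense: "\<exists>B c. finite B \<and> B \<subseteq> NN \<and> L2_norm k1 (\<lambda>x. W t x - comb B c ebas x) < e"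
    if t: "t \<in> {0..\<tau>}" and e: "0 < e" for t e
  proof (cases "t = 0")
    case False
    then show ?thesis using dpos[OF t _ e] t by auto
  next
    case True
    have e2: "0 < e / 2" using e by simp
    obtain \<delta> where \<delta>: "\<delta> > 0" "\<And>s. s \<in> {0..\<tau>} \<Longrightarrow> s \<noteq> t \<Longrightarrow> dist s t < \<delta> \<Longrightarrow> L2_norm k1 (\<lambda>x. W s x - W t x) < e / 2"
      using L2_tendsto_ball[OF Wlim[OF t] e2] by blast
    define s where "s = min (\<delta> / 2) \<tau>"
    have s: "s \<in> {0..\<tau>}" "0 < s" "L2_norm k1 (\<lambda>x. W s x - W t x) < e / 2"
      using \<delta>(1) \<tau> \<delta>(2)[of s] by (auto simp: s_def True dist_real_def)
    obtain B c' where B: "finite B" "B \<subseteq> NN" "L2_norm k1 (\<lambda>x. W s x - comb B c' ebas x) < e / 2"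
      using dpos[OF s(1,2) e2] by blast
    have "L2_norm k1 (\<lambda>x. W t x - comb B c' ebas x) \<le> L2_norm k1 (\<lambda>x. W t x - W s x) + L2_norm k1 (\<lambda>x. W s x - comb B c' ebas x)"
      by (rule L2_triangle_diff[OF WL[OF t] WL[OF s(1)] hasd_L2(1)[OF hasd_comb]])
    also have "\<dots> < e" using B(3) s(3) L2_norm_minus_commute[of "W t" "W s"] by linarith
    finally show ?thesis using B(1,2) by blast
  qed
  obtain M0 where M0: "\<And>M t. M \<ge> M0 \<Longrightarrow> t \<in> {0..\<tau>} \<Longrightarrow> L2_norm k1 (\<lambda>x. W t x - partial_sum ebas (AA M) (W t) x) \<le> r"
    using partial_sums_uniform[OF WL Wlim dense r(1)] by blast
  have "HH0_norm k1 (X t - XM M t) \<le> \<eta>" if M: "M > M0" and t: "t \<in> {0..\<tau>}" for M t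
  proof -
    have hk: "hkc_solution R S P k1 M (proj_HKC k1 M X0) (XM M)" using XM M by simp
    obtain a where a: "\<And>t. t \<ge> 0 \<Longrightarrow> fld (XM M t) = comb (AA M) (a t) ebas" "\<And>t i. i \<notin> HK M \<Longrightarrow> a t i = 0"
      and da: "\<And>t i. t \<ge> 0 \<Longrightarrow> i \<in> AA M \<Longrightarrow> ((\<lambda>s. a s i) has_real_derivative
        weak_rhs R S P (comb (AA M) (a t) ebas) (comb (AA M) (a t) ebas1) (comb (AA M) (a t) ebas3) (ebas i) (ebas1 i) (ebas3 i)) (at t within {0..})"
      using hkc_galerkin[OF hk] by blast
    have iN: "i \<in> NN" if "i \<in> AA M" for i using that AA(2) by blast
    define z where "z t = (\<Sum>i\<in>AA M. (a t i - c t i)\<^sup>2)" for t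
    define z' where "z' t = 2 * (\<Sum>i\<in>AA M. (a t i - c t i) *
      (weak_rhs R S P (comb (AA M) (a t) ebas) (comb (AA M) (a t) ebas1) (comb (AA M) (a t) ebas3) (ebas i) (ebas1 i) (ebas3 i)
       - weak_rhs R S P (W t) (W1 t) (W3 t) (ebas i) (ebas1 i) (ebas3 i)))" for t
    have a_cont: "continuous_on {0..\<tau>} (\<lambda>t. a t i)" if "i \<in> AA M" for i
    proof -
      have "continuous_on {0..} (\<lambda>t. a t i)"
        unfolding continuous_on_eq_continuous_within using DERIV_continuous[OF da[OF _ that]] by simp
      then show ?thesis by (rule continuous_on_subset) auto
    qed
    have "z t \<le> r * E"
      unfolding E_def
    proof (rule gronwall_by_energy[OF \<tau> \<kappa> K0 C0 less_imp_le[OF r(1)] _ y_cont _ _ _ _ dy _ _ t])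
      show "continuous_on {0..\<tau>} z"
        unfolding z_def by (intro continuous_intros a_cont c_cont iN)
      show "z 0 = 0"
      proof -
        have XM0: "XM M 0 = proj_HKC k1 M X0" using hk by (simp add: hkc_solution_def Let_def)
        \<comment> \<open>The initial value is attained almost everywhere, which is enough for
          equality of all coefficients.\<close>
        have "AE x in mC. W 0 x = fld X0 x"
          using X unfolding bc_solution_def Let_def W_def fld_def by auto
        then have "c 0 i = L2_inner k1 (fld X0) (ebas i)" for i
          unfolding c_def using HH0_L2[OF X0] \<tau>
          by (intro L2_inner_cong_AE L2_measurable WL fld_L2 eL) auto
        then have "a 0 i = c 0 i" if "i \<in> AA M" for i
          using initial_coefficients[OF X0 locked a(1)[of 0, unfolded XM0] a(2) that] by simp
        then show ?thesis by (simp add: z_def)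
      qed
      show "0 \<le> z s" for s by (simp add: z_def sum_nonneg)
      show "0 \<le> y s \<and> y s \<le> Y" if "s \<in> {0..\<tau>}" for s using y0 Y[OF that] by simp
      show "(z has_real_derivative z' s) (at s)" if s: "0 < s" "s < \<tau>" for s
      proof -
        \<comment> \<open>At positive times the one-sided derivative of the model is the ordinary
          one.\<close>
        have at: "at s within {0..} = at s" using s by (intro at_within_interior) (simp add: interior_real_atLeast)
        have "((\<lambda>t. (a t i - c t i)\<^sup>2) has_real_derivative 2 * ((a s i - c s i) *
          (weak_rhs R S P (comb (AA M) (a s) ebas) (comb (AA M) (a s) ebas1) (comb (AA M) (a s) ebas3) (ebas i) (ebas1 i) (ebas3 i)
           - weak_rhs R S P (W s) (W1 s) (W3 s) (ebas i) (ebas1 i) (ebas3 i)))) (at s)" if i: "i \<in> AA M" for i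
          using da[of s i] s i unfolding at
          by (auto intro!: derivative_eq_intros dc[OF s(1) iN[OF i]])
        then show ?thesis
          unfolding z_def[abs_def] z'_def sum_distrib_left by (intro DERIV_sum)
      qed
      show "2 * weak_rhs R S P (W s) (W1 s) (W3 s) (W s) (W1 s) (W3 s) \<le>
        - 2 * \<kappa> * (L2_inner k1 (W1 s) (W1 s) + L2_inner k1 (W3 s) (W3 s)) + 2 * K * y s" if s: "0 < s" "s < \<tau>" for s
        using energy_inequality[OF adm[OF s(1)] K] by (simp add: \<kappa>_def y_def)
      show "z' s \<le> C * (1 + (L2_inner k1 (W1 s) (W1 s) + L2_inner k1 (W3 s) (W3 s))) * (z s + r)" if s: "0 < s" "s < \<tau>" for s
      proof -
        have sI: "s \<in> {0..\<tau>}" using s by simp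
        have M': "M0 \<le> M" using M by simp
        note est = error_estimate[OF P AA(1) AA(2) adm[OF s(1)] K0 K M0[OF M' sI] r(2) Y[OF sI, unfolded y_def], of "a s"]
        show ?thesis
          using mult_left_mono[OF est, of 2] unfolding z'_def z_def c_def C_def \<kappa>_def
          by (simp only: mult.assoc zero_le_numeral)
      qed
    qed
    then have "z t \<le> (\<eta> / 2)\<^sup>2" using r(4) by linarith
    then have sz: "sqrt (z t) \<le> \<eta> / 2" using \<eta> by (intro real_le_lsqrt) (auto simp: z_def sum_nonneg)
    have t0: "0 \<le> t" using t by simp
    have aL: "comb (AA M) (a t) ebas \<in> L2_space k1" by (rule hasd_L2(1)[OF hasd_comb])
    note o = orthonormal_subset[OF orthonormal_ebas AA(2)[of M]]
    have ps: "partial_sum ebas (AA M) (W t) x = comb (AA M) (c t) ebas x" for x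
      by (simp add: partial_sum_def comb_def c_def)
    have "L2_norm k1 (\<lambda>x. comb (AA M) (c t) ebas x - comb (AA M) (a t) ebas x) = sqrt (z t)"
    proof -
      have "(\<lambda>x. comb (AA M) (c t) ebas x - comb (AA M) (a t) ebas x) = (\<lambda>x. \<Sum>i\<in>AA M. (c t i - a t i) *\<^sub>R ebas i x)"
        by (simp add: comb_def scaleR_diff_left sum_subtractf)
      then have "L2_norm k1 (\<lambda>x. comb (AA M) (c t) ebas x - comb (AA M) (a t) ebas x) = sqrt (\<Sum>i\<in>AA M. (c t i - a t i) * (c t i - a t i))"
        by (simp only: L2_norm_eq_sqrt L2_inner_combinations[OF o AA(1)])
      also have "(\<Sum>i\<in>AA M. (c t i - a t i) * (c t i - a t i)) = z t"
        unfolding z_def by (intro sum.cong refl) (simp add: power2_eq_square algebra_simps)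
      finally show ?thesis .
    qed
    moreover have "L2_norm k1 (\<lambda>x. W t x - comb (AA M) (c t) ebas x) \<le> r"
      using M0[OF less_imp_le[OF M] t] by (simp add: ps)
    moreover have "L2_norm k1 (\<lambda>x. W t x - comb (AA M) (a t) ebas x) \<le>
      L2_norm k1 (\<lambda>x. W t x - comb (AA M) (c t) ebas x) + L2_norm k1 (\<lambda>x. comb (AA M) (c t) ebas x - comb (AA M) (a t) ebas x)"
      by (rule L2_triangle_diff[OF WL[OF t] hasd_L2(1)[OF hasd_comb] aL])
    moreover have "HH0_norm k1 (X t - XM M t) = L2_norm k1 (\<lambda>x. W t x - comb (AA M) (a t) ebas x)"
    proof -
      have fst_snd: "fst (XM M t) = (\<lambda>x. fst (comb (AA M) (a t) ebas x))" "snd (XM M t) = (\<lambda>x. snd (comb (AA M) (a t) ebas x))"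
        unfolding a(1)[OF t0, symmetric] by (simp_all add: fld_def)
      have "fst (XM M t) \<in> L2_space k1" "snd (XM M t) \<in> L2_space k1"
        unfolding fst_snd by (rule L2_bounded_linear[OF bounded_linear_fst aL], rule L2_bounded_linear[OF bounded_linear_snd aL])
      with HH0_L2[OF XH[OF t]] show ?thesis
        by (subst HH0_norm_minus) (auto simp: W_def a(1)[OF t0])
    qed
    ultimately show ?thesis using sz r(3) by linarith
  qed
  then show ?thesis by blast
qed

end

section \<open>From uniform convergence in time to convergence in L2 of time\<close>

theorem mainTheorem4:
  fixes R S P k1 :: real and X0 :: state and X :: "real \<Rightarrow> state" and XM :: "nat \<Rightarrow> real \<Rightarrow> state"
  assumes "admissible R S P k1"
    and "X0 \<in> HH0 k1"
    and "phase_locked k1 X0"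
    and "bc_solution R S P k1 X0 X"
    and "\<And>M. M \<ge> 1 \<Longrightarrow> hkc_solution R S P k1 M (proj_HKC k1 M X0) (XM M)"
  shows "\<forall>\<tau>>0. \<forall>\<epsilon>>0. \<exists>Mstar>0. \<forall>M>Mstar. L2_time_norm k1 \<tau> (\<lambda>t. X t - XM M t) < \<epsilon>"
proof (intro allI impI)
  fix \<tau> \<epsilon> :: real
  assume \<tau>: "0 < \<tau>" and \<epsilon>: "0 < \<epsilon>"
  interpret channel k1
    using assms(1) by unfold_locales (simp add: admissible_def)
  have P: "0 < P" using assms(1) by (simp add: admissible_def)
  \<comment> \<open>A uniform error \<eta> costs sqrt \<tau> times \<eta> in L2 of [0,\<tau>]; the
    added 1 makes the final inequality strict.\<close>
  define \<eta> where "\<eta> = \<epsilon> / (sqrt \<tau> + 1)"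
  have st: "0 < sqrt \<tau>" using \<tau> by simp
  have \<eta>: "0 < \<eta>" using \<epsilon> st unfolding \<eta>_def by (intro divide_pos_pos) linarith+
  obtain M0 where M0: "\<And>M t. M > M0 \<Longrightarrow> t \<in> {0..\<tau>} \<Longrightarrow> HH0_norm k1 (X t - XM M t) \<le> \<eta>"
    using HH0_convergence[OF P assms(2-5) \<tau> \<eta>] by blast
  \<comment> \<open>The successor keeps the threshold positive even when \<open>M0\<close> is
    zero.\<close>
  have "L2_time_norm k1 \<tau> (\<lambda>t. X t - XM M t) < \<epsilon>" if M: "M > Suc M0" for M
  proof -
    have "(LINT t|lebesgue_on {0..\<tau>}. (HH0_norm k1 (X t - XM M t))\<^sup>2) \<le> (LINT t|lebesgue_on {0..\<tau>}. \<eta>\<^sup>2)"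
    proof (rule integral_mono')
      show "integrable (lebesgue_on {0..\<tau>}) (\<lambda>t. \<eta>\<^sup>2)" by (intro continuous_imp_integrable_real continuous_intros)
      show "(HH0_norm k1 (X t - XM M t))\<^sup>2 \<le> \<eta>\<^sup>2" if "t \<in> space (lebesgue_on {0..\<tau>})" for t
        using M0[of M t] M that by (intro power_mono) (auto simp: HH0_norm_def)
    qed simp
    also have "\<dots> = \<tau> * \<eta>\<^sup>2" using \<tau> by (simp add: measure_restrict_space)
    finally have "L2_time_norm k1 \<tau> (\<lambda>t. X t - XM M t) \<le> sqrt (\<tau> * \<eta>\<^sup>2)"
      unfolding L2_time_norm_def by (rule real_sqrt_le_mono)
    also have "\<dots> = sqrt \<tau> * \<eta>" using \<eta> by (simp add: real_sqrt_mult)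
    also have "\<dots> < (sqrt \<tau> + 1) * \<eta>" using \<eta> by (simp add: distrib_right)
    also have "\<dots> = \<epsilon>"
    proof -
      have "sqrt \<tau> + 1 \<noteq> 0" using st by linarith
      then show ?thesis by (simp add: \<eta>_def)
    qed
    finally show ?thesis .
  qed
  then show "\<exists>Mstar>0. \<forall>M>Mstar. L2_time_norm k1 \<tau> (\<lambda>t. X t - XM M t) < \<epsilon>"
    by (intro exI[of _ "Suc M0"]) auto
qed

end
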